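(* Let $N\ge 2$ be an integer, let $\beta>N$, and let $f(x)=I_{N/2}(x)/I_{N/2-1}(x)$ for $x>0$. Let $b$ be the unique strictly positive solution of the equation $x-\beta f(x)=0$, and let $$B^2=\frac{4\beta^2}{(1-\beta f'(b))b^2}\left[1-\frac{(N-1)f(b)}{b}-(f(b))^2\right],\qquad B>0.$$ For $n\ge 1$, let $\sigma=(\sigma_1,\dots,\sigma_n)$ be distributed according to the Gibbs measure $P_{n,\beta}$ of the mean field classical $N$-vector model, let $S_n=\sum_{j=1}^n\sigma_j$, and let $$W_n=\sqrt n\left(\frac{\beta^2}{n^2b^2}|S_n|^2-1\right).$$ Then there is a constant $C>0$ depending only on $\beta$ such that for all $n\ge 1$, $$\sup_{\|h'\|\le 1}\left|Eh(W_n/B)-Eh(Z)\right|\le C n^{-1/2}$$ and $$\sup_{z\in\mathbb R}\left|P\left(W_n/B\le z\right)-\Phi(z)\right|\le C n^{-1/2}.$$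
   Context: $\mathbb S^{N-1}$ is the unit sphere in $\mathbb R^N$, $\mu$ is the uniform probability measure on $\mathbb S^{N-1}$, $\Omega_n=(\mathbb S^{N-1})^n$, and $P_n=\mu\times\dots\times\mu$ is the product measure on $\Omega_n$. The Hamiltonian is $H_n(\sigma)=-\frac1{2n}\sum_{i=1}^n\sum_{j=1}^n\langle\sigma_i,\sigma_j\rangle$, where $\langle\cdot,\cdot\rangle$ is the Euclidean inner product in $\mathbb R^N$ and $|\cdot|$ is the Euclidean norm. For inverse temperature $\beta>0$ the Gibbs measure $P_{n,\beta}$ is the probability measure on $\Omega_n$ given by $dP_{n,\beta}(\sigma)=\frac1{Z_{n,\beta}}\exp(-\beta H_n(\sigma))\,dP_n(\sigma)$, with $Z_{n,\beta}=\int_{\Omega_n}\exp(-\beta H_n(\sigma))\,dP_n(\sigma)$. $I_\nu$ denotes the modified Bessel function of the first kind. For $\beta>N$ the equation $x-\beta f(x)=0$ has a unique strictly positive solution. $Z$ is a standard normal random variable and $\Phi$ its distribution function. For a real-valued function $g$, $\|g\|=\sup_x|g(x)|$; the first supremum is over functions $h:\mathbb R\to\mathbb R$ with $\|h'\|\le1$ (this supremum is the Wasserstein distance between the laws of $W_n/B$ and $Z$). *)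

theory Defs
  imports "HOL-Probability.Probability"
begin

text \<open>
  The dimension \<open>N\<close> has to be quantified inside the theorem (the constant there does not
  depend on it), so it cannot be the index of a type: \<open>\<real>\<^sup>N\<close> is represented by the functions
  in \<^term>\<open>extensional {..<N} :: (nat \<Rightarrow> real) set\<close>, the carrier of
  \<^term>\<open>\<Pi>\<^sub>M k\<in>{..<N}. lborel :: real measure\<close>, with Euclidean norm
  \<^term>\<open>\<lambda>x. L2_set x {..<N}\<close>.
\<close>

definition dot :: "nat \<Rightarrow> (nat \<Rightarrow> real) \<Rightarrow> (nat \<Rightarrow> real) \<Rightarrow> real" where
  "dot N x y = (\<Sum>k<N. x k * y k)"

definition unit_sphere :: "nat \<Rightarrow> (nat \<Rightarrow> real) set" where
  "unit_sphere N = {x \<in> extensional {..<N}. L2_set x {..<N} = 1}"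

definition unit_ball :: "nat \<Rightarrow> (nat \<Rightarrow> real) set" where
  "unit_ball N = {x \<in> extensional {..<N}. L2_set x {..<N} \<le> 1}"

definition radial_proj :: "nat \<Rightarrow> (nat \<Rightarrow> real) \<Rightarrow> (nat \<Rightarrow> real)" where
  "radial_proj N x = (\<lambda>k\<in>{..<N}. x k / L2_set x {..<N})"

text \<open>
  Normalised surface measure: a Borel set \<open>A\<close> of the sphere gets the fraction of the unit ball's
  volume taken up by the cone \<open>{r x | 0 < r \<le> 1, x \<in> A}\<close>.  The radial projection sends the
  origin, a null set, to itself; restricting to the sphere discards it.
\<close>

definition sphere_measure :: "nat \<Rightarrow> (nat \<Rightarrow> real) measure" where
  "sphere_measure N =
     restrict_space
       (distr (uniform_measure (\<Pi>\<^sub>M k\<in>{..<N}. lborel) (unit_ball N))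
          (\<Pi>\<^sub>M k\<in>{..<N}. borel) (radial_proj N))
       (unit_sphere N)"

text \<open>A configuration \<open>\<sigma>\<close> of \<open>n\<close> spins has \<open>\<sigma> i k\<close> as the \<open>k\<close>-th coordinate of the \<open>i\<close>-th spin.\<close>

definition config_measure :: "nat \<Rightarrow> nat \<Rightarrow> (nat \<Rightarrow> nat \<Rightarrow> real) measure" where
  "config_measure N n = (\<Pi>\<^sub>M i\<in>{1..n}. sphere_measure N)"

definition hamiltonian :: "nat \<Rightarrow> nat \<Rightarrow> (nat \<Rightarrow> nat \<Rightarrow> real) \<Rightarrow> real" where
  "hamiltonian N n \<sigma> = - (1 / (2 * real n)) * (\<Sum>i=1..n. \<Sum>j=1..n. dot N (\<sigma> i) (\<sigma> j))"

definition partition_fn :: "nat \<Rightarrow> real \<Rightarrow> nat \<Rightarrow> real" where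
  "partition_fn N \<beta> n = (\<integral>\<sigma>. exp (- \<beta> * hamiltonian N n \<sigma>) \<partial>config_measure N n)"

definition gibbs :: "nat \<Rightarrow> real \<Rightarrow> nat \<Rightarrow> (nat \<Rightarrow> nat \<Rightarrow> real) measure" where
  "gibbs N \<beta> n =
     density (config_measure N n)
       (\<lambda>\<sigma>. ennreal (1 / partition_fn N \<beta> n * exp (- \<beta> * hamiltonian N n \<sigma>)))"

text \<open>The modified Bessel function of the first kind, of order \<open>\<nu> \<ge> 0\<close> and for arguments \<open>x > 0\<close>.\<close>

definition bessel_I :: "real \<Rightarrow> real \<Rightarrow> real" where
  "bessel_I \<nu> x = (\<Sum>m. (x / 2) powr (2 * real m + \<nu>) / (fact m * Gamma (real m + \<nu> + 1)))"

definition bessel_ratio :: "nat \<Rightarrow> real \<Rightarrow> real" where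
  "bessel_ratio N x = bessel_I (real N / 2) x / bessel_I (real N / 2 - 1) x"

definition b_crit :: "nat \<Rightarrow> real \<Rightarrow> real" where
  "b_crit N \<beta> = (THE x. x > 0 \<and> x - \<beta> * bessel_ratio N x = 0)"

definition B_const :: "nat \<Rightarrow> real \<Rightarrow> real" where
  "B_const N \<beta> =
     (let f = bessel_ratio N; b = b_crit N \<beta> in
      sqrt (4 * \<beta>\<^sup>2 / ((1 - \<beta> * deriv f b) * b\<^sup>2)
            * (1 - (real N - 1) * f b / b - (f b)\<^sup>2)))"

definition total_spin :: "nat \<Rightarrow> (nat \<Rightarrow> nat \<Rightarrow> real) \<Rightarrow> (nat \<Rightarrow> real)" where
  "total_spin n \<sigma> = (\<lambda>k. \<Sum>j=1..n. \<sigma> j k)"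

definition W :: "nat \<Rightarrow> real \<Rightarrow> nat \<Rightarrow> (nat \<Rightarrow> nat \<Rightarrow> real) \<Rightarrow> real" where
  "W N \<beta> n \<sigma> =
     sqrt (real n) *
     (\<beta>\<^sup>2 / ((real n)\<^sup>2 * (b_crit N \<beta>)\<^sup>2) * (L2_set (total_spin n \<sigma>) {..<N})\<^sup>2 - 1)"

end

theory Submission
  imports Defs
begin

text \<open>
  Resample one uniformly chosen spin from its conditional law given the others. Writing
  \<open>Q = |\<beta> S\<^sub>n / n|\<^sup>2\<close>, this produces an exchangeable pair for \<open>W\<^sub>n = \<surd>n (Q / b\<^sup>2 - 1)\<close>
  with bounded increments, whose conditional drift and conditional second moment are, up to averages
  over the spins, smooth functions of \<open>Q\<close>; the normal approximation is then Stein's method, where the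
  Kolmogorov distance is reached through the concentration inequality obtained by testing the exchangeable
  pair against a truncated identity function.

  What has to be controlled is \<open>E (Q - b\<^sup>2)\<^sup>2 = O(1/n)\<close>. Averages over the spins of quantities
  that are conditionally centred given the other spins are \<open>O(n\<^sup>-\<^sup>1\<^sup>/\<^sup>2)\<close> in \<open>L\<^sup>2\<close>, because freezing one
  spin changes the others' contributions by \<open>O(1/n)\<close> only. Applied to the spin component along the field
  this shows that \<open>Q / \<beta> - \<surd>Q f(\<surd>Q)\<close> is \<open>O(n\<^sup>-\<^sup>1\<^sup>/\<^sup>2)\<close> in \<open>L\<^sup>2\<close>, so \<open>Q\<close> is
  close to \<open>0\<close> or to \<open>b\<^sup>2\<close>. The value \<open>0\<close> is ruled out because for \<open>\<beta> > N\<close> the resampling dynamics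
  drifts away from it.
\<close>

section \<open>Stein's method for exchangeable pairs\<close>

text \<open>The direction of the total spin does not concentrate, so everything is expressed through
  the squared length of the field; in the variable \<open>q = |h|^2\<close> the Laplace transform of
  the sphere is smooth up to \<open>q = 0\<close>. The limiting variance arises as follows. In one
  resampling step the decrease of \<open>Q\<close> has conditional mean proportional to
  \<open>Q / \<beta> - Q * logd N Q\<close>, whose slope at the root \<open>b^2\<close> is
  \<open>\<kappa> / \<beta>\<close> with \<open>\<kappa> = - \<beta> * b^2 * logd' N (b^2)\<close>.
  Its conditional mean square is proportional to twice the variance \<open>b^2 * v\<close> of the
  inner product of a spin with its field. Stein's method requires the second moment to be twice the
  drift rate, and this forces \<open>B^2 = 2 * \<beta>^2 * v / (\<kappa> * b^2)\<close>. The
  obstacle is the second root \<open>q = 0\<close> of the equation of state, near which the L2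
  estimate carries no information. A reversibility test gains a factor \<open>1/n\<close> on the
  mean of the weight \<open>Q + 1/n\<close> near 0, but passing from this weight to a probability
  loses a factor \<open>n\<close>; one test is therefore not enough.\<close>

abbreviation gauss_exp :: "(real \<Rightarrow> real) \<Rightarrow> real" where
  "gauss_exp h \<equiv> (\<integral>x. h x \<partial>std_normal_distribution)"

text \<open>Solutions of \<open>g' x = x * g x + h x - gauss_exp h\<close> differ by multiples of
  \<open>exp (x^2 / 2)\<close>, and this is the one that stays bounded: after centring by
  \<open>gauss_exp h\<close> the integrand has total integral 0, so the integral over
  \<open>{..x}\<close> is small at both ends.\<close>

definition stein_solution :: "(real \<Rightarrow> real) \<Rightarrow> real \<Rightarrow> real" where
  "stein_solution h x =
     exp (x\<^sup>2 / 2) * (LBINT t:{..x}. (h t - gauss_exp h) * exp (- t\<^sup>2 / 2))"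

section \<open>The Stein equation and bounds on its solution\<close>

lemma gauss_weight: "exp (- t\<^sup>2 / 2) = sqrt (2 * pi) * std_normal_density t"
  by (simp add: std_normal_density_def)

lemma integrable_gauss_affine:
  "integrable lborel (\<lambda>t::real. (a + \<bar>t\<bar>) * exp (- t\<^sup>2 / 2))"
proof -
  have "integrable lborel (\<lambda>t. std_normal_density t * \<bar>t\<bar> ^ k)" for k :: nat
    using integrable_std_normal_moment_abs by blast
  from this[of 0] this[of 1]
  have "integrable lborel (\<lambda>t. sqrt (2*pi) * (a * (std_normal_density t * \<bar>t\<bar>^0)
        + std_normal_density t * \<bar>t\<bar>^1))"
    by (intro integrable_mult_right integrable_add) auto
  thus ?thesis
    by (rule Bochner_Integration.integrable_cong[THEN iffD1, rotated -1])
       (auto simp: std_normal_density_def field_simps)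
qed

lemma integrable_gauss_linear_growth:
  fixes k :: "real \<Rightarrow> real"
  assumes [measurable]: "k \<in> borel_measurable borel" and "\<And>t. \<bar>k t\<bar> \<le> a + \<bar>t\<bar>"
  shows "integrable lborel (\<lambda>t. k t * exp (- t\<^sup>2 / 2))"
  by (rule Bochner_Integration.integrable_bound[OF integrable_gauss_affine[of a]])
     (use assms(2) in \<open>auto simp: abs_mult intro!: AE_I2 mult_right_mono order_trans[OF _ abs_ge_self]\<close>)

lemma gauss_exp_eq:
  fixes h :: "real \<Rightarrow> real"
  assumes [measurable]: "h \<in> borel_measurable borel"
  shows "(\<integral>t. h t * exp (- t\<^sup>2 / 2) \<partial>lborel) = sqrt (2 * pi) * gauss_exp h"
proof -
  have "gauss_exp h = (\<integral>t. std_normal_density t * h t \<partial>lborel)"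
    by (subst integral_density) (auto)
  thus ?thesis unfolding gauss_weight
    by (simp add: mult.assoc mult.commute[of "h _"] del: real_sqrt_mult)
qed

lemma integrable_std_normal_linear_growth:
  fixes h :: "real \<Rightarrow> real"
  assumes [measurable]: "h \<in> borel_measurable borel" and "\<And>t. \<bar>h t\<bar> \<le> a + \<bar>t\<bar>"
  shows "integrable std_normal_distribution h"
proof -
  have "integrable lborel (\<lambda>t. h t * exp (- t\<^sup>2 / 2))"
    using assms by (rule integrable_gauss_linear_growth)
  hence "integrable lborel (\<lambda>t. (1 / sqrt (2 * pi)) * (h t * exp (- t\<^sup>2 / 2)))"
    by (rule integrable_mult_right)
  hence "integrable lborel (\<lambda>t. std_normal_density t *\<^sub>R h t)"
    by (rule Bochner_Integration.integrable_cong[THEN iffD1, rotated -1])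
       (auto simp: std_normal_density_def)
  thus ?thesis by (subst integrable_density) auto
qed

text \<open>The half-line is cut at \<open>x - 1\<close>, so that only an integral over a compact
  interval varies with the endpoint and the fundamental theorem for continuous integrands
  applies.\<close>

lemma has_derivative_lower_integral:
  fixes k :: "real \<Rightarrow> real"
  assumes k: "continuous_on UNIV k" and int: "integrable lborel k"
  shows "((\<lambda>x. LBINT t:{..x}. k t) has_real_derivative k x) (at x)"
proof -
  have kb[measurable]: "k \<in> borel_measurable borel"
    using k by (rule borel_measurable_continuous_onI)
  have si: "set_integrable lborel S k" if "S \<in> sets borel" for S
    unfolding set_integrable_def using int that by (intro integrable_mult_indicator) auto
  have eq: "(LBINT t:{..u}. k t) = (LBINT t:{..<x-1}. k t) + integral {x-1..u} k"
    if "u \<in> {x-1..x+1}" for u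
  proof -
    have "{..u} = {..<x-1} \<union> {x-1..u}" using that by auto
    hence "(LBINT t:{..u}. k t) = (LBINT t:{..<x-1}. k t) + (LBINT t:{x-1..u}. k t)"
      by (simp only:) (rule set_integral_Un, auto intro!: si)
    also have "(LBINT t:{x-1..u}. k t) = integral {x-1..u} k"
      by (rule set_borel_integral_eq_integral(2)[OF si]) auto
    finally show ?thesis .
  qed
  have "((\<lambda>u. integral {x-1..u} k) has_real_derivative k x) (at x within {x-1..x+1})"
    by (rule integral_has_real_derivative) (auto intro: continuous_on_subset[OF k])
  hence "((\<lambda>u. (LBINT t:{..<x-1}. k t) + integral {x-1..u} k) has_real_derivative k x) (at x within {x-1..x+1})"
    by (auto intro!: derivative_eq_intros)
  hence "((\<lambda>x. LBINT t:{..x}. k t) has_real_derivative k x) (at x within {x-1..x+1})"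
    by (rule has_field_derivative_transform_within[where d=1]) (auto simp: eq)
  moreover have "at x within {x-1..x+1} = at x"
    by (rule at_within_interior) auto
  ultimately show ?thesis by simp
qed

text \<open>The growth bound admits both kinds of test function used later: Lipschitz functions
  vanishing at 0, and ramps with values between 0 and 1. As \<open>h\<close> is merely continuous,
  one derivative of the solution is all that is available.\<close>

lemma stein_solution_has_derivative:
  assumes h: "continuous_on UNIV h" "\<And>t. \<bar>h t\<bar> \<le> 1 + \<bar>t\<bar>"
  shows "(stein_solution h has_real_derivative
           x * stein_solution h x + h x - gauss_exp h) (at x)"
proof -
  let ?k = "\<lambda>t. (h t - gauss_exp h) * exp (- t\<^sup>2 / 2)"
  have hb: "h \<in> borel_measurable borel" using h(1) by (rule borel_measurable_continuous_onI)
  have bd: "\<bar>h t - gauss_exp h\<bar> \<le> (1 + \<bar>gauss_exp h\<bar>) + \<bar>t\<bar>" for t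
    using h(2)[of t] by linarith
  have "integrable lborel ?k"
    by (rule integrable_gauss_linear_growth[OF _ bd]) (use hb in measurable)
  moreover have "continuous_on UNIV ?k" by (intro continuous_intros h(1)) auto
  ultimately have "((\<lambda>x. LBINT t:{..x}. ?k t) has_real_derivative ?k x) (at x)"
    by (intro has_derivative_lower_integral)
  hence "((\<lambda>x. exp (x\<^sup>2 / 2) * (LBINT t:{..x}. ?k t)) has_real_derivative
      exp (x\<^sup>2 / 2) * ?k x + (exp (x\<^sup>2 / 2) * x) * (LBINT t:{..x}. ?k t)) (at x)"
    by (auto intro!: derivative_eq_intros)
  moreover have "exp (x\<^sup>2 / 2) * ?k x + (exp (x\<^sup>2 / 2) * x) * (LBINT t:{..x}. ?k t)
      = x * stein_solution h x + h x - gauss_exp h"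
    unfolding stein_solution_def by (simp add: exp_minus field_simps)
  moreover have "stein_solution h = (\<lambda>x. exp (x\<^sup>2 / 2) * (LBINT t:{..x}. ?k t))"
    by (rule ext) (simp add: stein_solution_def)
  ultimately show ?thesis by (simp only:)
qed

text \<open>For \<open>t \<ge> 1\<close> the factor \<open>a + \<bar>t\<bar>\<close> is at most
  \<open>(a + 1) * t\<close>, and \<open>t * exp (- t^2 / 2)\<close> has an explicit primitive. The
  resulting bound is exactly what cancels the factor \<open>exp (x^2 / 2)\<close> in
  \<open>stein_solution\<close>.\<close>

lemma gauss_upper_tail:
  fixes x :: real
  assumes "1 \<le> x" "0 \<le> a"
  shows "(LBINT t:{x..}. (a + \<bar>t\<bar>) * exp (- t\<^sup>2 / 2)) \<le> (a + 1) * exp (- x\<^sup>2 / 2)"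
proof -
  have lim: "((\<lambda>t::real. - (a + 1) * exp (- t\<^sup>2 / 2)) \<longlongrightarrow> 0) at_top"
  proof -
    have "filterlim (\<lambda>t::real. - t\<^sup>2 / 2) at_bot at_top"
      by real_asymp
    hence "((\<lambda>t::real. exp (- t\<^sup>2 / 2)) \<longlongrightarrow> 0) at_top"
      by (rule filterlim_compose[OF exp_at_bot])
    from tendsto_mult_left[OF this, of "-(a+1)"] show ?thesis by simp
  qed
  have der: "DERIV (\<lambda>t. - (a + 1) * exp (- t\<^sup>2 / 2)) t :> (a + 1) * t * exp (- t\<^sup>2 / 2)" for t :: real
    by (auto intro!: derivative_eq_intros simp: algebra_simps)
  have nn: "(\<integral>\<^sup>+t. ennreal ((a + 1) * t * exp (- t\<^sup>2 / 2)) * indicator {x..} t \<partial>lborel)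
      = ennreal (0 - - (a + 1) * exp (- x\<^sup>2 / 2))"
    by (rule nn_integral_FTC_atLeast[OF _ der _ lim]) (use assms in auto)
  have eq: "ennreal (indicator {x..} t * ((a + 1) * t * exp (- t\<^sup>2 / 2))) =
     ennreal ((a + 1) * t * exp (- t\<^sup>2 / 2)) * indicator {x..} t" for t
    by (auto split: split_indicator)
  have hb: "has_bochner_integral lborel (\<lambda>t. indicator {x..} t * ((a + 1) * t * exp (- t\<^sup>2 / 2)))
      ((a + 1) * exp (- x\<^sup>2 / 2))"
    by (rule has_bochner_integral_nn_integral)
       (use assms in \<open>auto simp only: eq nn diff_0 minus_mult_left minus_minus, auto split: split_indicator\<close>)
  have "(LBINT t:{x..}. (a + \<bar>t\<bar>) * exp (- t\<^sup>2 / 2)) \<le>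
     (\<integral>t. indicator {x..} t * ((a + 1) * t * exp (- t\<^sup>2 / 2)) \<partial>lborel)"
    unfolding set_lebesgue_integral_def
  proof (rule integral_mono)
    show "integrable lborel (\<lambda>t. indicat_real {x..} t *\<^sub>R ((a + \<bar>t\<bar>) * exp (- t\<^sup>2 / 2)))"
      by (intro integrable_mult_indicator integrable_gauss_affine) auto
    show "integrable lborel (\<lambda>t. indicator {x..} t * ((a + 1) * t * exp (- t\<^sup>2 / 2)))"
      using hb by (rule integrable.intros)
    fix t :: real
    show "indicat_real {x..} t *\<^sub>R ((a + \<bar>t\<bar>) * exp (- t\<^sup>2 / 2))
        \<le> indicator {x..} t * ((a + 1) * t * exp (- t\<^sup>2 / 2))"
    proof (cases "x \<le> t")
      case True
      have "a * 1 \<le> a * t" using assms True by (intro mult_left_mono) auto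
      hence "(a + \<bar>t\<bar>) * exp (- t\<^sup>2 / 2) \<le> (a + 1) * t * exp (- t\<^sup>2 / 2)"
        using True assms by (intro mult_right_mono) (auto simp: algebra_simps)
      with True show ?thesis by simp
    qed auto
  qed
  also have "\<dots> = (a + 1) * exp (- x\<^sup>2 / 2)"
    using hb by (rule has_bochner_integral_integral_eq)
  finally show ?thesis .
qed

lemma gauss_lower_tail:
  fixes x :: real
  assumes "x \<le> -1" "0 \<le> a"
  shows "(LBINT t:{..x}. (a + \<bar>t\<bar>) * exp (- t\<^sup>2 / 2)) \<le> (a + 1) * exp (- x\<^sup>2 / 2)"
proof -
  have "(LBINT t:{..x}. (a + \<bar>t\<bar>) * exp (- t\<^sup>2 / 2)) =
        (\<integral>t. indicator {..x} (0 + (-1) * t) *\<^sub>R ((a + \<bar>0 + (-1) * t\<bar>) * exp (- (0 + (-1) * t)\<^sup>2 / 2)) \<partial>lborel)"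
    unfolding set_lebesgue_integral_def
    by (subst lborel_integral_real_affine[where c="-1" and t=0]) auto
  also have "\<dots> = (LBINT t:{-x..}. (a + \<bar>t\<bar>) * exp (- t\<^sup>2 / 2))"
    unfolding set_lebesgue_integral_def
    by (rule Bochner_Integration.integral_cong) (auto split: split_indicator)
  also have "\<dots> \<le> (a + 1) * exp (- (- x)\<^sup>2 / 2)"
    by (rule gauss_upper_tail) (use assms in auto)
  finally show ?thesis by simp
qed

text \<open>The factor \<open>exp (x^2 / 2)\<close> is compensated by the Gaussian tail on the side
  of \<open>x\<close> away from the origin; for \<open>\<bar>x\<bar> \<le> 1\<close> it is bounded
  anyway. \<open>K\<close> is obtained before \<open>h\<close>, so one constant serves all test
  functions.\<close>

lemma stein_solution_bounded:
  obtains K :: real where "0 < K"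
    "\<And>h x. continuous_on UNIV h \<Longrightarrow> (\<And>t. \<bar>h t\<bar> \<le> 1 + \<bar>t\<bar>) \<Longrightarrow> \<bar>stein_solution h x\<bar> \<le> K"
    "\<And>h. continuous_on UNIV h \<Longrightarrow> (\<And>t. \<bar>h t\<bar> \<le> 1 + \<bar>t\<bar>) \<Longrightarrow> \<bar>gauss_exp h\<bar> \<le> K"
proof -
  define m where "m = gauss_exp (\<lambda>t. 1 + \<bar>t\<bar>)"
  have m0: "0 \<le> m" unfolding m_def by (rule integral_nonneg_AE) auto
  define A where "A = (\<integral>t. (1 + m + \<bar>t\<bar>) * exp (- t\<^sup>2 / 2) \<partial>lborel)"
  have A0: "0 \<le> A" unfolding A_def using m0 by (intro integral_nonneg_AE) auto
  \<comment> \<open>\<open>m + 2\<close> is the tail constant \<open>(1 + m) + 1\<close>;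
    \<open>exp (1/2) * A\<close> covers \<open>\<bar>x\<bar> \<le> 1\<close>, where the whole
    integral is used.\<close>
  define K where "K = m + 2 + exp (1/2) * A"
  have gb: "\<bar>gauss_exp h\<bar> \<le> m" if "continuous_on UNIV h" "\<And>t. \<bar>h t\<bar> \<le> 1 + \<bar>t\<bar>" for h
  proof -
    have hb: "h \<in> borel_measurable borel" using that(1) by (rule borel_measurable_continuous_onI)
    show ?thesis unfolding m_def
      using integrable_std_normal_linear_growth[of "\<lambda>t. 1 + \<bar>t\<bar>" 1] that(2)
      by (intro integral_abs_bound[THEN order_trans] integral_mono'
            ) auto
  qed
  have sb: "\<bar>stein_solution h x\<bar> \<le> K" if h: "continuous_on UNIV h" "\<And>t. \<bar>h t\<bar> \<le> 1 + \<bar>t\<bar>" for h x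
  proof -
    define k where "k = (\<lambda>t. (h t - gauss_exp h) * exp (- t\<^sup>2 / 2))"
    define l where "l = (\<lambda>t::real. (1 + m + \<bar>t\<bar>) * exp (- t\<^sup>2 / 2))"
    have hb[measurable]: "h \<in> borel_measurable borel" using h(1) by (rule borel_measurable_continuous_onI)
    have bd: "\<bar>h t - gauss_exp h\<bar> \<le> 1 + m + \<bar>t\<bar>" for t
      using h(2)[of t] gb[OF h] by linarith
    have kl: "\<bar>k t\<bar> \<le> l t" for t
      unfolding k_def l_def abs_mult using bd by (auto intro!: mult_right_mono)
    have ik: "integrable lborel k"
      unfolding k_def by (rule integrable_gauss_linear_growth[OF _ bd]) measurable
    have il: "integrable lborel l" unfolding l_def by (rule integrable_gauss_affine)
    have abs_le: "\<bar>LBINT t:S. k t\<bar> \<le> (LBINT t:S. l t)" if "S \<in> sets borel" for S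
      unfolding set_lebesgue_integral_def
    proof (rule order_trans[OF integral_abs_bound], rule integral_mono)
      show "integrable lborel (\<lambda>t. \<bar>indicat_real S t *\<^sub>R k t\<bar>)"
        using that ik by (intro integrable_abs integrable_mult_indicator) auto
      show "integrable lborel (\<lambda>t. indicat_real S t *\<^sub>R l t)"
        using that il by (intro integrable_mult_indicator) auto
    qed (use kl in \<open>auto split: split_indicator\<close>)
    \<comment> \<open>The centring pays off here: for \<open>x \<ge> 1\<close> the lower integral
      can be traded for minus the upper one.\<close>
    have tot: "(LBINT t:UNIV. k t) = 0"
    proof -
      have i1: "integrable lborel (\<lambda>t. h t * exp (- t\<^sup>2 / 2))"
        by (rule integrable_gauss_linear_growth[OF _ h(2)]) measurable
      have i2: "integrable lborel (\<lambda>t::real. gauss_exp h * exp (- t\<^sup>2 / 2))"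
        by (rule integrable_gauss_linear_growth[where a="\<bar>gauss_exp h\<bar>"]) auto
      have "(\<integral>t. k t \<partial>lborel) = (\<integral>t. h t * exp (- t\<^sup>2 / 2) \<partial>lborel) - (\<integral>t. gauss_exp h * exp (- t\<^sup>2 / 2) \<partial>lborel)"
        unfolding k_def left_diff_distrib by (rule Bochner_Integration.integral_diff[OF i1 i2])
      also have "\<dots> = sqrt (2*pi) * gauss_exp h - sqrt (2*pi) * gauss_exp (\<lambda>_. gauss_exp h)"
        by (subst (1 2) gauss_exp_eq) auto
      also have "gauss_exp (\<lambda>_. gauss_exp h) = gauss_exp h"
      proof -
        interpret prob_space std_normal_distribution
          by (rule prob_space_normal_density) simp
        show ?thesis using prob_space by simp
      qed
      finally show ?thesis by (simp add: set_lebesgue_integral_def)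
    qed
    have si: "set_integrable lborel S k" if "S \<in> sets borel" for S
      unfolding set_integrable_def using ik that by (intro integrable_mult_indicator) auto
    let ?F = "LBINT t:{..x}. k t"
    have "\<bar>?F\<bar> \<le> K * exp (- x\<^sup>2 / 2)"
    proof -
      consider "x \<le> -1" | "1 \<le> x" | "\<bar>x\<bar> \<le> 1" by linarith
      thus ?thesis
      proof cases
        case 1
        have "\<bar>?F\<bar> \<le> (1 + m + 1) * exp (- x\<^sup>2 / 2)"
          using abs_le[of "{..x}"] gauss_lower_tail[OF 1, of "1 + m"] m0 unfolding l_def by auto
        also have "\<dots> \<le> K * exp (- x\<^sup>2 / 2)"
          unfolding K_def using A0 by (intro mult_right_mono) auto
        finally show ?thesis .
      next
        case 2
        have "(LBINT t:UNIV. k t) = ?F + (LBINT t:{x<..}. k t)"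
        proof -
          have U: "UNIV = {..x} \<union> {x<..}" by auto
          show ?thesis unfolding U by (rule set_integral_Un) (auto intro!: si)
        qed
        hence "\<bar>?F\<bar> = \<bar>LBINT t:{x<..}. k t\<bar>" using tot by linarith
        also have "\<dots> \<le> (LBINT t:{x<..}. l t)" by (rule abs_le) auto
        also have "\<dots> \<le> (LBINT t:{x..}. l t)"
          unfolding set_lebesgue_integral_def
          by (intro integral_mono integrable_mult_indicator il)
             (use order_trans[OF abs_ge_zero kl] in \<open>auto split: split_indicator\<close>)
        also have "\<dots> \<le> (1 + m + 1) * exp (- x\<^sup>2 / 2)"
          using gauss_upper_tail[OF 2, of "1 + m"] m0 unfolding l_def by auto
        also have "\<dots> \<le> K * exp (- x\<^sup>2 / 2)"
          unfolding K_def using A0 by (intro mult_right_mono) auto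
        finally show ?thesis .
      next
        case 3
        have "\<bar>?F\<bar> \<le> (LBINT t:{..x}. l t)" by (rule abs_le) auto
        also have "\<dots> \<le> A"
          unfolding A_def set_lebesgue_integral_def l_def[symmetric] using il
          by (intro integral_mono integrable_mult_indicator il)
             (use order_trans[OF abs_ge_zero kl] in \<open>auto split: split_indicator\<close>)
        also have "\<dots> = (exp (1/2) * A) * exp (- 1 / 2)"
          by (simp add: exp_minus field_simps)
        also have "\<dots> \<le> K * exp (- x\<^sup>2 / 2)"
        proof (rule mult_mono)
          show "exp (- 1 / 2) \<le> exp (- x\<^sup>2 / 2)" using 3 by (simp add: abs_square_le_1)
        qed (use m0 A0 in \<open>auto simp: K_def\<close>)
        finally show ?thesis .
      qed
    qed
    hence "exp (x\<^sup>2 / 2) * \<bar>?F\<bar> \<le> exp (x\<^sup>2 / 2) * (K * exp (- x\<^sup>2 / 2))"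
      by (rule mult_left_mono) auto
    thus ?thesis
      unfolding stein_solution_def k_def[symmetric] by (simp add: abs_mult exp_minus field_simps)
  qed
  show thesis
    by (rule that[of K]) (use m0 A0 sb gb in \<open>auto simp: K_def intro: add_pos_nonneg order_trans[OF gb]\<close>)
qed

section \<open>Exchangeable pairs: concentration and the Stein estimate\<close>

lemma mvt_between:
  fixes \<psi> :: "real \<Rightarrow> real"
  assumes "\<And>t. (\<psi> has_real_derivative g t) (at t)"
  obtains \<xi> where "\<bar>\<xi> - x\<bar> \<le> \<bar>y - x\<bar>" "\<psi> x - \<psi> y = (x - y) * g \<xi>"
proof -
  consider "x < y" | "y < x" | "x = y" by linarith
  thus thesis
  proof cases
    case 1
    from MVT2[OF 1 assms] obtain z where "x < z" "z < y" "\<psi> y - \<psi> x = (y - x) * g z" by blast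
    thus ?thesis by (intro that[of z]) (auto simp: algebra_simps)
  next
    case 2
    from MVT2[OF 2 assms] obtain z where "y < z" "z < x" "\<psi> x - \<psi> y = (x - y) * g z" by blast
    thus ?thesis by (intro that[of z]) auto
  next
    case 3 thus ?thesis by (intro that[of x]) auto
  qed
qed

text \<open>Conditioning on \<open>T\<close> is expressed by testing against continuous functions,
  so no conditional expectations are formed; \<open>antisym\<close> is what is kept of
  exchangeability. \<open>\<rho>\<close> is the drift rate, \<open>\<delta>\<close> bounds the
  jumps, \<open>R\<close> and \<open>D\<close> are the errors in drift and second moment, and
  \<open>s\<close>, \<open>a\<close>, \<open>\<kappa>\<close>, \<open>d\<close> are the parameters
  on which the final constant may depend. \<open>R\<close> is controlled in L1 because it meets the
  bounded Stein solution; \<open>D\<close> meets its derivative, which may grow linearly in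
  \<open>T\<close>, and is controlled in L2.\<close>

locale exchangeable_pair = prob_space M for M :: "'a measure" +
  fixes T T' R D :: "'a \<Rightarrow> real" and \<delta> \<rho> s a \<kappa> d :: real
  assumes meas [measurable]: "T \<in> borel_measurable M" "T' \<in> borel_measurable M"
      "R \<in> borel_measurable M" "D \<in> borel_measurable M"
    and bounded: "\<exists>B. \<forall>x\<in>space M. \<bar>T x\<bar> \<le> B \<and> \<bar>T' x\<bar> \<le> B \<and> \<bar>R x\<bar> \<le> B \<and> \<bar>D x\<bar> \<le> B"
    and pos: "0 < \<rho>" "0 < \<delta>" "\<delta> \<le> d" "\<delta>\<^sup>2 \<le> \<kappa> * \<rho>"
    and close: "\<And>x. x \<in> space M \<Longrightarrow> \<bar>T x - T' x\<bar> \<le> \<delta>"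
    and antisym: "\<And>\<psi>. continuous_on UNIV \<psi> \<Longrightarrow>
      expectation (\<lambda>x. (T x - T' x) * \<psi> (T' x)) = - expectation (\<lambda>x. (T x - T' x) * \<psi> (T x))"
    and drift: "\<And>\<psi>. continuous_on UNIV \<psi> \<Longrightarrow>
      expectation (\<lambda>x. (T x - T' x) * \<psi> (T x)) = \<rho> * expectation (\<lambda>x. (T x + R x) * \<psi> (T x))"
    and quadratic: "\<And>\<psi>. continuous_on UNIV \<psi> \<Longrightarrow>
      expectation (\<lambda>x. (T x - T' x)\<^sup>2 * \<psi> (T x)) = 2 * \<rho> * expectation (\<lambda>x. (1 + D x) * \<psi> (T x))"
    and moments: "expectation (\<lambda>x. (T x)\<^sup>2) \<le> s" "expectation (\<lambda>x. \<bar>R x\<bar>) \<le> a * \<delta>"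
      "expectation (\<lambda>x. (D x)\<^sup>2) \<le> a * \<delta>\<^sup>2"
begin

text \<open>All four functions take values in one compact interval, so a continuous function of them
  is bounded. Most integrability obligations of the locale are instances of this.\<close>

lemma integrable_jointly_continuous:
  assumes F': "continuous_on UNIV (\<lambda>u. F (fst u) (fst (snd u)) (fst (snd (snd u))) (snd (snd (snd u))) :: real)"
  shows "integrable M (\<lambda>x. F (T x) (T' x) (R x) (D x))"
proof -
  have F: "continuous_on UNIV (\<lambda>(x, y, z, w). F x y z w)"
    using F' by (simp add: case_prod_unfold)
  obtain B where B: "\<And>x. x \<in> space M \<Longrightarrow> \<bar>T x\<bar> \<le> B" "\<And>x. x \<in> space M \<Longrightarrow> \<bar>T' x\<bar> \<le> B"
    "\<And>x. x \<in> space M \<Longrightarrow> \<bar>R x\<bar> \<le> B" "\<And>x. x \<in> space M \<Longrightarrow> \<bar>D x\<bar> \<le> B"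
    using bounded by meson
  let ?S = "{-B..B} \<times> {-B..B} \<times> {-B..B} \<times> {-B..B}"
  have "compact ((\<lambda>(x, y, z, w). F x y z w) ` ?S)"
    by (intro compact_continuous_image continuous_on_subset[OF F] compact_Times) auto
  from compact_imp_bounded[OF this] obtain C where C: "\<And>u. u \<in> ?S \<Longrightarrow> \<bar>(\<lambda>(x, y, z, w). F x y z w) u\<bar> \<le> C"
    unfolding bounded_iff real_norm_def by (metis imageI)
  show ?thesis
  proof (rule integrable_const_bound)
    show "AE x in M. norm (F (T x) (T' x) (R x) (D x)) \<le> C"
    proof (rule AE_I2)
      fix x assume x: "x \<in> space M"
      have "(T x, T' x, R x, D x) \<in> ?S" using B[OF x] by (auto simp: abs_le_iff)
      from C[OF this] show "norm (F (T x) (T' x) (R x) (D x)) \<le> C" by simp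
    qed
    have "(\<lambda>x. (\<lambda>(x, y, z, w). F x y z w) (T x, T' x, R x, D x)) \<in> borel_measurable M"
      by (rule measurable_compose[OF _ borel_measurable_continuous_onI[OF F]])
         (auto simp: borel_prod[symmetric])
    thus "(\<lambda>x. F (T x) (T' x) (R x) (D x)) \<in> borel_measurable M" by simp
  qed
qed

lemma int_TR: 
  "integrable M (\<lambda>x. (T x)\<^sup>2)" "integrable M (\<lambda>x. \<bar>R x\<bar>)" "integrable M (\<lambda>x. (D x)\<^sup>2)"
  "integrable M (\<lambda>x. \<bar>T x\<bar>)"
  by (rule integrable_jointly_continuous[of "\<lambda>t t' r d. t\<^sup>2"] 
      integrable_jointly_continuous[of "\<lambda>t t' r d. \<bar>r\<bar>"]
      integrable_jointly_continuous[of "\<lambda>t t' r d. d\<^sup>2"]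
      integrable_jointly_continuous[of "\<lambda>t t' r d. \<bar>t\<bar>"], intro continuous_intros)+

lemma expectation_abs_T: "expectation (\<lambda>x. \<bar>T x\<bar>) \<le> 1 + s"
proof -
  have "expectation (\<lambda>x. \<bar>T x\<bar>) \<le> expectation (\<lambda>x. 1 + (T x)\<^sup>2)"
  proof (rule integral_mono)
    fix x show "\<bar>T x\<bar> \<le> 1 + (T x)\<^sup>2"
      using zero_le_power2[of "\<bar>T x\<bar> - 1"] by (simp add: power2_eq_square algebra_simps) 
  qed (use int_TR in auto)
  also have "\<dots> = 1 + expectation (\<lambda>x. (T x)\<^sup>2)" using int_TR by (simp add: prob_space)
  finally show ?thesis using moments by linarith
qed

text \<open>What is bounded is not a probability but the indicator weighted by the squared jump, the
  form in which it enters the Stein error. On the window \<open>\<psi>\<close> has slope 1 at both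
  ends of the jump; elsewhere its monotonicity keeps the integrand nonnegative; and
  \<open>\<psi>\<close> itself is only of size \<open>\<delta>\<close>.\<close>

lemma concentration:
  "expectation (\<lambda>x. (T x - T' x)\<^sup>2 * indicator {z - 2 * \<delta>..z + 2 * \<delta>} (T x)) / (2 * \<rho>)
     \<le> 3 * \<delta> * (1 + s + a * d)"
proof -
  \<comment> \<open>The window has half-width \<open>2 * \<delta>\<close> and the linear part
    \<open>3 * \<delta>\<close>, so a jump of at most \<open>\<delta>\<close> starting in the window
    stays in the linear part.\<close>
  define \<psi> where "\<psi> = (\<lambda>x. max (- 3 * \<delta>) (min (3 * \<delta>) (x - z)))"
  have c: "continuous_on UNIV \<psi>" unfolding \<psi>_def by (intro continuous_intros)
  have \<psi>_bd: "\<bar>\<psi> x\<bar> \<le> 3 * \<delta>" for x using pos unfolding \<psi>_def by auto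
  have cc: "continuous_on UNIV (\<lambda>u. \<psi> (f u))" if "continuous_on UNIV f" for f :: "real\<times>real\<times>real\<times>real \<Rightarrow> real"
    using continuous_on_compose2[OF c that] by auto
  have i1: "integrable M (\<lambda>x. (T x - T' x) * \<psi> (T x))"
    by (rule integrable_jointly_continuous[of "\<lambda>t t' r d. (t - t') * \<psi> t"]) (intro continuous_intros cc)
  have i2: "integrable M (\<lambda>x. (T x - T' x) * \<psi> (T' x))"
    by (rule integrable_jointly_continuous[of "\<lambda>t t' r d. (t - t') * \<psi> t'"]) (intro continuous_intros cc)
  have i3: "integrable M (\<lambda>x. (T x + R x) * \<psi> (T x))"
    by (rule integrable_jointly_continuous[of "\<lambda>t t' r d. (t + r) * \<psi> t"]) (intro continuous_intros cc)
  have i4: "integrable M (\<lambda>x. (T x - T' x)\<^sup>2)"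
    by (rule integrable_jointly_continuous[of "\<lambda>t t' r d. (t - t')\<^sup>2"]) (intro continuous_intros cc)
  have "expectation (\<lambda>x. (T x - T' x)\<^sup>2 * indicator {z - 2 * \<delta>..z + 2 * \<delta>} (T x))
     \<le> expectation (\<lambda>x. (T x - T' x) * \<psi> (T x) - (T x - T' x) * \<psi> (T' x))"
  proof (rule integral_mono)
    show "integrable M (\<lambda>x. (T x - T' x)\<^sup>2 * indicator {z - 2 * \<delta>..z + 2 * \<delta>} (T x))"
      by (rule Bochner_Integration.integrable_bound[OF i4]) (auto split: split_indicator)
    show "integrable M (\<lambda>x. (T x - T' x) * \<psi> (T x) - (T x - T' x) * \<psi> (T' x))"
      using i1 i2 by auto
    fix x assume x: "x \<in> space M"
    have mono: "0 \<le> (T x - T' x) * (\<psi> (T x) - \<psi> (T' x))"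
    proof (cases "T x \<le> T' x")
      case True
      hence "\<psi> (T x) \<le> \<psi> (T' x)" unfolding \<psi>_def by (intro max.mono min.mono) auto
      with True show ?thesis by (intro mult_nonpos_nonpos) auto
    next
      case False
      hence "\<psi> (T' x) \<le> \<psi> (T x)" unfolding \<psi>_def by (intro max.mono min.mono) auto
      with False show ?thesis by (intro mult_nonneg_nonneg) auto
    qed
    show "(T x - T' x)\<^sup>2 * indicator {z - 2 * \<delta>..z + 2 * \<delta>} (T x)
        \<le> (T x - T' x) * \<psi> (T x) - (T x - T' x) * \<psi> (T' x)"
    proof (cases "T x \<in> {z - 2 * \<delta>..z + 2 * \<delta>}")
      case True
      with close[OF x] have "\<psi> (T x) = T x - z" "\<psi> (T' x) = T' x - z"
        unfolding \<psi>_def by (auto simp: abs_le_iff)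
      hence "(T x - T' x) * \<psi> (T x) - (T x - T' x) * \<psi> (T' x) = (T x - T' x)\<^sup>2"
        by (simp only:) (simp add: power2_eq_square algebra_simps)
      thus ?thesis using True by simp
    next
      case False thus ?thesis using mono by (simp add: algebra_simps)
    qed
  qed
  \<comment> \<open>By \<open>antisym\<close> the two terms contribute equally, whence the factor 2;
    \<open>drift\<close> then extracts \<open>\<rho>\<close>.\<close>
  also have "\<dots> = 2 * \<rho> * expectation (\<lambda>x. (T x + R x) * \<psi> (T x))"
    using antisym[OF c] drift[OF c] i1 i2 by simp
  also have "expectation (\<lambda>x. (T x + R x) * \<psi> (T x)) \<le> expectation (\<lambda>x. (\<bar>T x\<bar> + \<bar>R x\<bar>) * (3 * \<delta>))"
  proof (rule integral_mono[OF i3])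
    fix x
    have "(T x + R x) * \<psi> (T x) \<le> \<bar>T x + R x\<bar> * \<bar>\<psi> (T x)\<bar>" by (simp add: abs_mult[symmetric])
    also have "\<dots> \<le> (\<bar>T x\<bar> + \<bar>R x\<bar>) * (3 * \<delta>)" using \<psi>_bd by (intro mult_mono) auto
    finally show "(T x + R x) * \<psi> (T x) \<le> (\<bar>T x\<bar> + \<bar>R x\<bar>) * (3 * \<delta>)" .
  qed (use int_TR in auto)
  also have "\<dots> = (expectation (\<lambda>x. \<bar>T x\<bar>) + expectation (\<lambda>x. \<bar>R x\<bar>)) * (3 * \<delta>)"
    using int_TR by simp
  also have "\<dots> \<le> ((1 + s) + a * d) * (3 * \<delta>)"
  proof (rule mult_right_mono)
    have "0 \<le> a * \<delta>" using moments(2) by (rule order_trans[rotated]) auto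
    hence "a * \<delta> \<le> a * d" using pos by (intro mult_left_mono) (auto simp: zero_le_mult_iff)
    thus "expectation (\<lambda>x. \<bar>T x\<bar>) + expectation (\<lambda>x. \<bar>R x\<bar>) \<le> 1 + s + a * d"
      using expectation_abs_T moments by linarith
  qed (use pos in auto)
  finally show ?thesis using pos by (simp add: field_simps)
qed

text \<open>\<open>jump\<close> says that at scale \<open>\<delta>\<close> the function
  \<open>h\<close> is 1-Lipschitz apart from an oscillation of at most 1 near \<open>z\<close>. The
  indicator is there for ramps of slope \<open>1 / \<delta>\<close>, so that both distances follow
  from one estimate.\<close>

lemma stein_bound:
  fixes h :: "real \<Rightarrow> real"
  assumes h: "continuous_on UNIV h" "\<And>t. \<bar>h t\<bar> \<le> 1 + \<bar>t\<bar>"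
    and jump: "\<And>x y. \<bar>x - y\<bar> \<le> \<delta> \<Longrightarrow>
       \<bar>h x - h y\<bar> \<le> \<bar>x - y\<bar> + indicator {z - 2 * \<delta>..z + 2 * \<delta>} x"
    and K: "0 < K" "\<And>x. \<bar>stein_solution h x\<bar> \<le> K" "\<bar>gauss_exp h\<bar> \<le> K"
  shows "\<bar>expectation (\<lambda>x. h (T x)) - gauss_exp h\<bar>
     \<le> ((K + 1) * (a + 1 + s) + K * a + 3 * (1 + s + a * d) + \<kappa> * (K + 1) * (2 + d) * (1 + s)) * \<delta>"
proof -
  define \<psi> where "\<psi> = stein_solution h"
  \<comment> \<open>The derivative of \<open>\<psi>\<close>, by the Stein equation.\<close>
  define g where "g = (\<lambda>x. x * \<psi> x + h x - gauss_exp h)"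
  have d\<psi>: "(\<psi> has_real_derivative g x) (at x)" for x
    unfolding \<psi>_def g_def by (rule stein_solution_has_derivative[OF h])
  have c\<psi>: "continuous_on UNIV \<psi>"
    by (rule DERIV_continuous_on) (rule d\<psi>[THEN has_field_derivative_at_within])
  have cg: "continuous_on UNIV g" unfolding g_def by (intro continuous_intros c\<psi> h)
  have K\<psi>: "\<bar>\<psi> x\<bar> \<le> K" for x unfolding \<psi>_def by (rule K)
  have gK: "\<bar>g x\<bar> \<le> (K + 1) * (1 + \<bar>x\<bar>)" for x
  proof -
    have "\<bar>g x\<bar> \<le> \<bar>x\<bar> * \<bar>\<psi> x\<bar> + \<bar>h x\<bar> + \<bar>gauss_exp h\<bar>" unfolding g_def by (simp add: abs_mult[symmetric])
    also have "\<dots> \<le> \<bar>x\<bar> * K + (1 + \<bar>x\<bar>) + K"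
      using K\<psi>[of x] h(2)[of x] K(3) by (intro add_mono mult_left_mono) auto
    finally show ?thesis by (simp add: algebra_simps)
  qed
  have ccomp: "continuous_on UNIV (\<lambda>u. p (f u))"
    if "continuous_on UNIV p" "continuous_on UNIV f" for f :: "real\<times>real\<times>real\<times>real \<Rightarrow> real" and p :: "real \<Rightarrow> real"
    using continuous_on_compose2[OF that] by auto
  note ci = continuous_intros ccomp[OF c\<psi>] ccomp[OF cg] ccomp[OF h(1)]
  have i_h: "integrable M (\<lambda>x. h (T x))"
    by (rule integrable_jointly_continuous[of "\<lambda>t t' r d. h t"]) (intro ci)
  have i_g: "integrable M (\<lambda>x. g (T x))"
    by (rule integrable_jointly_continuous[of "\<lambda>t t' r d. g t"]) (intro ci)
  have i_Dg: "integrable M (\<lambda>x. D x * g (T x))"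
    by (rule integrable_jointly_continuous[of "\<lambda>t t' r d. d * g t"]) (intro ci)
  have i_T\<psi>: "integrable M (\<lambda>x. T x * \<psi> (T x))"
    by (rule integrable_jointly_continuous[of "\<lambda>t t' r d. t * \<psi> t"]) (intro ci)
  have i_R\<psi>: "integrable M (\<lambda>x. R x * \<psi> (T x))"
    by (rule integrable_jointly_continuous[of "\<lambda>t t' r d. r * \<psi> t"]) (intro ci)
  have i_\<Delta>\<psi>: "integrable M (\<lambda>x. (T x - T' x) * \<psi> (T x))"
    by (rule integrable_jointly_continuous[of "\<lambda>t t' r d. (t - t') * \<psi> t"]) (intro ci)
  have i_\<Delta>\<psi>': "integrable M (\<lambda>x. (T x - T' x) * \<psi> (T' x))"
    by (rule integrable_jointly_continuous[of "\<lambda>t t' r d. (t - t') * \<psi> t'"]) (intro ci)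
  have i_\<Delta>g: "integrable M (\<lambda>x. (T x - T' x)\<^sup>2 * g (T x))"
    by (rule integrable_jointly_continuous[of "\<lambda>t t' r d. (t - t')\<^sup>2 * g t"]) (intro ci)
  have i_\<Delta>: "integrable M (\<lambda>x. (T x - T' x)\<^sup>2)"
    by (rule integrable_jointly_continuous[of "\<lambda>t t' r d. (t - t')\<^sup>2"]) (intro ci)
  \<comment> \<open>The jump times the Taylor remainder that arises when
    \<open>\<psi> (T x) - \<psi> (T' x)\<close> is replaced by
    \<open>(T x - T' x) * g (T x)\<close>.\<close>
  define e where "e = (\<lambda>x. (T x - T' x) * (\<psi> (T x) - \<psi> (T' x)) - (T x - T' x)\<^sup>2 * g (T x))"
  have i_e: "integrable M e" unfolding e_def right_diff_distrib
    using i_\<Delta>\<psi> i_\<Delta>\<psi>' i_\<Delta>g by (intro Bochner_Integration.integrable_diff)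
  have Ee: "expectation e = 2 * expectation (\<lambda>x. (T x - T' x) * \<psi> (T x)) - expectation (\<lambda>x. (T x - T' x)\<^sup>2 * g (T x))"
    unfolding e_def right_diff_distrib using i_\<Delta>\<psi> i_\<Delta>\<psi>' i_\<Delta>g antisym[OF c\<psi>] by simp
  \<comment> \<open>After \<open>antisym\<close> the drift term and the quadratic term both carry
    the factor \<open>2 * \<rho>\<close>. The contributions \<open>T x * \<psi> (T x)\<close> cancel
    through the Stein equation, and \<open>h (T x) - gauss_exp h\<close> remains.\<close>
  have main: "expectation (\<lambda>x. h (T x)) - gauss_exp h =
     - expectation (\<lambda>x. D x * g (T x)) - expectation e / (2 * \<rho>) + expectation (\<lambda>x. R x * \<psi> (T x))"
  proof -
    have 1: "expectation (\<lambda>x. g (T x)) = expectation (\<lambda>x. T x * \<psi> (T x)) + expectation (\<lambda>x. h (T x)) - gauss_exp h"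
      unfolding g_def using i_T\<psi> i_h by (simp add: prob_space)
    have 2: "expectation (\<lambda>x. (T x - T' x) * \<psi> (T x)) =
        \<rho> * (expectation (\<lambda>x. T x * \<psi> (T x)) + expectation (\<lambda>x. R x * \<psi> (T x)))"
      unfolding drift[OF c\<psi>] distrib_right using i_T\<psi> i_R\<psi> by simp
    have 3: "expectation (\<lambda>x. (T x - T' x)\<^sup>2 * g (T x)) =
        2 * \<rho> * (expectation (\<lambda>x. g (T x)) + expectation (\<lambda>x. D x * g (T x)))"
      unfolding quadratic[OF cg] distrib_right using i_g i_Dg by simp
    have "expectation e = 2 * \<rho> * (gauss_exp h - expectation (\<lambda>x. h (T x))
        - expectation (\<lambda>x. D x * g (T x)) + expectation (\<lambda>x. R x * \<psi> (T x)))"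
      unfolding Ee 2 3 1 by (simp add: algebra_simps)
    thus ?thesis using pos(1) by (simp add: field_simps)
  qed
  have s0: "0 \<le> s" using moments(1) by (rule order_trans[rotated]) auto
  have B1: "\<bar>expectation (\<lambda>x. D x * g (T x))\<bar> \<le> (K + 1) * (a + 1 + s) * \<delta>"
  proof -
    have "\<bar>expectation (\<lambda>x. D x * g (T x))\<bar> \<le> expectation (\<lambda>x. \<bar>D x * g (T x)\<bar>)"
      by (rule integral_abs_bound)
    also have "\<dots> \<le> expectation (\<lambda>x. (K + 1) * ((D x)\<^sup>2 / \<delta> + \<delta> / 2 + \<delta> / 2 * (T x)\<^sup>2))"
    proof (rule integral_mono)
      fix x
      \<comment> \<open>A weighted arithmetic-geometric mean inequality: the weight
        \<open>\<delta>\<close> balances \<open>D\<close>, of L2 size \<open>\<delta>\<close>,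
        against \<open>1\<close> and \<open>T\<close>, of size 1.\<close>
      have am: "\<bar>D x\<bar> * y \<le> ((D x)\<^sup>2 / \<delta> + \<delta> * y\<^sup>2) / 2" for y
      proof -
        have "0 \<le> (\<bar>D x\<bar> - \<delta> * y)\<^sup>2 / \<delta>" using pos by auto
        also have "\<dots> = (D x)\<^sup>2 / \<delta> + \<delta> * y\<^sup>2 - 2 * (\<bar>D x\<bar> * y)"
          using pos by (simp add: power2_eq_square field_simps)
        finally show ?thesis by simp
      qed
      have "\<bar>D x * g (T x)\<bar> \<le> \<bar>D x\<bar> * ((K + 1) * (1 + \<bar>T x\<bar>))"
        unfolding abs_mult using gK by (intro mult_left_mono) auto
      also have "\<dots> = (K + 1) * (\<bar>D x\<bar> * 1 + \<bar>D x\<bar> * \<bar>T x\<bar>)" by (simp add: algebra_simps)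
      also have "\<dots> \<le> (K + 1) * (((D x)\<^sup>2 / \<delta> + \<delta> * 1\<^sup>2) / 2 + ((D x)\<^sup>2 / \<delta> + \<delta> * \<bar>T x\<bar>\<^sup>2) / 2)"
        using K(1) by (intro mult_left_mono add_mono am) auto
      also have "\<dots> = (K + 1) * ((D x)\<^sup>2 / \<delta> + \<delta> / 2 + \<delta> / 2 * (T x)\<^sup>2)"
        by (simp add: field_simps)
      finally show "\<bar>D x * g (T x)\<bar> \<le> (K + 1) * ((D x)\<^sup>2 / \<delta> + \<delta> / 2 + \<delta> / 2 * (T x)\<^sup>2)" .
    qed (use i_Dg int_TR in auto)
    also have "\<dots> = (K + 1) * (expectation (\<lambda>x. (D x)\<^sup>2) / \<delta> + \<delta> / 2 + \<delta> / 2 * expectation (\<lambda>x. (T x)\<^sup>2))"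
      using int_TR by (simp add: prob_space)
    also have "\<dots> \<le> (K + 1) * ((a * \<delta>\<^sup>2) / \<delta> + \<delta> / 2 + \<delta> / 2 * s)"
      using K(1) pos moments by (intro mult_left_mono add_mono divide_right_mono) auto
    also have "\<dots> \<le> (K + 1) * (a * \<delta> + \<delta> + \<delta> * s)"
      using K(1) pos s0 by (intro mult_left_mono add_mono) (auto simp: power2_eq_square)
    finally show ?thesis by (simp add: algebra_simps)
  qed
  have B2: "\<bar>expectation (\<lambda>x. R x * \<psi> (T x))\<bar> \<le> K * a * \<delta>"
  proof -
    have "\<bar>expectation (\<lambda>x. R x * \<psi> (T x))\<bar> \<le> expectation (\<lambda>x. \<bar>R x * \<psi> (T x)\<bar>)"
      by (rule integral_abs_bound)
    also have "\<dots> \<le> expectation (\<lambda>x. K * \<bar>R x\<bar>)"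
      by (rule integral_mono[OF integrable_abs[OF i_R\<psi>]]) (use int_TR K\<psi> in \<open>auto simp: abs_mult mult.commute[of K] intro!: mult_left_mono\<close>)
    also have "\<dots> = K * expectation (\<lambda>x. \<bar>R x\<bar>)" by simp
    also have "\<dots> \<le> K * (a * \<delta>)" using K moments by (intro mult_left_mono) auto
    finally show ?thesis by (simp add: mult.assoc)
  qed
  let ?J = "\<lambda>x. indicator {z - 2 * \<delta>..z + 2 * \<delta>} (T x) :: real"
  have B3: "\<bar>expectation e / (2 * \<rho>)\<bar> \<le> (3 * (1 + s + a * d) + \<kappa> * (K + 1) * (2 + d) * (1 + s)) * \<delta>"
  proof -
    define L where "L = (K + 1) * (2 + d)"
    have L0: "0 \<le> L" unfolding L_def using K pos by auto
    have e_bd: "\<bar>e x\<bar> \<le> (T x - T' x)\<^sup>2 * ?J x + \<delta> * \<delta>\<^sup>2 * (L * (1 + (T x)\<^sup>2))" if x: "x \<in> space M" for x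
    proof -
      obtain \<xi> where \<xi>: "\<bar>\<xi> - T x\<bar> \<le> \<bar>T' x - T x\<bar>" "\<psi> (T x) - \<psi> (T' x) = (T x - T' x) * g \<xi>"
        by (rule mvt_between[OF d\<psi>])
      \<comment> \<open>\<open>g\<close> cannot be expanded, as \<open>h\<close> is only continuous.
        Its change is read off from the Stein equation instead, as a change of \<open>h\<close> plus
        a change of \<open>\<psi>\<close>, and for the latter the mean value theorem is used a
        second time.\<close>
      obtain \<eta> where \<eta>: "\<bar>\<eta> - T x\<bar> \<le> \<bar>\<xi> - T x\<bar>" "\<psi> (T x) - \<psi> \<xi> = (T x - \<xi>) * g \<eta>"
        by (rule mvt_between[OF d\<psi>])
      have \<xi>d: "\<bar>\<xi> - T x\<bar> \<le> \<delta>" and \<eta>d: "\<bar>\<eta> - T x\<bar> \<le> d" using \<xi> \<eta> close[OF x] pos by auto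
      have "\<bar>g \<xi> - g (T x)\<bar> = \<bar>(h \<xi> - h (T x)) + (\<xi> - T x) * \<psi> \<xi> - T x * ((T x - \<xi>) * g \<eta>)\<bar>"
        by (simp only: \<eta>(2)[symmetric]) (simp add: g_def algebra_simps)
      also have "\<dots> \<le> \<bar>h (T x) - h \<xi>\<bar> + \<bar>(\<xi> - T x) * \<psi> \<xi>\<bar> + \<bar>T x * ((T x - \<xi>) * g \<eta>)\<bar>"
        by linarith
      also have "\<bar>h (T x) - h \<xi>\<bar> \<le> \<bar>T x - \<xi>\<bar> + ?J x"
        using jump[of "T x" \<xi>] \<xi>d by (auto simp: abs_minus_commute)
      also have "\<bar>T x - \<xi>\<bar> \<le> \<delta>" using \<xi>d by (simp add: abs_minus_commute)
      also have "\<bar>(\<xi> - T x) * \<psi> \<xi>\<bar> \<le> \<delta> * K"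
        unfolding abs_mult using \<xi>d K\<psi> pos by (intro mult_mono) auto
      also have "\<bar>T x * ((T x - \<xi>) * g \<eta>)\<bar> \<le> \<bar>T x\<bar> * (\<delta> * ((K + 1) * (1 + \<bar>T x\<bar> + d)))"
      proof -
        have "\<bar>g \<eta>\<bar> \<le> (K + 1) * (1 + \<bar>\<eta>\<bar>)" by (rule gK)
        also have "\<dots> \<le> (K + 1) * (1 + \<bar>T x\<bar> + d)" using \<eta>d K by (intro mult_left_mono) auto
        finally show ?thesis unfolding abs_mult using \<xi>d pos
          by (intro mult_left_mono mult_mono) (auto simp: abs_minus_commute)
      qed
      finally have "\<bar>g \<xi> - g (T x)\<bar> \<le> ?J x + \<delta> * ((K + 1) + (K + 1) * (\<bar>T x\<bar> * (1 + \<bar>T x\<bar> + d)))"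
        by (simp add: algebra_simps)
      also have "(K + 1) + (K + 1) * (\<bar>T x\<bar> * (1 + \<bar>T x\<bar> + d)) \<le> L * (1 + (T x)\<^sup>2)"
      proof -
        have t: "\<bar>T x\<bar> \<le> 1 + (T x)\<^sup>2"
          using zero_le_power2[of "\<bar>T x\<bar> - 1"] by (simp add: power2_eq_square algebra_simps)
        have "(1 + d) * \<bar>T x\<bar> \<le> (1 + d) * (1 + (T x)\<^sup>2)" using pos by (intro mult_left_mono t) auto
        moreover have "\<bar>T x\<bar> * (1 + \<bar>T x\<bar> + d) = (1 + d) * \<bar>T x\<bar> + (T x)\<^sup>2"
          by (simp add: algebra_simps power2_eq_square)
        ultimately have "1 + \<bar>T x\<bar> * (1 + \<bar>T x\<bar> + d) \<le> (2 + d) * (1 + (T x)\<^sup>2)"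
          by (simp add: algebra_simps)
        from mult_left_mono[OF this, of "K + 1"] K show ?thesis
          unfolding L_def by (simp add: algebra_simps)
      qed
      finally have gd: "\<bar>g \<xi> - g (T x)\<bar> \<le> ?J x + \<delta> * (L * (1 + (T x)\<^sup>2))" using pos by auto
      have "e x = (T x - T' x)\<^sup>2 * (g \<xi> - g (T x))"
        unfolding e_def \<xi>(2) by (simp add: power2_eq_square algebra_simps)
      hence "\<bar>e x\<bar> \<le> (T x - T' x)\<^sup>2 * (?J x + \<delta> * (L * (1 + (T x)\<^sup>2)))"
        using gd by (simp add: abs_mult mult_left_mono)
      also have "\<dots> = (T x - T' x)\<^sup>2 * ?J x + (T x - T' x)\<^sup>2 * (\<delta> * (L * (1 + (T x)\<^sup>2)))"
        by (simp add: distrib_left)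
      also have "(T x - T' x)\<^sup>2 * (\<delta> * (L * (1 + (T x)\<^sup>2))) \<le> \<delta>\<^sup>2 * (\<delta> * (L * (1 + (T x)\<^sup>2)))"
        using close[OF x] pos L0 by (intro mult_right_mono) (auto simp: abs_le_square_iff[symmetric])
      finally show ?thesis by (simp add: mult_ac)
    qed
    have iJ: "integrable M (\<lambda>x. (T x - T' x)\<^sup>2 * ?J x)"
      by (rule Bochner_Integration.integrable_bound[OF i_\<Delta>]) (auto split: split_indicator)
    have \<kappa>: "0 < \<kappa>"
    proof -
      have "0 < \<delta>\<^sup>2" using pos by simp
      hence "0 < \<kappa> * \<rho>" using pos(4) by linarith
      thus ?thesis using pos(1) by (simp add: zero_less_mult_iff)
    qed
    have "\<bar>expectation e\<bar> \<le> expectation (\<lambda>x. \<bar>e x\<bar>)" by (rule integral_abs_bound)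
    also have "\<dots> \<le> expectation (\<lambda>x. (T x - T' x)\<^sup>2 * ?J x + \<delta> * \<delta>\<^sup>2 * (L * (1 + (T x)\<^sup>2)))"
      by (rule integral_mono) (use i_e iJ int_TR e_bd in auto)
    also have "\<dots> = expectation (\<lambda>x. (T x - T' x)\<^sup>2 * ?J x) + \<delta> * \<delta>\<^sup>2 * (L * (1 + expectation (\<lambda>x. (T x)\<^sup>2)))"
      using iJ int_TR by (simp add: prob_space)
    \<comment> \<open>\<open>concentration\<close> handles the jump term and
      \<open>\<delta>^2 \<le> \<kappa> * \<rho>\<close> the cubic one; both then contain
      \<open>\<rho>\<close>, and division by \<open>2 * \<rho>\<close> leaves order
      \<open>\<delta>\<close>.\<close>
    also have "\<dots> \<le> 2 * \<rho> * (3 * \<delta> * (1 + s + a * d)) + \<delta> * (\<kappa> * \<rho>) * (L * (1 + s))"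
      using concentration[of z] pos L0 moments s0 \<kappa>
      by (intro add_mono mult_mono) (auto simp: field_simps)
    finally have "\<bar>expectation e\<bar> \<le> 2 * \<rho> * (3 * \<delta> * (1 + s + a * d)) + \<delta> * (\<kappa> * \<rho>) * (L * (1 + s))" .
    hence "\<bar>expectation e / (2 * \<rho>)\<bar> \<le> 3 * \<delta> * (1 + s + a * d) + \<delta> * \<kappa> * (L * (1 + s)) / 2"
      using pos by (simp add: abs_mult field_simps)
    also have "\<delta> * \<kappa> * (L * (1 + s)) / 2 \<le> \<delta> * \<kappa> * (L * (1 + s))"
      using mult_nonneg_nonneg[of "\<delta> * \<kappa>" "L * (1 + s)"] \<kappa> pos L0 s0 by (simp add: algebra_simps)
    finally show ?thesis unfolding L_def by (simp add: algebra_simps)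
  qed
  have "\<bar>expectation (\<lambda>x. h (T x)) - gauss_exp h\<bar> \<le> (K + 1) * (a + 1 + s) * \<delta>
     + (3 * (1 + s + a * d) + \<kappa> * (K + 1) * (2 + d) * (1 + s)) * \<delta> + K * a * \<delta>"
    unfolding main using B1 B2 B3 by linarith
  thus ?thesis by (simp add: algebra_simps)
qed

end

section \<open>From test functions to the two distances\<close>

lemma std_normal_cdf_increment:
  assumes "0 \<le> e"
  shows "cdf std_normal_distribution (z + e) \<le> cdf std_normal_distribution z + e"
proof -
  interpret prob_space std_normal_distribution by (rule prob_space_normal_density) simp
  have "{..z + e} = {..z} \<union> {z<..z + e}" using assms by auto
  hence "prob {..z + e} = prob {..z} + prob {z<..z + e}"
    by (simp only:) (rule finite_measure_Union, auto)
  moreover have "prob {z<..z + e} \<le> e"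
  proof -
    have "emeasure std_normal_distribution {z<..z + e} =
       (\<integral>\<^sup>+x. ennreal (std_normal_density x) * indicator {z<..z + e} x \<partial>lborel)"
      by (rule emeasure_density) auto
    also have "\<dots> \<le> (\<integral>\<^sup>+x. indicator {z<..z + e} x \<partial>lborel)"
    proof (rule nn_integral_mono)
      fix x :: real
      have "1 \<le> sqrt (2 * pi)" using pi_gt3 by (intro real_le_rsqrt) auto
      hence "std_normal_density x \<le> 1 * 1"
        unfolding std_normal_density_def by (intro mult_mono) auto
      hence "ennreal (std_normal_density x) \<le> 1" using ennreal_leI by fastforce
      thus "ennreal (std_normal_density x) * indicator {z<..z + e} x \<le> indicator {z<..z + e} x"
        by (auto split: split_indicator)
    qed
    also have "\<dots> = ennreal e" using assms by simp
    finally show ?thesis using assms by (simp add: emeasure_eq_measure)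
  qed
  ultimately show ?thesis by (simp add: cdf_def)
qed

text \<open>The constant is quantified before the probability space and the pair. This order is what
  later gives uniformity in \<open>n\<close>, on which the space, \<open>\<delta>\<close> and
  \<open>\<rho>\<close> all depend.\<close>

theorem exchangeable_pair_normal_approximation:
  fixes s a \<kappa> d :: real
  shows "\<exists>C>0. \<forall>(M :: 'a measure) T T' R D \<delta> \<rho>.
    exchangeable_pair M T T' R D \<delta> \<rho> s a \<kappa> d \<longrightarrow>
      (\<forall>h :: real \<Rightarrow> real. (\<forall>x y. \<bar>h x - h y\<bar> \<le> \<bar>x - y\<bar>) \<longrightarrow>
         \<bar>(\<integral>x. h (T x) \<partial>M) - gauss_exp h\<bar> \<le> C * \<delta>) \<and>
      (\<forall>z. \<bar>measure M {x \<in> space M. T x \<le> z} - cdf std_normal_distribution z\<bar> \<le> C * \<delta>)"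
proof -
  obtain K where K0: "0 < K" and
    K1: "\<And>h x. continuous_on UNIV h \<Longrightarrow> (\<And>t. \<bar>h t\<bar> \<le> 1 + \<bar>t\<bar>) \<Longrightarrow> \<bar>stein_solution h x\<bar> \<le> K" and
    K2: "\<And>h. continuous_on UNIV h \<Longrightarrow> (\<And>t. \<bar>h t\<bar> \<le> 1 + \<bar>t\<bar>) \<Longrightarrow> \<bar>gauss_exp h\<bar> \<le> K"
    by (rule stein_solution_bounded) blast
  define C0 where "C0 = (K + 1) * (a + 1 + s) + K * a + 3 * (1 + s + a * d) + \<kappa> * (K + 1) * (2 + d) * (1 + s)"
  \<comment> \<open>The extra 1 pays for shifting the argument of the normal distribution function
    by the ramp width \<open>\<delta>\<close>.\<close>
  define C where "C = \<bar>C0\<bar> + 1"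
  have "0 < C" unfolding C_def by simp
  moreover have "(\<forall>h :: real \<Rightarrow> real. (\<forall>x y. \<bar>h x - h y\<bar> \<le> \<bar>x - y\<bar>) \<longrightarrow>
         \<bar>(\<integral>x. h (T x) \<partial>M) - gauss_exp h\<bar> \<le> C * \<delta>) \<and>
      (\<forall>z. \<bar>measure M {x \<in> space M. T x \<le> z} - cdf std_normal_distribution z\<bar> \<le> C * \<delta>)"
    if "exchangeable_pair M T T' R D \<delta> \<rho> s a \<kappa> d" for M :: "'a measure" and T T' R D \<delta> \<rho>
  proof -
    interpret exchangeable_pair M T T' R D \<delta> \<rho> s a \<kappa> d by fact
    interpret N: prob_space std_normal_distribution by (rule prob_space_normal_density) simp
    have d0: "0 < \<delta>" by (rule pos)
    have bound: "\<bar>expectation (\<lambda>x. h (T x)) - gauss_exp h\<bar> \<le> (C - 1) * \<delta>"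
      if h: "continuous_on UNIV h" "\<And>t. \<bar>h t\<bar> \<le> 1 + \<bar>t\<bar>"
       and j: "\<And>x y. \<bar>x - y\<bar> \<le> \<delta> \<Longrightarrow>
       \<bar>h x - h y\<bar> \<le> \<bar>x - y\<bar> + indicator {z - 2 * \<delta>..z + 2 * \<delta>} x" for h z
    proof -
      have "\<bar>expectation (\<lambda>x. h (T x)) - gauss_exp h\<bar> \<le> C0 * \<delta>"
        unfolding C0_def by (rule stein_bound[OF h j K0]) (use K1[OF h] K2[OF h] in auto)
      also have "\<dots> \<le> (C - 1) * \<delta>" unfolding C_def using d0 by (intro mult_right_mono) auto
      finally show ?thesis .
    qed
    have le: "(C - 1) * \<delta> \<le> C * \<delta>" using d0 by simp
    have lip: "\<bar>(\<integral>x. h (T x) \<partial>M) - gauss_exp h\<bar> \<le> C * \<delta>"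
      if L: "\<forall>x y. \<bar>h x - h y\<bar> \<le> \<bar>x - y\<bar>" for h :: "real \<Rightarrow> real"
    proof -
      have c: "continuous_on UNIV h"
        by (rule lipschitz_on_continuous_on[of 1]) (use L in \<open>auto simp: lipschitz_on_def dist_real_def\<close>)
      have ih: "integrable std_normal_distribution h"
      proof (rule integrable_std_normal_linear_growth[where a="\<bar>h 0\<bar>"])
        show "h \<in> borel_measurable borel" using c by (rule borel_measurable_continuous_onI)
        fix t show "\<bar>h t\<bar> \<le> \<bar>h 0\<bar> + \<bar>t\<bar>" using L[rule_format, of t 0] by linarith
      qed
      have iT: "integrable M (\<lambda>x. h (T x))"
        by (rule integrable_jointly_continuous[of "\<lambda>t t' r d. h t"])
           (intro continuous_intros continuous_on_compose2[OF c], auto)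
      \<comment> \<open>Subtracting \<open>h 0\<close> brings \<open>h\<close> under the bound
        \<open>1 + \<bar>t\<bar>\<close> and changes both means by the same amount. The window is
        placed at 0 arbitrarily.\<close>
      have "\<bar>expectation (\<lambda>x. h (T x) - h 0) - gauss_exp (\<lambda>x. h x - h 0)\<bar> \<le> (C - 1) * \<delta>"
      proof (rule bound[of "\<lambda>x. h x - h 0" 0])
        show "continuous_on UNIV (\<lambda>x. h x - h 0)" by (intro continuous_intros c)
        fix t show "\<bar>h t - h 0\<bar> \<le> 1 + \<bar>t\<bar>" using L[rule_format, of t 0] by linarith
      next
        fix x y show "\<bar>h x - h 0 - (h y - h 0)\<bar> \<le> \<bar>x - y\<bar> + indicator {0 - 2 * \<delta>..0 + 2 * \<delta>} x"
          using L[rule_format, of x y] by (simp add: add_increasing2)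
      qed
      moreover have "expectation (\<lambda>x. h (T x) - h 0) = expectation (\<lambda>x. h (T x)) - h 0"
        using iT by (simp add: prob_space)
      moreover have "gauss_exp (\<lambda>x. h x - h 0) = gauss_exp h - h 0"
        using ih N.prob_space by simp
      ultimately show ?thesis using le by simp
    qed
    \<comment> \<open>A ramp falling from 1 to 0 on \<open>{z..z + \<delta>}\<close>. Its width
      equals the bound on the jumps, so smoothing error and Stein error have the same order.\<close>
    define H where "H = (\<lambda>z x. max 0 (min 1 (1 + (z - x) / \<delta>)))"
    have H1: "0 \<le> H z x" "H z x \<le> 1" for z x unfolding H_def by auto
    have Hle: "H z x \<le> indicator {..z + \<delta>} x" for z x
      using d0 unfolding H_def by (auto simp: field_simps split: split_indicator)
    have Hge: "indicator {..z} x \<le> H z x" for z x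
      using d0 unfolding H_def by (auto simp: field_simps split: split_indicator)
    have cH: "continuous_on UNIV (H z)" for z
      unfolding H_def by (intro continuous_intros) (use d0 in auto)
    have mH: "H z \<in> borel_measurable borel" for z
      using cH by (rule borel_measurable_continuous_onI)
    have Hout: "H z x = 1" if "x \<le> z" for z x using that d0 unfolding H_def by (auto simp: field_simps)
    have Hout': "H z x = 0" if "z + \<delta> \<le> x" for z x using that d0 unfolding H_def by (auto simp: field_simps)
    have Hb: "\<bar>expectation (\<lambda>x. H z (T x)) - gauss_exp (H z)\<bar> \<le> (C - 1) * \<delta>" for z
    proof (rule bound[OF cH, of _ z])
      fix t show "\<bar>H z t\<bar> \<le> 1 + \<bar>t\<bar>" using H1[of z t] by auto
    next
      fix x y assume xy: "\<bar>x - y\<bar> \<le> \<delta>"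
      show "\<bar>H z x - H z y\<bar> \<le> \<bar>x - y\<bar> + indicator {z - 2 * \<delta>..z + 2 * \<delta>} x"
      proof (cases "x \<in> {z - 2 * \<delta>..z + 2 * \<delta>}")
        case True
        thus ?thesis using H1[of z x] H1[of z y] by auto
      next
        case False
        \<comment> \<open>Outside the window, a point and any neighbour within
          \<open>\<delta>\<close> lie on the same flat piece of the ramp.\<close>
        hence "x \<le> z \<and> y \<le> z \<or> z + \<delta> \<le> x \<and> z + \<delta> \<le> y" using xy d0 by auto
        thus ?thesis using Hout Hout' by auto
      qed
    qed
    have iH: "integrable M (\<lambda>x. H z (T x))" for z
      by (rule integrable_const_bound[where B=1]) (use H1 mH in \<open>auto intro: measurable_compose[OF meas(1)]\<close>)
    have iH': "integrable std_normal_distribution (H z)" for z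
      by (rule N.integrable_const_bound[where B=1]) (use H1 mH in auto)
    have P: "prob {x \<in> space M. T x \<le> z} = expectation (\<lambda>x. indicator {..z} (T x))" for z
    proof -
      have "expectation (\<lambda>x. indicator {..z} (T x)) = expectation (indicat_real {x \<in> space M. T x \<le> z})"
        by (rule Bochner_Integration.integral_cong) (auto split: split_indicator)
      also have "\<dots> = prob ({x \<in> space M. T x \<le> z} \<inter> space M)" by (rule Bochner_Integration.integral_indicator)
      also have "{x \<in> space M. T x \<le> z} \<inter> space M = {x \<in> space M. T x \<le> z}" by auto
      finally show ?thesis by simp
    qed
    have iI: "integrable M (\<lambda>x. indicator {..z} (T x) :: real)" for z
      by (rule integrable_const_bound[where B=1]) auto
    have G: "cdf std_normal_distribution z = gauss_exp (indicator {..z})" for z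
      by (simp add: cdf_def)
    have iI': "integrable std_normal_distribution (indicator {..z} :: real \<Rightarrow> real)" for z
      by (rule N.integrable_const_bound[where B=1]) auto
    have kol: "\<bar>prob {x \<in> space M. T x \<le> z} - cdf std_normal_distribution z\<bar> \<le> C * \<delta>" for z
    proof -
      \<comment> \<open>\<open>H z\<close> serves for the upper bound and
        \<open>H (z - \<delta>)\<close> for the lower one, each at the cost of one shift by
        \<open>\<delta>\<close>.\<close>
      have "prob {x \<in> space M. T x \<le> z} \<le> expectation (\<lambda>x. H z (T x))"
        unfolding P by (rule integral_mono[OF iI iH]) (rule Hge)
      moreover have "gauss_exp (H z) \<le> cdf std_normal_distribution (z + \<delta>)"
        unfolding G by (rule integral_mono[OF iH' iI']) (rule Hle)
      moreover have "expectation (\<lambda>x. H (z - \<delta>) (T x)) \<le> prob {x \<in> space M. T x \<le> z}"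
        unfolding P by (rule integral_mono[OF iH iI]) (use Hle[of "z - \<delta>"] in auto)
      moreover have "cdf std_normal_distribution (z - \<delta>) \<le> gauss_exp (H (z - \<delta>))"
        unfolding G by (rule integral_mono[OF iI' iH']) (rule Hge)
      moreover have "cdf std_normal_distribution (z + \<delta>) \<le> cdf std_normal_distribution z + \<delta>"
        "cdf std_normal_distribution z \<le> cdf std_normal_distribution (z - \<delta>) + \<delta>"
        using std_normal_cdf_increment[of \<delta> z] std_normal_cdf_increment[of \<delta> "z - \<delta>"] d0 by auto
      moreover have "(C - 1) * \<delta> = C * \<delta> - \<delta>" by (simp add: algebra_simps)
      ultimately show ?thesis using Hb[of z] Hb[of "z - \<delta>"] unfolding abs_le_iff by linarith
    qed
    from lip kol show ?thesis by blast
  qed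
  ultimately show ?thesis by blast
qed

section \<open>Power series and Bessel functions\<close>

text \<open>\<open>sph N |h|\<^sup>2\<close> is the Laplace transform \<open>\<integral> exp \<langle>h, s\<rangle> d\<mu>(s)\<close> of the uniform measure on the sphere;
  in the variable \<open>q = |h|\<^sup>2\<close> it is an entire function, unlike the Bessel functions it stands for, and
  \<open>logd N q = f(\<surd>q) / \<surd>q\<close>.\<close>

definition sph_coeff :: "nat \<Rightarrow> nat \<Rightarrow> real" where
  "sph_coeff N m = 1 / (4 ^ m * fact m * pochhammer (real N / 2) m)"

definition sph :: "nat \<Rightarrow> real \<Rightarrow> real" where
  "sph N q = (\<Sum>m. sph_coeff N m * q ^ m)"

definition sph1 :: "nat \<Rightarrow> real \<Rightarrow> real" where
  "sph1 N q = (\<Sum>m. diffs (sph_coeff N) m * q ^ m)"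

definition sph2 :: "nat \<Rightarrow> real \<Rightarrow> real" where
  "sph2 N q = (\<Sum>m. diffs (diffs (sph_coeff N)) m * q ^ m)"

definition sph3 :: "nat \<Rightarrow> real \<Rightarrow> real" where
  "sph3 N q = (\<Sum>m. diffs (diffs (diffs (sph_coeff N))) m * q ^ m)"

section \<open>Convergence and differential equation of the series\<close>

lemma sph_coeff_0 [simp]: "sph_coeff N 0 = 1"
  by (simp add: sph_coeff_def)

lemma sph_coeff_pos:
  assumes "2 \<le> N"
  shows "0 < sph_coeff N m"
  unfolding sph_coeff_def using assms by (auto intro!: divide_pos_pos mult_pos_pos pochhammer_pos)

text \<open>The coefficient form of the differential equation \<open>sph_ode\<close>. It also yields
  the comparison with the exponential series on which convergence rests.\<close>

lemma sph_coeff_Suc: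
  assumes "2 \<le> N"
  shows "(real m + 1) * (real m + real N / 2) * sph_coeff N (Suc m) = sph_coeff N m / 4"
proof -
  have "0 < pochhammer (real N / 2) m" using assms by (intro pochhammer_pos) auto
  hence "sph_coeff N (Suc m) = sph_coeff N m / (4 * ((real m + 1) * (real m + real N / 2)))"
    unfolding sph_coeff_def pochhammer_Suc fact_Suc power_Suc using assms
    by (simp add: divide_simps add.commute)
  moreover have "(real m + 1) * (real m + real N / 2) \<noteq> 0" using assms by auto
  ultimately show ?thesis by simp
qed

lemma sph_coeff_le:
  assumes "2 \<le> N"
  shows "sph_coeff N m \<le> 1 / fact m"
proof (induction m)
  case (Suc m)
  have "4 * (real m + 1) * (real m + real N / 2) \<noteq> 0" using assms by auto
  hence "sph_coeff N (Suc m) = sph_coeff N m / (4 * (real m + 1) * (real m + real N / 2))"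
  proof (subst nonzero_eq_divide_eq)
    have "sph_coeff N (Suc m) * (4 * (real m + 1) * (real m + real N / 2))
        = 4 * ((real m + 1) * (real m + real N / 2) * sph_coeff N (Suc m))" by (simp only: mult_ac)
    thus "sph_coeff N (Suc m) * (4 * (real m + 1) * (real m + real N / 2)) = sph_coeff N m"
      unfolding sph_coeff_Suc[OF assms] by simp
  qed
  also have "\<dots> \<le> (1 / fact m) / (real m + 1)"
  proof (rule frac_le)
    have "(real m + 1) * 1 \<le> (real m + 1) * (4 * (real m + real N / 2))"
      using assms by (intro mult_left_mono) auto
    also have "\<dots> = 4 * (real m + 1) * (real m + real N / 2)" by (simp only: mult_ac)
    finally show "real m + 1 \<le> 4 * (real m + 1) * (real m + real N / 2)" by simp
  qed (use Suc in auto)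
  finally show ?case by (simp add: field_simps)
qed simp

lemma summable_sph:
  assumes "2 \<le> N"
  shows "summable (\<lambda>m. sph_coeff N m * q ^ m)"
proof (rule summable_comparison_test')
  show "summable (\<lambda>m. inverse (fact m) * \<bar>q\<bar> ^ m)" by (rule summable_exp)
  fix m
  show "norm (sph_coeff N m * q ^ m) \<le> inverse (fact m) * \<bar>q\<bar> ^ m"
    using sph_coeff_le[OF assms, of m] sph_coeff_pos[OF assms, of m]
    by (auto simp: abs_mult power_abs divide_inverse intro!: mult_right_mono)
qed

lemma summable_sph1: "2 \<le> N \<Longrightarrow> summable (\<lambda>m. diffs (sph_coeff N) m * q ^ m)"
  using termdiff_converges_all summable_sph by blast

lemma summable_sph2: "2 \<le> N \<Longrightarrow> summable (\<lambda>m. diffs (diffs (sph_coeff N)) m * q ^ m)"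
  using termdiff_converges_all summable_sph1 by blast

lemma sph_has_derivative: "2 \<le> N \<Longrightarrow> (sph N has_real_derivative sph1 N q) (at q)"
  unfolding sph_def[abs_def] sph1_def
  by (rule termdiffs_strong_converges_everywhere) (rule summable_sph)

lemma sph1_has_derivative: "2 \<le> N \<Longrightarrow> (sph1 N has_real_derivative sph2 N q) (at q)"
  unfolding sph1_def[abs_def] sph2_def
  by (rule termdiffs_strong_converges_everywhere) (rule summable_sph1)

lemma sph2_has_derivative: "2 \<le> N \<Longrightarrow> (sph2 N has_real_derivative sph3 N q) (at q)"
  unfolding sph2_def[abs_def] sph3_def
  by (rule termdiffs_strong_converges_everywhere) (rule summable_sph2)

lemma sph_at_0: "sph N 0 = 1"
  unfolding sph_def using powser_zero[of "sph_coeff N"] by simp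

lemma sph1_at_0: "2 \<le> N \<Longrightarrow> sph1 N 0 = 1 / (2 * real N)"
  unfolding sph1_def using powser_zero[of "diffs (sph_coeff N)"] sph_coeff_Suc[of N 0]
  by (simp add: diffs_def field_simps)

lemma sph_ge_1:
  assumes "2 \<le> N" "0 \<le> q"
  shows "1 \<le> sph N q"
proof -
  have "(\<Sum>m<1. sph_coeff N m * q ^ m) \<le> sph N q"
    unfolding sph_def
    by (rule sum_le_suminf[OF summable_sph[OF assms(1)]])
       (use assms less_imp_le[OF sph_coeff_pos[OF assms(1)]] in auto)
  thus ?thesis by simp
qed

lemma sph1_pos:
  assumes "2 \<le> N" "0 \<le> q"
  shows "0 < sph1 N q"
proof -
  have "(\<Sum>m<1. diffs (sph_coeff N) m * q ^ m) \<le> sph1 N q"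
    unfolding sph1_def
    by (rule sum_le_suminf[OF summable_sph1[OF assms(1)]])
       (use assms less_imp_le[OF sph_coeff_pos[OF assms(1)]] in \<open>auto simp: diffs_def\<close>)
  moreover have "0 < diffs (sph_coeff N) 0" by (simp add: diffs_def sph_coeff_pos assms)
  ultimately show ?thesis by simp
qed

text \<open>For \<open>u h = sph N (|h|^2)\<close> on N-dimensional space this is the equation
  "Laplacian of \<open>u\<close> equals \<open>u\<close>", as befits an average of the functions
  \<open>exp <h, s>\<close> over unit vectors \<open>s\<close>. It is the modified Bessel equation
  with its singular factor removed; here the coefficients are compared.\<close>

lemma sph_ode:
  assumes "2 \<le> N"
  shows "q * sph2 N q + real N / 2 * sph1 N q = sph N q / 4"
proof -
  let ?d = "diffs (sph_coeff N)"
  have "(\<lambda>n. of_nat n * ?d n * q ^ (n - Suc 0)) sums sph2 N q"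
    unfolding sph2_def by (rule diffs_equiv) (rule summable_sph2[OF assms])
  hence "(\<lambda>n. q * (of_nat n * ?d n * q ^ (n - Suc 0))) sums (q * sph2 N q)"
    by (rule sums_mult)
  moreover have "q * (of_nat n * ?d n * q ^ (n - Suc 0)) = of_nat n * ?d n * q ^ n" for n
    by (cases n) auto
  ultimately have 1: "(\<lambda>n. of_nat n * ?d n * q ^ n) sums (q * sph2 N q)" by simp
  have 2: "(\<lambda>n. real N / 2 * (?d n * q ^ n)) sums (real N / 2 * sph1 N q)"
    unfolding sph1_def by (intro sums_mult summable_sums summable_sph1 assms)
  have 3: "(\<lambda>n. (1 / 4) * (sph_coeff N n * q ^ n)) sums ((1 / 4) * sph N q)"
    unfolding sph_def by (intro sums_mult summable_sums summable_sph assms)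
  have "of_nat n * ?d n * q ^ n + real N / 2 * (?d n * q ^ n) = (1 / 4) * (sph_coeff N n * q ^ n)" for n
  proof -
    have "of_nat n * ?d n * q ^ n + real N / 2 * (?d n * q ^ n) =
       ((real n + 1) * (real n + real N / 2) * sph_coeff N (Suc n)) * q ^ n"
      by (simp add: diffs_def algebra_simps)
    thus ?thesis unfolding sph_coeff_Suc[OF assms] by simp
  qed
  with sums_add[OF 1 2] have "(\<lambda>n. (1 / 4) * (sph_coeff N n * q ^ n)) sums (q * sph2 N q + real N / 2 * sph1 N q)"
    by (simp only:)
  from sums_unique2[OF this 3] show ?thesis by simp
qed

text \<open>The same equation with \<open>N + 2\<close> in place of \<open>N\<close>: up to a
  constant factor, \<open>sph1\<close> is the function \<open>sph\<close> of dimension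
  \<open>N + 2\<close>.\<close>

lemma sph_ode':
  assumes "2 \<le> N"
  shows "q * sph3 N q + (1 + real N / 2) * sph2 N q = sph1 N q / 4"
proof -
  have "((\<lambda>q. q * sph2 N q + real N / 2 * sph1 N q) has_real_derivative
     (q * sph3 N q + 1 * sph2 N q) + real N / 2 * sph2 N q) (at q)"
    by (auto intro!: derivative_eq_intros sph1_has_derivative sph2_has_derivative assms)
  moreover have "((\<lambda>q. sph N q / 4) has_real_derivative sph1 N q / 4) (at q)"
    by (intro DERIV_cdivide sph_has_derivative assms)
  ultimately show ?thesis
    unfolding sph_ode[OF assms] using DERIV_unique by (fastforce simp: algebra_simps)
qed

definition logd :: "nat \<Rightarrow> real \<Rightarrow> real" where
  "logd N q = 2 * sph1 N q / sph N q"

definition logd' :: "nat \<Rightarrow> real \<Rightarrow> real" where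
  "logd' N q = 2 * (sph2 N q * sph N q - (sph1 N q)\<^sup>2) / (sph N q)\<^sup>2"

text \<open>The mean of \<open><h, s>^2\<close> under the uniform measure on the sphere reweighted
  by \<open>exp <h, s>\<close>, where \<open>q = |h|^2\<close>.\<close>

definition second_moment :: "nat \<Rightarrow> real \<Rightarrow> real" where
  "second_moment N q = (4 * q\<^sup>2 * sph2 N q + 2 * q * sph1 N q) / sph N q"

section \<open>The logarithmic derivative and its monotonicity\<close>

lemma logd_has_derivative:
  assumes "2 \<le> N" "0 \<le> q"
  shows "(logd N has_real_derivative logd' N q) (at q)"
proof -
  have "sph N q \<noteq> 0" using sph_ge_1[OF assms] by simp
  thus ?thesis unfolding logd_def[abs_def] logd'_def
    by (auto intro!: derivative_eq_intros sph1_has_derivative sph_has_derivative assms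
        simp: field_simps power2_eq_square)
qed

text \<open>The Wronskian-type expression \<open>q\<^sup>1\<^sup>+\<^sup>N\<^sup>/\<^sup>2 (P'' P - P'\<^sup>2)\<close> vanishes at the origin and, by the
  differential equation, has derivative \<open>- q\<^sup>N\<^sup>/\<^sup>2 P'\<^sup>2\<close>.\<close>

lemma logd'_neg:
  assumes N: "2 \<le> N" and q: "0 \<le> q"
  shows "logd' N q < 0"
proof -
  define G where "G = (\<lambda>q. sph2 N q * sph N q - (sph1 N q)\<^sup>2)"
  have dG: "(G has_real_derivative sph3 N q * sph N q - sph2 N q * sph1 N q) (at q)" for q
    unfolding G_def by (auto intro!: derivative_eq_intros sph1_has_derivative sph2_has_derivative sph_has_derivative N
        simp: algebra_simps)
  have "G q < 0"
  proof (cases "q = 0")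
    case True
    \<comment> \<open>At the origin the Taylor coefficients are compared directly; the point is
      \<open>4 * N * (N + 2) > (2 * N)^2\<close>.\<close>
    have "sph2 N 0 = 1 / (4 * real N * (2 + real N))"
      using sph_ode'[OF N, of 0] N unfolding sph1_at_0[OF N] by (simp add: divide_simps) (simp add: algebra_simps)
    moreover have "1 / (4 * real N * (2 + real N)) < 1 / (2 * real N)\<^sup>2"
      using N by (intro divide_strict_left_mono) (auto simp: power2_eq_square)
    ultimately show ?thesis
      unfolding True G_def sph1_at_0[OF N] sph_at_0 by (simp add: power_one_over[symmetric] power_divide)
  next
    case False
    hence q0: "0 < q" using q by simp
    \<comment> \<open>Substituting \<open>q = r^2\<close> turns \<open>q\<close> to the power
      \<open>1 + N/2\<close> into the integer power \<open>r^(N + 2)\<close>, which is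
      differentiable at 0 as well.\<close>
    define F where "F = (\<lambda>r. (r ^ (N + 2)) * G (r\<^sup>2))"
    have dF: "(F has_real_derivative - 2 * r ^ (N + 1) * (sph1 N (r\<^sup>2))\<^sup>2) (at r)" for r
    proof -
      \<comment> \<open>Both differential equations enter: once multiplied by \<open>sph\<close> and
        \<open>sph1\<close>, their right-hand sides cancel and only the square of
        \<open>sph1\<close> is left.\<close>
      have e: "r\<^sup>2 * (sph3 N (r\<^sup>2) * sph N (r\<^sup>2) - sph2 N (r\<^sup>2) * sph1 N (r\<^sup>2)) + (1 + real N / 2) * G (r\<^sup>2)
           = - (sph1 N (r\<^sup>2))\<^sup>2"
      proof -
        have "r\<^sup>2 * (sph3 N (r\<^sup>2) * sph N (r\<^sup>2) - sph2 N (r\<^sup>2) * sph1 N (r\<^sup>2)) + (1 + real N / 2) * G (r\<^sup>2) =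
           (r\<^sup>2 * sph3 N (r\<^sup>2) + (1 + real N / 2) * sph2 N (r\<^sup>2)) * sph N (r\<^sup>2)
           - (r\<^sup>2 * sph2 N (r\<^sup>2) + real N / 2 * sph1 N (r\<^sup>2)) * sph1 N (r\<^sup>2) - (sph1 N (r\<^sup>2))\<^sup>2"
          unfolding G_def by (simp add: algebra_simps power2_eq_square)
        also have "\<dots> = - (sph1 N (r\<^sup>2))\<^sup>2" unfolding sph_ode[OF N] sph_ode'[OF N] by simp
        finally show ?thesis .
      qed
      have "((\<lambda>r. G (r\<^sup>2)) has_real_derivative
         (sph3 N (r\<^sup>2) * sph N (r\<^sup>2) - sph2 N (r\<^sup>2) * sph1 N (r\<^sup>2)) * (2 * r)) (at r)"
        by (rule DERIV_chain2[OF dG]) (auto intro!: derivative_eq_intros)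
      moreover have "((\<lambda>r. r ^ (N + 2)) has_real_derivative real (N + 2) * r ^ (N + 1)) (at r)"
        using DERIV_pow[of "N + 2" r] by simp
      ultimately have "(F has_real_derivative
         r ^ (N + 2) * ((sph3 N (r\<^sup>2) * sph N (r\<^sup>2) - sph2 N (r\<^sup>2) * sph1 N (r\<^sup>2)) * (2 * r))
         + (real (N + 2) * r ^ (N + 1)) * G (r\<^sup>2)) (at r)"
        unfolding F_def by (intro DERIV_cong[OF DERIV_mult]) (auto simp: algebra_simps)
      moreover have "r ^ (N + 2) * ((sph3 N (r\<^sup>2) * sph N (r\<^sup>2) - sph2 N (r\<^sup>2) * sph1 N (r\<^sup>2)) * (2 * r))
         + (real (N + 2) * r ^ (N + 1)) * G (r\<^sup>2) =
         2 * r ^ (N + 1) * (r\<^sup>2 * (sph3 N (r\<^sup>2) * sph N (r\<^sup>2) - sph2 N (r\<^sup>2) * sph1 N (r\<^sup>2)) + (1 + real N / 2) * G (r\<^sup>2))"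
        by (simp add: algebra_simps power2_eq_square)
      ultimately show ?thesis unfolding e by simp
    qed
    have "F (sqrt q) < F 0"
    proof (rule DERIV_neg_imp_decreasing_open[of 0 "sqrt q" F])
      show "0 < sqrt q" using q0 by simp
      show "continuous_on {0..sqrt q} F"
        by (rule DERIV_continuous_on) (rule dF[THEN has_field_derivative_at_within])
      fix x assume x: "0 < x" "x < sqrt q"
      have "0 < 2 * x ^ (N + 1) * (sph1 N (x\<^sup>2))\<^sup>2"
        using x sph1_pos[OF N, of "x\<^sup>2"] by (intro mult_pos_pos zero_less_power) auto
      thus "\<exists>y. (F has_real_derivative y) (at x) \<and> y < 0" using dF[of x] by force
    qed
    hence "sqrt q ^ (N + 2) * G q < 0" unfolding F_def using q0 by simp
    thus ?thesis using q0 by (simp add: mult_less_0_iff)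
  qed
  thus ?thesis unfolding logd'_def G_def using sph_ge_1[OF assms]
    by (intro divide_neg_pos) auto
qed

section \<open>Identification with the Bessel functions\<close>

lemma bessel_I_lower:
  assumes N: "2 \<le> N" and x: "0 < x"
  shows "bessel_I (real N / 2 - 1) x = (x / 2) powr (real N / 2 - 1) / Gamma (real N / 2) * sph N (x\<^sup>2)"
proof -
  let ?c = "(x / 2) powr (real N / 2 - 1) / Gamma (real N / 2)"
  have "(x / 2) powr (2 * real m + (real N / 2 - 1)) / (fact m * Gamma (real m + (real N / 2 - 1) + 1))
     = ?c * (sph_coeff N m * (x\<^sup>2) ^ m)" for m
  proof -
    have G: "Gamma (real N / 2 + real m) = pochhammer (real N / 2) m * Gamma (real N / 2)"
    proof -
      have "real N / 2 \<notin> \<int>\<^sub>\<le>\<^sub>0" using N by (auto elim!: nonpos_Ints_cases)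
      from pochhammer_Gamma[OF this, of m] N show ?thesis
        by (auto simp: field_simps Gamma_eq_zero_iff elim!: nonpos_Ints_cases)
    qed
    have "(x / 2) powr (2 * real m + (real N / 2 - 1)) = (x / 2) ^ (2 * m) * (x / 2) powr (real N / 2 - 1)"
      using x by (simp add: powr_add powr_realpow[symmetric])
    also have "(x / 2) ^ (2 * m) = (x\<^sup>2) ^ m / 4 ^ m"
      by (simp add: power_mult power_divide)
    finally show ?thesis
      unfolding sph_coeff_def using G by (simp add: add_ac mult_ac)
  qed
  hence "bessel_I (real N / 2 - 1) x = (\<Sum>m. ?c * (sph_coeff N m * (x\<^sup>2) ^ m))"
    unfolding bessel_I_def by simp
  also have "\<dots> = ?c * sph N (x\<^sup>2)"
    unfolding sph_def by (rule suminf_mult[OF summable_sph[OF N]])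
  finally show ?thesis .
qed

text \<open>Raising the order by one corresponds to differentiating the series: the factor
  \<open>m + 1\<close> from \<open>diffs\<close> cancels against \<open>fact (Suc m)\<close> in
  \<open>sph_coeff\<close>.\<close>

lemma bessel_I_upper:
  assumes N: "2 \<le> N" and x: "0 < x"
  shows "bessel_I (real N / 2) x = (x / 2) powr (real N / 2) / Gamma (real N / 2) * (4 * sph1 N (x\<^sup>2))"
proof -
  let ?c = "(x / 2) powr (real N / 2) / Gamma (real N / 2)"
  have "(x / 2) powr (2 * real m + real N / 2) / (fact m * Gamma (real m + real N / 2 + 1))
     = ?c * 4 * (diffs (sph_coeff N) m * (x\<^sup>2) ^ m)" for m
  proof -
    have G: "Gamma (real N / 2 + real (Suc m)) = pochhammer (real N / 2) (Suc m) * Gamma (real N / 2)"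
    proof -
      have "real N / 2 \<notin> \<int>\<^sub>\<le>\<^sub>0" using N by (auto elim!: nonpos_Ints_cases)
      from pochhammer_Gamma[OF this, of "Suc m"] N show ?thesis
        by (auto simp: field_simps Gamma_eq_zero_iff elim!: nonpos_Ints_cases)
    qed
    have "(x / 2) powr (2 * real m + real N / 2) = (x / 2) ^ (2 * m) * (x / 2) powr (real N / 2)"
      using x by (simp add: powr_add powr_realpow[symmetric])
    also have "(x / 2) ^ (2 * m) = (x\<^sup>2) ^ m / 4 ^ m"
      by (simp add: power_mult power_divide)
    finally have 1: "(x / 2) powr (2 * real m + real N / 2) = (x\<^sup>2) ^ m / 4 ^ m * (x / 2) powr (real N / 2)" .
    have 2: "Gamma (real m + real N / 2 + 1) = pochhammer (real N / 2) (Suc m) * Gamma (real N / 2)"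
      using G by (simp add: add_ac)
    show ?thesis
      unfolding 1 2 diffs_def sph_coeff_def fact_Suc power_Suc by (simp add: divide_simps del: of_nat_Suc)
  qed
  hence "bessel_I (real N / 2) x = (\<Sum>m. ?c * 4 * (diffs (sph_coeff N) m * (x\<^sup>2) ^ m))"
    unfolding bessel_I_def by simp
  also have "\<dots> = ?c * 4 * sph1 N (x\<^sup>2)"
    unfolding sph1_def by (rule suminf_mult[OF summable_sph1[OF N]])
  finally show ?thesis by simp
qed

text \<open>The Gamma factors cancel and the two powers differ by one factor \<open>x / 2\<close>,
  which leaves \<open>2 * x * sph1 / sph\<close>.\<close>

lemma bessel_ratio_eq:
  assumes N: "2 \<le> N" and x: "0 < x"
  shows "bessel_ratio N x = x * logd N (x\<^sup>2)"
proof -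
  have "(x / 2) powr (real N / 2) = (x / 2) powr (real N / 2 - 1) * (x / 2)"
    using x powr_add[of "x/2" "real N / 2 - 1" 1] by simp
  moreover have "Gamma (real N / 2) \<noteq> 0" using N by (auto simp: Gamma_eq_zero_iff elim!: nonpos_Ints_cases)
  moreover have "(x / 2) powr (real N / 2 - 1) \<noteq> 0" using x by simp
  moreover have "sph N (x\<^sup>2) \<noteq> 0" using sph_ge_1[OF N, of "x\<^sup>2"] by auto
  ultimately show ?thesis
    unfolding bessel_ratio_def bessel_I_lower[OF assms] bessel_I_upper[OF assms] logd_def
    by (simp add: field_simps)
qed

lemma bessel_ratio_has_derivative:
  assumes N: "2 \<le> N" and x: "0 < x"
  shows "(bessel_ratio N has_real_derivative logd N (x\<^sup>2) + 2 * x\<^sup>2 * logd' N (x\<^sup>2)) (at x)"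
proof -
  have "((\<lambda>x. logd N (x\<^sup>2)) has_real_derivative logd' N (x\<^sup>2) * (2 * x)) (at x)"
    by (rule DERIV_chain2[OF logd_has_derivative[OF N]]) (auto intro!: derivative_eq_intros)
  hence "((\<lambda>x. x * logd N (x\<^sup>2)) has_real_derivative logd N (x\<^sup>2) + 2 * x\<^sup>2 * logd' N (x\<^sup>2)) (at x)"
    by (auto intro!: derivative_eq_intros simp: power2_eq_square algebra_simps)
  thus ?thesis
    by (rule has_field_derivative_transform_within_open[where S="{0<..}"])
       (use x bessel_ratio_eq[OF N] in auto)
qed

lemma logd_at_0: "2 \<le> N \<Longrightarrow> logd N 0 = 1 / real N"
  unfolding logd_def by (simp add: sph1_at_0 sph_at_0)

lemma logd_strict_decreasing:
  assumes N: "2 \<le> N" and "0 \<le> p" "p < q"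
  shows "logd N q < logd N p"
  by (rule DERIV_neg_imp_decreasing[OF assms(3)])
     (use assms logd_has_derivative[OF N] logd'_neg[OF N] in \<open>meson order_trans\<close>)

text \<open>The differential equation eliminates \<open>sph2\<close>, so the second moment is an
  algebraic expression in \<open>logd\<close>.\<close>

lemma second_moment_eq:
  assumes "2 \<le> N" "0 \<le> q"
  shows "second_moment N q = q * (1 - (real N - 1) * logd N q)"
proof -
  have n: "sph N q \<noteq> 0" using sph_ge_1[OF assms] by simp
  have "second_moment N q = (4 * q * (q * sph2 N q) + 2 * q * sph1 N q) / sph N q"
    unfolding second_moment_def by (simp add: power2_eq_square mult_ac)
  also have "q * sph2 N q = sph N q / 4 - real N / 2 * sph1 N q" using sph_ode[OF assms(1), of q] by simp
  finally show ?thesis unfolding logd_def using n by (simp add: field_simps)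
qed

text \<open>The Riccati equation belonging to the second-order linear equation
  \<open>sph_ode\<close>. It eliminates \<open>logd'\<close> wherever that is multiplied by
  \<open>q\<close>.\<close>

lemma logd_riccati:
  assumes "2 \<le> N" "0 \<le> q"
  shows "2 * q * logd' N q = 1 - real N * logd N q - q * (logd N q)\<^sup>2"
proof -
  have n: "sph N q \<noteq> 0" using sph_ge_1[OF assms] by simp
  have "2 * q * logd' N q = (4 * (q * sph2 N q) * sph N q - 4 * q * (sph1 N q)\<^sup>2) / (sph N q)\<^sup>2"
    unfolding logd'_def by (simp add: algebra_simps)
  also have "q * sph2 N q = sph N q / 4 - real N / 2 * sph1 N q" using sph_ode[OF assms(1), of q] by simp
  finally have "2 * q * logd' N q = (sph N q * sph N q - 2 * real N * sph1 N q * sph N q - 4 * q * (sph1 N q)\<^sup>2) / (sph N q)\<^sup>2"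
    by (simp add: algebra_simps)
  thus ?thesis unfolding logd_def using n by (simp add: diff_divide_distrib power2_eq_square mult_ac)
qed

section \<open>Gaussian integrals and the uniform measure on the sphere\<close>

abbreviation lebN :: "nat \<Rightarrow> (nat \<Rightarrow> real) measure" where
  "lebN N \<equiv> \<Pi>\<^sub>M k\<in>{..<N}. lborel"

abbreviation nrm :: "nat \<Rightarrow> (nat \<Rightarrow> real) \<Rightarrow> real" where
  "nrm N x \<equiv> L2_set x {..<N}"

definition scale_vec :: "nat \<Rightarrow> real \<Rightarrow> (nat \<Rightarrow> real) \<Rightarrow> (nat \<Rightarrow> real)" where
  "scale_vec N c x = (\<lambda>k\<in>{..<N}. c * x k)"

section \<open>Scaling and polar coordinates for Lebesgue measure\<close>

lemma space_lebN: "space (lebN N) = extensional {..<N}"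
  by (simp add: space_PiM PiE_UNIV_domain PiE_def)

lemma measurable_nrm [measurable]:
  "nrm N \<in> borel_measurable (lebN N)" "nrm N \<in> borel_measurable (\<Pi>\<^sub>M k\<in>{..<N}. borel)"
  unfolding L2_set_def by measurable

lemma measurable_dot [measurable]:
  "dot N y \<in> borel_measurable (lebN N)" "dot N y \<in> borel_measurable (\<Pi>\<^sub>M k\<in>{..<N}. borel)"
  unfolding dot_def by measurable

lemma measurable_scale_vec [measurable]: "scale_vec N c \<in> lebN N \<rightarrow>\<^sub>M lebN N"
  unfolding scale_vec_def by measurable

lemma measurable_radial_proj [measurable]:
  "radial_proj N \<in> lebN N \<rightarrow>\<^sub>M (\<Pi>\<^sub>M k\<in>{..<N}. borel)"
  unfolding radial_proj_def by measurable

lemma nrm_scale_vec: "nrm N (scale_vec N c x) = \<bar>c\<bar> * nrm N x"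
  unfolding scale_vec_def L2_set_def
  by (simp add: power_mult_distrib sum_distrib_left[symmetric] real_sqrt_mult)

lemma radial_proj_scale_vec: "0 < c \<Longrightarrow> radial_proj N (scale_vec N c x) = radial_proj N x"
  unfolding radial_proj_def nrm_scale_vec by (auto simp: scale_vec_def restrict_def)

text \<open>Uniqueness of product measures reduces the claim to boxes, on which each of the
  \<open>N\<close> coordinates contributes one factor \<open>\<bar>c\<bar>\<close>.\<close>

lemma nn_integral_lebN_scale:
  assumes c: "c \<noteq> 0" and F: "F \<in> borel_measurable (lebN N)"
  shows "(\<integral>\<^sup>+x. F x \<partial>lebN N) = ennreal (\<bar>c\<bar> ^ N) * (\<integral>\<^sup>+x. F (scale_vec N c x) \<partial>lebN N)"
proof -
  interpret product_sigma_finite "\<lambda>_::nat. lborel :: real measure" by standard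
  define P where "P = density (distr (lebN N) (lebN N) (scale_vec N c)) (\<lambda>_. ennreal (\<bar>c\<bar> ^ N))"
  have "P = lebN N"
  proof (rule PiM_eqI)
    show "sets P = sets (lebN N)" by (simp add: P_def)
    fix A :: "nat \<Rightarrow> real set" assume A: "\<And>i. i \<in> {..<N} \<Longrightarrow> A i \<in> sets lborel"
    have PA: "Pi\<^sub>E {..<N} A \<in> sets (lebN N)" using A by (intro sets_PiM_I_finite) auto
    have pre: "scale_vec N c -` Pi\<^sub>E {..<N} A \<inter> space (lebN N) = Pi\<^sub>E {..<N} (\<lambda>k. {x. c * x \<in> A k})"
      unfolding space_lebN scale_vec_def by (auto simp: PiE_def Pi_def)
    have sc: "{x. c * x \<in> B} \<in> sets lborel" if "B \<in> sets borel" for B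
    proof -
      have "(\<lambda>x. c * x) -` B \<inter> space borel \<in> sets borel"
        by (rule measurable_sets[OF _ that]) simp
      thus ?thesis by (simp add: vimage_def)
    qed
    have one: "ennreal \<bar>c\<bar> * emeasure lborel {x. c * x \<in> B} = emeasure lborel B" if B: "B \<in> sets borel" for B
    proof -
      have "emeasure lborel B = emeasure (density (distr lborel borel (\<lambda>x. 0 + c * x)) (\<lambda>_. ennreal \<bar>c\<bar>)) B"
        using lborel_real_affine[OF c, of 0] by simp
      also have "\<dots> = ennreal \<bar>c\<bar> * emeasure (distr lborel borel (\<lambda>x. 0 + c * x)) B"
        using B by (subst emeasure_density_const) auto
      also have "emeasure (distr lborel borel (\<lambda>x. 0 + c * x)) B = emeasure lborel {x. c * x \<in> B}"
        using B by (subst emeasure_distr) (auto simp: vimage_def)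
      finally show ?thesis by simp
    qed
    have "emeasure P (Pi\<^sub>E {..<N} A) = ennreal (\<bar>c\<bar> ^ N) * emeasure (lebN N) (Pi\<^sub>E {..<N} (\<lambda>k. {x. c * x \<in> A k}))"
      unfolding P_def using PA by (subst emeasure_density_const) (auto simp: emeasure_distr pre)
    also have "\<dots> = ennreal \<bar>c\<bar> ^ N * (\<Prod>k<N. emeasure lborel {x. c * x \<in> A k})"
      using A sc by (subst emeasure_PiM) (auto simp: ennreal_power)
    also have "\<dots> = (\<Prod>k<N. ennreal \<bar>c\<bar> * emeasure lborel {x. c * x \<in> A k})"
      by (simp add: prod.distrib)
    also have "\<dots> = (\<Prod>k<N. emeasure lborel (A k))"
      using A by (intro prod.cong) (auto intro!: one)
    finally show "emeasure P (Pi\<^sub>E {..<N} A) = (\<Prod>i<N. emeasure lborel (A i))" .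
  qed simp
  hence "(\<integral>\<^sup>+x. F x \<partial>lebN N) = (\<integral>\<^sup>+x. F x \<partial>P)" by simp
  also have "\<dots> = (\<integral>\<^sup>+x. ennreal (\<bar>c\<bar> ^ N) * F x \<partial>distr (lebN N) (lebN N) (scale_vec N c))"
    unfolding P_def using F by (subst nn_integral_density) auto
  also have "\<dots> = (\<integral>\<^sup>+x. ennreal (\<bar>c\<bar> ^ N) * F (scale_vec N c x) \<partial>lebN N)"
    using F by (subst nn_integral_distr) auto
  also have "\<dots> = ennreal (\<bar>c\<bar> ^ N) * (\<integral>\<^sup>+x. F (scale_vec N c x) \<partial>lebN N)"
    by (rule nn_integral_cmult) (use measurable_compose[OF measurable_scale_vec F] in simp)
  finally show ?thesis .
qed

lemma AE_nrm_pos: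
  assumes "0 < N"
  shows "AE x in lebN N. 0 < nrm N x"
proof (rule AE_I)
  interpret product_sigma_finite "\<lambda>_::nat. lborel :: real measure" by standard
  show "{x \<in> space (lebN N). \<not> 0 < nrm N x} \<subseteq> Pi\<^sub>E {..<N} (\<lambda>_. {0})"
    unfolding space_lebN
  proof (rule subsetI)
    fix x assume "x \<in> {x \<in> extensional {..<N}. \<not> 0 < nrm N x}"
    hence x: "x \<in> extensional {..<N}" "\<not> 0 < nrm N x" by auto
    hence "nrm N x = 0" using L2_set_nonneg[of x "{..<N}"] by linarith
    thus "x \<in> Pi\<^sub>E {..<N} (\<lambda>_. {0})" using x by (intro PiE_I) (auto simp: L2_set_eq_0_iff extensional_def)
  qed
  show "emeasure (lebN N) (Pi\<^sub>E {..<N} (\<lambda>_. {0})) = 0"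
    using assms by (subst emeasure_PiM) (auto simp: zero_power)
  show "Pi\<^sub>E {..<N} (\<lambda>_. {0}) \<in> sets (lebN N)" by (intro sets_PiM_I_finite) auto
qed

lemma unit_ball_sets [measurable]: "unit_ball N \<in> sets (lebN N)"
proof -
  have "unit_ball N = {x \<in> space (lebN N). nrm N x \<le> 1}"
    unfolding unit_ball_def space_lebN by simp
  thus ?thesis by simp
qed

lemma unit_sphere_sets [measurable]: "unit_sphere N \<in> sets (\<Pi>\<^sub>M k\<in>{..<N}. borel)"
proof -
  have "unit_sphere N = {x \<in> space (\<Pi>\<^sub>M k\<in>{..<N}. borel). nrm N x = 1}"
    unfolding unit_sphere_def by (auto simp: space_PiM PiE_def)
  thus ?thesis by simp
qed

lemma emeasure_unit_ball_finite: "emeasure (lebN N) (unit_ball N) < \<infinity>"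
proof -
  interpret product_sigma_finite "\<lambda>_::nat. lborel :: real measure" by standard
  have "unit_ball N \<subseteq> Pi\<^sub>E {..<N} (\<lambda>_. {-1..1})"
  proof
    fix x assume x: "x \<in> unit_ball N"
    have "\<bar>x k\<bar> \<le> 1" if "k < N" for k
    proof -
      have "\<bar>x k\<bar> \<le> nrm N x"
        using member_le_L2_set[of "{..<N}" k "\<lambda>k. \<bar>x k\<bar>"] that by (simp add: L2_set_def)
      thus ?thesis using x unfolding unit_ball_def by auto
    qed
    thus "x \<in> Pi\<^sub>E {..<N} (\<lambda>_. {-1..1})"
      using x unfolding unit_ball_def by (auto simp: PiE_def abs_le_iff)
  qed
  hence "emeasure (lebN N) (unit_ball N) \<le> emeasure (lebN N) (Pi\<^sub>E {..<N} (\<lambda>_. {-1..1}))"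
    by (intro emeasure_mono sets_PiM_I_finite) auto
  also have "\<dots> = (\<Prod>k<N. 2)"
    by (subst emeasure_PiM) auto
  also have "\<dots> < \<infinity>" by (simp add: power_less_top_ennreal)
  finally show ?thesis .
qed

text \<open>Polar coordinates for a function that only depends on the direction of its argument.\<close>

lemma nn_integral_polar:
  assumes N: "0 < N" and h[measurable]: "h \<in> borel_measurable (lebN N)"
    and hom: "\<And>c x. 0 < c \<Longrightarrow> h (scale_vec N c x) = h x"
    and fin: "(\<integral>\<^sup>+x. h x * indicator (unit_ball N) x \<partial>lebN N) < \<infinity>"
    and G[measurable]: "G \<in> borel_measurable borel"
  shows "(\<integral>\<^sup>+x. h x * G (nrm N x) \<partial>lebN N) = (\<integral>\<^sup>+x. h x * indicator (unit_ball N) x \<partial>lebN N) *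
     (\<integral>\<^sup>+r. ennreal (real N * r ^ (N - 1)) * indicator {0..} r * G r \<partial>lborel)"
proof -
  define H where "H = (\<integral>\<^sup>+x. h x * indicator (unit_ball N) x \<partial>lebN N)"
  \<comment> \<open>The law of the norm under the weight \<open>h\<close>. By homogeneity and
    scaling it gives \<open>{..u}\<close> the mass \<open>u^N * H\<close> for positive
    \<open>u\<close>, and \<open>\<rho>\<close> is the measure with the density that integrates to
    the same values.\<close>
  define \<nu> where "\<nu> = distr (density (lebN N) h) borel (nrm N)"
  define \<rho> where "\<rho> = density lborel (\<lambda>r. H * (ennreal (real N * r ^ (N - 1)) * indicator {0..} r))"
  have \<nu>: "emeasure \<nu> {..u} = ennreal ((max 0 u) ^ N) * H" for u
  proof -
    have e: "emeasure \<nu> {..u} = (\<integral>\<^sup>+x. h x * indicator {x \<in> space (lebN N). nrm N x \<le> u} x \<partial>lebN N)"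
    proof -
      have "emeasure \<nu> {..u} = emeasure (density (lebN N) h) (nrm N -` {..u} \<inter> space (lebN N))"
        unfolding \<nu>_def by (subst emeasure_distr) auto
      also have "nrm N -` {..u} \<inter> space (lebN N) = {x \<in> space (lebN N). nrm N x \<le> u}" by auto
      also have "emeasure (density (lebN N) h) \<dots> = (\<integral>\<^sup>+x. h x * indicator {x \<in> space (lebN N). nrm N x \<le> u} x \<partial>lebN N)"
        by (rule emeasure_density) auto
      finally show ?thesis .
    qed
    show ?thesis
    proof (cases "0 < u")
      case True
      have "emeasure \<nu> {..u} = ennreal (\<bar>u\<bar> ^ N) * (\<integral>\<^sup>+x. h (scale_vec N u x) *
          indicator {x \<in> space (lebN N). nrm N x \<le> u} (scale_vec N u x) \<partial>lebN N)"
        unfolding e using True by (intro nn_integral_lebN_scale) auto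
      also have "(\<integral>\<^sup>+x. h (scale_vec N u x) *
          indicator {x \<in> space (lebN N). nrm N x \<le> u} (scale_vec N u x) \<partial>lebN N) = H"
        unfolding H_def
      proof (rule nn_integral_cong)
        fix x assume x: "x \<in> space (lebN N)"
        have s: "scale_vec N u x \<in> space (lebN N)" unfolding space_lebN scale_vec_def by auto
        have "nrm N (scale_vec N u x) \<le> u \<longleftrightarrow> nrm N x \<le> 1"
          unfolding nrm_scale_vec using True by (simp add: mult_le_cancel_left1)
        thus "h (scale_vec N u x) * indicator {x \<in> space (lebN N). nrm N x \<le> u} (scale_vec N u x)
           = h x * indicator (unit_ball N) x"
          using s x True hom unfolding unit_ball_def space_lebN by (auto split: split_indicator)
      qed
      finally show ?thesis using True by (simp add: max_def)
    next
      case False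
      have "emeasure \<nu> {..u} = (\<integral>\<^sup>+x. 0 \<partial>lebN N)"
        unfolding e by (rule nn_integral_cong_AE) (use AE_nrm_pos[OF N] False in \<open>auto split: split_indicator\<close>)
      thus ?thesis using False N by (simp add: max_def)
    qed
  qed
  have \<rho>: "emeasure \<rho> {..u} = ennreal ((max 0 u) ^ N) * H" for u
  proof -
    have "emeasure \<rho> {..u} = (\<integral>\<^sup>+r. H * (ennreal (real N * r ^ (N - 1)) * indicator {0..u} r) \<partial>lborel)"
      unfolding \<rho>_def by (subst emeasure_density) (auto intro!: nn_integral_cong split: split_indicator)
    also have "\<dots> = H * (\<integral>\<^sup>+r. ennreal (real N * r ^ (N - 1)) * indicator {0..u} r \<partial>lborel)"
      by (rule nn_integral_cmult) auto
    also have "(\<integral>\<^sup>+r. ennreal (real N * r ^ (N - 1)) * indicator {0..u} r \<partial>lborel) = ennreal ((max 0 u) ^ N)"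
    proof (cases "0 \<le> u")
      case True
      have "(\<integral>\<^sup>+r. ennreal (real N * r ^ (N - 1)) * indicator {0..u} r \<partial>lborel) = ennreal (u ^ N - 0 ^ N)"
        by (rule nn_integral_FTC_Icc)
           (use True in \<open>auto intro!: derivative_eq_intros\<close>)
      thus ?thesis using True N by (simp add: max_def)
    next
      case False thus ?thesis using N by (simp add: max_def)
    qed
    finally show ?thesis by (simp add: mult.commute)
  qed
  have "\<nu> = \<rho>"
  proof (rule measure_eqI_generator_eq[where E="range (\<lambda>a::real. {..a})" and \<Omega>=UNIV and A="\<lambda>i. {..real i}"])
    show "Int_stable (range (\<lambda>a::real. {..a}))"
      by (auto simp: Int_stable_def image_iff)
    show "emeasure \<nu> X = emeasure \<rho> X" if "X \<in> range (\<lambda>a::real. {..a})" for X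
      using that \<nu> \<rho> by auto
    show "sets \<nu> = sigma_sets UNIV (range (\<lambda>a::real. {..a}))"
      unfolding \<nu>_def by (simp add: borel_eq_atMost)
    show "sets \<rho> = sigma_sets UNIV (range (\<lambda>a::real. {..a}))"
      unfolding \<rho>_def by (simp add: borel_eq_atMost)
    show "(\<Union>i. {..real i}) = UNIV" by (auto intro: real_arch_simple)
    \<comment> \<open>Uniqueness from a generator needs finite values on an exhausting sequence;
      this is where finiteness of \<open>H\<close> is used.\<close>
    show "emeasure \<nu> {..real i} \<noteq> \<infinity>" for i
      unfolding \<nu> using fin unfolding H_def[symmetric] by (simp add: ennreal_mult_eq_top_iff)
  qed auto
  have "(\<integral>\<^sup>+x. h x * G (nrm N x) \<partial>lebN N) = (\<integral>\<^sup>+r. G r \<partial>\<nu>)"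
    unfolding \<nu>_def by (subst nn_integral_distr) (auto simp: nn_integral_density)
  also have "\<dots> = (\<integral>\<^sup>+r. H * (ennreal (real N * r ^ (N - 1)) * indicator {0..} r * G r) \<partial>lborel)"
    unfolding \<open>\<nu> = \<rho>\<close> \<rho>_def by (subst nn_integral_density) (auto simp: mult.assoc)
  also have "\<dots> = H * (\<integral>\<^sup>+r. ennreal (real N * r ^ (N - 1)) * indicator {0..} r * G r \<partial>lborel)"
    by (rule nn_integral_cmult) auto
  finally show ?thesis unfolding H_def .
qed

section \<open>Radial and directional moments of Gaussian vectors\<close>

definition half_moment :: "nat \<Rightarrow> real" where
  "half_moment k = (\<integral>x. indicator {0..} x *\<^sub>R (exp (- x\<^sup>2) * x ^ k) \<partial>lborel)"

lemma half_moment_cases: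
  "half_moment (2 * j) = sqrt pi / 2 * (fact (2 * j) / (2 ^ (2 * j) * fact j))"
  "half_moment (2 * j + 1) = fact j / 2"
  unfolding half_moment_def
  using gaussian_moment_even_pos[of j] gaussian_moment_odd_pos[of j]
  by (simp_all only: has_bochner_integral_integral_eq)

lemma half_moment_pos: "0 < half_moment k"
proof (cases "even k")
  case True
  then obtain j where "k = 2 * j" by blast
  thus ?thesis by (simp add: half_moment_cases)
next
  case False
  then obtain j where "k = 2 * j + 1" by (elim oddE)
  thus ?thesis by (simp only: half_moment_cases) simp
qed

text \<open>The functional equation of Gamma, as \<open>half_moment k\<close> is
  \<open>Gamma ((k + 1) / 2) / 2\<close>; it is read off from the closed forms for even and odd
  \<open>k\<close>.\<close>

lemma half_moment_rec: "half_moment (k + 2) = (real k + 1) / 2 * half_moment k"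
proof (cases "even k")
  case True
  then obtain j where k: "k = 2 * j" by blast
  hence k2: "k + 2 = 2 * Suc j" by simp
  have f: "fact (2 * Suc j) = (2 * real j + 2) * (2 * real j + 1) * (fact (2 * j) :: real)"
    by (simp add: algebra_simps)
  show ?thesis unfolding k2 half_moment_cases f unfolding k half_moment_cases
    by (simp add: divide_simps)
next
  case False
  then obtain j where k: "k = 2 * j + 1" by (elim oddE)
  hence k2: "k + 2 = 2 * Suc j + 1" by simp
  show ?thesis unfolding k2 half_moment_cases unfolding k half_moment_cases
    by (simp add: field_simps)
qed

text \<open>The source of the rising factorial in \<open>sph_coeff\<close>: it is a quotient of two
  radial moments.\<close>

lemma half_moment_shift:
  assumes "0 < N"
  shows "half_moment (N - 1 + 2 * m) = pochhammer (real N / 2) m * half_moment (N - 1)"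
proof (induction m)
  case (Suc m)
  have "half_moment (N - 1 + 2 * Suc m) = half_moment ((N - 1 + 2 * m) + 2)" by simp
  also have "\<dots> = (real (N - 1 + 2 * m) + 1) / 2 * half_moment (N - 1 + 2 * m)"
    by (rule half_moment_rec)
  also have "(real (N - 1 + 2 * m) + 1) / 2 = real N / 2 + real m" using assms by (simp add: of_nat_diff field_simps)
  finally show ?case unfolding Suc pochhammer_Suc by simp
qed simp

lemma nn_half_moment:
  "(\<integral>\<^sup>+r. ennreal (exp (- r\<^sup>2) * r ^ k) * indicator {0..} r \<partial>lborel) = ennreal (half_moment k)"
proof -
  have "integrable lborel (\<lambda>x::real. indicator {0..} x *\<^sub>R (exp (- x\<^sup>2) * x ^ k))"
  proof (cases "even k")
    case True
    then obtain j where "k = 2 * j" by blast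
    thus ?thesis using gaussian_moment_even_pos[of j] by (auto simp: has_bochner_integral_iff)
  next
    case False
    then obtain j where "k = 2 * j + 1" by (elim oddE)
    thus ?thesis using gaussian_moment_odd_pos[of j] by (simp only: has_bochner_integral_iff)
  qed
  hence "(\<integral>\<^sup>+x. ennreal (indicator {0..} x *\<^sub>R (exp (- x\<^sup>2) * x ^ k)) \<partial>lborel) = ennreal (half_moment k)"
    unfolding half_moment_def by (intro nn_integral_eq_integral) (auto split: split_indicator)
  moreover have "ennreal (indicator {0..} x *\<^sub>R (exp (- x\<^sup>2) * x ^ k)) = ennreal (exp (- x\<^sup>2) * x ^ k) * indicator {0..} x" for x :: real
    by (auto split: split_indicator)
  ultimately show ?thesis by simp
qed

text \<open>Variance 1/2 makes the density \<open>exp (- x^2) / sqrt pi\<close>, so that radial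
  integrals are values of \<open>half_moment\<close> without rescaling.\<close>

abbreviation gauss1 :: "real measure" where
  "gauss1 \<equiv> density lborel (normal_density 0 (1 / sqrt 2))"

abbreviation gaussN :: "nat \<Rightarrow> (nat \<Rightarrow> real) measure" where
  "gaussN N \<equiv> \<Pi>\<^sub>M k\<in>{..<N}. gauss1"

lemma prob_gauss1: "prob_space gauss1"
  by (rule prob_space_normal_density) simp

lemma prob_gaussN: "prob_space (gaussN N)"
  by (intro prob_space_PiM prob_gauss1)

lemma sets_gaussN: "sets (gaussN N) = sets (lebN N)"
  by (rule sets_PiM_cong) auto

text \<open>The product of the one-dimensional densities depends on \<open>nrm N x\<close> alone,
  which opens Gaussian integrals to polar coordinates.\<close>

lemma gaussN_eq_density:
  "gaussN N = density (lebN N) (\<lambda>x. ennreal ((1 / sqrt pi) ^ N * exp (- (nrm N x)\<^sup>2)))"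
proof -
  interpret L: product_sigma_finite "\<lambda>_::nat. lborel :: real measure" by standard
  interpret G: product_sigma_finite "\<lambda>_::nat. gauss1"
    by (intro product_sigma_finite.intro prob_space_imp_sigma_finite prob_gauss1)
  have d: "ennreal ((1 / sqrt pi) ^ N * exp (- (nrm N x)\<^sup>2)) = (\<Prod>k<N. ennreal (normal_density 0 (1 / sqrt 2) (x k)))" for x
  proof -
    have "(\<Prod>k<N. normal_density 0 (1 / sqrt 2) (x k)) = (\<Prod>k<N. (1 / sqrt pi) * exp (- (x k)\<^sup>2))"
      by (intro prod.cong) (auto simp: normal_density_def power_divide)
    also have "\<dots> = (1 / sqrt pi) ^ N * exp (- (\<Sum>k<N. (x k)\<^sup>2))"
      by (simp only: prod.distrib exp_sum[symmetric] sum_negf[symmetric] prod_constant finite_lessThan card_lessThan)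
    also have "(\<Sum>k<N. (x k)\<^sup>2) = (nrm N x)\<^sup>2" by (simp add: L2_set_def sum_nonneg)
    finally show ?thesis by (subst prod_ennreal) auto
  qed
  have "density (lebN N) (\<lambda>x. ennreal ((1 / sqrt pi) ^ N * exp (- (nrm N x)\<^sup>2))) = gaussN N"
  proof (rule G.PiM_eqI)
    fix A :: "nat \<Rightarrow> real set" assume A: "\<And>i. i \<in> {..<N} \<Longrightarrow> A i \<in> sets gauss1"
    have A': "Pi\<^sub>E {..<N} A \<in> sets (lebN N)" using A by (intro sets_PiM_I_finite) auto
    have "emeasure (density (lebN N) (\<lambda>x. ennreal ((1 / sqrt pi) ^ N * exp (- (nrm N x)\<^sup>2)))) (Pi\<^sub>E {..<N} A)
      = (\<integral>\<^sup>+x. ennreal ((1 / sqrt pi) ^ N * exp (- (nrm N x)\<^sup>2)) * indicator (Pi\<^sub>E {..<N} A) x \<partial>lebN N)"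
      using A' by (intro emeasure_density) auto
    also have "\<dots> = (\<integral>\<^sup>+x. (\<Prod>k<N. ennreal (normal_density 0 (1 / sqrt 2) (x k)) * indicator (A k) (x k)) \<partial>lebN N)"
    proof (rule nn_integral_cong)
      fix x assume "x \<in> space (lebN N)"
      hence "indicator (Pi\<^sub>E {..<N} A) x = (\<Prod>k<N. indicator (A k) (x k) :: ennreal)"
        unfolding space_lebN by (auto simp: PiE_def Pi_def indicator_def prod_zero_iff)
      thus "ennreal ((1 / sqrt pi) ^ N * exp (- (nrm N x)\<^sup>2)) * indicator (Pi\<^sub>E {..<N} A) x
        = (\<Prod>k<N. ennreal (normal_density 0 (1 / sqrt 2) (x k)) * indicator (A k) (x k))"
        unfolding d by (simp add: prod.distrib)
    qed
    also have "\<dots> = (\<Prod>k<N. \<integral>\<^sup>+t. ennreal (normal_density 0 (1 / sqrt 2) t) * indicator (A k) t \<partial>lborel)"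
      using A by (intro L.product_nn_integral_prod) auto
    also have "\<dots> = (\<Prod>k<N. emeasure gauss1 (A k))"
      using A by (intro prod.cong) (auto simp: emeasure_density)
    finally show "emeasure (density (lebN N) (\<lambda>x. ennreal ((1 / sqrt pi) ^ N * exp (- (nrm N x)\<^sup>2)))) (Pi\<^sub>E {..<N} A)
      = (\<Prod>i<N. emeasure gauss1 (A i))" .
  qed (auto simp: sets_gaussN)
  thus ?thesis ..
qed

text \<open>Taking \<open>h = 1\<close> and \<open>m = 0\<close> yields the volume of the ball;
  taking for \<open>h\<close> an even power of the direction's component along \<open>y\<close>
  yields the moments of the sphere measure. The radial factor is explicit in both cases.\<close>

lemma gaussN_polar:
  assumes N: "0 < N" and h[measurable]: "h \<in> borel_measurable (lebN N)"
    and hom: "\<And>c x. 0 < c \<Longrightarrow> h (scale_vec N c x) = h x"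
    and fin: "(\<integral>\<^sup>+x. h x * indicator (unit_ball N) x \<partial>lebN N) < \<infinity>"
  shows "(\<integral>\<^sup>+x. h x * ennreal (nrm N x ^ (2 * m)) \<partial>gaussN N) =
     (\<integral>\<^sup>+x. h x * indicator (unit_ball N) x \<partial>lebN N) *
     ennreal ((1 / sqrt pi) ^ N * real N * half_moment (N - 1) * pochhammer (real N / 2) m)"
proof -
  let ?G = "\<lambda>r. ennreal ((1 / sqrt pi) ^ N * exp (- r\<^sup>2) * r ^ (2 * m))"
  have "(\<integral>\<^sup>+x. h x * ennreal (nrm N x ^ (2 * m)) \<partial>gaussN N) = (\<integral>\<^sup>+x. h x * ?G (nrm N x) \<partial>lebN N)"
    unfolding gaussN_eq_density
    by (subst nn_integral_density) (auto intro!: nn_integral_cong simp: ennreal_mult' mult_ac)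
  also have "\<dots> = (\<integral>\<^sup>+x. h x * indicator (unit_ball N) x \<partial>lebN N) *
     (\<integral>\<^sup>+r. ennreal (real N * r ^ (N - 1)) * indicator {0..} r * ?G r \<partial>lborel)"
    by (rule nn_integral_polar[OF N h hom fin]) auto
  also have "(\<integral>\<^sup>+r. ennreal (real N * r ^ (N - 1)) * indicator {0..} r * ?G r \<partial>lborel) =
     (\<integral>\<^sup>+r. ennreal ((1 / sqrt pi) ^ N * real N) * (ennreal (exp (- r\<^sup>2) * r ^ (N - 1 + 2 * m)) * indicator {0..} r) \<partial>lborel)"
    by (rule nn_integral_cong)
       (auto simp: ennreal_mult'[symmetric] power_add mult_ac split: split_indicator)
  also have "\<dots> = ennreal ((1 / sqrt pi) ^ N * real N) * ennreal (half_moment (N - 1 + 2 * m))"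
    by (subst nn_integral_cmult) (auto simp: nn_half_moment)
  also have "\<dots> = ennreal ((1 / sqrt pi) ^ N * real N * half_moment (N - 1) * pochhammer (real N / 2) m)"
    unfolding half_moment_shift[OF N] using half_moment_pos[of "N - 1"]
    by (subst ennreal_mult'[symmetric]) (auto simp: mult_ac)
  finally show ?thesis .
qed

text \<open>A linear combination of independent centred normal variables of variance 1/2 is normal
  with variance \<open>dot N y y / 2\<close>, and the even moments of a normal variable are
  known.\<close>

lemma gaussN_dot_moment:
  assumes q: "0 < dot N y y"
  shows "(\<integral>\<^sup>+x. ennreal ((dot N y x) ^ (2 * m)) \<partial>gaussN N) = ennreal (fact (2 * m) * (dot N y y) ^ m / (4 ^ m * fact m))"
proof -
  interpret G: prob_space "gaussN N" by (rule prob_gaussN)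
  \<comment> \<open>Coordinates with \<open>y k = 0\<close> are dropped, since
    \<open>y k * x k\<close> would then be degenerate and have no normal density.\<close>
  define I where "I = {k. k < N \<and> y k \<noteq> 0}"
  have I: "finite I" "I \<subseteq> {..<N}" unfolding I_def by auto
  have Ine: "I \<noteq> {}"
  proof
    assume "I = {}"
    hence "dot N y y = 0" unfolding I_def dot_def by auto
    thus False using q by simp
  qed
  have dI: "dot N y x = (\<Sum>k\<in>I. y k * x k)" for x
    unfolding dot_def by (rule sum.mono_neutral_right) (auto simp: I_def)
  have comp: "distr (gaussN N) borel (\<lambda>x. x k) = gauss1" if "k < N" for k
  proof -
    have "distr (gaussN N) gauss1 (\<lambda>x. x k) = gauss1"
      using that by (intro distr_PiM_component prob_gauss1) auto
    moreover have "distr (gaussN N) gauss1 (\<lambda>x. x k) = distr (gaussN N) borel (\<lambda>x. x k)"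
      by (rule distr_cong) auto
    ultimately show ?thesis by simp
  qed
  have meas: "(\<lambda>x. x k) \<in> borel_measurable (gaussN N)" if "k < N" for k
  proof -
    have "(\<lambda>x. x k) \<in> gaussN N \<rightarrow>\<^sub>M gauss1" using that by (intro measurable_component_singleton) auto
    thus ?thesis by simp
  qed
  have ind: "G.indep_vars (\<lambda>_. borel) (\<lambda>k x. x k) I"
  proof (subst G.indep_vars_iff_distr_eq_PiM')
    have "distr (gaussN N) (\<Pi>\<^sub>M i\<in>I. borel) (\<lambda>x. \<lambda>i\<in>I. x i) = distr (gaussN N) (\<Pi>\<^sub>M i\<in>I. gauss1) (\<lambda>x. \<lambda>i\<in>I. x (id i))"
      by (rule distr_cong) (auto intro!: sets_PiM_cong)
    also have "\<dots> = (\<Pi>\<^sub>M i\<in>I. gauss1)"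
      using I prob_gauss1 by (intro distr_PiM_reindex[of "{..<N}" "\<lambda>_. gauss1" id I]) auto
    also have "\<dots> = (\<Pi>\<^sub>M i\<in>I. distr (gaussN N) borel (\<lambda>x. x i))"
      by (rule PiM_cong) (use I comp in auto)
    finally show "distr (gaussN N) (\<Pi>\<^sub>M i\<in>I. borel) (\<lambda>x. \<lambda>i\<in>I. x i) = (\<Pi>\<^sub>M i\<in>I. distr (gaussN N) borel (\<lambda>x. x i))" .
  qed (use Ine I meas in auto)
  have ind': "G.indep_vars (\<lambda>_. borel) (\<lambda>k x. y k * x k) I"
    using G.indep_vars_compose2[OF ind, of "\<lambda>k t. y k * t" "\<lambda>_. borel"] by simp
  have dist: "distributed (gaussN N) lborel (\<lambda>x. y k * x k) (normal_density 0 (\<bar>y k\<bar> * (1 / sqrt 2)))" if "k \<in> I" for k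
  proof -
    have k: "k < N" "y k \<noteq> 0" using that by (auto simp: I_def)
    have "distributed (gaussN N) lborel (\<lambda>x. x k) (normal_density 0 (1 / sqrt 2))"
      unfolding distributed_def
    proof (intro conjI)
      show "distr (gaussN N) lborel (\<lambda>x. x k) = gauss1"
        using comp[OF k(1)] by (simp cong: distr_cong)
    qed (use meas[OF k(1)] in auto)
    from G.normal_density_affine[OF this _ k(2), of 0] show ?thesis by simp
  qed
  define s where "s = sqrt (\<Sum>k\<in>I. (\<bar>y k\<bar> * (1 / sqrt 2))\<^sup>2)"
  have D: "distributed (gaussN N) lborel (dot N y) (normal_density 0 s)"
  proof -
    have "distributed (gaussN N) lborel (\<lambda>x. \<Sum>k\<in>I. y k * x k) (normal_density (\<Sum>k\<in>I. 0) s)"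
      unfolding s_def by (rule G.sum_indep_normal[OF I(1) Ine ind' _ dist]) (auto simp: I_def)
    thus ?thesis unfolding dI[abs_def, symmetric] by (simp add: dI[abs_def])
  qed
  have s2: "s\<^sup>2 = dot N y y / 2"
  proof -
    have "s\<^sup>2 = (\<Sum>k\<in>I. (\<bar>y k\<bar> * (1 / sqrt 2))\<^sup>2)" unfolding s_def by (simp add: sum_nonneg)
    also have "\<dots> = (\<Sum>k\<in>I. y k * y k) / 2"
      by (simp add: power_mult_distrib power_divide sum_divide_distrib power2_eq_square)
    finally show ?thesis using dI[of y] by simp
  qed
  have "0 \<le> s" unfolding s_def by (intro real_sqrt_ge_zero sum_nonneg) auto
  moreover have "s \<noteq> 0" using s2 q by auto
  ultimately have s0: "0 < s" by simp
  have "(\<integral>\<^sup>+x. ennreal ((dot N y x) ^ (2 * m)) \<partial>gaussN N) = (\<integral>\<^sup>+t. ennreal (normal_density 0 s t) * ennreal (t ^ (2 * m)) \<partial>lborel)"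
    by (rule distributed_nn_integral[OF D, symmetric]) auto
  also have "\<dots> = (\<integral>\<^sup>+t. ennreal (normal_density 0 s t * (t - 0) ^ (2 * m)) \<partial>lborel)"
    by (rule nn_integral_cong) (simp add: ennreal_mult')
  also have "\<dots> = ennreal (fact (2 * m) / ((2 / s\<^sup>2) ^ m * fact m))"
    using normal_moment_even[OF s0, of 0 m]
    by (subst nn_integral_eq_integral) (auto simp: has_bochner_integral_iff)
  also have "fact (2 * m) / ((2 / s\<^sup>2) ^ m * fact m) = fact (2 * m) * (dot N y y) ^ m / (4 ^ m * fact m)"
    unfolding s2 using q by (simp add: power_divide field_simps)
  finally show ?thesis .
qed

section \<open>Volume of the unit ball and integration over the sphere\<close>

definition ball_vol :: "nat \<Rightarrow> real" where
  "ball_vol N = 1 / ((1 / sqrt pi) ^ N * real N * half_moment (N - 1))"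

lemma ball_vol_pos: "0 < N \<Longrightarrow> 0 < ball_vol N"
  unfolding ball_vol_def using half_moment_pos by auto

text \<open>The Gaussian measure has total mass 1, so the volume is the reciprocal of the radial
  constant in \<open>gaussN_polar\<close>.\<close>

lemma emeasure_unit_ball:
  assumes N: "0 < N"
  shows "emeasure (lebN N) (unit_ball N) = ennreal (ball_vol N)"
proof -
  interpret G: prob_space "gaussN N" by (rule prob_gaussN)
  let ?c = "(1 / sqrt pi) ^ N * real N * half_moment (N - 1)"
  have c: "0 < ?c" using half_moment_pos[of "N - 1"] N by auto
  have "(\<integral>\<^sup>+x. 1 * ennreal (nrm N x ^ (2 * 0)) \<partial>gaussN N) =
     (\<integral>\<^sup>+x. 1 * indicator (unit_ball N) x \<partial>lebN N) * ennreal (?c * pochhammer (real N / 2) 0)"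
    by (rule gaussN_polar[OF N]) (use emeasure_unit_ball_finite[of N] in auto)
  hence e: "1 = emeasure (lebN N) (unit_ball N) * ennreal ?c"
    using G.emeasure_space_1 by simp
  have "emeasure (lebN N) (unit_ball N) = emeasure (lebN N) (unit_ball N) * (ennreal ?c * ennreal (1 / ?c))"
 
  proof -
    have "ennreal ?c * ennreal (1 / ?c) = ennreal (?c * (1 / ?c))"
      using c by (intro ennreal_mult'[symmetric]) auto
    also have "?c * (1 / ?c) = 1" using c by (metis nonzero_mult_div_cancel_right mult.commute mult_1 times_divide_eq_left less_irrefl)
    finally show ?thesis by simp
  qed
  also have "\<dots> = ennreal (1 / ?c)" using e by (simp add: mult.assoc[symmetric])
  finally show ?thesis unfolding ball_vol_def .
qed

lemma nn_integral_sphere_measure: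
  assumes N: "0 < N" and h[measurable]: "h \<in> borel_measurable (\<Pi>\<^sub>M k\<in>{..<N}. borel)"
  shows "(\<integral>\<^sup>+s. h s \<partial>sphere_measure N) =
    (\<integral>\<^sup>+x. h (radial_proj N x) * indicator (unit_sphere N) (radial_proj N x) * indicator (unit_ball N) x \<partial>lebN N) / ennreal (ball_vol N)"
proof -
  have "(\<integral>\<^sup>+s. h s \<partial>sphere_measure N) =
     (\<integral>\<^sup>+s. h s * indicator (unit_sphere N) s \<partial>distr (uniform_measure (lebN N) (unit_ball N)) (\<Pi>\<^sub>M k\<in>{..<N}. borel) (radial_proj N))"
    unfolding sphere_measure_def by (rule nn_integral_restrict_space) simp
  also have "\<dots> = (\<integral>\<^sup>+x. h (radial_proj N x) * indicator (unit_sphere N) (radial_proj N x) \<partial>uniform_measure (lebN N) (unit_ball N))"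
    by (rule nn_integral_distr) auto
  also have "\<dots> = (\<integral>\<^sup>+x. h (radial_proj N x) * indicator (unit_sphere N) (radial_proj N x) * indicator (unit_ball N) x \<partial>lebN N) / emeasure (lebN N) (unit_ball N)"
    by (rule nn_integral_uniform_measure) auto
  finally show ?thesis unfolding emeasure_unit_ball[OF N] .
qed

lemma radial_proj_in_sphere:
  assumes "0 < nrm N x"
  shows "radial_proj N x \<in> unit_sphere N"
proof -
  have "nrm N (radial_proj N x) = nrm N (scale_vec N (1 / nrm N x) x)"
    unfolding radial_proj_def scale_vec_def by (rule L2_set_cong) auto
  also have "\<dots> = 1" unfolding nrm_scale_vec using assms by simp
  finally show ?thesis unfolding unit_sphere_def by (simp add: radial_proj_def)
qed

lemma space_sphere_measure: "space (sphere_measure N) = unit_sphere N"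
  unfolding sphere_measure_def by (auto simp: space_restrict_space space_PiM unit_sphere_def PiE_def)

lemma sets_sphere_measure: "sets (sphere_measure N) = sets (restrict_space (\<Pi>\<^sub>M k\<in>{..<N}. borel) (unit_sphere N))"
  unfolding sphere_measure_def by (rule sets_restrict_space_cong) simp

lemma measurable_sphere_measure:
  assumes "f \<in> (\<Pi>\<^sub>M k\<in>{..<N}. borel) \<rightarrow>\<^sub>M K"
  shows "f \<in> sphere_measure N \<rightarrow>\<^sub>M K"
proof -
  have "f \<in> restrict_space (\<Pi>\<^sub>M k\<in>{..<N}. borel) (unit_sphere N) \<rightarrow>\<^sub>M K"
    by (rule measurable_restrict_space1[OF assms])
  thus ?thesis using measurable_cong_sets[OF sets_sphere_measure refl] by blast
qed

lemma prob_space_sphere_measure: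
  assumes N: "0 < N"
  shows "prob_space (sphere_measure N)"
proof
  have "emeasure (sphere_measure N) (space (sphere_measure N)) = (\<integral>\<^sup>+s. 1 \<partial>sphere_measure N)" by simp
  also have "\<dots> = (\<integral>\<^sup>+x. 1 * indicator (unit_sphere N) (radial_proj N x) * indicator (unit_ball N) x \<partial>lebN N) / ennreal (ball_vol N)"
    by (rule nn_integral_sphere_measure[OF N]) auto
  also have "(\<integral>\<^sup>+x. 1 * indicator (unit_sphere N) (radial_proj N x) * indicator (unit_ball N) x \<partial>lebN N)
     = (\<integral>\<^sup>+x. indicator (unit_ball N) x \<partial>lebN N)"
    by (rule nn_integral_cong_AE) (use AE_nrm_pos[OF N] radial_proj_in_sphere in \<open>auto elim!: eventually_mono\<close>)
  also have "\<dots> = ennreal (ball_vol N)" using emeasure_unit_ball[OF N] by simp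
  also have "ennreal (ball_vol N) / ennreal (ball_vol N) = 1"
    using ball_vol_pos[OF N] by (simp add: divide_ennreal)
  finally show "emeasure (sphere_measure N) (space (sphere_measure N)) = 1" .
qed

section \<open>Moments and Laplace transform of the sphere measure\<close>

lemma abs_dot_le: "\<bar>dot N x y\<bar> \<le> nrm N x * nrm N y"
proof -
  have "\<bar>dot N x y\<bar> \<le> (\<Sum>k<N. \<bar>x k\<bar> * \<bar>y k\<bar>)"
    unfolding dot_def by (rule order_trans[OF sum_abs]) (simp add: abs_mult)
  also have "\<dots> \<le> nrm N x * nrm N y" by (rule L2_set_mult_ineq)
  finally show ?thesis .
qed

lemma dot_self: "dot N x x = (nrm N x)\<^sup>2"
  unfolding dot_def L2_set_def by (simp add: sum_nonneg power2_eq_square)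

lemma dot_radial_proj:
  assumes "0 < nrm N x"
  shows "dot N y x = nrm N x * dot N y (radial_proj N x)"
  unfolding dot_def radial_proj_def using assms by (simp add: sum_distrib_left)

text \<open>The Gaussian moment of \<open>dot N y x\<close> is known in two ways: as a
  one-dimensional normal moment, and as a radial moment times the moment of the direction. Division
  gives the claim; \<open>y\<close> of length 0, where the normal law degenerates, is treated
  apart.\<close>

lemma sphere_even_moment_nn:
  assumes N: "0 < N"
  shows "(\<integral>\<^sup>+s. ennreal ((dot N y s) ^ (2 * m)) \<partial>sphere_measure N) = ennreal (fact (2 * m) * sph_coeff N m * (dot N y y) ^ m)"
proof (cases "dot N y y = 0")
  case True
  interpret prob_space "sphere_measure N" by (rule prob_space_sphere_measure[OF N])
  have "nrm N y = 0" using True dot_self[of N y] by simp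
  hence "dot N y s = 0" for s using abs_dot_le[of N y s] by simp
  thus ?thesis using True emeasure_space_1 by (cases m) auto
next
  case False
  hence q: "0 < dot N y y" using dot_self[of N y] by auto
  define h where "h = (\<lambda>x. ennreal ((dot N y (radial_proj N x)) ^ (2 * m)) * indicator (unit_sphere N) (radial_proj N x))"
  have hm[measurable]: "h \<in> borel_measurable (lebN N)" unfolding h_def by measurable
  let ?H = "\<integral>\<^sup>+x. h x * indicator (unit_ball N) x \<partial>lebN N"
  let ?c = "(1 / sqrt pi) ^ N * real N * half_moment (N - 1)"
  let ?p = "pochhammer (real N / 2) m"
  have c: "0 < ?c" using half_moment_pos[of "N - 1"] N by auto
  have p: "0 < ?p" using N by (intro pochhammer_pos) auto
  have fin: "?H < \<infinity>"
  proof -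
    have "?H \<le> (\<integral>\<^sup>+x. ennreal ((nrm N y) ^ (2 * m)) * indicator (unit_ball N) x \<partial>lebN N)"
    proof (rule nn_integral_mono, rule mult_right_mono)
      fix x
      show "h x \<le> ennreal ((nrm N y) ^ (2 * m))"
      proof (cases "radial_proj N x \<in> unit_sphere N")
        case True
        hence "\<bar>dot N y (radial_proj N x)\<bar> \<le> nrm N y"
          using abs_dot_le[of N y "radial_proj N x"] unfolding unit_sphere_def by simp
        from power_mono[OF this, of "2 * m"] show ?thesis
          unfolding h_def using True by (simp add: power_even_abs ennreal_leI)
      qed (simp add: h_def)
    qed simp
    also have "\<dots> = ennreal ((nrm N y) ^ (2 * m)) * emeasure (lebN N) (unit_ball N)"
      by (rule nn_integral_cmult_indicator) simp
    also have "\<dots> < \<infinity>" using emeasure_unit_ball_finite[of N] by (simp add: ennreal_mult_less_top)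
    finally show ?thesis .
  qed
  have "(\<integral>\<^sup>+x. h x * ennreal (nrm N x ^ (2 * m)) \<partial>gaussN N) = ?H * ennreal (?c * ?p)"
    by (rule gaussN_polar[OF N hm _ fin]) (simp add: h_def radial_proj_scale_vec)
  moreover have "(\<integral>\<^sup>+x. h x * ennreal (nrm N x ^ (2 * m)) \<partial>gaussN N) = (\<integral>\<^sup>+x. ennreal ((dot N y x) ^ (2 * m)) \<partial>gaussN N)"
  proof (rule nn_integral_cong_AE)
    have "AE x in gaussN N. 0 < nrm N x"
      unfolding gaussN_eq_density using AE_nrm_pos[OF N] by (subst AE_density) (auto elim!: eventually_mono)
    thus "AE x in gaussN N. h x * ennreal (nrm N x ^ (2 * m)) = ennreal ((dot N y x) ^ (2 * m))"
    proof (rule eventually_mono)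
      fix x assume x: "0 < nrm N x"
      show "h x * ennreal (nrm N x ^ (2 * m)) = ennreal ((dot N y x) ^ (2 * m))"
        unfolding h_def dot_radial_proj[OF x] using radial_proj_in_sphere[OF x]
        by (simp add: ennreal_mult'[symmetric] ennreal_mult''[symmetric] power_mult_distrib mult.commute)
    qed
  qed
  ultimately have "?H * ennreal (?c * ?p) = ennreal (fact (2 * m) * (dot N y y) ^ m / (4 ^ m * fact m))"
    using gaussN_dot_moment[OF q] by simp
  hence "?H * ennreal (?c * ?p) * ennreal (1 / ?p) = ennreal (fact (2 * m) * (dot N y y) ^ m / (4 ^ m * fact m)) * ennreal (1 / ?p)"
    by simp
  moreover have "?H * ennreal (?c * ?p) * ennreal (1 / ?p) = ?H * ennreal ?c"
  proof -
    have "ennreal (?c * ?p) * ennreal (1 / ?p) = ennreal (?c * ?p * (1 / ?p))"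
      using c p by (intro ennreal_mult'[symmetric]) auto
    also have "?c * ?p * (1 / ?p) = ?c" using p by (metis nonzero_mult_div_cancel_right mult.right_neutral times_divide_eq_right less_irrefl)
    finally show ?thesis by (simp add: mult.assoc)
  qed
  moreover have "ennreal (fact (2 * m) * (dot N y y) ^ m / (4 ^ m * fact m)) * ennreal (1 / ?p)
     = ennreal (fact (2 * m) * sph_coeff N m * (dot N y y) ^ m)"
    using p q by (subst ennreal_mult'[symmetric]) (auto simp: sph_coeff_def)
  ultimately have "?H * ennreal ?c = ennreal (fact (2 * m) * sph_coeff N m * (dot N y y) ^ m)" by simp
  moreover have "(\<integral>\<^sup>+s. ennreal ((dot N y s) ^ (2 * m)) \<partial>sphere_measure N) = ?H / ennreal (ball_vol N)"
    unfolding h_def by (rule nn_integral_sphere_measure[OF N]) measurable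
  moreover have "?H / ennreal (ball_vol N) = ?H * ennreal ?c"
    unfolding ball_vol_def divide_ennreal_def using c by (simp add: inverse_ennreal)
  ultimately show ?thesis by simp
qed

text \<open>Lebesgue measure and the ball are invariant under the scaling by \<open>-1\<close>. This
  is what annihilates the odd moments.\<close>

lemma nn_integral_sphere_reflect:
  assumes N: "0 < N" and h[measurable]: "h \<in> borel_measurable borel"
  shows "(\<integral>\<^sup>+s. h (dot N y s) \<partial>sphere_measure N) = (\<integral>\<^sup>+s. h (- dot N y s) \<partial>sphere_measure N)"
proof -
  let ?R = "scale_vec N (-1)"
  have R: "radial_proj N (?R x) = ?R (radial_proj N x)" for x
    unfolding radial_proj_def nrm_scale_vec by (auto simp: scale_vec_def restrict_def)
  have d: "dot N y (?R z) = - dot N y z" for z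
    unfolding dot_def scale_vec_def by (simp add: sum_negf)
  have S: "?R z \<in> unit_sphere N \<longleftrightarrow> z \<in> unit_sphere N" if "z \<in> extensional {..<N}" for z
    unfolding unit_sphere_def using that by (auto simp: nrm_scale_vec) (auto simp: scale_vec_def)
  have B: "?R z \<in> unit_ball N \<longleftrightarrow> z \<in> unit_ball N" if "z \<in> extensional {..<N}" for z
    unfolding unit_ball_def using that by (auto simp: nrm_scale_vec) (auto simp: scale_vec_def)
  have "(\<integral>\<^sup>+x. h (dot N y (radial_proj N x)) * indicator (unit_sphere N) (radial_proj N x) * indicator (unit_ball N) x \<partial>lebN N)
    = ennreal (\<bar>-1\<bar> ^ N) * (\<integral>\<^sup>+x. h (dot N y (radial_proj N (?R x))) * indicator (unit_sphere N) (radial_proj N (?R x)) * indicator (unit_ball N) (?R x) \<partial>lebN N)"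
    by (rule nn_integral_lebN_scale) auto
  also have "\<dots> = (\<integral>\<^sup>+x. h (- dot N y (radial_proj N x)) * indicator (unit_sphere N) (radial_proj N x) * indicator (unit_ball N) x \<partial>lebN N)"
    unfolding R d
    by (auto intro!: nn_integral_cong simp: space_lebN B S radial_proj_def split: split_indicator)
  finally show ?thesis by (subst (1 2) nn_integral_sphere_measure[OF N]) auto
qed

lemma sphere_moments:
  assumes N: "0 < N"
  shows "(\<integral>s. (dot N y s) ^ (2 * m) \<partial>sphere_measure N) = fact (2 * m) * sph_coeff N m * (dot N y y) ^ m"
    and "(\<integral>s. (dot N y s) ^ (2 * m + 1) \<partial>sphere_measure N) = 0"
proof -
  have md[measurable]: "dot N y \<in> borel_measurable (sphere_measure N)"
    by (rule measurable_sphere_measure) measurable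
  show "(\<integral>s. (dot N y s) ^ (2 * m) \<partial>sphere_measure N) = fact (2 * m) * sph_coeff N m * (dot N y y) ^ m"
    using sphere_even_moment_nn[OF N, of y m] N dot_self[of N y]
    by (intro integral_eq_nn_integral[THEN trans]) (auto simp: sph_coeff_def pochhammer_nonneg)
  show "(\<integral>s. (dot N y s) ^ (2 * m + 1) \<partial>sphere_measure N) = 0"
  proof (cases "integrable (sphere_measure N) (\<lambda>s. (dot N y s) ^ (2 * m + 1))")
    case True
    show ?thesis unfolding real_lebesgue_integral_def[OF True]
      using nn_integral_sphere_reflect[OF N, of "\<lambda>t. ennreal (t ^ (2 * m + 1))" y] by simp
  \<comment> \<open>A function that is not integrable has integral 0 by convention, so the claim
    holds in this case too.\<close>
  qed (rule not_integrable_integral_eq)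
qed

text \<open>\<open>V\<close> is bounded, so the exponential series may be integrated term by term.
  The shift \<open>j\<close> treats \<open>exp V\<close>, \<open>V * exp V\<close> and
  \<open>V^2 * exp V\<close> together.\<close>

lemma (in prob_space) exp_moment_series:
  fixes V :: "'a \<Rightarrow> real"
  assumes [measurable]: "V \<in> borel_measurable M" and B: "\<And>x. x \<in> space M \<Longrightarrow> \<bar>V x\<bar> \<le> B"
  shows "(\<lambda>k. expectation (\<lambda>x. V x ^ (k + j)) / fact k) sums expectation (\<lambda>x. V x ^ j * exp (V x))"
proof -
  obtain x0 where "x0 \<in> space M" using not_empty by blast
  with B have B0: "0 \<le> B" by fastforce
  have Bp: "\<bar>V x ^ (k + j) / fact k\<bar> \<le> B ^ j * (inverse (fact k) * B ^ k)" if "x \<in> space M" for x k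
  proof -
    have "\<bar>V x\<bar> ^ (k + j) \<le> B ^ (k + j)" using B[OF that] by (intro power_mono) auto
    thus ?thesis by (simp add: abs_mult power_abs power_add field_simps)
  qed
  have int: "integrable M (\<lambda>x. V x ^ (k + j) / fact k)" for k
    by (rule integrable_const_bound[where B="B ^ j * (inverse (fact k) * B ^ k)"]) (use Bp in auto)
  have sB: "summable (\<lambda>k. B ^ j * (inverse (fact k) * B ^ k))"
    by (intro summable_mult summable_exp)
  have "(\<lambda>k. expectation (\<lambda>x. V x ^ (k + j) / fact k)) sums expectation (\<lambda>x. \<Sum>k. V x ^ (k + j) / fact k)"
  proof (rule sums_integral[OF int])
    show "AE x in M. summable (\<lambda>k. norm (V x ^ (k + j) / fact k))"
      by (rule AE_I2, rule summable_comparison_test'[OF sB]) (use Bp in auto)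
    show "summable (\<lambda>k. expectation (\<lambda>x. norm (V x ^ (k + j) / fact k)))"
    proof (rule summable_comparison_test'[OF sB])
      fix k
      have "expectation (\<lambda>x. norm (V x ^ (k + j) / fact k)) \<le> expectation (\<lambda>x. B ^ j * (inverse (fact k) * B ^ k))"
        by (rule integral_mono[OF integrable_norm[OF int]]) (use Bp in auto)
      thus "norm (expectation (\<lambda>x. norm (V x ^ (k + j) / fact k))) \<le> B ^ j * (inverse (fact k) * B ^ k)"
        by (simp add: prob_space)
    qed
  qed
  moreover have "(\<Sum>k. V x ^ (k + j) / fact k) = V x ^ j * exp (V x)" for x
  proof -
    have "(\<lambda>k. V x ^ j * (inverse (fact k) * V x ^ k)) sums (V x ^ j * exp (V x))"
      by (intro sums_mult exp_converges[of "V x", simplified])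
    hence "(\<lambda>k. V x ^ (k + j) / fact k) sums (V x ^ j * exp (V x))"
      by (simp add: power_add field_simps)
    thus ?thesis by (rule sums_unique[symmetric])
  qed
  ultimately show ?thesis by simp
qed

text \<open>After expansion of the exponential the odd moments vanish, and the even ones reproduce
  the coefficients of \<open>sph\<close> and of its first two derivatives.\<close>

lemma sphere_exp_moments:
  assumes N: "2 \<le> N"
  shows "(\<integral>s. exp (dot N y s) \<partial>sphere_measure N) = sph N (dot N y y)"
    and "(\<integral>s. dot N y s * exp (dot N y s) \<partial>sphere_measure N) = 2 * dot N y y * sph1 N (dot N y y)"
    and "(\<integral>s. (dot N y s)\<^sup>2 * exp (dot N y s) \<partial>sphere_measure N) =
      4 * (dot N y y)\<^sup>2 * sph2 N (dot N y y) + 2 * dot N y y * sph1 N (dot N y y)"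
proof -
  have N0: "0 < N" using N by simp
  interpret prob_space "sphere_measure N" by (rule prob_space_sphere_measure[OF N0])
  define q where "q = dot N y y"
  let ?e = "\<lambda>k. expectation (\<lambda>s. dot N y s ^ k)"
  have ev: "?e (2 * m) = fact (2 * m) * sph_coeff N m * q ^ m" and od: "?e (2 * m + 1) = 0" for m
    using sphere_moments[OF N0, of y m] unfolding q_def by auto
  have md: "dot N y \<in> borel_measurable (sphere_measure N)"
    by (rule measurable_sphere_measure) measurable
  have bd: "\<bar>dot N y s\<bar> \<le> nrm N y" if "s \<in> space (sphere_measure N)" for s
    using abs_dot_le[of N y s] that unfolding space_sphere_measure unit_sphere_def by simp
  note ser = exp_moment_series[OF md bd]
  \<comment> \<open>The series are thinned to the terms with \<open>k + j\<close> even: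
    \<open>k = 2 * m\<close> for \<open>j = 0\<close> and \<open>j = 2\<close>, and
    \<open>k = 2 * m + 1\<close> for \<open>j = 1\<close>.\<close>
  have mono0: "strict_mono (\<lambda>m::nat. 2 * m)" and mono1: "strict_mono (\<lambda>m::nat. 2 * m + 1)"
    by (auto simp: strict_mono_def)
  have odd0: "?e (k + 0) / fact k = 0" and odd2: "?e (k + 2) / fact k = 0" if "k \<notin> range (\<lambda>m::nat. 2 * m)" for k
  proof -
    have "odd k" using that by auto
    then obtain m where m: "k = 2 * m + 1" by (elim oddE)
    have "k + 2 = 2 * Suc m + 1" unfolding m by simp
    thus "?e (k + 2) / fact k = 0" using od[of "Suc m"] by (simp only: div_0)
    show "?e (k + 0) / fact k = 0" unfolding m using od[of m] by simp
  qed
  have odd1: "?e (k + 1) / fact k = 0" if "k \<notin> range (\<lambda>m::nat. 2 * m + 1)" for k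
  proof -
    have "even k"
    proof (rule ccontr)
      assume "odd k"
      then obtain m where "k = 2 * m + 1" by (elim oddE)
      thus False using that by blast
    qed
    then obtain m where m: "k = 2 * m" by blast
    show ?thesis unfolding m using od[of m] by simp
  qed
  have s0: "(\<lambda>m. ?e (2 * m) / fact (2 * m)) sums expectation (\<lambda>s. dot N y s ^ 0 * exp (dot N y s))"
    using ser[of 0] sums_mono_reindex[OF mono0, of "\<lambda>k. ?e (k + 0) / fact k"] odd0 by simp
  have s1: "(\<lambda>m. ?e (2 * m + 1 + 1) / fact (2 * m + 1)) sums expectation (\<lambda>s. dot N y s ^ 1 * exp (dot N y s))"
    using ser[of 1] sums_mono_reindex[OF mono1, of "\<lambda>k. ?e (k + 1) / fact k"] odd1 by simp
  have s2: "(\<lambda>m. ?e (2 * m + 2) / fact (2 * m)) sums expectation (\<lambda>s. dot N y s ^ 2 * exp (dot N y s))"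
    using ser[of 2] sums_mono_reindex[OF mono0, of "\<lambda>k. ?e (k + 2) / fact k"] odd2 by simp
  have "(\<lambda>m. ?e (2 * m) / fact (2 * m)) sums sph N q"
    unfolding ev sph_def using summable_sums[OF summable_sph[OF N, of q]] by simp
  from sums_unique2[OF s0 this] show "(\<integral>s. exp (dot N y s) \<partial>sphere_measure N) = sph N (dot N y y)"
    unfolding q_def by simp
  let ?d = "diffs (sph_coeff N)"
  have e2: "?e (2 * m + 2) = (2 * real m + 2) * (2 * real m + 1) * fact (2 * m) * sph_coeff N (Suc m) * q ^ Suc m" for m
    using ev[of "Suc m"] by (simp add: algebra_simps)
  have t1: "?e (2 * m + 1 + 1) / fact (2 * m + 1) = 2 * q * (?d m * q ^ m)" for m
  proof -
    have e: "?e (2 * m + 1 + 1) = ?e (2 * m + 2)" by simp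
    have f: "fact (2 * m + 1) = (2 * real m + 1) * (fact (2 * m) :: real)" by simp
    have "2 * real m + 1 \<noteq> 0" by linarith
    thus ?thesis unfolding e e2 f diffs_def
      by (simp only: divide_eq_eq mult_eq_0_iff fact_nonzero if_False simp_thms) (simp add: algebra_simps)
  qed
  have "(\<lambda>m. ?e (2 * m + 1 + 1) / fact (2 * m + 1)) sums (2 * q * sph1 N q)"
    unfolding t1 sph1_def by (intro sums_mult summable_sums summable_sph1 N)
  from sums_unique2[OF s1 this] show "(\<integral>s. dot N y s * exp (dot N y s) \<partial>sphere_measure N) = 2 * dot N y y * sph1 N (dot N y y)"
    unfolding q_def by simp
  have t2: "?e (2 * m + 2) / fact (2 * m) = 4 * q * (real m * ?d m * q ^ m) + 2 * q * (?d m * q ^ m)" for m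
    unfolding e2 diffs_def by (simp add: field_simps)
  have d2: "(\<lambda>m. real m * ?d m * q ^ m) sums (q * sph2 N q)"
  proof -
    have "(\<lambda>n. of_nat n * ?d n * q ^ (n - Suc 0)) sums sph2 N q"
      unfolding sph2_def by (rule diffs_equiv) (rule summable_sph2[OF N])
    hence "(\<lambda>n. q * (of_nat n * ?d n * q ^ (n - Suc 0))) sums (q * sph2 N q)"
      by (rule sums_mult)
    moreover have "q * (of_nat n * ?d n * q ^ (n - Suc 0)) = of_nat n * ?d n * q ^ n" for n
      by (cases n) auto
    ultimately show ?thesis by simp
  qed
  have "(\<lambda>m. ?e (2 * m + 2) / fact (2 * m)) sums (4 * q * (q * sph2 N q) + 2 * q * sph1 N q)"
    unfolding t2 by (intro sums_add sums_mult d2) (auto simp: sph1_def intro!: sums_mult summable_sums summable_sph1 N)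
  from sums_unique2[OF s2 this] show "(\<integral>s. (dot N y s)\<^sup>2 * exp (dot N y s) \<partial>sphere_measure N) =
      4 * (dot N y y)\<^sup>2 * sph2 N (dot N y y) + 2 * dot N y y * sph1 N (dot N y y)"
    unfolding q_def by (simp add: power2_eq_square mult_ac)
qed

text \<open>Strict positivity of the variance under the tilted law. The tilt is at least
  \<open>exp (- nrm N y)\<close>, and without it the mean square distance from any constant is at
  least the second moment, because the mean is 0; that second moment is positive by its explicit
  value.\<close>

lemma second_moment_gt:
  assumes N: "2 \<le> N" and q: "0 < q"
  shows "(q * logd N q)\<^sup>2 < second_moment N q"
proof -
  have N0: "0 < N" using N by simp
  interpret prob_space "sphere_measure N" by (rule prob_space_sphere_measure[OF N0])
  \<comment> \<open>Any vector of squared length \<open>q\<close> would do.\<close>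
  define y where "y = (\<lambda>k::nat. if k = 0 then sqrt q else 0)"
  have yy: "dot N y y = q"
  proof -
    have "dot N y y = (\<Sum>k\<in>{0}. y k * y k)"
      unfolding dot_def by (rule sum.mono_neutral_right) (use N0 in \<open>auto simp: y_def\<close>)
    thus ?thesis using q by (simp add: y_def)
  qed
  define V where "V = dot N y"
  have VY: "V y = q" unfolding V_def by (rule yy)
  have V[measurable]: "V \<in> borel_measurable (sphere_measure N)"
    unfolding V_def by (rule measurable_sphere_measure) measurable
  have bd: "\<bar>V s\<bar> \<le> nrm N y" if "s \<in> space (sphere_measure N)" for s
    using abs_dot_le[of N y s] that unfolding space_sphere_measure unit_sphere_def V_def by simp
  have int: "integrable (sphere_measure N) (\<lambda>s. V s ^ j * exp (V s))" for j
    by (rule integrable_const_bound[where B="nrm N y ^ j * exp (nrm N y)"])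
       (use bd in \<open>auto intro!: AE_I2 mult_mono power_mono simp: abs_mult power_abs\<close>, use abs_le_D1 in fastforce)
  have intV: "integrable (sphere_measure N) (\<lambda>s. V s ^ j)" for j
    by (rule integrable_const_bound[where B="nrm N y ^ j"])
       (use bd in \<open>auto intro!: AE_I2 power_mono simp: power_abs\<close>)
  \<comment> \<open>The mean of \<open>V\<close> under the tilted law.\<close>
  define c where "c = q * logd N q"
  have P: "1 \<le> sph N q" using sph_ge_1[OF N, of q] q by simp
  have E0: "expectation (\<lambda>s. exp (V s)) = sph N q"
    and E1: "expectation (\<lambda>s. V s * exp (V s)) = c * sph N q"
    and E2: "expectation (\<lambda>s. (V s)\<^sup>2 * exp (V s)) = second_moment N q * sph N q"
    using sphere_exp_moments[OF N, of y] P unfolding V_def[symmetric] VY c_def logd_def second_moment_def by auto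
  have "0 < exp (- nrm N y) * (fact (2 * 1) * sph_coeff N 1 * q ^ 1)"
    using sph_coeff_pos[OF N, of 1] q by simp
  also have "\<dots> \<le> exp (- nrm N y) * (expectation (\<lambda>s. (V s)\<^sup>2) + c\<^sup>2)"
    using sphere_moments(1)[OF N0, of y 1] unfolding V_def[symmetric] VY by simp
  also have "expectation (\<lambda>s. (V s)\<^sup>2) + c\<^sup>2 = expectation (\<lambda>s. (V s)\<^sup>2 - 2 * c * V s + c\<^sup>2)"
    using sphere_moments(2)[OF N0, of y 0] intV[of 2] intV[of 1] unfolding V_def[symmetric] by (simp add: prob_space)
  also have "exp (- nrm N y) * \<dots> = expectation (\<lambda>s. exp (- nrm N y) * ((V s)\<^sup>2 - 2 * c * V s + c\<^sup>2))"
    by simp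
  also have "\<dots> \<le> expectation (\<lambda>s. (V s)\<^sup>2 * exp (V s) - 2 * c * (V s * exp (V s)) + c\<^sup>2 * exp (V s))"
  proof (rule integral_mono)
    fix s assume s: "s \<in> space (sphere_measure N)"
    have e: "(V s)\<^sup>2 - 2 * c * V s + c\<^sup>2 = (V s - c)\<^sup>2" by (simp add: power2_eq_square algebra_simps)
    have "exp (- nrm N y) * (V s - c)\<^sup>2 \<le> exp (V s) * (V s - c)\<^sup>2"
      using bd[OF s] by (intro mult_right_mono) auto
    thus "exp (- nrm N y) * ((V s)\<^sup>2 - 2 * c * V s + c\<^sup>2) \<le> (V s)\<^sup>2 * exp (V s) - 2 * c * (V s * exp (V s)) + c\<^sup>2 * exp (V s)"
      unfolding e by (simp add: power2_eq_square algebra_simps)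
  qed (use int[of 0] int[of 1] int[of 2] intV[of 1] intV[of 2] in auto)
  also have "\<dots> = (second_moment N q - c\<^sup>2) * sph N q"
  proof -
    have "expectation (\<lambda>s. (V s)\<^sup>2 * exp (V s) - 2 * c * (V s * exp (V s)) + c\<^sup>2 * exp (V s))
       = expectation (\<lambda>s. (V s)\<^sup>2 * exp (V s)) - 2 * c * expectation (\<lambda>s. V s * exp (V s)) + c\<^sup>2 * expectation (\<lambda>s. exp (V s))"
      using int[of 0] int[of 1] int[of 2] by simp
    thus ?thesis unfolding E0 E1 E2 by (simp add: power2_eq_square algebra_simps)
  qed
  finally show ?thesis using P unfolding c_def by (simp add: zero_less_mult_iff)
qed

section \<open>The critical point and the limiting variance\<close>

lemma logd_pos: "2 \<le> N \<Longrightarrow> 0 \<le> q \<Longrightarrow> 0 < logd N q"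
  unfolding logd_def using sph1_pos[of N q] sph_ge_1[of N q] by auto

text \<open>For the Bessel ratio this says \<open>f(x) < 1\<close>. It follows from positivity of
  the tilted variance, as the second moment is at most \<open>q\<close>.\<close>

lemma logd_sq_less:
  assumes N: "2 \<le> N" and q: "0 < q"
  shows "q * (logd N q)\<^sup>2 < 1"
proof -
  have "0 \<le> (real N - 1) * logd N q" using logd_pos[OF N, of q] q N by auto
  hence "second_moment N q \<le> q * 1"
    unfolding second_moment_eq[OF N less_imp_le[OF q]] using q by (intro mult_left_mono) auto
  with second_moment_gt[OF assms] have "q * (q * (logd N q)\<^sup>2) < q * 1"
    by (simp add: power2_eq_square mult_ac)
  thus ?thesis using q by (simp only: mult_less_cancel_left_pos)
qed

text \<open>In the variable \<open>q = x^2\<close> the equation reads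
  \<open>logd N q = 1 / \<beta>\<close>, and \<open>logd\<close> is strictly decreasing. At 0 its
  value \<open>1 / N\<close> exceeds \<open>1 / \<beta>\<close>; at \<open>q = \<beta>^2\<close> the
  bound \<open>logd_sq_less\<close> places it below. The intermediate value theorem then locates the
  root.\<close>

lemma b_crit_properties:
  assumes N: "2 \<le> N" and \<beta>: "real N < \<beta>"
  shows "0 < b_crit N \<beta>" "\<beta> * logd N ((b_crit N \<beta>)\<^sup>2) = 1" "(b_crit N \<beta>)\<^sup>2 \<le> \<beta>\<^sup>2"
proof -
  have b0: "0 < \<beta>" using N \<beta> by simp
  have eq: "x - \<beta> * bessel_ratio N x = 0 \<longleftrightarrow> \<beta> * logd N (x\<^sup>2) = 1" if "0 < x" for x
    unfolding bessel_ratio_eq[OF N that] using that by (simp add: algebra_simps)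
  have c: "continuous_on {0..\<beta>\<^sup>2} (logd N)"
    by (rule DERIV_continuous_on) (use logd_has_derivative[OF N] in \<open>auto intro: has_field_derivative_at_within\<close>)
  have "(\<beta> * logd N (\<beta>\<^sup>2))\<^sup>2 < 1\<^sup>2" using logd_sq_less[OF N, of "\<beta>\<^sup>2"] b0 by (simp add: power_mult_distrib)
  hence h1: "\<beta> * logd N (\<beta>\<^sup>2) < 1" by (rule power_less_imp_less_base) simp
  have h0: "1 < \<beta> * logd N 0" using \<beta> N by (simp add: logd_at_0)
  have "\<exists>q\<ge>0. q \<le> \<beta>\<^sup>2 \<and> logd N q = 1 / \<beta>"
    by (rule IVT2') (use h0 h1 b0 c in \<open>auto simp: field_simps\<close>)
  then obtain q where q: "0 \<le> q" "q \<le> \<beta>\<^sup>2" "logd N q = 1 / \<beta>" by blast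
  have "q \<noteq> 0" using q(3) h0 b0 by (auto simp: field_simps)
  with q have q0: "0 < q" by simp
  have u: "x = sqrt q" if x: "0 < x \<and> x - \<beta> * bessel_ratio N x = 0" for x
  proof -
    have "\<beta> * logd N (x\<^sup>2) = \<beta> * logd N q" using x eq[of x] q b0 by simp
    hence "logd N (x\<^sup>2) = logd N q" using b0 by simp
    hence "x\<^sup>2 = q"
      using logd_strict_decreasing[OF N, of "x\<^sup>2" q] logd_strict_decreasing[OF N, of q "x\<^sup>2"] q
      by (cases "x\<^sup>2" q rule: linorder_cases) auto
    thus ?thesis using x by auto
  qed
  have ex: "0 < sqrt q \<and> sqrt q - \<beta> * bessel_ratio N (sqrt q) = 0"
    using q0 q b0 eq[of "sqrt q"] by auto
  have "b_crit N \<beta> = sqrt q"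
    unfolding b_crit_def by (rule the_equality) (use ex u in auto)
  thus "0 < b_crit N \<beta>" "\<beta> * logd N ((b_crit N \<beta>)\<^sup>2) = 1" "(b_crit N \<beta>)\<^sup>2 \<le> \<beta>\<^sup>2"
    using q0 q b0 by auto
qed

text \<open>\<open>q * v\<close> is the limiting variance of the inner product of a spin with its
  field, and \<open>\<kappa>\<close> the restoring slope of the dynamics. At the root
  \<open>f b = b / \<beta>\<close> turns the bracket in \<open>B_const\<close> into
  \<open>v\<close>, while \<open>1 - \<beta> * f' b = 2 * \<kappa>\<close>. In this form the
  constants appear in the exchangeable pair.\<close>

lemma B_const_properties:
  assumes N: "2 \<le> N" and \<beta>: "real N < \<beta>"
  defines "q \<equiv> (b_crit N \<beta>)\<^sup>2"
  defines "v \<equiv> 1 - (real N - 1) / \<beta> - q / \<beta>\<^sup>2" and "\<kappa> \<equiv> - \<beta> * q * logd' N q"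
  shows "0 < v" "0 < \<kappa>" "0 < B_const N \<beta>" "(B_const N \<beta>)\<^sup>2 = 2 * \<beta>\<^sup>2 * v / (\<kappa> * q)"
    "second_moment N q - (q / \<beta>)\<^sup>2 = q * v"
proof -
  have b0: "0 < \<beta>" using N \<beta> by simp
  note b = b_crit_properties[OF N \<beta>]
  have q0: "0 < q" unfolding q_def using b by simp
  have l: "logd N q = 1 / \<beta>" using b(2) b0 unfolding q_def by (simp add: field_simps)
  show "0 < \<kappa>" unfolding \<kappa>_def using b0 q0 logd'_neg[OF N, of q] by (simp add: mult_pos_neg)
  show qv: "second_moment N q - (q / \<beta>)\<^sup>2 = q * v"
    unfolding second_moment_eq[OF N less_imp_le[OF q0]] l v_def using b0 by (simp add: power2_eq_square field_simps)
  have "0 < q * v" using second_moment_gt[OF N q0] unfolding qv[symmetric] l by simp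
  thus v: "0 < v" using q0 by (simp add: zero_less_mult_iff)
  have f: "bessel_ratio N (b_crit N \<beta>) = b_crit N \<beta> / \<beta>"
    unfolding bessel_ratio_eq[OF N b(1)] using l unfolding q_def by simp
  have d: "deriv (bessel_ratio N) (b_crit N \<beta>) = 1 / \<beta> + 2 * q * logd' N q"
    using DERIV_imp_deriv[OF bessel_ratio_has_derivative[OF N b(1)]] l unfolding q_def by simp
  have "B_const N \<beta> = sqrt (4 * \<beta>\<^sup>2 / ((1 - \<beta> * (1 / \<beta> + 2 * q * logd' N q)) * q) * v)"
    unfolding B_const_def Let_def f d v_def using b(1) by (simp add: q_def power_divide)
  also have "1 - \<beta> * (1 / \<beta> + 2 * q * logd' N q) = 2 * \<kappa>"
    unfolding \<kappa>_def using b0 by (simp add: algebra_simps)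
  also have "4 * \<beta>\<^sup>2 / (2 * \<kappa> * q) * v = 2 * \<beta>\<^sup>2 * v / (\<kappa> * q)" by simp
  finally have B: "B_const N \<beta> = sqrt (2 * \<beta>\<^sup>2 * v / (\<kappa> * q))" .
  show "0 < B_const N \<beta>" "(B_const N \<beta>)\<^sup>2 = 2 * \<beta>\<^sup>2 * v / (\<kappa> * q)"
    unfolding B using b0 v \<open>0 < \<kappa>\<close> q0 by auto
qed

section \<open>The Gibbs measure and single-spin resampling\<close>

lemma dot_commute: "dot N x y = dot N y x"
  unfolding dot_def by (simp add: mult.commute)

lemma dot_add_left: "dot N (\<lambda>k. x k + y k) z = dot N x z + dot N y z"
  unfolding dot_def by (simp add: distrib_right sum.distrib)

lemma dot_mult_left: "dot N (\<lambda>k. c * x k) z = c * dot N x z"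
  unfolding dot_def by (simp add: sum_distrib_left mult.assoc)

lemma dot_diff_left: "dot N (\<lambda>k. x k - y k) z = dot N x z - dot N y z"
  unfolding dot_def by (simp add: left_diff_distrib sum_subtractf)

lemma dot_sum_left: "dot N (\<lambda>k. \<Sum>j\<in>A. x j k) z = (\<Sum>j\<in>A. dot N (x j) z)"
  unfolding dot_def by (simp add: sum_distrib_right sum.swap[of _ _ A])

lemma dot_add_right: "dot N z (\<lambda>k. x k + y k) = dot N z x + dot N z y"
  unfolding dot_def by (simp add: distrib_left sum.distrib)

lemma dot_mult_right: "dot N z (\<lambda>k. c * x k) = c * dot N z x"
  unfolding dot_def by (simp add: sum_distrib_left mult_ac)

lemma dot_sum_right: "dot N z (\<lambda>k. \<Sum>j\<in>A. x j k) = (\<Sum>j\<in>A. dot N z (x j))"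
  unfolding dot_def by (simp add: sum_distrib_left sum.swap[of _ _ A])

text \<open>\<open>n\<close> is a parameter of the locale, so bounds proved inside must display
  their constants for uniformity in \<open>n\<close> to be visible outside.\<close>

locale vector_model =
  fixes N n :: nat and \<beta> :: real
  assumes N: "2 \<le> N" and n: "1 \<le> n" and \<beta>: "0 < \<beta>"
begin

abbreviation "\<mu> \<equiv> sphere_measure N"
abbreviation "\<Omega> \<equiv> config_measure N n"
abbreviation "I \<equiv> {1..n}"

definition field :: "(nat \<Rightarrow> nat \<Rightarrow> real) \<Rightarrow> nat \<Rightarrow> real" where
  "field \<sigma> = (\<lambda>k. \<beta> / real n * (\<Sum>j\<in>I. \<sigma> j k))"

text \<open>The field exerted on spin \<open>i\<close> by the other spins. It is unaffected by
  resampling spin \<open>i\<close>, so functions of it are constants for the conditional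
  law.\<close>

definition cavity :: "nat \<Rightarrow> (nat \<Rightarrow> nat \<Rightarrow> real) \<Rightarrow> nat \<Rightarrow> real" where
  "cavity i \<sigma> = (\<lambda>k. \<beta> / real n * (\<Sum>j\<in>I - {i}. \<sigma> j k))"

definition Q :: "(nat \<Rightarrow> nat \<Rightarrow> real) \<Rightarrow> real" where
  "Q \<sigma> = dot N (field \<sigma>) (field \<sigma>)"

definition Qc :: "nat \<Rightarrow> (nat \<Rightarrow> nat \<Rightarrow> real) \<Rightarrow> real" where
  "Qc i \<sigma> = dot N (cavity i \<sigma>) (cavity i \<sigma>)"

definition t :: "nat \<Rightarrow> (nat \<Rightarrow> nat \<Rightarrow> real) \<Rightarrow> real" where
  "t i \<sigma> = dot N (cavity i \<sigma>) (\<sigma> i)"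

definition weight :: "(nat \<Rightarrow> nat \<Rightarrow> real) \<Rightarrow> real" where
  "weight \<sigma> = exp (real n / (2 * \<beta>) * Q \<sigma>)"

text \<open>The density, with respect to \<open>\<mu>\<close>, of the conditional law of spin
  \<open>i\<close> given the others: the self-interaction of a unit spin is constant and drops out,
  and \<open>sph N (Qc i \<sigma>)\<close> normalises.\<close>

definition kernel :: "nat \<Rightarrow> (nat \<Rightarrow> nat \<Rightarrow> real) \<Rightarrow> (nat \<Rightarrow> real) \<Rightarrow> real" where
  "kernel i \<sigma> s = exp (dot N (cavity i \<sigma>) s) / sph N (Qc i \<sigma>)"

definition ex :: "((nat \<Rightarrow> nat \<Rightarrow> real) \<Rightarrow> real) \<Rightarrow> real" where
  "ex g = (\<integral>\<sigma>. g \<sigma> \<partial>gibbs N \<beta> n)"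

section \<open>Relations between \<open>Q\<close> and the cavity fields\<close>

lemma n0: "0 < real n" using n by simp

lemma N0: "0 < N" using N by simp

sublocale \<mu>: prob_space \<mu> by (rule prob_space_sphere_measure[OF N0])

sublocale \<Omega>: prob_space \<Omega>
  unfolding config_measure_def by (rule prob_space_PiM) (rule \<mu>.prob_space_axioms)

sublocale \<Omega>\<mu>: pair_prob_space \<Omega> \<mu> ..

lemma space_\<Omega>: "space \<Omega> = Pi\<^sub>E I (\<lambda>_. unit_sphere N)"
  unfolding config_measure_def by (simp add: space_PiM space_sphere_measure)

lemma spin_mem: "\<sigma> \<in> space \<Omega> \<Longrightarrow> i \<in> I \<Longrightarrow> \<sigma> i \<in> space \<mu>"
  unfolding space_\<Omega> space_sphere_measure by auto

lemma nrm_spin: "s \<in> space \<mu> \<Longrightarrow> nrm N s = 1"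
  unfolding space_sphere_measure unit_sphere_def by simp

lemma dot_spin: "s \<in> space \<mu> \<Longrightarrow> dot N s s = 1"
  by (simp add: dot_self nrm_spin)

lemma update_mem: "\<sigma> \<in> space \<Omega> \<Longrightarrow> i \<in> I \<Longrightarrow> s \<in> space \<mu> \<Longrightarrow> \<sigma>(i := s) \<in> space \<Omega>"
  unfolding space_\<Omega> space_sphere_measure by (auto simp: PiE_def extensional_def)

lemma cavity_update: "cavity i (\<sigma>(i := s)) = cavity i \<sigma>"
  unfolding cavity_def by auto

lemma Qc_update: "Qc i (\<sigma>(i := s)) = Qc i \<sigma>"
  unfolding Qc_def cavity_update ..

lemma t_update: "t i (\<sigma>(i := s)) = dot N (cavity i \<sigma>) s"
  unfolding t_def cavity_update by simp

lemma kernel_update: "kernel i (\<sigma>(i := s)) = kernel i \<sigma>"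
  unfolding kernel_def Qc_update cavity_update ..

lemma field_eq: "i \<in> I \<Longrightarrow> field \<sigma> = (\<lambda>k. cavity i \<sigma> k + \<beta> / real n * \<sigma> i k)"
  unfolding field_def cavity_def distrib_left[symmetric] by (rule ext) (subst sum.remove[of I i], auto)

text \<open>Spin \<open>i\<close> has unit length, so its quadratic contribution is the constant
  \<open>(\<beta> / n)^2\<close>, and \<open>Q\<close> depends on spin \<open>i\<close> linearly,
  through \<open>t i\<close>.\<close>

lemma Q_cavity:
  assumes "\<sigma> \<in> space \<Omega>" "i \<in> I"
  shows "Q \<sigma> = Qc i \<sigma> + 2 * \<beta> / real n * t i \<sigma> + (\<beta> / real n)\<^sup>2"
  unfolding Q_def field_eq[OF assms(2)] Qc_def t_def
  using dot_spin[OF spin_mem[OF assms]]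
  by (simp only: dot_add_left dot_mult_left dot_add_right dot_mult_right dot_commute[of N "\<sigma> i" "cavity i \<sigma>"])
     (simp add: power2_eq_square algebra_simps)

lemma field_dot: "\<sigma> \<in> space \<Omega> \<Longrightarrow> i \<in> I \<Longrightarrow> dot N (field \<sigma>) (\<sigma> i) = t i \<sigma> + \<beta> / real n"
  unfolding field_eq t_def by (simp only: dot_add_left dot_mult_left dot_spin[OF spin_mem] mult_1_right)

text \<open>The alignments of the spins with their cavity fields add up to a function of
  \<open>Q\<close>. This closes the drift of \<open>Q\<close> and, through the term
  \<open>- \<beta>\<close>, supplies the outward push at \<open>Q = 0\<close>.\<close>

lemma sum_t:
  assumes "\<sigma> \<in> space \<Omega>"
  shows "(\<Sum>i\<in>I. t i \<sigma>) = real n / \<beta> * Q \<sigma> - \<beta>"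
proof -
  have "Q \<sigma> = \<beta> / real n * (\<Sum>i\<in>I. dot N (\<sigma> i) (field \<sigma>))"
    unfolding Q_def by (subst (1) field_def) (simp only: dot_mult_left dot_sum_left)
  also have "(\<Sum>i\<in>I. dot N (\<sigma> i) (field \<sigma>)) = (\<Sum>i\<in>I. t i \<sigma> + \<beta> / real n)"
    by (rule sum.cong) (auto simp: dot_commute[of N _ "field \<sigma>"] field_dot[OF assms])
  also have "\<dots> = (\<Sum>i\<in>I. t i \<sigma>) + \<beta>" using n0 by (simp add: sum.distrib)
  finally show ?thesis using n0 \<beta> by (simp add: field_simps)
qed

lemma Qc_nonneg: "0 \<le> Qc i \<sigma>" and Q_nonneg: "0 \<le> Q \<sigma>"
  unfolding Qc_def Q_def dot_self by auto

lemma abs_dot_spins: "s \<in> space \<mu> \<Longrightarrow> s' \<in> space \<mu> \<Longrightarrow> \<bar>dot N s s'\<bar> \<le> 1"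
  using abs_dot_le[of N s s'] nrm_spin by simp

lemma dot_sum_bound:
  assumes "\<sigma> \<in> space \<Omega>" "A \<subseteq> I"
  shows "dot N (\<lambda>k. \<beta> / real n * (\<Sum>j\<in>A. \<sigma> j k)) (\<lambda>k. \<beta> / real n * (\<Sum>j\<in>A. \<sigma> j k)) \<le> \<beta>\<^sup>2"
proof -
  have fA: "finite A" using assms(2) finite_subset by blast
  let ?X = "\<lambda>k. \<Sum>j\<in>A. \<sigma> j k"
  have "dot N ?X ?X = (\<Sum>i\<in>A. \<Sum>j\<in>A. dot N (\<sigma> j) (\<sigma> i))"
    by (simp only: dot_sum_left dot_sum_right) (rule sum.swap)
  also have "\<dots> \<le> (\<Sum>i\<in>A. \<Sum>j\<in>A. 1)"
  proof (intro sum_mono)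
    fix i j assume "i \<in> A" "j \<in> A"
    hence "\<sigma> i \<in> space \<mu>" "\<sigma> j \<in> space \<mu>" using assms spin_mem by auto
    from abs_dot_spins[OF this] show "dot N (\<sigma> j) (\<sigma> i) \<le> 1" by (simp add: dot_commute)
  qed
  also have "\<dots> = real (card A) * real (card A)" by simp
  also have "\<dots> \<le> real n * real n"
    using card_mono[OF _ assms(2)] by (intro mult_mono) auto
  finally have "(\<beta> / real n)\<^sup>2 * dot N ?X ?X \<le> (\<beta> / real n)\<^sup>2 * (real n * real n)"
    by (rule mult_left_mono) simp
  also have "\<dots> = \<beta>\<^sup>2" using n0 by (simp add: power2_eq_square)
  finally show ?thesis
    by (simp only: dot_mult_left dot_mult_right power2_eq_square mult.assoc)
qed

lemma Qc_le: "\<sigma> \<in> space \<Omega> \<Longrightarrow> Qc i \<sigma> \<le> \<beta>\<^sup>2"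
  unfolding Qc_def cavity_def by (rule dot_sum_bound) auto

lemma Q_le: "\<sigma> \<in> space \<Omega> \<Longrightarrow> Q \<sigma> \<le> \<beta>\<^sup>2"
  unfolding Q_def field_def by (rule dot_sum_bound) auto

lemma dot_cavity_sq:
  assumes "s \<in> space \<mu>"
  shows "(dot N (cavity i \<sigma>) s)\<^sup>2 \<le> Qc i \<sigma>"
proof -
  have "\<bar>dot N (cavity i \<sigma>) s\<bar> \<le> nrm N (cavity i \<sigma>)"
    using abs_dot_le[of N "cavity i \<sigma>" s] nrm_spin[OF assms] by simp
  from power_mono[OF this, of 2] show ?thesis unfolding Qc_def dot_self by simp
qed

lemma dot_cavity_le:
  assumes "\<sigma> \<in> space \<Omega>" "s \<in> space \<mu>"
  shows "\<bar>dot N (cavity i \<sigma>) s\<bar> \<le> \<beta>"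
proof -
  have "(dot N (cavity i \<sigma>) s)\<^sup>2 \<le> \<beta>\<^sup>2" using dot_cavity_sq[OF assms(2)] Qc_le[OF assms(1)] by (rule order_trans)
  thus ?thesis using \<beta> by (simp add: abs_le_square_iff[symmetric])
qed

lemma t_le: "\<sigma> \<in> space \<Omega> \<Longrightarrow> i \<in> I \<Longrightarrow> \<bar>t i \<sigma>\<bar> \<le> \<beta>"
  unfolding t_def by (intro dot_cavity_le spin_mem)

lemma Q_Qc:
  assumes "\<sigma> \<in> space \<Omega>" "i \<in> I"
  shows "\<bar>Qc i \<sigma> - Q \<sigma>\<bar> \<le> 3 * \<beta>\<^sup>2 / real n"
proof -
  have "\<bar>Qc i \<sigma> - Q \<sigma>\<bar> = \<bar>2 * \<beta> / real n * t i \<sigma> + (\<beta> / real n)\<^sup>2\<bar>"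
    unfolding Q_cavity[OF assms] by simp
  also have "\<dots> \<le> 2 * \<beta> / real n * \<bar>t i \<sigma>\<bar> + (\<beta> / real n)\<^sup>2"
    using \<beta> n0 by (intro order_trans[OF abs_triangle_ineq]) (simp add: abs_mult)
  also have "\<dots> \<le> 2 * \<beta> / real n * \<beta> + \<beta>\<^sup>2 / real n"
  proof (intro add_mono mult_left_mono)
    have "1 * real n \<le> real n * real n" using n by (intro mult_right_mono) auto
    thus "(\<beta> / real n)\<^sup>2 \<le> \<beta>\<^sup>2 / real n"
      using n0 \<beta> unfolding power_divide by (intro divide_left_mono) (auto simp: power2_eq_square)
  qed (use t_le[OF assms] \<beta> n0 in auto)
  finally show ?thesis by (simp add: power2_eq_square)
qed

section \<open>Measurability and integrals of the conditional density\<close>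

lemma measurable_spin: "j \<in> I \<Longrightarrow> (\<lambda>\<sigma>. \<sigma> j) \<in> \<Omega> \<rightarrow>\<^sub>M \<mu>"
  unfolding config_measure_def by (rule measurable_component_singleton)

lemma measurable_coord_\<mu>: "k < N \<Longrightarrow> (\<lambda>s. s k) \<in> borel_measurable \<mu>"
  by (rule measurable_sphere_measure, rule measurable_component_singleton) auto

lemma measurable_coord: "j \<in> I \<Longrightarrow> k < N \<Longrightarrow> (\<lambda>\<sigma>. \<sigma> j k) \<in> borel_measurable \<Omega>"
  by (rule measurable_compose[OF measurable_spin measurable_coord_\<mu>])

lemma measurable_field: "k < N \<Longrightarrow> (\<lambda>\<sigma>. field \<sigma> k) \<in> borel_measurable \<Omega>"
  unfolding field_def by (intro borel_measurable_times borel_measurable_const borel_measurable_sum measurable_coord)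

lemma measurable_cavity: "k < N \<Longrightarrow> (\<lambda>\<sigma>. cavity i \<sigma> k) \<in> borel_measurable \<Omega>"
  unfolding cavity_def by (intro borel_measurable_times borel_measurable_const borel_measurable_sum measurable_coord) auto

lemma measurable_Q [measurable]: "Q \<in> borel_measurable \<Omega>"
  unfolding Q_def dot_def by (intro borel_measurable_times borel_measurable_sum measurable_field) auto

lemma measurable_Qc [measurable]: "Qc i \<in> borel_measurable \<Omega>"
  unfolding Qc_def dot_def by (intro borel_measurable_times borel_measurable_sum measurable_cavity) auto

lemma measurable_t [measurable]: "i \<in> I \<Longrightarrow> t i \<in> borel_measurable \<Omega>"
  unfolding t_def dot_def by (intro borel_measurable_times borel_measurable_sum measurable_cavity measurable_coord) auto

lemma measurable_weight [measurable]: "weight \<in> borel_measurable \<Omega>"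
  unfolding weight_def by measurable

lemma measurable_dot_cavity [measurable]:
  "(\<lambda>x. dot N (cavity i (fst x)) (snd x)) \<in> borel_measurable (\<Omega> \<Otimes>\<^sub>M \<mu>)"
  unfolding dot_def
  by (intro borel_measurable_times borel_measurable_sum measurable_compose[OF measurable_fst measurable_cavity]
      measurable_compose[OF measurable_snd measurable_coord_\<mu>]) auto

text \<open>\<open>logd\<close> is a quotient whose denominator is controlled on the nonnegative
  axis only; composing with \<open>max 0\<close> extends it continuously to the line.\<close>

lemma measurable_compose_continuous:
  fixes f :: "real \<Rightarrow> real"
  assumes "continuous_on {0..} f" "g \<in> borel_measurable M" "\<And>x. x \<in> space M \<Longrightarrow> 0 \<le> g x"
  shows "(\<lambda>x. f (g x)) \<in> borel_measurable M"
proof -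
  have "continuous_on UNIV (\<lambda>x. f (max 0 x))"
    by (rule continuous_on_compose2[OF assms(1)]) (auto intro!: continuous_intros)
  from measurable_compose[OF assms(2) borel_measurable_continuous_onI[OF this]]
  have "(\<lambda>x. f (max 0 (g x))) \<in> borel_measurable M" .
  thus ?thesis by (rule measurable_cong[THEN iffD1, rotated]) (use assms(3) in auto)
qed

lemma continuous_sph: "continuous_on {0..} (sph N)"
  by (rule DERIV_continuous_on) (use sph_has_derivative[OF N] in \<open>auto intro: has_field_derivative_at_within\<close>)

lemma continuous_logd: "continuous_on {0..} (logd N)"
  by (rule DERIV_continuous_on) (use logd_has_derivative[OF N] in \<open>auto intro: has_field_derivative_at_within\<close>)

lemma measurable_kernel: "(\<lambda>x. kernel i (fst x) (snd x)) \<in> borel_measurable (\<Omega> \<Otimes>\<^sub>M \<mu>)"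
proof -
  have "(\<lambda>\<sigma>. sph N (Qc i \<sigma>)) \<in> borel_measurable \<Omega>"
    by (rule measurable_compose_continuous[OF continuous_sph]) (auto simp: Qc_nonneg)
  from measurable_compose[OF measurable_fst this]
  have "(\<lambda>x. sph N (Qc i (fst x))) \<in> borel_measurable (\<Omega> \<Otimes>\<^sub>M \<mu>)" .
  thus ?thesis unfolding kernel_def by measurable
qed

lemma kernel_pos: "0 < kernel i \<sigma> s"
  unfolding kernel_def using sph_ge_1[OF N Qc_nonneg, of i \<sigma>] by simp

lemma kernel_le:
  assumes "\<sigma> \<in> space \<Omega>" "s \<in> space \<mu>"
  shows "kernel i \<sigma> s \<le> exp \<beta>"
proof -
  have "kernel i \<sigma> s \<le> exp \<beta> / 1"
    unfolding kernel_def using sph_ge_1[OF N Qc_nonneg, of i \<sigma>] dot_cavity_le[OF assms, of i]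
    by (intro frac_le) auto
  thus ?thesis by simp
qed

lemma kernel_integrals:
  shows "(\<integral>s. kernel i \<sigma> s \<partial>\<mu>) = 1"
    and "(\<integral>s. dot N (cavity i \<sigma>) s * kernel i \<sigma> s \<partial>\<mu>) = Qc i \<sigma> * logd N (Qc i \<sigma>)"
    and "(\<integral>s. (dot N (cavity i \<sigma>) s)\<^sup>2 * kernel i \<sigma> s \<partial>\<mu>) = second_moment N (Qc i \<sigma>)"
  using sphere_exp_moments[OF N, of "cavity i \<sigma>"] sph_ge_1[OF N Qc_nonneg, of i \<sigma>]
  unfolding kernel_def times_divide_eq_right Qc_def[symmetric] logd_def second_moment_def
  by auto

section \<open>Exchange of an old and a new spin\<close>

lemma measurable_update: "i \<in> I \<Longrightarrow> (\<lambda>x. (fst x)(i := snd x)) \<in> \<Omega> \<Otimes>\<^sub>M \<mu> \<rightarrow>\<^sub>M \<Omega>"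
  unfolding config_measure_def
  by (rule measurable_fun_upd[where J=I]) (auto simp: insert_absorb)

lemma measurable_swap: "i \<in> I \<Longrightarrow> (\<lambda>x. ((fst x)(i := snd x), fst x i)) \<in> \<Omega> \<Otimes>\<^sub>M \<mu> \<rightarrow>\<^sub>M \<Omega> \<Otimes>\<^sub>M \<mu>"
  by (intro measurable_Pair measurable_update measurable_compose[OF measurable_fst measurable_spin])

text \<open>The resampled spin is treated as a spin with index 0; exchanging it with spin \<open>i\<close> permutes
  the coordinates of a product measure.\<close>

lemma integral_swap:
  fixes F :: "_ \<Rightarrow> real"
  assumes i: "i \<in> I" and F: "F \<in> borel_measurable (\<Omega> \<Otimes>\<^sub>M \<mu>)"
  shows "(\<integral>x. F ((fst x)(i := snd x), fst x i) \<partial>(\<Omega> \<Otimes>\<^sub>M \<mu>)) = (\<integral>x. F x \<partial>(\<Omega> \<Otimes>\<^sub>M \<mu>))"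
proof -
  let ?P = "\<Pi>\<^sub>M i\<in>insert 0 I. \<mu>"
  define pr where "pr = (\<lambda>\<omega>::nat \<Rightarrow> nat \<Rightarrow> real. (restrict \<omega> I, \<omega> 0))"
  have pr: "pr \<in> ?P \<rightarrow>\<^sub>M \<Omega> \<Otimes>\<^sub>M \<mu>"
    unfolding pr_def config_measure_def
    by (intro measurable_Pair measurable_restrict_subset measurable_component_singleton) auto
  have dP: "distr (\<mu> \<Otimes>\<^sub>M \<Omega>) ?P (\<lambda>(x, X). X(0 := x)) = ?P"
    unfolding config_measure_def by (rule distr_pair_PiM_eq_PiM) (auto intro: \<mu>.prob_space_axioms)
  have up: "(\<lambda>(x, X). X(0 := x)) \<in> \<mu> \<Otimes>\<^sub>M \<Omega> \<rightarrow>\<^sub>M ?P"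
    unfolding config_measure_def case_prod_beta
    by (rule measurable_fun_upd[where J=I]) auto
  \<comment> \<open>Integrals over configuration and new spin lift to the enlarged product and
    descend again, so that only the permutation of coordinates is left to be handled there.\<close>
  have base: "(\<integral>\<omega>. G (pr \<omega>) \<partial>?P) = (\<integral>x. G x \<partial>(\<Omega> \<Otimes>\<^sub>M \<mu>))" if G: "G \<in> borel_measurable (\<Omega> \<Otimes>\<^sub>M \<mu>)" for G :: "_ \<Rightarrow> real"
  proof -
    have Gp: "(\<lambda>\<omega>. G (pr \<omega>)) \<in> borel_measurable ?P" by (rule measurable_compose[OF pr G])
    have "(\<integral>\<omega>. G (pr \<omega>) \<partial>?P) = (\<integral>\<omega>. G (pr \<omega>) \<partial>distr (\<mu> \<Otimes>\<^sub>M \<Omega>) ?P (\<lambda>(x, X). X(0 := x)))"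
      unfolding dP ..
    also have "\<dots> = (\<integral>z. G (pr ((\<lambda>(x, X). X(0 := x)) z)) \<partial>(\<mu> \<Otimes>\<^sub>M \<Omega>))"
      by (rule integral_distr[OF up Gp])
    also have "\<dots> = (\<integral>z. G (snd z, fst z) \<partial>(\<mu> \<Otimes>\<^sub>M \<Omega>))"
    proof (rule Bochner_Integration.integral_cong[OF refl])
      fix z assume "z \<in> space (\<mu> \<Otimes>\<^sub>M \<Omega>)"
      then obtain s \<sigma> where z: "z = (s, \<sigma>)" "\<sigma> \<in> space \<Omega>" by (auto simp: space_pair_measure)
      have "\<sigma> \<in> extensional I" using z(2) unfolding space_\<Omega> by (auto simp: PiE_def)
      hence "restrict (\<sigma>(0 := s)) I = \<sigma>" by (auto simp: restrict_def extensional_def)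
      thus "G (pr ((\<lambda>(x, X). X(0 := x)) z)) = G (snd z, fst z)" unfolding z(1) pr_def by simp
    qed
    also have "\<dots> = (\<integral>x. G x \<partial>(\<Omega> \<Otimes>\<^sub>M \<mu>))"
    proof -
      have "\<Omega> \<Otimes>\<^sub>M \<mu> = distr (\<mu> \<Otimes>\<^sub>M \<Omega>) (\<Omega> \<Otimes>\<^sub>M \<mu>) (\<lambda>(x, y). (y, x))"
        by (rule \<Omega>\<mu>.distr_pair_swap)
      hence "(\<integral>x. G x \<partial>(\<Omega> \<Otimes>\<^sub>M \<mu>)) = (\<integral>x. G x \<partial>distr (\<mu> \<Otimes>\<^sub>M \<Omega>) (\<Omega> \<Otimes>\<^sub>M \<mu>) (\<lambda>(x, y). (y, x)))" by simp
      also have "\<dots> = (\<integral>z. G (snd z, fst z) \<partial>(\<mu> \<Otimes>\<^sub>M \<Omega>))"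
        by (subst integral_distr[OF measurable_pair_swap' G]) (simp add: case_prod_beta)
      finally show ?thesis ..
    qed
    finally show ?thesis .
  qed
  \<comment> \<open>The transposition of 0 and \<open>i\<close>; index 0 is free because spins are
    numbered from 1.\<close>
  define \<pi> where "\<pi> = (\<lambda>k::nat. if k = 0 then i else if k = i then 0 else k)"
  have \<pi>: "inj_on \<pi> (insert 0 I)" "\<pi> \<in> insert 0 I \<rightarrow> insert 0 I"
    unfolding \<pi>_def using i by (auto simp: inj_on_def)
  have perm: "distr ?P ?P (\<lambda>\<omega>. \<lambda>k\<in>insert 0 I. \<omega> (\<pi> k)) = ?P"
    using distr_PiM_reindex[OF _ \<pi>, of "\<lambda>_. \<mu>"] \<mu>.prob_space_axioms by simp
  have pm: "(\<lambda>\<omega>. \<lambda>k\<in>insert 0 I. \<omega> (\<pi> k)) \<in> ?P \<rightarrow>\<^sub>M ?P"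
    by (intro measurable_restrict measurable_component_singleton) (rule funcset_mem[OF \<pi>(2)])
  have Fs: "(\<lambda>x. F ((fst x)(i := snd x), fst x i)) \<in> borel_measurable (\<Omega> \<Otimes>\<^sub>M \<mu>)"
    by (rule measurable_compose[OF measurable_swap[OF i] F])
  have "(\<integral>x. F x \<partial>(\<Omega> \<Otimes>\<^sub>M \<mu>)) = (\<integral>\<omega>. F (pr \<omega>) \<partial>distr ?P ?P (\<lambda>\<omega>. \<lambda>k\<in>insert 0 I. \<omega> (\<pi> k)))"
    unfolding perm base[OF F] ..
  also have "\<dots> = (\<integral>\<omega>. F (pr (\<lambda>k\<in>insert 0 I. \<omega> (\<pi> k))) \<partial>?P)"
    by (rule integral_distr[OF pm measurable_compose[OF pr F]])
  also have "\<dots> = (\<integral>\<omega>. F ((fst (pr \<omega>))(i := snd (pr \<omega>)), fst (pr \<omega>) i) \<partial>?P)"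
  proof (rule Bochner_Integration.integral_cong[OF refl])
    fix \<omega> :: "nat \<Rightarrow> nat \<Rightarrow> real"
    have "restrict (\<lambda>k\<in>insert 0 I. \<omega> (\<pi> k)) I = (restrict \<omega> I)(i := \<omega> 0)"
      using i unfolding \<pi>_def by (auto simp: restrict_def fun_eq_iff)
    moreover have "(\<lambda>k\<in>insert 0 I. \<omega> (\<pi> k)) 0 = \<omega> i" unfolding \<pi>_def by simp
    ultimately show "F (pr (\<lambda>k\<in>insert 0 I. \<omega> (\<pi> k))) = F ((fst (pr \<omega>))(i := snd (pr \<omega>)), fst (pr \<omega>) i)"
      unfolding pr_def using i by simp
  qed
  also have "\<dots> = (\<integral>x. F ((fst x)(i := snd x), fst x i) \<partial>(\<Omega> \<Otimes>\<^sub>M \<mu>))"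
    by (rule base[OF Fs])
  finally show ?thesis ..
qed

text \<open>The weight is a function of the cavity field times \<open>exp (t i \<sigma>)\<close>,
  the kernel another one times \<open>exp (dot N (cavity i \<sigma>) s)\<close>. The product is
  symmetric in the old and the new spin.\<close>

lemma weight_kernel_swap:
  assumes \<sigma>: "\<sigma> \<in> space \<Omega>" and i: "i \<in> I" and s: "s \<in> space \<mu>"
  shows "weight (\<sigma>(i := s)) * kernel i (\<sigma>(i := s)) (\<sigma> i) = weight \<sigma> * kernel i \<sigma> s"
proof -
  have w: "weight \<tau> = exp (real n / (2 * \<beta>) * (Qc i \<tau> + (\<beta> / real n)\<^sup>2)) * exp (t i \<tau>)" if "\<tau> \<in> space \<Omega>" for \<tau>
    unfolding weight_def Q_cavity[OF that i] exp_add[symmetric] using n0 \<beta> by (simp add: field_simps)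
  show ?thesis
    unfolding w[OF \<sigma>] w[OF update_mem[OF \<sigma> i s]] Qc_update t_update kernel_update
    by (simp add: kernel_def t_def)
qed

section \<open>The Gibbs measure as a weighted product measure\<close>

lemma weight_eq: "weight \<sigma> = exp (- \<beta> * hamiltonian N n \<sigma>)"
proof -
  let ?X = "\<lambda>k. \<Sum>j\<in>I. \<sigma> j k"
  have "(\<Sum>i\<in>I. \<Sum>j\<in>I. dot N (\<sigma> i) (\<sigma> j)) = dot N ?X ?X"
    by (simp only: dot_sum_left dot_sum_right)
  moreover have "Q \<sigma> = (\<beta> / real n)\<^sup>2 * dot N ?X ?X"
    unfolding Q_def field_def
    by (simp only: dot_mult_left dot_mult_right power2_eq_square mult.assoc)
  ultimately show ?thesis
    unfolding weight_def hamiltonian_def using n0 \<beta> by (simp add: power2_eq_square field_simps)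
qed

lemma Q_eq: "Q \<sigma> = \<beta>\<^sup>2 / (real n)\<^sup>2 * (nrm N (total_spin n \<sigma>))\<^sup>2"
proof -
  let ?X = "\<lambda>k. \<Sum>j\<in>I. \<sigma> j k"
  have "Q \<sigma> = (\<beta> / real n)\<^sup>2 * dot N ?X ?X"
    unfolding Q_def field_def
    by (simp only: dot_mult_left dot_mult_right power2_eq_square mult.assoc)
  thus ?thesis unfolding dot_self total_spin_def by (simp add: power_divide)
qed

lemma weight_ge: "1 \<le> weight \<sigma>"
  unfolding weight_def using Q_nonneg[of \<sigma>] n0 \<beta> by simp

lemma weight_le: "\<sigma> \<in> space \<Omega> \<Longrightarrow> weight \<sigma> \<le> exp (real n / (2 * \<beta>) * \<beta>\<^sup>2)"
  unfolding weight_def using Q_le[of \<sigma>] n0 \<beta> by (simp add: divide_right_mono)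

definition "Zn = (\<integral>\<sigma>. weight \<sigma> \<partial>\<Omega>)"

lemma Zn_eq: "Zn = partition_fn N \<beta> n"
  unfolding Zn_def partition_fn_def weight_eq ..

lemma weight_nonneg: "0 \<le> weight \<sigma>"
  using weight_ge[of \<sigma>] by linarith

lemma integrable_weight: "integrable \<Omega> weight"
  by (rule \<Omega>.integrable_const_bound[where B="exp (real n / (2 * \<beta>) * \<beta>\<^sup>2)"])
     (use weight_le weight_ge in \<open>auto intro!: AE_I2 simp: abs_of_nonneg order_trans[OF zero_le_one]\<close>)

lemma Zn_pos: "0 < Zn"
proof -
  have "1 = (\<integral>\<sigma>. (1::real) \<partial>\<Omega>)" using \<Omega>.prob_space by simp
  also have "\<dots> \<le> Zn" unfolding Zn_def
    by (rule integral_mono) (use integrable_weight weight_ge in auto)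
  finally show ?thesis by simp
qed

lemma gibbs_eq: "gibbs N \<beta> n = density \<Omega> (\<lambda>\<sigma>. ennreal (weight \<sigma> / Zn))"
  unfolding gibbs_def weight_eq Zn_eq by simp

lemma space_gibbs: "space (gibbs N \<beta> n) = space \<Omega>" and sets_gibbs: "sets (gibbs N \<beta> n) = sets \<Omega>"
  unfolding gibbs_eq by auto

lemma measurable_gibbs: "f \<in> \<Omega> \<rightarrow>\<^sub>M K \<Longrightarrow> f \<in> gibbs N \<beta> n \<rightarrow>\<^sub>M K"
  using measurable_cong_sets[OF sets_gibbs refl] by blast

sublocale G: prob_space "gibbs N \<beta> n"
proof
  have "emeasure (gibbs N \<beta> n) (space (gibbs N \<beta> n)) = (\<integral>\<^sup>+\<sigma>. ennreal (weight \<sigma> / Zn) * indicator (space \<Omega>) \<sigma> \<partial>\<Omega>)"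
    unfolding gibbs_eq by (subst emeasure_density) auto
  also have "\<dots> = (\<integral>\<^sup>+\<sigma>. ennreal (weight \<sigma> / Zn) \<partial>\<Omega>)"
    by (rule nn_integral_cong) auto
  also have "\<dots> = ennreal (\<integral>\<sigma>. weight \<sigma> / Zn \<partial>\<Omega>)"
    by (rule nn_integral_eq_integral) (use integrable_weight weight_nonneg Zn_pos in \<open>auto intro!: AE_I2 divide_nonneg_pos\<close>)
  also have "(\<integral>\<sigma>. weight \<sigma> / Zn \<partial>\<Omega>) = 1" using Zn_pos by (simp add: Zn_def[symmetric])
  finally show "emeasure (gibbs N \<beta> n) (space (gibbs N \<beta> n)) = 1" by simp
qed

lemma ex_eq:
  assumes "g \<in> borel_measurable \<Omega>"
  shows "ex g = (\<integral>\<sigma>. weight \<sigma> * g \<sigma> \<partial>\<Omega>) / Zn"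
proof -
  have "ex g = (\<integral>\<sigma>. weight \<sigma> / Zn * g \<sigma> \<partial>\<Omega>)"
    unfolding ex_def gibbs_eq
    using assms weight_nonneg Zn_pos
    by (subst integral_density) (auto intro!: AE_I2 divide_nonneg_pos)
  thus ?thesis by simp
qed

text \<open>\<open>F\<close> receives the old configuration and the new spin separately, so that
  increments, which involve both \<open>\<sigma>\<close> and \<open>\<sigma>(i := s)\<close>, can be
  averaged over the new spin.\<close>

definition resample :: "nat \<Rightarrow> ((nat \<Rightarrow> nat \<Rightarrow> real) \<Rightarrow> (nat \<Rightarrow> real) \<Rightarrow> real) \<Rightarrow> (nat \<Rightarrow> nat \<Rightarrow> real) \<Rightarrow> real" where
  "resample i F \<sigma> = (\<integral>s. F \<sigma> s * kernel i \<sigma> s \<partial>\<mu>)"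

lemma integrable_gibbs:
  fixes g :: "_ \<Rightarrow> real"
  assumes "g \<in> borel_measurable \<Omega>" "\<And>\<sigma>. \<sigma> \<in> space \<Omega> \<Longrightarrow> \<bar>g \<sigma>\<bar> \<le> C"
  shows "integrable (gibbs N \<beta> n) g"
  by (rule G.integrable_const_bound[where B=C]) (use assms measurable_gibbs in \<open>auto simp: space_gibbs\<close>)

lemma ex_mono:
  assumes "g \<in> borel_measurable \<Omega>" "\<And>\<sigma>. \<sigma> \<in> space \<Omega> \<Longrightarrow> \<bar>g \<sigma>\<bar> \<le> C"
    and "h \<in> borel_measurable \<Omega>" "\<And>\<sigma>. \<sigma> \<in> space \<Omega> \<Longrightarrow> \<bar>h \<sigma>\<bar> \<le> C'"
    and "\<And>\<sigma>. \<sigma> \<in> space \<Omega> \<Longrightarrow> g \<sigma> \<le> h \<sigma>"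
  shows "ex g \<le> ex h"
  unfolding ex_def
  by (rule integral_mono[OF integrable_gibbs[OF assms(1,2)] integrable_gibbs[OF assms(3,4)]])
     (auto simp: space_gibbs assms(5))

lemma ex_cong: "(\<And>\<sigma>. \<sigma> \<in> space \<Omega> \<Longrightarrow> g \<sigma> = h \<sigma>) \<Longrightarrow> ex g = ex h"
  unfolding ex_def by (rule Bochner_Integration.integral_cong) (auto simp: space_gibbs)

lemma ex_const [simp]: "ex (\<lambda>_. c) = c"
  unfolding ex_def using G.prob_space by simp

lemma ex_sum: "(\<And>i. i \<in> A \<Longrightarrow> integrable (gibbs N \<beta> n) (f i)) \<Longrightarrow> ex (\<lambda>\<sigma>. \<Sum>i\<in>A. f i \<sigma>) = (\<Sum>i\<in>A. ex (f i))"
  unfolding ex_def by (rule Bochner_Integration.integral_sum)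

lemma measurable_fst_comp: "g \<in> borel_measurable \<Omega> \<Longrightarrow> (\<lambda>x. g (fst x)) \<in> borel_measurable (\<Omega> \<Otimes>\<^sub>M \<mu>)"
  by (rule measurable_compose[OF measurable_fst])

lemma measurable_update_comp:
  "i \<in> I \<Longrightarrow> g \<in> borel_measurable \<Omega> \<Longrightarrow> (\<lambda>x. g ((fst x)(i := snd x))) \<in> borel_measurable (\<Omega> \<Otimes>\<^sub>M \<mu>)"
  by (rule measurable_compose[OF measurable_update])

lemma integrable_kernel:
  assumes F: "(\<lambda>x. F (fst x) (snd x)) \<in> borel_measurable (\<Omega> \<Otimes>\<^sub>M \<mu>)"
    and B: "\<And>\<sigma> s. \<sigma> \<in> space \<Omega> \<Longrightarrow> s \<in> space \<mu> \<Longrightarrow> \<bar>F \<sigma> s\<bar> \<le> C"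
    and \<sigma>: "\<sigma> \<in> space \<Omega>"
  shows "integrable \<mu> (\<lambda>s. F \<sigma> s * kernel i \<sigma> s)"
proof (rule \<mu>.integrable_const_bound[where B="C * exp \<beta>"])
  have m: "(\<lambda>s. (\<sigma>, s)) \<in> \<mu> \<rightarrow>\<^sub>M \<Omega> \<Otimes>\<^sub>M \<mu>" using \<sigma> by measurable
  show "(\<lambda>s. F \<sigma> s * kernel i \<sigma> s) \<in> borel_measurable \<mu>"
    using measurable_compose[OF m F] measurable_compose[OF m measurable_kernel[of i]]
    by (intro borel_measurable_times) auto
  show "AE s in \<mu>. norm (F \<sigma> s * kernel i \<sigma> s) \<le> C * exp \<beta>"
  proof (rule AE_I2)
    fix s assume s: "s \<in> space \<mu>"
    show "norm (F \<sigma> s * kernel i \<sigma> s) \<le> C * exp \<beta>"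
      unfolding real_norm_def abs_mult using B[OF \<sigma> s] kernel_le[OF \<sigma> s, of i] kernel_pos[of i \<sigma> s]
      by (intro mult_mono) auto
  qed
qed

lemma resample_bound:
  assumes F: "(\<lambda>x. F (fst x) (snd x)) \<in> borel_measurable (\<Omega> \<Otimes>\<^sub>M \<mu>)"
    and B: "\<And>\<sigma> s. \<sigma> \<in> space \<Omega> \<Longrightarrow> s \<in> space \<mu> \<Longrightarrow> \<bar>F \<sigma> s\<bar> \<le> C"
    and \<sigma>: "\<sigma> \<in> space \<Omega>"
  shows "\<bar>resample i F \<sigma>\<bar> \<le> C"
proof -
  have ik: "integrable \<mu> (\<lambda>s. kernel i \<sigma> s)"
    using integrable_kernel[of "\<lambda>_ _. 1" 1 \<sigma> i] \<sigma> by simp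
  have "\<bar>resample i F \<sigma>\<bar> \<le> (\<integral>s. \<bar>F \<sigma> s * kernel i \<sigma> s\<bar> \<partial>\<mu>)"
    unfolding resample_def by (rule integral_abs_bound)
  also have "\<dots> \<le> (\<integral>s. C * kernel i \<sigma> s \<partial>\<mu>)"
    by (rule integral_mono[OF integrable_abs[OF integrable_kernel[OF F B \<sigma>]]])
       (use ik B[OF \<sigma>] kernel_pos in \<open>auto simp: abs_mult abs_of_pos intro!: mult_right_mono less_imp_le\<close>)
  also have "\<dots> = C" by (simp add: kernel_integrals)
  finally show ?thesis .
qed

lemma measurable_resample:
  assumes F: "(\<lambda>x. F (fst x) (snd x)) \<in> borel_measurable (\<Omega> \<Otimes>\<^sub>M \<mu>)"
  shows "resample i F \<in> borel_measurable \<Omega>"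
proof -
  have "(\<lambda>x. F (fst x) (snd x) * kernel i (fst x) (snd x)) \<in> borel_measurable (\<Omega> \<Otimes>\<^sub>M \<mu>)"
    by (intro borel_measurable_times F measurable_kernel)
  from \<mu>.borel_measurable_lebesgue_integral[of "\<lambda>\<sigma> s. F \<sigma> s * kernel i \<sigma> s", unfolded case_prod_beta, OF this]
  show ?thesis unfolding resample_def .
qed

lemma resample_fst [simp]: "resample i (\<lambda>\<sigma> s. g \<sigma>) \<sigma> = g \<sigma>"
  unfolding resample_def by (simp add: kernel_integrals)

lemma ex_resample:
  assumes F: "(\<lambda>x. F (fst x) (snd x)) \<in> borel_measurable (\<Omega> \<Otimes>\<^sub>M \<mu>)"
    and B: "\<And>\<sigma> s. \<sigma> \<in> space \<Omega> \<Longrightarrow> s \<in> space \<mu> \<Longrightarrow> \<bar>F \<sigma> s\<bar> \<le> C"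
  shows "ex (resample i F) = (\<integral>x. weight (fst x) * kernel i (fst x) (snd x) * F (fst x) (snd x) \<partial>(\<Omega> \<Otimes>\<^sub>M \<mu>)) / Zn"
    and "integrable (\<Omega> \<Otimes>\<^sub>M \<mu>) (\<lambda>x. weight (fst x) * kernel i (fst x) (snd x) * F (fst x) (snd x))"
proof -
  let ?W = "exp (real n / (2 * \<beta>) * \<beta>\<^sup>2)"
  show int: "integrable (\<Omega> \<Otimes>\<^sub>M \<mu>) (\<lambda>x. weight (fst x) * kernel i (fst x) (snd x) * F (fst x) (snd x))"
  proof (rule \<Omega>\<mu>.P.integrable_const_bound[where B="?W * exp \<beta> * C"])
    show "(\<lambda>x. weight (fst x) * kernel i (fst x) (snd x) * F (fst x) (snd x)) \<in> borel_measurable (\<Omega> \<Otimes>\<^sub>M \<mu>)"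
      by (intro borel_measurable_times F measurable_kernel measurable_fst_comp measurable_weight)
    show "AE x in \<Omega> \<Otimes>\<^sub>M \<mu>. norm (weight (fst x) * kernel i (fst x) (snd x) * F (fst x) (snd x)) \<le> ?W * exp \<beta> * C"
    proof (rule AE_I2)
      fix x assume "x \<in> space (\<Omega> \<Otimes>\<^sub>M \<mu>)"
      hence x: "fst x \<in> space \<Omega>" "snd x \<in> space \<mu>" by (auto simp: space_pair_measure)
      show "norm (weight (fst x) * kernel i (fst x) (snd x) * F (fst x) (snd x)) \<le> ?W * exp \<beta> * C"
        unfolding real_norm_def abs_mult
        using weight_le[OF x(1)] kernel_le[OF x, of i] B[OF x] weight_nonneg[of "fst x"] less_imp_le[OF kernel_pos[of i "fst x" "snd x"]]
        by (intro mult_mono) auto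
    qed
  qed
  have "ex (resample i F) = (\<integral>\<sigma>. weight \<sigma> * resample i F \<sigma> \<partial>\<Omega>) / Zn"
    by (rule ex_eq) (rule measurable_resample[OF F])
  also have "(\<integral>\<sigma>. weight \<sigma> * resample i F \<sigma> \<partial>\<Omega>) = (\<integral>\<sigma>. (\<integral>s. weight \<sigma> * kernel i \<sigma> s * F \<sigma> s \<partial>\<mu>) \<partial>\<Omega>)"
    unfolding resample_def by (simp add: integral_mult_right_zero[symmetric] mult_ac del: integral_mult_right_zero)
  also have "\<dots> = (\<integral>x. weight (fst x) * kernel i (fst x) (snd x) * F (fst x) (snd x) \<partial>(\<Omega> \<Otimes>\<^sub>M \<mu>))"
    using \<Omega>\<mu>.integral_fst'[OF int] by simp
  finally show "ex (resample i F) = (\<integral>x. weight (fst x) * kernel i (fst x) (snd x) * F (fst x) (snd x) \<partial>(\<Omega> \<Otimes>\<^sub>M \<mu>)) / Zn" .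
qed

text \<open>Reversibility of the resampling step: the product measure is invariant under the
  exchange of spins, and so is weight times kernel.\<close>

lemma detailed_balance:
  assumes i: "i \<in> I" and F: "(\<lambda>x. F (fst x) (snd x)) \<in> borel_measurable (\<Omega> \<Otimes>\<^sub>M \<mu>)"
    and B: "\<And>\<sigma> s. \<sigma> \<in> space \<Omega> \<Longrightarrow> s \<in> space \<mu> \<Longrightarrow> \<bar>F \<sigma> s\<bar> \<le> C"
  shows "ex (resample i F) = ex (resample i (\<lambda>\<sigma> s. F (\<sigma>(i := s)) (\<sigma> i)))"
proof -
  let ?H = "\<lambda>x. weight (fst x) * kernel i (fst x) (snd x) * F (fst x) (snd x)"
  have F': "(\<lambda>x. F ((fst x)(i := snd x)) (fst x i)) \<in> borel_measurable (\<Omega> \<Otimes>\<^sub>M \<mu>)"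
    using measurable_compose[OF measurable_swap[OF i] F] by simp
  have B': "\<bar>F (\<sigma>(i := s)) (\<sigma> i)\<bar> \<le> C" if "\<sigma> \<in> space \<Omega>" "s \<in> space \<mu>" for \<sigma> s
    by (rule B[OF update_mem[OF that(1) i that(2)] spin_mem[OF that(1) i]])
  have "ex (resample i (\<lambda>\<sigma> s. F (\<sigma>(i := s)) (\<sigma> i))) =
     (\<integral>x. weight (fst x) * kernel i (fst x) (snd x) * F ((fst x)(i := snd x)) (fst x i) \<partial>(\<Omega> \<Otimes>\<^sub>M \<mu>)) / Zn"
    by (rule ex_resample(1)[OF F' B'])
  also have "(\<integral>x. weight (fst x) * kernel i (fst x) (snd x) * F ((fst x)(i := snd x)) (fst x i) \<partial>(\<Omega> \<Otimes>\<^sub>M \<mu>))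
     = (\<integral>x. ?H ((fst x)(i := snd x), fst x i) \<partial>(\<Omega> \<Otimes>\<^sub>M \<mu>))"
    by (rule Bochner_Integration.integral_cong)
       (auto simp: space_pair_measure weight_kernel_swap[OF _ i])
  also have "\<dots> = (\<integral>x. ?H x \<partial>(\<Omega> \<Otimes>\<^sub>M \<mu>))"
    by (rule integral_swap[OF i]) (intro borel_measurable_times F measurable_kernel measurable_fst_comp measurable_weight)
  also have "\<dots> / Zn = ex (resample i F)" by (rule ex_resample(1)[OF F B, symmetric])
  finally show ?thesis ..
qed

text \<open>By reversibility the configuration may be replaced by the resampled one. Then
  \<open>V\<close>, which does not see spin \<open>i\<close>, comes out of the average over the new
  spin, and the average of \<open>Y\<close> is 0.\<close>

lemma ex_centred_zero:
  assumes i: "i \<in> I" and Y: "Y \<in> borel_measurable \<Omega>" "\<And>\<sigma>. \<sigma> \<in> space \<Omega> \<Longrightarrow> \<bar>Y \<sigma>\<bar> \<le> C"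
    and V: "V \<in> borel_measurable \<Omega>" "\<And>\<sigma>. \<sigma> \<in> space \<Omega> \<Longrightarrow> \<bar>V \<sigma>\<bar> \<le> C'"
    and V': "\<And>\<sigma> s. \<sigma> \<in> space \<Omega> \<Longrightarrow> s \<in> space \<mu> \<Longrightarrow> V (\<sigma>(i := s)) = V \<sigma>"
    and Z: "\<And>\<sigma>. \<sigma> \<in> space \<Omega> \<Longrightarrow> resample i (\<lambda>\<sigma> s. Y (\<sigma>(i := s))) \<sigma> = 0"
  shows "ex (\<lambda>\<sigma>. V \<sigma> * Y \<sigma>) = 0"
proof -
  have "ex (\<lambda>\<sigma>. V \<sigma> * Y \<sigma>) = ex (resample i (\<lambda>\<sigma> s. V \<sigma> * Y \<sigma>))"
    by (rule ex_cong) simp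
  also have "\<dots> = ex (resample i (\<lambda>\<sigma> s. V (\<sigma>(i := s)) * Y (\<sigma>(i := s))))"
  proof (rule detailed_balance[OF i])
    show "(\<lambda>x. V (fst x) * Y (fst x)) \<in> borel_measurable (\<Omega> \<Otimes>\<^sub>M \<mu>)"
      by (intro borel_measurable_times measurable_fst_comp Y V)
    show "\<bar>V \<sigma> * Y \<sigma>\<bar> \<le> C' * C" if "\<sigma> \<in> space \<Omega>" for \<sigma>
      unfolding abs_mult using V(2)[OF that] Y(2)[OF that] by (intro mult_mono) auto
  qed
  also have "\<dots> = ex (\<lambda>_. 0)"
  proof (rule ex_cong)
    fix \<sigma> assume \<sigma>: "\<sigma> \<in> space \<Omega>"
    have "resample i (\<lambda>\<sigma> s. V (\<sigma>(i := s)) * Y (\<sigma>(i := s))) \<sigma> = (\<integral>s. V \<sigma> * (Y (\<sigma>(i := s)) * kernel i \<sigma> s) \<partial>\<mu>)"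
      unfolding resample_def by (rule Bochner_Integration.integral_cong) (auto simp: V'[OF \<sigma>] mult.assoc)
    also have "\<dots> = V \<sigma> * resample i (\<lambda>\<sigma> s. Y (\<sigma>(i := s))) \<sigma>"
      unfolding resample_def by simp
    finally show "resample i (\<lambda>\<sigma> s. V (\<sigma>(i := s)) * Y (\<sigma>(i := s))) \<sigma> = 0"
      using Z[OF \<sigma>] by simp
  qed
  finally show ?thesis by simp
qed

text \<open>Weak dependence: freezing spin \<open>i\<close> changes \<open>Y j\<close> by \<open>O(1/n)\<close> and makes it orthogonal to \<open>Y i\<close>.\<close>

lemma ex_sum_square:
  assumes Y: "\<And>i. i \<in> I \<Longrightarrow> Y i \<in> borel_measurable \<Omega>"
      "\<And>i \<sigma>. i \<in> I \<Longrightarrow> \<sigma> \<in> space \<Omega> \<Longrightarrow> \<bar>Y i \<sigma>\<bar> \<le> C"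
    and Z: "\<And>i \<sigma>. i \<in> I \<Longrightarrow> \<sigma> \<in> space \<Omega> \<Longrightarrow> resample i (\<lambda>\<sigma> s. Y i (\<sigma>(i := s))) \<sigma> = 0"
    and diff: "\<And>i j \<sigma> s. i \<in> I \<Longrightarrow> j \<in> I \<Longrightarrow> i \<noteq> j \<Longrightarrow> \<sigma> \<in> space \<Omega> \<Longrightarrow> s \<in> space \<mu> \<Longrightarrow>
       \<bar>Y j \<sigma> - Y j (\<sigma>(i := s))\<bar> \<le> c / real n"
    and C: "0 \<le> C" "0 \<le> c"
  shows "ex (\<lambda>\<sigma>. (\<Sum>i\<in>I. Y i \<sigma>)\<^sup>2) \<le> (C\<^sup>2 + C * c) * real n"
proof -
  \<comment> \<open>An arbitrary reference value at which a spin is frozen.\<close>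
  obtain s0 where s0: "s0 \<in> space \<mu>" using \<mu>.not_empty by blast
  have YY: "(\<lambda>\<sigma>. Y i \<sigma> * Y j \<sigma>) \<in> borel_measurable \<Omega>" "\<And>\<sigma>. \<sigma> \<in> space \<Omega> \<Longrightarrow> \<bar>Y i \<sigma> * Y j \<sigma>\<bar> \<le> C * C"
    if "i \<in> I" "j \<in> I" for i j
    using that Y C by (auto intro!: mult_mono simp: abs_mult)
  have "ex (\<lambda>\<sigma>. (\<Sum>i\<in>I. Y i \<sigma>)\<^sup>2) = ex (\<lambda>\<sigma>. \<Sum>i\<in>I. \<Sum>j\<in>I. Y i \<sigma> * Y j \<sigma>)"
    by (simp add: power2_eq_square sum_product)
  also have "\<dots> = (\<Sum>i\<in>I. \<Sum>j\<in>I. ex (\<lambda>\<sigma>. Y i \<sigma> * Y j \<sigma>))"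
  proof -
    have i: "integrable (gibbs N \<beta> n) (\<lambda>\<sigma>. Y i \<sigma> * Y j \<sigma>)" if "i \<in> I" "j \<in> I" for i j
      by (rule integrable_gibbs[OF YY[OF that]])
    have "ex (\<lambda>\<sigma>. \<Sum>i\<in>I. \<Sum>j\<in>I. Y i \<sigma> * Y j \<sigma>) = (\<Sum>i\<in>I. ex (\<lambda>\<sigma>. \<Sum>j\<in>I. Y i \<sigma> * Y j \<sigma>))"
      by (intro ex_sum Bochner_Integration.integrable_sum i)
    also have "\<dots> = (\<Sum>i\<in>I. \<Sum>j\<in>I. ex (\<lambda>\<sigma>. Y i \<sigma> * Y j \<sigma>))"
      by (intro sum.cong refl ex_sum i)
    finally show ?thesis .
  qed
  \<comment> \<open>Order \<open>n\<close> arises from \<open>n\<close> diagonal terms of size 1 and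
    about \<open>n^2\<close> off-diagonal terms of size \<open>1/n\<close>.\<close>
  also have "\<dots> \<le> (\<Sum>i\<in>I. \<Sum>j\<in>I. (if i = j then C\<^sup>2 else 0) + C * c / real n)"
  proof (intro sum_mono)
    fix i j assume ij: "i \<in> I" "j \<in> I"
    show "ex (\<lambda>\<sigma>. Y i \<sigma> * Y j \<sigma>) \<le> (if i = j then C\<^sup>2 else 0) + C * c / real n"
    proof (cases "i = j")
      case True
      have "ex (\<lambda>\<sigma>. Y i \<sigma> * Y j \<sigma>) \<le> ex (\<lambda>_. C\<^sup>2)"
        by (rule ex_mono[OF YY[OF ij]]) (use YY(2)[OF ij] in \<open>auto simp: power2_eq_square abs_le_iff\<close>)
      thus ?thesis using True C n0 by (simp add: add_increasing2)
    next
      case False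
      define V where "V = (\<lambda>\<sigma>. Y j (\<sigma>(i := s0)))"
      have um: "(\<lambda>\<sigma>. \<sigma>(i := s0)) \<in> \<Omega> \<rightarrow>\<^sub>M \<Omega>"
      proof -
        have "(\<lambda>\<sigma>. (\<sigma>, s0)) \<in> \<Omega> \<rightarrow>\<^sub>M \<Omega> \<Otimes>\<^sub>M \<mu>" using s0 by measurable
        from measurable_compose[OF this measurable_update[OF ij(1)]] show ?thesis by simp
      qed
      have V: "V \<in> borel_measurable \<Omega>" "\<And>\<sigma>. \<sigma> \<in> space \<Omega> \<Longrightarrow> \<bar>V \<sigma>\<bar> \<le> C"
        unfolding V_def using measurable_compose[OF um Y(1)[OF ij(2)]] Y(2)[OF ij(2) update_mem[OF _ ij(1) s0]] by auto
      have zero: "ex (\<lambda>\<sigma>. V \<sigma> * Y i \<sigma>) = 0"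
        by (rule ex_centred_zero[OF ij(1) Y(1)[OF ij(1)] Y(2)[OF ij(1)] V _ Z[OF ij(1)]]) (auto simp: V_def)
      have VY: "(\<lambda>\<sigma>. V \<sigma> * Y i \<sigma>) \<in> borel_measurable \<Omega>" "\<And>\<sigma>. \<sigma> \<in> space \<Omega> \<Longrightarrow> \<bar>V \<sigma> * Y i \<sigma>\<bar> \<le> C * C"
        using V Y(1)[OF ij(1)] Y(2)[OF ij(1)] C by (auto intro!: mult_mono simp: abs_mult)
      have "ex (\<lambda>\<sigma>. Y i \<sigma> * Y j \<sigma>) = ex (\<lambda>\<sigma>. Y i \<sigma> * Y j \<sigma>) - ex (\<lambda>\<sigma>. V \<sigma> * Y i \<sigma>)"
        using zero by simp
      also have "\<dots> = ex (\<lambda>\<sigma>. Y i \<sigma> * Y j \<sigma> - V \<sigma> * Y i \<sigma>)"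
        unfolding ex_def using integrable_gibbs[OF YY[OF ij]] integrable_gibbs[OF VY] by simp
      also have "\<dots> \<le> ex (\<lambda>_. C * (c / real n))"
      proof (rule ex_mono)
        show "(\<lambda>\<sigma>. Y i \<sigma> * Y j \<sigma> - V \<sigma> * Y i \<sigma>) \<in> borel_measurable \<Omega>" using YY[OF ij] VY by auto
        fix \<sigma> assume \<sigma>: "\<sigma> \<in> space \<Omega>"
        have "\<bar>Y i \<sigma> * Y j \<sigma> - V \<sigma> * Y i \<sigma>\<bar> = \<bar>Y i \<sigma>\<bar> * \<bar>Y j \<sigma> - V \<sigma>\<bar>"
          by (simp add: abs_mult[symmetric] algebra_simps)
        also have "\<dots> \<le> C * (c / real n)"
          using Y(2)[OF ij(1) \<sigma>] diff[OF ij False \<sigma> s0] C unfolding V_def by (intro mult_mono) auto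
        finally show b: "\<bar>Y i \<sigma> * Y j \<sigma> - V \<sigma> * Y i \<sigma>\<bar> \<le> C * (c / real n)" .
        thus "Y i \<sigma> * Y j \<sigma> - V \<sigma> * Y i \<sigma> \<le> C * (c / real n)" by linarith
      qed auto
      finally show ?thesis using False by simp
    qed
  qed
  also have "\<dots> = (C\<^sup>2 + C * c) * real n"
    using n0 by (simp add: sum.distrib algebra_simps)
  finally show ?thesis .
qed

section \<open>Influence of one spin on the cavity field of another\<close>

lemma cavity_diff:
  assumes "i \<in> I" "j \<in> I" "i \<noteq> j"
  shows "cavity j \<sigma> = (\<lambda>k. cavity j (\<sigma>(i := s)) k + \<beta> / real n * (\<sigma> i k - s k))"
proof (rule ext)
  fix k
  have "(\<Sum>l\<in>I - {j}. (\<sigma>(i := s)) l k) = s k + (\<Sum>l\<in>I - {j} - {i}. \<sigma> l k)"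
    using assms by (subst sum.remove[of _ i]) auto
  moreover have "(\<Sum>l\<in>I - {j}. \<sigma> l k) = \<sigma> i k + (\<Sum>l\<in>I - {j} - {i}. \<sigma> l k)"
    using assms by (subst sum.remove[of _ i]) auto
  ultimately have "(\<Sum>l\<in>I - {j}. \<sigma> l k) = (\<Sum>l\<in>I - {j}. (\<sigma>(i := s)) l k) + (\<sigma> i k - s k)" by simp
  thus "cavity j \<sigma> k = cavity j (\<sigma>(i := s)) k + \<beta> / real n * (\<sigma> i k - s k)"
    unfolding cavity_def by (simp only: distrib_left)
qed

lemma cavity_dot_diff:
  assumes "i \<in> I" "j \<in> I" "i \<noteq> j"
  shows "dot N (cavity j \<sigma>) z = dot N (cavity j (\<sigma>(i := s))) z + \<beta> / real n * (dot N (\<sigma> i) z - dot N s z)"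
  by (subst cavity_diff[OF assms, of \<sigma> s]) (simp only: dot_add_left dot_mult_left dot_diff_left)

lemma t_diff:
  assumes ij: "i \<in> I" "j \<in> I" "i \<noteq> j" and \<sigma>: "\<sigma> \<in> space \<Omega>" and s: "s \<in> space \<mu>"
  shows "\<bar>t j \<sigma> - t j (\<sigma>(i := s))\<bar> \<le> 2 * \<beta> / real n"
proof -
  have "t j \<sigma> - t j (\<sigma>(i := s)) = \<beta> / real n * (dot N (\<sigma> i) (\<sigma> j) - dot N s (\<sigma> j))"
    unfolding t_def using ij cavity_dot_diff[OF ij, of \<sigma> "\<sigma> j" s] by simp
  hence "\<bar>t j \<sigma> - t j (\<sigma>(i := s))\<bar> = \<beta> / real n * \<bar>dot N (\<sigma> i) (\<sigma> j) - dot N s (\<sigma> j)\<bar>"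
    using \<beta> n0 by (simp add: abs_mult)
  also have "\<dots> \<le> \<beta> / real n * 2"
    using abs_dot_spins[OF spin_mem[OF \<sigma> ij(1)] spin_mem[OF \<sigma> ij(2)]] abs_dot_spins[OF s spin_mem[OF \<sigma> ij(2)]] \<beta> n0
    by (intro mult_left_mono) auto
  finally show ?thesis by (simp add: mult.commute)
qed

lemma Qc_diff:
  assumes ij: "i \<in> I" "j \<in> I" "i \<noteq> j" and \<sigma>: "\<sigma> \<in> space \<Omega>" and s: "s \<in> space \<mu>"
  shows "\<bar>Qc j \<sigma> - Qc j (\<sigma>(i := s))\<bar> \<le> 4 * \<beta>\<^sup>2 / real n"
proof -
  let ?\<tau> = "\<sigma>(i := s)"
  let ?a = "cavity j \<sigma>" and ?b = "cavity j ?\<tau>"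
  have \<tau>: "?\<tau> \<in> space \<Omega>" by (rule update_mem[OF \<sigma> ij(1) s])
  have si: "\<sigma> i \<in> space \<mu>" by (rule spin_mem[OF \<sigma> ij(1)])
  \<comment> \<open>The two arguments of the inner product are changed one after the other, each
    change contributing at most \<open>2 * \<beta>\<close> before the factor
    \<open>\<beta> / n\<close>.\<close>
  have "Qc j \<sigma> - Qc j ?\<tau> = (dot N ?a ?a - dot N ?b ?a) + (dot N ?a ?b - dot N ?b ?b)"
    unfolding Qc_def by (simp add: dot_commute)
  also have "\<dots> = \<beta> / real n * ((dot N ?a (\<sigma> i) - dot N ?a s) + (dot N ?b (\<sigma> i) - dot N ?b s))"
    using cavity_dot_diff[OF ij, of \<sigma> ?a s] cavity_dot_diff[OF ij, of \<sigma> ?b s]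
    by (simp add: dot_commute algebra_simps)
  finally have "\<bar>Qc j \<sigma> - Qc j ?\<tau>\<bar> = \<beta> / real n * \<bar>(dot N ?a (\<sigma> i) - dot N ?a s) + (dot N ?b (\<sigma> i) - dot N ?b s)\<bar>"
    using \<beta> n0 by (simp add: abs_mult)
  also have "\<dots> \<le> \<beta> / real n * (4 * \<beta>)"
    using dot_cavity_le[OF \<sigma> si, of j] dot_cavity_le[OF \<sigma> s, of j] dot_cavity_le[OF \<tau> si, of j] dot_cavity_le[OF \<tau> s, of j] \<beta> n0
    by (intro mult_left_mono) auto
  finally show ?thesis by (simp add: power2_eq_square mult_ac)
qed

end

text \<open>The mean of \<open><h, s>\<close> under the tilted law with \<open>q = |h|^2\<close>,
  that is \<open>x * f(x)\<close> at \<open>x = sqrt q\<close>.\<close>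

definition mean_proj :: "nat \<Rightarrow> real \<Rightarrow> real" where
  "mean_proj N q = q * logd N q"

text \<open>This is \<open>logd + q * logd'\<close> with \<open>logd'\<close> eliminated by the
  Riccati equation; it can therefore be differentiated once more without a formula for the second
  derivative of \<open>logd\<close>.\<close>

definition mean_proj' :: "nat \<Rightarrow> real \<Rightarrow> real" where
  "mean_proj' N q = (1 + (2 - real N) * logd N q - q * (logd N q)\<^sup>2) / 2"

section \<open>Regularity of the tilted moments\<close>

lemma mean_proj_has_derivative:
  assumes "2 \<le> N" "0 \<le> q"
  shows "(mean_proj N has_real_derivative mean_proj' N q) (at q)"
proof -
  have "(mean_proj N has_real_derivative logd N q + q * logd' N q) (at q)"
    unfolding mean_proj_def[abs_def]
    by (auto intro!: derivative_eq_intros logd_has_derivative[OF assms])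
  moreover have "logd N q + q * logd' N q = mean_proj' N q"
    using logd_riccati[OF assms] unfolding mean_proj'_def by (simp add: algebra_simps)
  ultimately show ?thesis by simp
qed

lemma mean_value_Icc:
  fixes f :: "real \<Rightarrow> real"
  assumes d: "\<And>x. x \<in> {0..r} \<Longrightarrow> (f has_real_derivative f' x) (at x)" and x: "x \<in> {0..r}" and y: "y \<in> {0..r}"
  obtains \<xi> where "\<xi> \<in> {0..r}" "\<bar>\<xi> - y\<bar> \<le> \<bar>x - y\<bar>" "f x - f y = (x - y) * f' \<xi>"
proof -
  consider "x < y" | "y < x" | "x = y" by linarith
  thus thesis
  proof cases
    case 1
    from MVT2[of x y f f'] d x y 1 obtain z where "x < z" "z < y" "f y - f x = (y - x) * f' z" by auto
    thus ?thesis using x y by (intro that[of z]) (auto simp: algebra_simps)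
  next
    case 2
    from MVT2[of y x f f'] d x y 2 obtain z where "y < z" "z < x" "f x - f y = (x - y) * f' z" by auto
    thus ?thesis using x y by (intro that[of z]) auto
  next
    case 3 thus ?thesis using x by (intro that[of x]) auto
  qed
qed

lemma continuously_differentiable_lipschitz:
  fixes f :: "real \<Rightarrow> real"
  assumes d: "\<And>x. x \<in> {0..r} \<Longrightarrow> (f has_real_derivative f' x) (at x)" and c: "continuous_on {0..r} f'"
  obtains L where "0 < L" "\<And>x y. x \<in> {0..r} \<Longrightarrow> y \<in> {0..r} \<Longrightarrow> \<bar>f x - f y\<bar> \<le> L * \<bar>x - y\<bar>"
proof -
  have "bounded (f' ` {0..r})" by (intro compact_imp_bounded compact_continuous_image c) auto
  then obtain L where L: "0 < L" "\<And>x. x \<in> {0..r} \<Longrightarrow> \<bar>f' x\<bar> \<le> L"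
    unfolding bounded_pos by auto
  show thesis
  proof (rule that[OF L(1)])
    fix x y assume xy: "x \<in> {0..r}" "y \<in> {0..r}"
    obtain \<xi> where "\<xi> \<in> {0..r}" "f x - f y = (x - y) * f' \<xi>"
      using mean_value_Icc[OF d xy] by metis
    thus "\<bar>f x - f y\<bar> \<le> L * \<bar>x - y\<bar>"
      using L(2)[of \<xi>] by (simp add: abs_mult mult.commute mult_right_mono)
  qed
qed

lemma continuous_on_logd:
  assumes "2 \<le> N" "S \<subseteq> {0..}"
  shows "continuous_on S (logd N)"
  by (rule DERIV_continuous_on) (use assms logd_has_derivative[OF assms(1)] in \<open>auto intro: has_field_derivative_at_within\<close>)

lemma continuous_on_logd':
  assumes N: "2 \<le> N" and S: "S \<subseteq> {0..}"
  shows "continuous_on S (logd' N)"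
proof -
  have "continuous_on S (sph N)" "continuous_on S (sph1 N)" "continuous_on S (sph2 N)"
    by (rule DERIV_continuous_on, rule has_field_derivative_at_within,
        rule sph_has_derivative[OF N] sph1_has_derivative[OF N] sph2_has_derivative[OF N])+
  moreover have "\<forall>q\<in>S. (sph N q)\<^sup>2 \<noteq> 0" using S sph_ge_1[OF N] by fastforce
  ultimately show ?thesis unfolding logd'_def[abs_def] by (intro continuous_intros) auto
qed

text \<open>One \<open>L\<close> for all the regularity used later. The first three bounds allow
  \<open>Qc\<close> to be replaced by \<open>Q\<close> and \<open>Q\<close> by its limit; the last
  is a second-order expansion at the root, needed because the drift must be linear there up to a
  quadratic error.\<close>

lemma lipschitz_constants:
  assumes N: "2 \<le> N" and q0: "q0 \<in> {0..r}"
  obtains L where "0 < L"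
    "\<And>x y. x \<in> {0..r} \<Longrightarrow> y \<in> {0..r} \<Longrightarrow> \<bar>mean_proj N x - mean_proj N y\<bar> \<le> L * \<bar>x - y\<bar>"
    "\<And>x y. x \<in> {0..r} \<Longrightarrow> y \<in> {0..r} \<Longrightarrow> \<bar>second_moment N x - second_moment N y\<bar> \<le> L * \<bar>x - y\<bar>"
    "\<And>x y. x \<in> {0..r} \<Longrightarrow> y \<in> {0..r} \<Longrightarrow> \<bar>x * mean_proj N x - y * mean_proj N y\<bar> \<le> L * \<bar>x - y\<bar>"
    "\<And>x. x \<in> {0..r} \<Longrightarrow> \<bar>mean_proj N x - mean_proj N q0 - mean_proj' N q0 * (x - q0)\<bar> \<le> L * (x - q0)\<^sup>2"
proof -
  have sub: "{0..r} \<subseteq> {0..}" by auto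
  note cl = continuous_on_logd[OF N sub] and cl' = continuous_on_logd'[OF N sub]
  have cm': "continuous_on {0..r} (mean_proj' N)"
    unfolding mean_proj'_def by (intro continuous_intros cl) auto
  have cm: "continuous_on {0..r} (mean_proj N)"
    unfolding mean_proj_def by (intro continuous_intros cl)
  have dm: "(mean_proj N has_real_derivative mean_proj' N x) (at x)" if "x \<in> {0..r}" for x
    using mean_proj_has_derivative[OF N] that by auto
  obtain L1 where L1: "0 < L1" "\<And>x y. x \<in> {0..r} \<Longrightarrow> y \<in> {0..r} \<Longrightarrow> \<bar>mean_proj N x - mean_proj N y\<bar> \<le> L1 * \<bar>x - y\<bar>"
    using continuously_differentiable_lipschitz[OF dm cm'] by blast
  have L2: "\<bar>second_moment N x - second_moment N y\<bar> \<le> (1 + real N * L1) * \<bar>x - y\<bar>"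
    if xy: "x \<in> {0..r}" "y \<in> {0..r}" for x y
  proof -
    \<comment> \<open>By \<open>second_moment_eq\<close> the second moment is
      \<open>q - (N - 1) * mean_proj N q\<close>, so its Lipschitz bound is inherited.\<close>
    have "second_moment N x - second_moment N y = (x - y) - (real N - 1) * (mean_proj N x - mean_proj N y)"
      using xy second_moment_eq[OF N, of x] second_moment_eq[OF N, of y] unfolding mean_proj_def
      by (simp add: algebra_simps)
    hence "\<bar>second_moment N x - second_moment N y\<bar> \<le> \<bar>x - y\<bar> + (real N - 1) * \<bar>mean_proj N x - mean_proj N y\<bar>"
      using N by (simp only:) (rule order_trans[OF abs_triangle_ineq4], simp add: abs_mult)
    also have "\<dots> \<le> \<bar>x - y\<bar> + real N * (L1 * \<bar>x - y\<bar>)"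
      using N L1(2)[OF xy] by (intro add_left_mono mult_mono) auto
    finally show ?thesis by (simp add: algebra_simps)
  qed
  obtain L3 where L3: "0 < L3" "\<And>x y. x \<in> {0..r} \<Longrightarrow> y \<in> {0..r} \<Longrightarrow> \<bar>x * mean_proj N x - y * mean_proj N y\<bar> \<le> L3 * \<bar>x - y\<bar>"
  proof (rule continuously_differentiable_lipschitz[of r "\<lambda>x. x * mean_proj N x" "\<lambda>x. mean_proj N x + mean_proj' N x * x"])
    show "((\<lambda>x. x * mean_proj N x) has_real_derivative mean_proj N x + mean_proj' N x * x) (at x)" if "x \<in> {0..r}" for x
      using dm[OF that] by (auto intro!: derivative_eq_intros)
    show "continuous_on {0..r} (\<lambda>x. mean_proj N x + mean_proj' N x * x)" by (intro continuous_intros cm cm')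
  qed blast
  obtain L4 where L4: "0 < L4" "\<And>x y. x \<in> {0..r} \<Longrightarrow> y \<in> {0..r} \<Longrightarrow> \<bar>mean_proj' N x - mean_proj' N y\<bar> \<le> L4 * \<bar>x - y\<bar>"
  proof (rule continuously_differentiable_lipschitz[of r "mean_proj' N"
        "\<lambda>q. ((2 - real N) * logd' N q - ((logd N q)\<^sup>2 + 2 * q * logd N q * logd' N q)) / 2"])
    show "(mean_proj' N has_real_derivative ((2 - real N) * logd' N q - ((logd N q)\<^sup>2 + 2 * q * logd N q * logd' N q)) / 2) (at q)"
      if "q \<in> {0..r}" for q
    proof -
      have d: "(logd N has_real_derivative logd' N q) (at q)" using that by (intro logd_has_derivative[OF N]) auto
      have "((\<lambda>q. 1 + (2 - real N) * logd N q - q * (logd N q)\<^sup>2) has_real_derivative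
          ((2 - real N) * logd' N q - ((logd N q)\<^sup>2 + 2 * q * logd N q * logd' N q))) (at q)"
        by (rule derivative_eq_intros d refl)+ (simp add: algebra_simps)
      from DERIV_cdivide[OF this, of 2] show ?thesis unfolding mean_proj'_def[abs_def] .
    qed
    show "continuous_on {0..r} (\<lambda>q. ((2 - real N) * logd' N q - ((logd N q)\<^sup>2 + 2 * q * logd N q * logd' N q)) / 2)"
      by (intro continuous_intros cl cl') auto
  qed blast
  define L where "L = L1 + (1 + real N * L1) + L3 + L4"
  have L: "0 < L" "L1 \<le> L" "1 + real N * L1 \<le> L" "L3 \<le> L" "L4 \<le> L"
    unfolding L_def using L1(1) L3(1) L4(1) mult_nonneg_nonneg[of "real N" L1] by (auto intro!: add_pos_nonneg add_nonneg_nonneg simp: add.assoc)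
  show thesis
  proof (rule that[OF L(1)])
    fix x y assume xy: "x \<in> {0..r}" "y \<in> {0..r}"
    show "\<bar>mean_proj N x - mean_proj N y\<bar> \<le> L * \<bar>x - y\<bar>"
      using L1(2)[OF xy] mult_right_mono[OF L(2), of "\<bar>x - y\<bar>"] by linarith
    show "\<bar>second_moment N x - second_moment N y\<bar> \<le> L * \<bar>x - y\<bar>"
      using L2[OF xy] mult_right_mono[OF L(3), of "\<bar>x - y\<bar>"] by linarith
    show "\<bar>x * mean_proj N x - y * mean_proj N y\<bar> \<le> L * \<bar>x - y\<bar>"
      using L3(2)[OF xy] mult_right_mono[OF L(4), of "\<bar>x - y\<bar>"] by linarith
  next
    fix x assume x: "x \<in> {0..r}"
    obtain \<xi> where \<xi>: "\<xi> \<in> {0..r}" "\<bar>\<xi> - q0\<bar> \<le> \<bar>x - q0\<bar>" "mean_proj N x - mean_proj N q0 = (x - q0) * mean_proj' N \<xi>"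
      using mean_value_Icc[OF dm x q0] by metis
    have "\<bar>mean_proj N x - mean_proj N q0 - mean_proj' N q0 * (x - q0)\<bar> = \<bar>x - q0\<bar> * \<bar>mean_proj' N \<xi> - mean_proj' N q0\<bar>"
      unfolding \<xi>(3) abs_mult[symmetric] by (simp add: algebra_simps)
    also have "\<dots> \<le> \<bar>x - q0\<bar> * (L * \<bar>x - q0\<bar>)"
    proof (rule mult_left_mono)
      have "\<bar>mean_proj' N \<xi> - mean_proj' N q0\<bar> \<le> L4 * \<bar>\<xi> - q0\<bar>" by (rule L4(2)[OF \<xi>(1) q0])
      also have "\<dots> \<le> L * \<bar>x - q0\<bar>" using L4(1) L \<xi>(2) by (intro mult_mono) auto
      finally show "\<bar>mean_proj' N \<xi> - mean_proj' N q0\<bar> \<le> L * \<bar>x - q0\<bar>" .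
    qed simp
    also have "\<dots> = L * \<bar>x - q0\<bar>\<^sup>2" by (simp only: power2_eq_square mult.left_commute)
    also have "\<dots> = L * (x - q0)\<^sup>2" by simp
    finally show "\<bar>mean_proj N x - mean_proj N q0 - mean_proj' N q0 * (x - q0)\<bar> \<le> L * (x - q0)\<^sup>2" .
  qed
qed

text \<open>Since \<open>mean_proj^2 \<le> second_moment \<le> q\<close>, the tilted averages obey
  the bounds valid for the inner product of a unit spin with a field of length at most
  \<open>r\<close>.\<close>

lemma mean_proj_bounds:
  assumes N: "2 \<le> N" and q: "0 \<le> q" "q \<le> r\<^sup>2" and r: "0 \<le> r"
  shows "0 \<le> mean_proj N q" "mean_proj N q \<le> r" "0 \<le> second_moment N q" "second_moment N q \<le> r\<^sup>2"
proof -
  show m0: "0 \<le> mean_proj N q" unfolding mean_proj_def using logd_pos[OF N q(1)] q by simp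
  have "(mean_proj N q)\<^sup>2 \<le> second_moment N q \<and> second_moment N q \<le> q"
  proof (cases "q = 0")
    case True thus ?thesis using second_moment_eq[OF N, of 0] by (simp add: mean_proj_def)
  next
    case False
    hence q': "0 < q" using q by simp
    have "0 \<le> (real N - 1) * logd N q" using logd_pos[OF N q(1)] N by auto
    hence "second_moment N q \<le> q * 1"
      unfolding second_moment_eq[OF N q(1)] using q by (intro mult_left_mono) auto
    thus ?thesis using second_moment_gt[OF N q'] by (simp add: mean_proj_def)
  qed
  hence "(mean_proj N q)\<^sup>2 \<le> r\<^sup>2" and s: "second_moment N q \<le> r\<^sup>2" "0 \<le> second_moment N q"
    using q by (auto intro: order_trans zero_le_power2)
  thus "mean_proj N q \<le> r" using r by (simp add: abs_le_square_iff[symmetric])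
  show "0 \<le> second_moment N q" "second_moment N q \<le> r\<^sup>2" by (rule s)+
qed

context vector_model
begin

text \<open>The bound is hidden in an existential quantifier, so that integrability under
  \<open>gibbs\<close> is settled by introduction rules and the size of irrelevant bounds never has
  to be computed.\<close>

definition nice :: "((nat \<Rightarrow> nat \<Rightarrow> real) \<Rightarrow> real) \<Rightarrow> bool" where
  "nice g \<longleftrightarrow> g \<in> borel_measurable \<Omega> \<and> (\<exists>C. \<forall>\<sigma>\<in>space \<Omega>. \<bar>g \<sigma>\<bar> \<le> C)"

definition nice2 :: "((nat \<Rightarrow> nat \<Rightarrow> real) \<Rightarrow> (nat \<Rightarrow> real) \<Rightarrow> real) \<Rightarrow> bool" where
  "nice2 F \<longleftrightarrow> (\<lambda>x. F (fst x) (snd x)) \<in> borel_measurable (\<Omega> \<Otimes>\<^sub>M \<mu>) \<and>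
     (\<exists>C. \<forall>\<sigma>\<in>space \<Omega>. \<forall>s\<in>space \<mu>. \<bar>F \<sigma> s\<bar> \<le> C)"

lemma niceI: "g \<in> borel_measurable \<Omega> \<Longrightarrow> (\<And>\<sigma>. \<sigma> \<in> space \<Omega> \<Longrightarrow> \<bar>g \<sigma>\<bar> \<le> C) \<Longrightarrow> nice g"
  unfolding nice_def by blast

lemma nice2I: "(\<lambda>x. F (fst x) (snd x)) \<in> borel_measurable (\<Omega> \<Otimes>\<^sub>M \<mu>) \<Longrightarrow>
    (\<And>\<sigma> s. \<sigma> \<in> space \<Omega> \<Longrightarrow> s \<in> space \<mu> \<Longrightarrow> \<bar>F \<sigma> s\<bar> \<le> C) \<Longrightarrow> nice2 F"
  unfolding nice2_def by blast

lemma nice_integrable: "nice g \<Longrightarrow> integrable (gibbs N \<beta> n) g"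
  unfolding nice_def using integrable_gibbs by blast

text \<open>Two bounded functions take their values in a compact rectangle, on which a continuous
  function is bounded. Most of the closure rules are instances.\<close>

lemma nice_combine:
  assumes "nice f" "nice g" "continuous_on UNIV (\<lambda>(x, y). h x y :: real)"
  shows "nice (\<lambda>\<sigma>. h (f \<sigma>) (g \<sigma>))"
proof -
  obtain C C' where C: "\<And>\<sigma>. \<sigma> \<in> space \<Omega> \<Longrightarrow> \<bar>f \<sigma>\<bar> \<le> C" "\<And>\<sigma>. \<sigma> \<in> space \<Omega> \<Longrightarrow> \<bar>g \<sigma>\<bar> \<le> C'"
    using assms(1,2) unfolding nice_def by blast
  let ?S = "{-C..C} \<times> {-C'..C'}"
  have "bounded ((\<lambda>(x, y). h x y) ` ?S)"
    by (intro compact_imp_bounded compact_continuous_image continuous_on_subset[OF assms(3)] compact_Times) auto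
  then obtain K where K: "\<And>z. z \<in> ?S \<Longrightarrow> \<bar>(\<lambda>(x, y). h x y) z\<bar> \<le> K"
    unfolding bounded_iff real_norm_def by (metis imageI)
  show ?thesis
  proof (rule niceI)
    have "(\<lambda>\<sigma>. (\<lambda>(x, y). h x y) (f \<sigma>, g \<sigma>)) \<in> borel_measurable \<Omega>"
      by (rule measurable_compose[OF _ borel_measurable_continuous_onI[OF assms(3)]])
         (use assms(1,2) in \<open>auto simp: nice_def borel_prod[symmetric]\<close>)
    thus "(\<lambda>\<sigma>. h (f \<sigma>) (g \<sigma>)) \<in> borel_measurable \<Omega>" by simp
    fix \<sigma> assume \<sigma>: "\<sigma> \<in> space \<Omega>"
    have "(f \<sigma>, g \<sigma>) \<in> ?S" using C[OF \<sigma>] by (auto simp: abs_le_iff)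
    from K[OF this] show "\<bar>h (f \<sigma>) (g \<sigma>)\<bar> \<le> K" by simp
  qed
qed

lemma nice_const: "nice (\<lambda>_. c)"
  by (rule niceI[of _ "\<bar>c\<bar>"]) auto

lemma nice_add: "nice f \<Longrightarrow> nice g \<Longrightarrow> nice (\<lambda>\<sigma>. f \<sigma> + g \<sigma>)"
  by (rule nice_combine) (auto simp: case_prod_beta intro!: continuous_intros)

lemma nice_diff: "nice f \<Longrightarrow> nice g \<Longrightarrow> nice (\<lambda>\<sigma>. f \<sigma> - g \<sigma>)"
  by (rule nice_combine) (auto simp: case_prod_beta intro!: continuous_intros)

lemma nice_mult: "nice f \<Longrightarrow> nice g \<Longrightarrow> nice (\<lambda>\<sigma>. f \<sigma> * g \<sigma>)"
  by (rule nice_combine) (auto simp: case_prod_beta intro!: continuous_intros)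

lemma nice_abs: "nice f \<Longrightarrow> nice (\<lambda>\<sigma>. \<bar>f \<sigma>\<bar>)"
  by (rule nice_combine[of f f]) (auto simp: case_prod_beta intro!: continuous_intros)

lemma nice_power: "nice f \<Longrightarrow> nice (\<lambda>\<sigma>. f \<sigma> ^ k)"
  by (rule nice_combine[of f f]) (auto simp: case_prod_beta intro!: continuous_intros)

lemma nice_divide: "nice f \<Longrightarrow> nice (\<lambda>\<sigma>. f \<sigma> / c)"
  using nice_mult[OF _ nice_const[of "inverse c"]] by (simp add: divide_inverse)

lemma nice_continuous: "continuous_on UNIV h \<Longrightarrow> nice f \<Longrightarrow> nice (\<lambda>\<sigma>. h (f \<sigma>))"
  by (rule nice_combine[of f f "\<lambda>x y. h x"]) (auto simp: case_prod_beta intro!: continuous_on_compose2[of UNIV h] continuous_intros)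

lemma nice_sum: "(\<And>i. i \<in> A \<Longrightarrow> nice (f i)) \<Longrightarrow> nice (\<lambda>\<sigma>. \<Sum>i\<in>A. f i \<sigma>)"
  by (induction A rule: infinite_finite_induct) (auto intro: nice_add nice_const)

lemma nice_Q: "nice Q"
  by (rule niceI[OF measurable_Q, of "\<beta>\<^sup>2"]) (use Q_nonneg Q_le in auto)

lemma nice_Qc: "nice (Qc i)"
  by (rule niceI[OF measurable_Qc, of _ "\<beta>\<^sup>2"]) (use Qc_nonneg Qc_le in auto)

lemma nice_t: "i \<in> I \<Longrightarrow> nice (t i)"
  by (rule niceI[OF measurable_t, of _ \<beta>]) (use t_le in auto)

lemma nice_nonneg_continuous:
  assumes "continuous_on {0..} h" "nice f" "\<And>\<sigma>. 0 \<le> f \<sigma>"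
  shows "nice (\<lambda>\<sigma>. h (f \<sigma>))"
proof -
  have "continuous_on UNIV (\<lambda>x. h (max 0 x))"
    by (rule continuous_on_compose2[OF assms(1)]) (auto intro!: continuous_intros)
  from nice_continuous[OF this assms(2)] show ?thesis using assms(3) by (simp add: max_absorb2)
qed

lemma continuous_mean_proj: "continuous_on {0..} (mean_proj N)"
  unfolding mean_proj_def by (intro continuous_intros continuous_logd)

lemma continuous_second_moment: "continuous_on {0..} (second_moment N)"
proof -
  have "continuous_on {0..} (\<lambda>q. q * (1 - (real N - 1) * logd N q))"
    by (intro continuous_intros continuous_logd)
  thus ?thesis by (rule continuous_on_eq) (simp add: second_moment_eq[OF N])
qed

lemma nice_mean_proj: "nice (\<lambda>\<sigma>. mean_proj N (Q \<sigma>))" "nice (\<lambda>\<sigma>. mean_proj N (Qc i \<sigma>))"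
  by (rule nice_nonneg_continuous[OF continuous_mean_proj] nice_Q nice_Qc Q_nonneg Qc_nonneg)+

lemma nice_second_moment: "nice (\<lambda>\<sigma>. second_moment N (Q \<sigma>))" "nice (\<lambda>\<sigma>. second_moment N (Qc i \<sigma>))"
  by (rule nice_nonneg_continuous[OF continuous_second_moment] nice_Q nice_Qc Q_nonneg Qc_nonneg)+

lemma nice_indicator: "nice (\<lambda>\<sigma>. indicator {..<e} (Q \<sigma>))"
  by (rule niceI[of _ 1]) (auto split: split_indicator)

lemmas nice_intros = nice_add nice_diff nice_mult nice_abs nice_power nice_divide nice_sum nice_Q nice_Qc nice_t
  nice_mean_proj nice_second_moment nice_indicator nice_const

lemma nice2_fst: "nice g \<Longrightarrow> nice2 (\<lambda>\<sigma> s. g \<sigma>)"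
  unfolding nice_def nice2_def using measurable_fst_comp by blast

lemma nice2_update: "i \<in> I \<Longrightarrow> nice g \<Longrightarrow> nice2 (\<lambda>\<sigma> s. g (\<sigma>(i := s)))"
proof -
  assume i: "i \<in> I" and g: "nice g"
  then obtain C where C: "\<And>\<sigma>. \<sigma> \<in> space \<Omega> \<Longrightarrow> \<bar>g \<sigma>\<bar> \<le> C" unfolding nice_def by blast
  show ?thesis
    by (rule nice2I[OF _ C[OF update_mem[OF _ i]]])
       (use g in \<open>auto simp: nice_def intro: measurable_update_comp[OF i]\<close>)
qed

lemma nice2_dot: "nice2 (\<lambda>\<sigma> s. dot N (cavity i \<sigma>) s)"
  by (rule nice2I[OF measurable_dot_cavity dot_cavity_le])

lemma nice2_combine:
  assumes "nice2 f" "nice2 g" "continuous_on UNIV (\<lambda>(x, y). h x y :: real)"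
  shows "nice2 (\<lambda>\<sigma> s. h (f \<sigma> s) (g \<sigma> s))"
proof -
  obtain C C' where C: "\<And>\<sigma> s. \<sigma> \<in> space \<Omega> \<Longrightarrow> s \<in> space \<mu> \<Longrightarrow> \<bar>f \<sigma> s\<bar> \<le> C" "\<And>\<sigma> s. \<sigma> \<in> space \<Omega> \<Longrightarrow> s \<in> space \<mu> \<Longrightarrow> \<bar>g \<sigma> s\<bar> \<le> C'"
    using assms(1,2) unfolding nice2_def by blast
  let ?S = "{-C..C} \<times> {-C'..C'}"
  have "bounded ((\<lambda>(x, y). h x y) ` ?S)"
    by (intro compact_imp_bounded compact_continuous_image continuous_on_subset[OF assms(3)] compact_Times) auto
  then obtain K where K: "\<And>z. z \<in> ?S \<Longrightarrow> \<bar>(\<lambda>(x, y). h x y) z\<bar> \<le> K"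
    unfolding bounded_iff real_norm_def by (metis imageI)
  show ?thesis
  proof (rule nice2I)
    have "(\<lambda>x. (\<lambda>(x, y). h x y) (f (fst x) (snd x), g (fst x) (snd x))) \<in> borel_measurable (\<Omega> \<Otimes>\<^sub>M \<mu>)"
      by (rule measurable_compose[OF _ borel_measurable_continuous_onI[OF assms(3)]])
         (use assms(1,2) in \<open>auto simp: nice2_def borel_prod[symmetric]\<close>)
    thus "(\<lambda>x. h (f (fst x) (snd x)) (g (fst x) (snd x))) \<in> borel_measurable (\<Omega> \<Otimes>\<^sub>M \<mu>)" by simp
    fix \<sigma> s assume \<sigma>: "\<sigma> \<in> space \<Omega>" "s \<in> space \<mu>"
    have "(f \<sigma> s, g \<sigma> s) \<in> ?S" using C[OF \<sigma>] by (auto simp: abs_le_iff)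
    from K[OF this] show "\<bar>h (f \<sigma> s) (g \<sigma> s)\<bar> \<le> K" by simp
  qed
qed

lemma nice2_add: "nice2 f \<Longrightarrow> nice2 g \<Longrightarrow> nice2 (\<lambda>\<sigma> s. f \<sigma> s + g \<sigma> s)"
  by (rule nice2_combine) (auto simp: case_prod_beta intro!: continuous_intros)

lemma nice2_diff: "nice2 f \<Longrightarrow> nice2 g \<Longrightarrow> nice2 (\<lambda>\<sigma> s. f \<sigma> s - g \<sigma> s)"
  by (rule nice2_combine) (auto simp: case_prod_beta intro!: continuous_intros)

lemma nice2_mult: "nice2 f \<Longrightarrow> nice2 g \<Longrightarrow> nice2 (\<lambda>\<sigma> s. f \<sigma> s * g \<sigma> s)"
  by (rule nice2_combine) (auto simp: case_prod_beta intro!: continuous_intros)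

lemma nice2_power: "nice2 f \<Longrightarrow> nice2 (\<lambda>\<sigma> s. f \<sigma> s ^ k)"
  by (rule nice2_combine[of f f "\<lambda>x y. x ^ k"]) (auto simp: case_prod_beta intro!: continuous_intros)

lemma nice2_const: "nice2 (\<lambda>_ _. c)"
  by (rule nice2_fst) (rule nice_const)

lemmas nice2_intros = nice2_add nice2_diff nice2_mult nice2_power nice2_const nice2_dot nice2_fst nice2_update

lemma nice2_integrable: "nice2 F \<Longrightarrow> \<sigma> \<in> space \<Omega> \<Longrightarrow> integrable \<mu> (\<lambda>s. F \<sigma> s * kernel i \<sigma> s)"
proof -
  assume F: "nice2 F" and \<sigma>: "\<sigma> \<in> space \<Omega>"
  then obtain C where C: "\<And>\<sigma> s. \<sigma> \<in> space \<Omega> \<Longrightarrow> s \<in> space \<mu> \<Longrightarrow> \<bar>F \<sigma> s\<bar> \<le> C"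
    and m: "(\<lambda>x. F (fst x) (snd x)) \<in> borel_measurable (\<Omega> \<Otimes>\<^sub>M \<mu>)" unfolding nice2_def by blast
  show ?thesis by (rule integrable_kernel[OF m C \<sigma>])
qed

lemma nice_resample: "nice2 F \<Longrightarrow> nice (resample i F)"
proof -
  assume F: "nice2 F"
  then obtain C where C: "\<And>\<sigma> s. \<sigma> \<in> space \<Omega> \<Longrightarrow> s \<in> space \<mu> \<Longrightarrow> \<bar>F \<sigma> s\<bar> \<le> C"
    and m: "(\<lambda>x. F (fst x) (snd x)) \<in> borel_measurable (\<Omega> \<Otimes>\<^sub>M \<mu>)" unfolding nice2_def by blast
  show ?thesis by (rule niceI[OF measurable_resample[OF m] resample_bound[OF m C]])
qed

lemma resample_add: "nice2 F \<Longrightarrow> nice2 G \<Longrightarrow> \<sigma> \<in> space \<Omega> \<Longrightarrow>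
    resample i (\<lambda>\<sigma> s. F \<sigma> s + G \<sigma> s) \<sigma> = resample i F \<sigma> + resample i G \<sigma>"
  unfolding resample_def by (simp add: distrib_right nice2_integrable)

lemma resample_diff: "nice2 F \<Longrightarrow> nice2 G \<Longrightarrow> \<sigma> \<in> space \<Omega> \<Longrightarrow>
    resample i (\<lambda>\<sigma> s. F \<sigma> s - G \<sigma> s) \<sigma> = resample i F \<sigma> - resample i G \<sigma>"
  unfolding resample_def by (simp add: left_diff_distrib nice2_integrable)

lemma resample_cmult: "resample i (\<lambda>\<sigma> s. c \<sigma> * F \<sigma> s) \<sigma> = c \<sigma> * resample i F \<sigma>"
  unfolding resample_def by (simp add: mult.assoc)

lemma resample_cong: "(\<And>s. s \<in> space \<mu> \<Longrightarrow> F \<sigma> s = G \<sigma> s) \<Longrightarrow> resample i F \<sigma> = resample i G \<sigma>"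
  unfolding resample_def by (rule Bochner_Integration.integral_cong) auto

lemma resample_mono: "nice2 F \<Longrightarrow> nice2 G \<Longrightarrow> \<sigma> \<in> space \<Omega> \<Longrightarrow> (\<And>s. s \<in> space \<mu> \<Longrightarrow> F \<sigma> s \<le> G \<sigma> s) \<Longrightarrow>
    resample i F \<sigma> \<le> resample i G \<sigma>"
  unfolding resample_def
  by (rule integral_mono) (auto intro: nice2_integrable mult_right_mono less_imp_le[OF kernel_pos])

lemma resample_dot: "resample i (\<lambda>\<sigma> s. dot N (cavity i \<sigma>) s) \<sigma> = mean_proj N (Qc i \<sigma>)"
  and resample_dot_sq: "resample i (\<lambda>\<sigma> s. (dot N (cavity i \<sigma>) s)\<^sup>2) \<sigma> = second_moment N (Qc i \<sigma>)"
  unfolding resample_def mean_proj_def by (simp_all add: kernel_integrals)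

lemma balance: "i \<in> I \<Longrightarrow> nice2 F \<Longrightarrow> ex (resample i F) = ex (resample i (\<lambda>\<sigma> s. F (\<sigma>(i := s)) (\<sigma> i)))"
proof -
  assume i: "i \<in> I" and F: "nice2 F"
  then obtain C where C: "\<And>\<sigma> s. \<sigma> \<in> space \<Omega> \<Longrightarrow> s \<in> space \<mu> \<Longrightarrow> \<bar>F \<sigma> s\<bar> \<le> C"
    and m: "(\<lambda>x. F (fst x) (snd x)) \<in> borel_measurable (\<Omega> \<Otimes>\<^sub>M \<mu>)" unfolding nice2_def by blast
  show ?thesis by (rule detailed_balance[OF i m C])
qed

lemma ex_add: "nice f \<Longrightarrow> nice g \<Longrightarrow> ex (\<lambda>\<sigma>. f \<sigma> + g \<sigma>) = ex f + ex g"
  unfolding ex_def by (simp add: nice_integrable)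

lemma ex_cmult: "ex (\<lambda>\<sigma>. c * f \<sigma>) = c * ex f"
  unfolding ex_def by simp

lemma ex_le: "nice f \<Longrightarrow> nice g \<Longrightarrow> (\<And>\<sigma>. \<sigma> \<in> space \<Omega> \<Longrightarrow> f \<sigma> \<le> g \<sigma>) \<Longrightarrow> ex f \<le> ex g"
  unfolding ex_def by (rule integral_mono) (auto simp: nice_integrable space_gibbs)

lemma ex_nonneg: "(\<And>\<sigma>. \<sigma> \<in> space \<Omega> \<Longrightarrow> 0 \<le> f \<sigma>) \<Longrightarrow> 0 \<le> ex f"
  unfolding ex_def by (rule Bochner_Integration.integral_nonneg) (simp add: space_gibbs)

lemma ex_sum': "(\<And>i. i \<in> A \<Longrightarrow> nice (f i)) \<Longrightarrow> ex (\<lambda>\<sigma>. \<Sum>i\<in>A. f i \<sigma>) = (\<Sum>i\<in>A. ex (f i))"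
  by (rule ex_sum) (rule nice_integrable)

lemma Q_mem: "\<sigma> \<in> space \<Omega> \<Longrightarrow> Q \<sigma> \<in> {0..\<beta>\<^sup>2}" and Qc_mem: "\<sigma> \<in> space \<Omega> \<Longrightarrow> Qc i \<sigma> \<in> {0..\<beta>\<^sup>2}"
  using Q_nonneg Q_le Qc_nonneg Qc_le by auto

section \<open>Fluctuations of conditionally centred sums\<close>

lemma mean_fluctuation:
  assumes L: "0 \<le> L" "\<And>x y. x \<in> {0..\<beta>\<^sup>2} \<Longrightarrow> y \<in> {0..\<beta>\<^sup>2} \<Longrightarrow> \<bar>mean_proj N x - mean_proj N y\<bar> \<le> L * \<bar>x - y\<bar>"
  shows "ex (\<lambda>\<sigma>. (\<Sum>i\<in>I. t i \<sigma> - mean_proj N (Qc i \<sigma>))\<^sup>2) \<le> ((2 * \<beta>)\<^sup>2 + 2 * \<beta> * (2 * \<beta> + 4 * \<beta>\<^sup>2 * L)) * real n"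
proof (rule ex_sum_square)
  fix i assume i: "i \<in> I"
  have nc: "nice (\<lambda>\<sigma>. t i \<sigma> - mean_proj N (Qc i \<sigma>))" by (intro nice_intros i)
  show "(\<lambda>\<sigma>. t i \<sigma> - mean_proj N (Qc i \<sigma>)) \<in> borel_measurable \<Omega>"
    using nc unfolding nice_def by blast
  fix \<sigma> assume \<sigma>: "\<sigma> \<in> space \<Omega>"
  have m: "0 \<le> mean_proj N (Qc i \<sigma>)" "mean_proj N (Qc i \<sigma>) \<le> \<beta>"
    using mean_proj_bounds[OF N Qc_nonneg Qc_le[OF \<sigma>]] \<beta> by auto
  show "\<bar>t i \<sigma> - mean_proj N (Qc i \<sigma>)\<bar> \<le> 2 * \<beta>"
    using m t_le[OF \<sigma> i] by linarith
  have "resample i (\<lambda>\<sigma> s. t i (\<sigma>(i := s)) - mean_proj N (Qc i (\<sigma>(i := s)))) \<sigma>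
      = resample i (\<lambda>\<sigma> s. dot N (cavity i \<sigma>) s - mean_proj N (Qc i \<sigma>)) \<sigma>"
    unfolding t_update Qc_update ..
  also have "\<dots> = 0"
    by (subst resample_diff) (intro nice2_intros nice_intros \<sigma> | simp add: resample_dot)+
  finally show "resample i (\<lambda>\<sigma> s. t i (\<sigma>(i := s)) - mean_proj N (Qc i (\<sigma>(i := s)))) \<sigma> = 0" .
next
  fix i j \<sigma> s assume ij: "i \<in> I" "j \<in> I" "i \<noteq> j" and \<sigma>: "\<sigma> \<in> space \<Omega>" and s: "s \<in> space \<mu>"
  have \<tau>: "\<sigma>(i := s) \<in> space \<Omega>" by (rule update_mem[OF \<sigma> ij(1) s])
  have "\<bar>mean_proj N (Qc j \<sigma>) - mean_proj N (Qc j (\<sigma>(i := s)))\<bar> \<le> L * \<bar>Qc j \<sigma> - Qc j (\<sigma>(i := s))\<bar>"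
    by (rule L(2)[OF Qc_mem[OF \<sigma>] Qc_mem[OF \<tau>]])
  also have "\<dots> \<le> L * (4 * \<beta>\<^sup>2 / real n)" by (rule mult_left_mono[OF Qc_diff[OF ij \<sigma> s] L(1)])
  finally show "\<bar>t j \<sigma> - mean_proj N (Qc j \<sigma>) - (t j (\<sigma>(i := s)) - mean_proj N (Qc j (\<sigma>(i := s))))\<bar>
     \<le> (2 * \<beta> + 4 * \<beta>\<^sup>2 * L) / real n"
    using t_diff[OF ij \<sigma> s] by (simp add: add_divide_distrib mult_ac)
qed (use \<beta> L in auto)

text \<open>Within \<open>ex_sum_square\<close>, a single term is at most \<open>\<beta>^2\<close>;
  the influence of another spin is \<open>4 * \<beta>^2\<close> through the factorised difference of
  squares and \<open>4 * \<beta>^2 * L\<close> through \<open>Qc j\<close>, both over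
  \<open>n\<close>.\<close>

lemma square_fluctuation:
  assumes L: "0 \<le> L" "\<And>x y. x \<in> {0..\<beta>\<^sup>2} \<Longrightarrow> y \<in> {0..\<beta>\<^sup>2} \<Longrightarrow> \<bar>second_moment N x - second_moment N y\<bar> \<le> L * \<bar>x - y\<bar>"
  shows "ex (\<lambda>\<sigma>. (\<Sum>i\<in>I. (t i \<sigma>)\<^sup>2 - second_moment N (Qc i \<sigma>))\<^sup>2) \<le> ((\<beta>\<^sup>2)\<^sup>2 + \<beta>\<^sup>2 * (4 * \<beta>\<^sup>2 + 4 * \<beta>\<^sup>2 * L)) * real n"
proof (rule ex_sum_square)
  fix i assume i: "i \<in> I"
  have nc: "nice (\<lambda>\<sigma>. (t i \<sigma>)\<^sup>2 - second_moment N (Qc i \<sigma>))" by (intro nice_intros i)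
  show "(\<lambda>\<sigma>. (t i \<sigma>)\<^sup>2 - second_moment N (Qc i \<sigma>)) \<in> borel_measurable \<Omega>"
    using nc unfolding nice_def by blast
  fix \<sigma> assume \<sigma>: "\<sigma> \<in> space \<Omega>"
  have m: "0 \<le> second_moment N (Qc i \<sigma>)" "second_moment N (Qc i \<sigma>) \<le> \<beta>\<^sup>2"
    using mean_proj_bounds[OF N Qc_nonneg Qc_le[OF \<sigma>]] \<beta> by auto
  have "(t i \<sigma>)\<^sup>2 \<le> \<beta>\<^sup>2" using t_le[OF \<sigma> i] \<beta> by (simp add: abs_le_square_iff[symmetric])
  thus "\<bar>(t i \<sigma>)\<^sup>2 - second_moment N (Qc i \<sigma>)\<bar> \<le> \<beta>\<^sup>2" using m zero_le_power2[of "t i \<sigma>"] by linarith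
  have "resample i (\<lambda>\<sigma> s. (t i (\<sigma>(i := s)))\<^sup>2 - second_moment N (Qc i (\<sigma>(i := s)))) \<sigma>
      = resample i (\<lambda>\<sigma> s. (dot N (cavity i \<sigma>) s)\<^sup>2 - second_moment N (Qc i \<sigma>)) \<sigma>"
    unfolding t_update Qc_update ..
  also have "\<dots> = 0"
    by (subst resample_diff) (intro nice2_intros nice_intros \<sigma> | simp add: resample_dot_sq)+
  finally show "resample i (\<lambda>\<sigma> s. (t i (\<sigma>(i := s)))\<^sup>2 - second_moment N (Qc i (\<sigma>(i := s)))) \<sigma> = 0" .
next
  fix i j \<sigma> s assume ij: "i \<in> I" "j \<in> I" "i \<noteq> j" and \<sigma>: "\<sigma> \<in> space \<Omega>" and s: "s \<in> space \<mu>"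
  let ?\<tau> = "\<sigma>(i := s)"
  have \<tau>: "?\<tau> \<in> space \<Omega>" by (rule update_mem[OF \<sigma> ij(1) s])
  have "\<bar>second_moment N (Qc j \<sigma>) - second_moment N (Qc j ?\<tau>)\<bar> \<le> L * \<bar>Qc j \<sigma> - Qc j ?\<tau>\<bar>"
    by (rule L(2)[OF Qc_mem[OF \<sigma>] Qc_mem[OF \<tau>]])
  also have "\<dots> \<le> L * (4 * \<beta>\<^sup>2 / real n)" by (rule mult_left_mono[OF Qc_diff[OF ij \<sigma> s] L(1)])
  finally have 1: "\<bar>second_moment N (Qc j \<sigma>) - second_moment N (Qc j ?\<tau>)\<bar> \<le> 4 * \<beta>\<^sup>2 * L / real n"
    by (simp add: mult_ac)
  have "\<bar>(t j \<sigma>)\<^sup>2 - (t j ?\<tau>)\<^sup>2\<bar> = \<bar>t j \<sigma> - t j ?\<tau>\<bar> * \<bar>t j \<sigma> + t j ?\<tau>\<bar>"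
    by (simp add: power2_eq_square abs_mult[symmetric] algebra_simps)
  also have "\<dots> \<le> 2 * \<beta> / real n * (2 * \<beta>)"
    using t_diff[OF ij \<sigma> s] t_le[OF \<sigma> ij(2)] t_le[OF \<tau> ij(2)] \<beta> n0 by (intro mult_mono) auto
  finally have 2: "\<bar>(t j \<sigma>)\<^sup>2 - (t j ?\<tau>)\<^sup>2\<bar> \<le> 4 * \<beta>\<^sup>2 / real n"
    by (simp add: power2_eq_square mult_ac)
  show "\<bar>(t j \<sigma>)\<^sup>2 - second_moment N (Qc j \<sigma>) - ((t j ?\<tau>)\<^sup>2 - second_moment N (Qc j ?\<tau>))\<bar>
     \<le> (4 * \<beta>\<^sup>2 + 4 * \<beta>\<^sup>2 * L) / real n"
    using 1 2 by (simp add: add_divide_distrib)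
qed (use \<beta> L in auto)

end

section \<open>Concentration\<close>

lemma sum_squared_le: "(a + b)\<^sup>2 \<le> 2 * a\<^sup>2 + 2 * (b\<^sup>2 :: real)"
  using zero_le_power2[of "a - b"] by (simp add: power2_eq_square algebra_simps)

context vector_model
begin

text \<open>\<open>Q\<close> is quadratic in the spins, so removing each spin once costs
  \<open>2 * Q\<close> in total to leading order; hence \<open>real n - 2\<close>.\<close>

lemma sum_Qc:
  assumes \<sigma>: "\<sigma> \<in> space \<Omega>"
  shows "(\<Sum>i\<in>I. Qc i \<sigma>) = (real n - 2) * Q \<sigma> + \<beta>\<^sup>2 / real n"
proof -
  have "(\<Sum>i\<in>I. Qc i \<sigma>) = (\<Sum>i\<in>I. Q \<sigma> - 2 * \<beta> / real n * t i \<sigma> - (\<beta> / real n)\<^sup>2)"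
    by (rule sum.cong[OF refl]) (use Q_cavity[OF \<sigma>] in auto)
  also have "\<dots> = real n * Q \<sigma> - 2 * \<beta> / real n * (\<Sum>i\<in>I. t i \<sigma>) - real n * (\<beta> / real n)\<^sup>2"
    by (simp add: sum_subtractf sum_distrib_left)
  also have "\<dots> = (real n - 2) * Q \<sigma> + \<beta>\<^sup>2 / real n"
    unfolding sum_t[OF \<sigma>] using n0 \<beta> by (simp add: field_simps power2_eq_square)
  finally show ?thesis .
qed

lemma Q_update:
  assumes "\<sigma> \<in> space \<Omega>" "i \<in> I" "s \<in> space \<mu>"
  shows "Q (\<sigma>(i := s)) - Q \<sigma> = 2 * \<beta> / real n * (dot N (cavity i \<sigma>) s - t i \<sigma>)"
  unfolding Q_cavity[OF assms(1,2)] Q_cavity[OF update_mem[OF assms] assms(2)] Qc_update t_update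
  by (simp add: algebra_simps)

text \<open>The cavity field is the field minus \<open>\<beta> / n\<close> times a unit vector. Near
  \<open>Q = 0\<close> this bound makes the squared increment of \<open>Q\<close> of order
  \<open>(Q + 1/n) / n^2\<close>, proportional to the weight \<open>Q + 1/n\<close> that also
  measures the drift.\<close>

lemma Qc_le_Q:
  assumes "\<sigma> \<in> space \<Omega>" "i \<in> I"
  shows "Qc i \<sigma> \<le> 2 * Q \<sigma> + 2 * \<beta>\<^sup>2 / real n * (1 / real n)"
proof -
  let ?a = "dot N (field \<sigma>) (\<sigma> i)" and ?c = "\<beta> / real n"
  have "Q \<sigma> = Qc i \<sigma> + 2 * ?c * (?a - ?c) + ?c\<^sup>2"
    unfolding Q_cavity[OF assms] field_dot[OF assms] by simp
  hence e: "Qc i \<sigma> = Q \<sigma> - 2 * ?c * ?a + ?c\<^sup>2" by (simp add: algebra_simps power2_eq_square)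
  have "\<bar>?a\<bar> \<le> nrm N (field \<sigma>)"
    using abs_dot_le[of N "field \<sigma>" "\<sigma> i"] nrm_spin[OF spin_mem[OF assms]] by simp
  from power_mono[OF this, of 2] have a: "?a\<^sup>2 \<le> Q \<sigma>" unfolding Q_def dot_self by simp
  have "0 \<le> (?c + ?a)\<^sup>2" by simp
  hence "- 2 * ?c * ?a \<le> ?c\<^sup>2 + ?a\<^sup>2" by (simp add: power2_eq_square algebra_simps)
  hence "Qc i \<sigma> \<le> 2 * Q \<sigma> + 2 * ?c\<^sup>2" using e a by linarith
  thus ?thesis by (simp add: power2_eq_square)
qed

text \<open>The regime of small \<open>Q\<close> is unstable: there the resampling dynamics has an outward drift of order
  \<open>Q + 1/n\<close>, and testing reversibility against a decreasing function of \<open>Q\<close> gains a factor \<open>1/n\<close>.\<close>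

lemma small_Q_recursion:
  assumes \<eta>: "0 < \<eta>" "\<And>q. 0 \<le> q \<Longrightarrow> q \<le> \<epsilon> \<Longrightarrow> (1 + \<eta>) / \<beta> \<le> logd N q"
    and e: "0 < e" "2 * e + 3 * \<beta>\<^sup>2 / real n \<le> \<epsilon>" and big: "4 * (1 + \<eta>) / \<eta> \<le> real n"
    and c0: "c0 = min (\<eta> / (2 * \<beta>)) \<beta>"
  shows "ex (\<lambda>\<sigma>. (Q \<sigma> + 1 / real n) * indicator {..<e} (Q \<sigma>)) \<le>
    16 * \<beta> * (1 + \<beta>\<^sup>2) / (c0 * e * real n) * ex (\<lambda>\<sigma>. (Q \<sigma> + 1 / real n) * indicator {..<2 * e} (Q \<sigma>))"
    (is "ex ?A1 \<le> _ * ex ?A2")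
proof -
  \<comment> \<open>Decreasing and Lipschitz with constant \<open>1 / (2 * e)\<close>, zero from
    \<open>2 * e\<close> on, and at least 1/2 on \<open>{0..e}\<close>.\<close>
  define \<psi> where "\<psi> = (\<lambda>q::real. max 0 (1 - q / (2 * e)))"
  have c\<psi>: "continuous_on UNIV \<psi>" unfolding \<psi>_def using e by (intro continuous_intros) auto
  define P where "P = (\<lambda>\<sigma>. \<psi> (Q \<sigma>))"
  have nP: "nice P" unfolding P_def by (rule nice_continuous[OF c\<psi> nice_Q])
  let ?J = "\<lambda>\<sigma>. indicator {..<2 * e} (Q \<sigma>) :: real"
  have step: "ex (resample i (\<lambda>\<sigma> s. (Q (\<sigma>(i := s)) - Q \<sigma>) * P \<sigma>)) \<le> 16 * \<beta>\<^sup>2 * (1 + \<beta>\<^sup>2) / (e * (real n)\<^sup>2) * ex ?A2"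
    if i: "i \<in> I" for i
  proof -
    let ?F = "\<lambda>\<sigma> s. (Q (\<sigma>(i := s)) - Q \<sigma>) * P \<sigma>"
    let ?F' = "\<lambda>\<sigma> s. (Q \<sigma> - Q (\<sigma>(i := s))) * P (\<sigma>(i := s))"
    \<comment> \<open>\<open>?H\<close> and \<open>?H'\<close> arise from each other by exchanging
      the old and the new configuration, so their means agree. Both are needed, as possibly only one
      end of a jump lies below \<open>2 * e\<close>.\<close>
    let ?H = "\<lambda>\<sigma> s. 1 / (2 * e) * (Q (\<sigma>(i := s)) - Q \<sigma>)\<^sup>2 * ?J \<sigma>"
    let ?H' = "\<lambda>\<sigma> s. 1 / (2 * e) * (Q \<sigma> - Q (\<sigma>(i := s)))\<^sup>2 * ?J (\<sigma>(i := s))"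
    have nJ': "nice2 (\<lambda>\<sigma> s. ?J (\<sigma>(i := s)))" by (rule nice2_update[OF i nice_indicator])
    have nF: "nice2 ?F" "nice2 ?F'" by (intro nice2_intros i nice_intros nP)+
    have nH: "nice2 ?H" by (intro nice2_intros i nice_intros)
    have nH': "nice2 ?H'" by (intro nice2_mult nJ' nice2_intros i nice_intros)
    have bF: "ex (resample i ?F) = ex (resample i ?F')" using balance[OF i nF(1)] by simp
    have bH: "ex (resample i ?H) = ex (resample i ?H')" using balance[OF i nH] by simp
    \<comment> \<open>Reversibility symmetrises the drift term into a product of the increments of
      \<open>Q\<close> and of \<open>P\<close>. Being quadratic in the jump, it is smaller by a
      factor \<open>1/n\<close>.\<close>
    have "2 * ex (resample i ?F) = ex (\<lambda>\<sigma>. resample i ?F \<sigma> + resample i ?F' \<sigma>)"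
      using bF nF by (simp add: ex_add nice_resample)
    also have "\<dots> \<le> ex (\<lambda>\<sigma>. resample i ?H \<sigma> + resample i ?H' \<sigma>)"
    proof (rule ex_le)
      fix \<sigma> assume \<sigma>: "\<sigma> \<in> space \<Omega>"
      have "resample i ?F \<sigma> + resample i ?F' \<sigma> = resample i (\<lambda>\<sigma> s. ?F \<sigma> s + ?F' \<sigma> s) \<sigma>"
        by (rule resample_add[OF nF \<sigma>, symmetric])
      also have "\<dots> \<le> resample i (\<lambda>\<sigma> s. ?H \<sigma> s + ?H' \<sigma> s) \<sigma>"
      proof (rule resample_mono[OF nice2_add[OF nF] nice2_add[OF nH nH'] \<sigma>])
        fix s
        let ?q = "Q \<sigma>" and ?q' = "Q (\<sigma>(i := s))"
        have lip: "\<bar>\<psi> ?q - \<psi> ?q'\<bar> \<le> 1 / (2 * e) * \<bar>?q' - ?q\<bar>"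
        proof -
          have "\<bar>max 0 a - max 0 b\<bar> \<le> \<bar>a - b\<bar>" for a b :: real by linarith
          from this[of "1 - ?q / (2 * e)" "1 - ?q' / (2 * e)"]
          have "\<bar>\<psi> ?q - \<psi> ?q'\<bar> \<le> \<bar>(?q' - ?q) / (2 * e)\<bar>"
            unfolding \<psi>_def by (simp add: diff_divide_distrib)
          thus ?thesis using e by (simp add: abs_divide)
        qed
        have "(?q' - ?q) * (\<psi> ?q - \<psi> ?q') \<le> \<bar>?q' - ?q\<bar> * \<bar>\<psi> ?q - \<psi> ?q'\<bar>"
          by (simp add: abs_mult[symmetric])
        also have "\<dots> \<le> 1 / (2 * e) * (?q' - ?q)\<^sup>2 * (?J \<sigma> + ?J (\<sigma>(i := s)))"
        proof (cases "2 * e \<le> ?q \<and> 2 * e \<le> ?q'")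
          case True
          hence "\<psi> ?q = 0" "\<psi> ?q' = 0" unfolding \<psi>_def using e by (auto simp: field_simps)
          thus ?thesis using e by simp
        next
          case False
          have "\<bar>?q' - ?q\<bar> * \<bar>\<psi> ?q - \<psi> ?q'\<bar> \<le> \<bar>?q' - ?q\<bar> * (1 / (2 * e) * \<bar>?q' - ?q\<bar>)"
            by (rule mult_left_mono[OF lip]) simp
          also have "\<dots> = 1 / (2 * e) * \<bar>?q' - ?q\<bar>\<^sup>2 * 1"
            by (simp only: power2_eq_square mult_ac)
          also have "\<dots> \<le> 1 / (2 * e) * \<bar>?q' - ?q\<bar>\<^sup>2 * (?J \<sigma> + ?J (\<sigma>(i := s)))"
            using False e by (intro mult_left_mono) (auto split: split_indicator)
          finally show ?thesis by simp
        qed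
        finally show "?F \<sigma> s + ?F' \<sigma> s \<le> ?H \<sigma> s + ?H' \<sigma> s"
          unfolding P_def by (simp add: algebra_simps power2_commute)
      qed
      also have "\<dots> = resample i ?H \<sigma> + resample i ?H' \<sigma>"
        by (rule resample_add[OF nH nH' \<sigma>])
      finally show "resample i ?F \<sigma> + resample i ?F' \<sigma> \<le> resample i ?H \<sigma> + resample i ?H' \<sigma>" .
    qed (intro nice_add nice_resample nF nH nH')+
    also have "\<dots> = 2 * ex (resample i ?H)"
      using bH nH nH' by (simp add: ex_add nice_resample)
    finally have "ex (resample i ?F) \<le> ex (resample i ?H)" by simp
    also have "\<dots> \<le> ex (\<lambda>\<sigma>. 16 * \<beta>\<^sup>2 * (1 + \<beta>\<^sup>2) / (e * (real n)\<^sup>2) * ?A2 \<sigma>)"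
    proof (rule ex_le)
      fix \<sigma> assume \<sigma>: "\<sigma> \<in> space \<Omega>"
      have "resample i ?H \<sigma> \<le> resample i (\<lambda>\<sigma> s. 16 * \<beta>\<^sup>2 * (1 + \<beta>\<^sup>2) / (e * (real n)\<^sup>2) * ?A2 \<sigma>) \<sigma>"
      proof (rule resample_mono[OF nH _ \<sigma>])
        fix s assume s: "s \<in> space \<mu>"
        let ?d = "dot N (cavity i \<sigma>) s"
        have "?d\<^sup>2 \<le> Qc i \<sigma>" "(t i \<sigma>)\<^sup>2 \<le> Qc i \<sigma>"
          using dot_cavity_sq[OF s] dot_cavity_sq[OF spin_mem[OF \<sigma> i]] unfolding t_def by auto
        moreover have "(?d - t i \<sigma>)\<^sup>2 \<le> 2 * ?d\<^sup>2 + 2 * (t i \<sigma>)\<^sup>2"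
          using zero_le_power2[of "?d + t i \<sigma>"] by (simp add: power2_eq_square algebra_simps)
        ultimately have "(?d - t i \<sigma>)\<^sup>2 \<le> 4 * Qc i \<sigma>" by linarith
        also have "\<dots> \<le> 4 * (2 * Q \<sigma> + 2 * \<beta>\<^sup>2 / real n * (1 / real n))"
          by (rule mult_left_mono[OF Qc_le_Q[OF \<sigma> i]]) simp
        also have "\<dots> \<le> 8 * (1 + \<beta>\<^sup>2) * (Q \<sigma> + 1 / real n)"
        proof -
          have g: "4 * (2 * a + 2 * c * x) \<le> 8 * (1 + c) * (a + x)" if "0 \<le> a" "0 \<le> x" "0 \<le> c" for a x c :: real
            using mult_nonneg_nonneg[OF that(3,1)] that by (simp add: algebra_simps)
          have "2 * \<beta>\<^sup>2 / real n * (1 / real n) \<le> 2 * \<beta>\<^sup>2 * (1 / real n)"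
            using n by (intro mult_right_mono) (auto simp: divide_le_eq mult_le_cancel_left1)
          hence "4 * (2 * Q \<sigma> + 2 * \<beta>\<^sup>2 / real n * (1 / real n)) \<le> 4 * (2 * Q \<sigma> + 2 * \<beta>\<^sup>2 * (1 / real n))"
            by (intro mult_left_mono add_left_mono) auto
          also have "\<dots> \<le> 8 * (1 + \<beta>\<^sup>2) * (Q \<sigma> + 1 / real n)"
            by (rule g) (use Q_nonneg in auto)
          finally show ?thesis .
        qed
        finally have b: "(?d - t i \<sigma>)\<^sup>2 \<le> 8 * (1 + \<beta>\<^sup>2) * (Q \<sigma> + 1 / real n)" .
        have "(Q (\<sigma>(i := s)) - Q \<sigma>)\<^sup>2 = (2 * \<beta> / real n)\<^sup>2 * (?d - t i \<sigma>)\<^sup>2"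
          unfolding Q_update[OF \<sigma> i s] by (simp only: power_mult_distrib)
        also have "\<dots> \<le> (2 * \<beta> / real n)\<^sup>2 * (8 * (1 + \<beta>\<^sup>2) * (Q \<sigma> + 1 / real n))"
          by (rule mult_left_mono[OF b]) simp
        finally have "1 / (2 * e) * (Q (\<sigma>(i := s)) - Q \<sigma>)\<^sup>2 * ?J \<sigma>
          \<le> 1 / (2 * e) * ((2 * \<beta> / real n)\<^sup>2 * (8 * (1 + \<beta>\<^sup>2) * (Q \<sigma> + 1 / real n))) * ?J \<sigma>"
          using e by (intro mult_right_mono mult_left_mono) auto
        also have "\<dots> = 16 * \<beta>\<^sup>2 * (1 + \<beta>\<^sup>2) / (e * (real n)\<^sup>2) * ?A2 \<sigma>"
          by (simp add: power_divide power_mult_distrib)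
        finally show "?H \<sigma> s \<le> 16 * \<beta>\<^sup>2 * (1 + \<beta>\<^sup>2) / (e * (real n)\<^sup>2) * ?A2 \<sigma>" .
      qed (intro nice2_fst nice_intros)
      thus "resample i ?H \<sigma> \<le> 16 * \<beta>\<^sup>2 * (1 + \<beta>\<^sup>2) / (e * (real n)\<^sup>2) * ?A2 \<sigma>" by simp
    qed (intro nice_resample nH nice_intros)+
    also have "\<dots> = 16 * \<beta>\<^sup>2 * (1 + \<beta>\<^sup>2) / (e * (real n)\<^sup>2) * ex ?A2" by (rule ex_cmult)
    finally show ?thesis .
  qed
  have c0p: "0 < c0" unfolding c0 using \<eta> \<beta> by simp
  have "\<beta> * c0 * ex ?A1 = ex (\<lambda>\<sigma>. \<beta> * c0 * ?A1 \<sigma>)" by (rule ex_cmult[symmetric])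
  also have "\<dots> \<le> ex (\<lambda>\<sigma>. \<Sum>i\<in>I. resample i (\<lambda>\<sigma> s. (Q (\<sigma>(i := s)) - Q \<sigma>) * P \<sigma>) \<sigma>)"
  proof (rule ex_le)
    fix \<sigma> assume \<sigma>: "\<sigma> \<in> space \<Omega>"
    have "resample i (\<lambda>\<sigma> s. (Q (\<sigma>(i := s)) - Q \<sigma>) * P \<sigma>) \<sigma> = P \<sigma> * (2 * \<beta> / real n * (mean_proj N (Qc i \<sigma>) - t i \<sigma>))"
      if i: "i \<in> I" for i
    proof -
      have "resample i (\<lambda>\<sigma> s. (Q (\<sigma>(i := s)) - Q \<sigma>) * P \<sigma>) \<sigma> =
         resample i (\<lambda>\<sigma> s. (P \<sigma> * (2 * \<beta> / real n)) * (dot N (cavity i \<sigma>) s - t i \<sigma>)) \<sigma>"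
        by (rule resample_cong) (simp only: Q_update[OF \<sigma> i] mult_ac)
      also have "\<dots> = (P \<sigma> * (2 * \<beta> / real n)) * resample i (\<lambda>\<sigma> s. dot N (cavity i \<sigma>) s - t i \<sigma>) \<sigma>"
        by (rule resample_cmult)
      also have "resample i (\<lambda>\<sigma> s. dot N (cavity i \<sigma>) s - t i \<sigma>) \<sigma> = mean_proj N (Qc i \<sigma>) - t i \<sigma>"
        by (subst resample_diff[OF nice2_dot nice2_fst[OF nice_t[OF i]] \<sigma>]) (simp add: resample_dot)
      finally show ?thesis by (simp only: mult.assoc)
    qed
    hence "(\<Sum>i\<in>I. resample i (\<lambda>\<sigma> s. (Q (\<sigma>(i := s)) - Q \<sigma>) * P \<sigma>) \<sigma>) =
        (\<Sum>i\<in>I. P \<sigma> * (2 * \<beta> / real n * (mean_proj N (Qc i \<sigma>) - t i \<sigma>)))"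
      by (intro sum.cong) auto
    also have "\<dots> = P \<sigma> * (2 * \<beta> / real n) * (\<Sum>i\<in>I. mean_proj N (Qc i \<sigma>) - t i \<sigma>)"
      by (simp only: sum_distrib_left mult.assoc)
    finally have S: "(\<Sum>i\<in>I. resample i (\<lambda>\<sigma> s. (Q (\<sigma>(i := s)) - Q \<sigma>) * P \<sigma>) \<sigma>) =
        P \<sigma> * (2 * \<beta> / real n) * (\<Sum>i\<in>I. mean_proj N (Qc i \<sigma>) - t i \<sigma>)" .
    have "\<beta> * c0 * ?A1 \<sigma> \<le> P \<sigma> * (2 * \<beta> / real n) * (\<Sum>i\<in>I. mean_proj N (Qc i \<sigma>) - t i \<sigma>)"
    proof (cases "Q \<sigma> < 2 * e")
      case False
      hence "P \<sigma> = 0" unfolding P_def \<psi>_def using e by (auto simp: field_simps)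
      thus ?thesis using False e by simp
    next
      case True
      \<comment> \<open>The supercritical slope \<open>(1 + \<eta>) / \<beta>\<close> supplies the
        part proportional to \<open>Q\<close>, and the constant \<open>\<beta>\<close> of
        \<open>sum_t\<close> the part of order 1; \<open>c0\<close> is the smaller of the two
        rates.\<close>
      have "real n * c0 * (Q \<sigma> + 1 / real n) \<le> (\<Sum>i\<in>I. mean_proj N (Qc i \<sigma>) - t i \<sigma>)"
      proof -
        have "(\<Sum>i\<in>I. (1 + \<eta>) / \<beta> * Qc i \<sigma>) \<le> (\<Sum>i\<in>I. mean_proj N (Qc i \<sigma>))"
        proof (rule sum_mono)
          fix i assume i: "i \<in> I"
          have "Qc i \<sigma> \<le> \<epsilon>" using Q_Qc[OF \<sigma> i] True e by linarith
          from mult_right_mono[OF \<eta>(2)[OF Qc_nonneg this] Qc_nonneg[of i \<sigma>]]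
          show "(1 + \<eta>) / \<beta> * Qc i \<sigma> \<le> mean_proj N (Qc i \<sigma>)"
            unfolding mean_proj_def by (simp add: mult.commute)
        qed
        hence "(1 + \<eta>) / \<beta> * ((real n - 2) * Q \<sigma> + \<beta>\<^sup>2 / real n) - (real n / \<beta> * Q \<sigma> - \<beta>)
           \<le> (\<Sum>i\<in>I. mean_proj N (Qc i \<sigma>) - t i \<sigma>)"
          unfolding sum_distrib_left[symmetric] sum_Qc[OF \<sigma>] sum_subtractf sum_t[OF \<sigma>] by simp
        moreover have "real n * c0 * (Q \<sigma> + 1 / real n) \<le>
           (1 + \<eta>) / \<beta> * ((real n - 2) * Q \<sigma> + \<beta>\<^sup>2 / real n) - (real n / \<beta> * Q \<sigma> - \<beta>)"
        proof -
          \<comment> \<open>By \<open>big\<close>, the 2 in \<open>real n - 2\<close> costs at most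
            half of the gain \<open>\<eta>\<close>.\<close>
          have "4 * (1 + \<eta>) \<le> real n * \<eta>" using big \<eta> by (simp add: field_simps)
          hence "real n * (\<eta> / 2) \<le> real n * \<eta> - 2 * (1 + \<eta>)" by (simp add: field_simps)
          from mult_right_mono[OF this, of "Q \<sigma> / \<beta>"]
          have "real n * (\<eta> / 2) * (Q \<sigma> / \<beta>) \<le> (real n * \<eta> - 2 * (1 + \<eta>)) * (Q \<sigma> / \<beta>)"
            using Q_nonneg[of \<sigma>] \<beta> by simp
          moreover have "c0 * (real n * Q \<sigma>) \<le> (\<eta> / (2 * \<beta>)) * (real n * Q \<sigma>)"
            using Q_nonneg[of \<sigma>] by (intro mult_right_mono) (auto simp: c0)
          moreover have "c0 \<le> \<beta>" by (simp add: c0)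
          moreover have "0 \<le> (1 + \<eta>) / \<beta> * (\<beta>\<^sup>2 / real n)" using \<eta> \<beta> by auto
          moreover have "(1 + \<eta>) / \<beta> * ((real n - 2) * Q \<sigma>) - real n / \<beta> * Q \<sigma> = (real n * \<eta> - 2 * (1 + \<eta>)) * (Q \<sigma> / \<beta>)"
            using \<beta> by (simp add: field_simps)
          moreover have "real n * c0 * (Q \<sigma> + 1 / real n) = c0 * (real n * Q \<sigma>) + c0"
            using n0 by (simp add: field_simps)
          moreover have "(\<eta> / (2 * \<beta>)) * (real n * Q \<sigma>) = real n * (\<eta> / 2) * (Q \<sigma> / \<beta>)" by simp
          ultimately show ?thesis unfolding distrib_left[of "(1 + \<eta>) / \<beta>"] by linarith
        qed
        ultimately show ?thesis by linarith
      qed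
      hence f1: "P \<sigma> * (2 * \<beta> / real n) * (real n * c0 * (Q \<sigma> + 1 / real n)) \<le>
         P \<sigma> * (2 * \<beta> / real n) * (\<Sum>i\<in>I. mean_proj N (Qc i \<sigma>) - t i \<sigma>)"
        unfolding P_def \<psi>_def using \<beta> n0 by (intro mult_left_mono) auto
      have f2: "P \<sigma> * (2 * \<beta> / real n) * (real n * c0 * (Q \<sigma> + 1 / real n)) = (2 * P \<sigma>) * (\<beta> * c0 * (Q \<sigma> + 1 / real n))"
        using n0 by simp
      \<comment> \<open>Uses that \<open>P\<close> is at least 1/2 where
        \<open>Q \<sigma> < e\<close>.\<close>
      have f3: "(indicator {..<e} (Q \<sigma>)) * (\<beta> * c0 * (Q \<sigma> + 1 / real n)) \<le> (2 * P \<sigma>) * (\<beta> * c0 * (Q \<sigma> + 1 / real n))"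
      proof (rule mult_right_mono)
        show "indicator {..<e} (Q \<sigma>) \<le> 2 * P \<sigma>"
          unfolding P_def \<psi>_def using e by (auto simp: field_simps split: split_indicator)
        show "0 \<le> \<beta> * c0 * (Q \<sigma> + 1 / real n)" using \<beta> c0p Q_nonneg[of \<sigma>] n0 by auto
      qed
      have "\<beta> * c0 * ?A1 \<sigma> = (indicator {..<e} (Q \<sigma>)) * (\<beta> * c0 * (Q \<sigma> + 1 / real n))" by (simp only: mult_ac)
      also have "\<dots> \<le> P \<sigma> * (2 * \<beta> / real n) * (\<Sum>i\<in>I. mean_proj N (Qc i \<sigma>) - t i \<sigma>)"
        by (rule order_trans[OF f3 f1[unfolded f2]])
      finally show ?thesis .
    qed
    thus "\<beta> * c0 * ?A1 \<sigma> \<le> (\<Sum>i\<in>I. resample i (\<lambda>\<sigma> s. (Q (\<sigma>(i := s)) - Q \<sigma>) * P \<sigma>) \<sigma>)"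
      unfolding S .
  qed (intro nice_intros nice_resample nice2_intros nP | assumption)+
  also have "\<dots> = (\<Sum>i\<in>I. ex (resample i (\<lambda>\<sigma> s. (Q (\<sigma>(i := s)) - Q \<sigma>) * P \<sigma>)))"
    by (rule ex_sum') (intro nice_resample nice2_intros nice_intros nP, assumption)
  also have "\<dots> \<le> (\<Sum>i\<in>I. 16 * \<beta>\<^sup>2 * (1 + \<beta>\<^sup>2) / (e * (real n)\<^sup>2) * ex ?A2)"
    by (rule sum_mono) (rule step)
  also have "\<dots> = 16 * \<beta>\<^sup>2 * (1 + \<beta>\<^sup>2) / (e * real n) * ex ?A2"
    using n0 by (simp add: power2_eq_square)
  finally have "\<beta> * c0 * ex ?A1 \<le> 16 * \<beta>\<^sup>2 * (1 + \<beta>\<^sup>2) / (e * real n) * ex ?A2" .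
  hence "ex ?A1 \<le> (16 * \<beta>\<^sup>2 * (1 + \<beta>\<^sup>2) / (e * real n) * ex ?A2) / (\<beta> * c0)"
    by (subst pos_le_divide_eq) (use \<beta> c0p in \<open>auto simp only: mult.commute[of "ex _" "\<beta> * c0"] intro: mult_pos_pos\<close>)
  also have "\<dots> = 16 * \<beta> * (1 + \<beta>\<^sup>2) / (c0 * e * real n) * ex ?A2"
    using \<beta> by (simp add: power2_eq_square mult_ac)
  finally show ?thesis .
qed

text \<open>Two applications of the recursion, at \<open>e\<close> and \<open>2 * e\<close>, bound
  the mean of \<open>Q + 1/n\<close> over \<open>Q < e\<close> by order \<open>1/n^2\<close>, and
  the weight is at least \<open>1/n\<close>. With \<open>e = \<epsilon> / 8\<close> the second
  application reaches up to \<open>4 * e = \<epsilon> / 2\<close>, which leaves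
  \<open>\<epsilon> / 2\<close> for the distance between \<open>Qc\<close> and
  \<open>Q\<close>.\<close>

lemma small_Q_unlikely:
  assumes \<eta>: "0 < \<eta>" "\<And>q. 0 \<le> q \<Longrightarrow> q \<le> \<epsilon> \<Longrightarrow> (1 + \<eta>) / \<beta> \<le> logd N q" and \<epsilon>: "0 < \<epsilon>"
    and c0: "c0 = min (\<eta> / (2 * \<beta>)) \<beta>" and e: "e = \<epsilon> / 8"
    and k: "k = 16 * \<beta> * (1 + \<beta>\<^sup>2) / (c0 * e)"
  shows "ex (\<lambda>\<sigma>. indicator {..<e} (Q \<sigma>)) \<le> (4 * (1 + \<eta>) / \<eta> + 6 * \<beta>\<^sup>2 / \<epsilon> + k\<^sup>2 * (1 + \<beta>\<^sup>2)) / real n"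
proof -
  let ?n0 = "4 * (1 + \<eta>) / \<eta> + 6 * \<beta>\<^sup>2 / \<epsilon>"
  have e0: "0 < e" using e \<epsilon> by simp
  have c0p: "0 < c0" unfolding c0 using \<eta> \<beta> by simp
  have kp: "0 < k" unfolding k using \<beta> c0p e0 by (auto intro!: divide_pos_pos mult_pos_pos add_pos_nonneg)
  let ?A = "\<lambda>e. ex (\<lambda>\<sigma>. (Q \<sigma> + 1 / real n) * indicator {..<e} (Q \<sigma>))"
  show ?thesis
  \<comment> \<open>For small \<open>n\<close> the trivial bound 1 is at most
    \<open>?n0 / n\<close>.\<close>
  proof (cases "?n0 \<le> real n")
    case False
    have "ex (\<lambda>\<sigma>. indicator {..<e} (Q \<sigma>)) \<le> ex (\<lambda>_. 1)"
      by (rule ex_le) (auto intro: nice_intros split: split_indicator)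
    also have "\<dots> \<le> ?n0 / real n" using False n0 by (simp add: field_simps)
    also have "\<dots> \<le> (?n0 + k\<^sup>2 * (1 + \<beta>\<^sup>2)) / real n" using n0 by (intro divide_right_mono) auto
    finally show ?thesis .
  next
    case True
    have t1: "0 \<le> 6 * \<beta>\<^sup>2 / \<epsilon>" "0 \<le> 4 * (1 + \<eta>) / \<eta>" using \<epsilon> \<eta> by auto
    hence n1: "4 * (1 + \<eta>) / \<eta> \<le> real n" and n2: "6 * \<beta>\<^sup>2 / \<epsilon> \<le> real n" using True by linarith+
    have s: "3 * \<beta>\<^sup>2 / real n \<le> \<epsilon> / 2" using n2 n0 \<epsilon> by (simp add: field_simps)
    have r1: "?A e \<le> 16 * \<beta> * (1 + \<beta>\<^sup>2) / (c0 * e * real n) * ?A (2 * e)"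
      by (rule small_Q_recursion[OF \<eta> e0 _ n1 c0]) (use s e \<epsilon> in auto)
    have r2: "?A (2 * e) \<le> 16 * \<beta> * (1 + \<beta>\<^sup>2) / (c0 * (2 * e) * real n) * ?A (2 * (2 * e))"
      by (rule small_Q_recursion[OF \<eta> _ _ n1 c0]) (use s e e0 \<epsilon> in auto)
    have A4: "?A (2 * (2 * e)) \<le> 1 + \<beta>\<^sup>2"
    proof -
      have "?A (2 * (2 * e)) \<le> ex (\<lambda>_. 1 + \<beta>\<^sup>2)"
      proof (rule ex_le)
        fix \<sigma> assume \<sigma>: "\<sigma> \<in> space \<Omega>"
        have "1 / real n \<le> 1" using n by simp
        hence "Q \<sigma> + 1 / real n \<le> 1 + \<beta>\<^sup>2" using Q_le[OF \<sigma>] by linarith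
        moreover have "0 \<le> Q \<sigma> + 1 / real n" using Q_nonneg[of \<sigma>] n0 by auto
        ultimately show "(Q \<sigma> + 1 / real n) * indicator {..<2 * (2 * e)} (Q \<sigma>) \<le> 1 + \<beta>\<^sup>2"
          by (auto split: split_indicator)
      qed (intro nice_intros)+
      thus ?thesis by simp
    qed
    have A0: "0 \<le> ?A x" for x using Q_nonneg n0 by (intro ex_nonneg) (auto split: split_indicator)
    have k1: "16 * \<beta> * (1 + \<beta>\<^sup>2) / (c0 * e * real n) = k / real n" unfolding k by simp
    have k2: "16 * \<beta> * (1 + \<beta>\<^sup>2) / (c0 * (2 * e) * real n) \<le> k / real n"
    proof -
      have "16 * \<beta> * (1 + \<beta>\<^sup>2) / (c0 * (2 * e) * real n) = k / real n / 2" unfolding k by simp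
      also have "\<dots> \<le> k / real n" using kp n0 by (simp add: field_simps)
      finally show ?thesis .
    qed
    have "?A (2 * e) \<le> k / real n * (1 + \<beta>\<^sup>2)"
      using r2 mult_mono[OF k2 A4 _ A0] kp n0 by (auto intro: order_trans)
    hence "k / real n * ?A (2 * e) \<le> k / real n * (k / real n * (1 + \<beta>\<^sup>2))"
      by (rule mult_left_mono) (use kp n0 in simp)
    with r1[unfolded k1] have "?A e \<le> k / real n * (k / real n * (1 + \<beta>\<^sup>2))" by (rule order_trans)
    hence "real n * ?A e \<le> k\<^sup>2 * (1 + \<beta>\<^sup>2) / real n"
      using n0 by (simp add: field_simps power2_eq_square)
    moreover have "ex (\<lambda>\<sigma>. indicator {..<e} (Q \<sigma>)) \<le> ex (\<lambda>\<sigma>. real n * ((Q \<sigma> + 1 / real n) * indicator {..<e} (Q \<sigma>)))"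
    proof (rule ex_le)
      fix \<sigma>
      have "1 \<le> real n * (Q \<sigma> + 1 / real n)" using n0 Q_nonneg[of \<sigma>] by (simp add: distrib_left)
      thus "indicator {..<e} (Q \<sigma>) \<le> real n * ((Q \<sigma> + 1 / real n) * indicator {..<e} (Q \<sigma>))"
        by (auto split: split_indicator)
    qed (intro nice_intros)+
    ultimately have "ex (\<lambda>\<sigma>. indicator {..<e} (Q \<sigma>)) \<le> k\<^sup>2 * (1 + \<beta>\<^sup>2) / real n"
      unfolding ex_cmult by linarith
    also have "\<dots> \<le> (?n0 + k\<^sup>2 * (1 + \<beta>\<^sup>2)) / real n" using n0 t1 by (intro divide_right_mono) auto
    finally show ?thesis .
  qed
qed

text \<open>In the sum over all spins, the self-interaction contributes \<open>\<beta>\<close> and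
  the replacement of every \<open>Qc\<close> by \<open>Q\<close> at most
  \<open>3 * L * \<beta>^2\<close>; both are bounded, against fluctuations of order
  \<open>sqrt n\<close>.\<close>

lemma equation_of_state:
  assumes L: "0 \<le> L" "\<And>x y. x \<in> {0..\<beta>\<^sup>2} \<Longrightarrow> y \<in> {0..\<beta>\<^sup>2} \<Longrightarrow> \<bar>mean_proj N x - mean_proj N y\<bar> \<le> L * \<bar>x - y\<bar>"
  shows "ex (\<lambda>\<sigma>. (Q \<sigma> / \<beta> - mean_proj N (Q \<sigma>))\<^sup>2) \<le>
    (2 * ((2 * \<beta>)\<^sup>2 + 2 * \<beta> * (2 * \<beta> + 4 * \<beta>\<^sup>2 * L)) + 2 * (\<beta> + 3 * L * \<beta>\<^sup>2)\<^sup>2) / real n"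
proof -
  let ?Y = "\<lambda>\<sigma>. \<Sum>i\<in>I. t i \<sigma> - mean_proj N (Qc i \<sigma>)"
  let ?b = "\<beta> + 3 * L * \<beta>\<^sup>2"
  let ?K = "(2 * \<beta>)\<^sup>2 + 2 * \<beta> * (2 * \<beta> + 4 * \<beta>\<^sup>2 * L)"
  have nY: "nice ?Y" by (intro nice_intros) assumption
  have "ex (\<lambda>\<sigma>. (Q \<sigma> / \<beta> - mean_proj N (Q \<sigma>))\<^sup>2) \<le> ex (\<lambda>\<sigma>. 2 / (real n)\<^sup>2 * (?Y \<sigma>)\<^sup>2 + 2 * ?b\<^sup>2 / (real n)\<^sup>2)"
  proof (rule ex_le)
    fix \<sigma> assume \<sigma>: "\<sigma> \<in> space \<Omega>"
    have "real n * (Q \<sigma> / \<beta> - mean_proj N (Q \<sigma>)) = ?Y \<sigma> + \<beta> + (\<Sum>i\<in>I. mean_proj N (Qc i \<sigma>) - mean_proj N (Q \<sigma>))"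
      unfolding sum_subtractf sum_t[OF \<sigma>] by (simp add: algebra_simps)
    moreover have "\<bar>\<Sum>i\<in>I. mean_proj N (Qc i \<sigma>) - mean_proj N (Q \<sigma>)\<bar> \<le> (\<Sum>i\<in>I. L * (3 * \<beta>\<^sup>2 / real n))"
    proof (rule order_trans[OF sum_abs], rule sum_mono)
      fix i assume i: "i \<in> I"
      have "\<bar>mean_proj N (Qc i \<sigma>) - mean_proj N (Q \<sigma>)\<bar> \<le> L * \<bar>Qc i \<sigma> - Q \<sigma>\<bar>"
        by (rule L(2)[OF Qc_mem[OF \<sigma>] Q_mem[OF \<sigma>]])
      also have "\<dots> \<le> L * (3 * \<beta>\<^sup>2 / real n)" by (rule mult_left_mono[OF Q_Qc[OF \<sigma> i] L(1)])
      finally show "\<bar>mean_proj N (Qc i \<sigma>) - mean_proj N (Q \<sigma>)\<bar> \<le> L * (3 * \<beta>\<^sup>2 / real n)" .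
    qed
    moreover have "(\<Sum>i\<in>I. L * (3 * \<beta>\<^sup>2 / real n)) = 3 * L * \<beta>\<^sup>2" using n0 by simp
    ultimately have "\<bar>real n * (Q \<sigma> / \<beta> - mean_proj N (Q \<sigma>))\<bar> \<le> \<bar>?Y \<sigma>\<bar> + ?b"
      using \<beta> by linarith
    from power_mono[OF this, of 2] have "(real n)\<^sup>2 * (Q \<sigma> / \<beta> - mean_proj N (Q \<sigma>))\<^sup>2 \<le> (\<bar>?Y \<sigma>\<bar> + ?b)\<^sup>2"
      by (simp add: power_mult_distrib abs_mult)
    also have "\<dots> \<le> 2 * (?Y \<sigma>)\<^sup>2 + 2 * ?b\<^sup>2"
      using sum_squared_le[of "\<bar>?Y \<sigma>\<bar>" ?b] by simp
    finally show "(Q \<sigma> / \<beta> - mean_proj N (Q \<sigma>))\<^sup>2 \<le> 2 / (real n)\<^sup>2 * (?Y \<sigma>)\<^sup>2 + 2 * ?b\<^sup>2 / (real n)\<^sup>2"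
      using n0 by (simp add: divide_simps mult.commute)
  qed (intro nice_intros nY)+
  also have "\<dots> = 2 / (real n)\<^sup>2 * ex (\<lambda>\<sigma>. (?Y \<sigma>)\<^sup>2) + 2 * ?b\<^sup>2 / (real n)\<^sup>2"
    by (subst ex_add, (intro nice_intros nY)+) (simp only: ex_cmult ex_const)
  also have "\<dots> \<le> 2 / (real n)\<^sup>2 * (?K * real n) + 2 * ?b\<^sup>2 / real n"
  proof (intro add_mono mult_left_mono mean_fluctuation[OF L])
    have "1 * real n \<le> real n * real n" using n by (intro mult_right_mono) auto
    thus "2 * ?b\<^sup>2 / (real n)\<^sup>2 \<le> 2 * ?b\<^sup>2 / real n"
      using n0 by (intro divide_left_mono) (auto simp: power2_eq_square)
  qed auto
  also have "\<dots> = (2 * ?K + 2 * ?b\<^sup>2) / real n" using n0 by (simp add: power2_eq_square add_divide_distrib)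
  finally show ?thesis .
qed

text \<open>The defect in the equation of state factors as
  \<open>Q * (1 / \<beta> - logd N Q)\<close>. Above \<open>e\<close> the first factor is at least
  \<open>e\<close> and the second at least \<open>\<delta> * \<bar>Q - q0\<bar>\<close>; below
  \<open>e\<close> the trivial bound \<open>\<beta>^2\<close> meets a small probability. The
  constants enter as equations, so that instantiating them by reflexivity yields an explicit bound
  free of \<open>n\<close>.\<close>

lemma Q_concentration:
  assumes L: "0 \<le> L" "\<And>x y. x \<in> {0..\<beta>\<^sup>2} \<Longrightarrow> y \<in> {0..\<beta>\<^sup>2} \<Longrightarrow> \<bar>mean_proj N x - mean_proj N y\<bar> \<le> L * \<bar>x - y\<bar>"
    and \<eta>: "0 < \<eta>" "\<And>q. 0 \<le> q \<Longrightarrow> q \<le> \<epsilon> \<Longrightarrow> (1 + \<eta>) / \<beta> \<le> logd N q" and \<epsilon>: "0 < \<epsilon>"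
    and \<delta>: "0 < \<delta>" "\<And>q. q \<in> {0..\<beta>\<^sup>2} \<Longrightarrow> \<delta> * \<bar>q - q0\<bar> \<le> \<bar>1 / \<beta> - logd N q\<bar>" and q0: "q0 \<in> {0..\<beta>\<^sup>2}"
    and c0: "c0 = min (\<eta> / (2 * \<beta>)) \<beta>" and e: "e = \<epsilon> / 8"
    and k: "k = 16 * \<beta> * (1 + \<beta>\<^sup>2) / (c0 * e)"
    and K1: "K1 = 2 * ((2 * \<beta>)\<^sup>2 + 2 * \<beta> * (2 * \<beta> + 4 * \<beta>\<^sup>2 * L)) + 2 * (\<beta> + 3 * L * \<beta>\<^sup>2)\<^sup>2"
    and K2: "K2 = 4 * (1 + \<eta>) / \<eta> + 6 * \<beta>\<^sup>2 / \<epsilon> + k\<^sup>2 * (1 + \<beta>\<^sup>2)"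
  shows "ex (\<lambda>\<sigma>. (Q \<sigma> - q0)\<^sup>2) \<le> ((\<beta>\<^sup>2)\<^sup>2 * K2 + K1 / (e * \<delta>)\<^sup>2) / real n"
proof -
  have e0: "0 < e" using e \<epsilon> by simp
  have "ex (\<lambda>\<sigma>. (Q \<sigma> - q0)\<^sup>2) \<le> ex (\<lambda>\<sigma>. (\<beta>\<^sup>2)\<^sup>2 * indicator {..<e} (Q \<sigma>) + 1 / (e * \<delta>)\<^sup>2 * (Q \<sigma> / \<beta> - mean_proj N (Q \<sigma>))\<^sup>2)"
  proof (rule ex_le)
    fix \<sigma> assume \<sigma>: "\<sigma> \<in> space \<Omega>"
    show "(Q \<sigma> - q0)\<^sup>2 \<le> (\<beta>\<^sup>2)\<^sup>2 * indicator {..<e} (Q \<sigma>) + 1 / (e * \<delta>)\<^sup>2 * (Q \<sigma> / \<beta> - mean_proj N (Q \<sigma>))\<^sup>2"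
    proof (cases "Q \<sigma> < e")
      case True
      have "\<bar>Q \<sigma> - q0\<bar> \<le> \<beta>\<^sup>2" using Q_mem[OF \<sigma>] q0 by auto
      from power_mono[OF this, of 2] have "(Q \<sigma> - q0)\<^sup>2 \<le> (\<beta>\<^sup>2)\<^sup>2" by simp
      thus ?thesis using True by (simp add: add_increasing2)
    next
      case False
      have "(e * \<delta>) * \<bar>Q \<sigma> - q0\<bar> = e * (\<delta> * \<bar>Q \<sigma> - q0\<bar>)" by simp
      also have "\<dots> \<le> Q \<sigma> * \<bar>1 / \<beta> - logd N (Q \<sigma>)\<bar>"
        using False \<delta>(1) \<delta>(2)[OF Q_mem[OF \<sigma>]] Q_nonneg[of \<sigma>] by (intro mult_mono) auto
      also have "\<dots> = \<bar>Q \<sigma> / \<beta> - mean_proj N (Q \<sigma>)\<bar>"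
      proof -
        have "Q \<sigma> / \<beta> - mean_proj N (Q \<sigma>) = Q \<sigma> * (1 / \<beta> - logd N (Q \<sigma>))"
          unfolding mean_proj_def by (simp add: right_diff_distrib)
        thus ?thesis using Q_nonneg[of \<sigma>] by (simp add: abs_mult)
      qed
      finally have "((e * \<delta>) * \<bar>Q \<sigma> - q0\<bar>)\<^sup>2 \<le> \<bar>Q \<sigma> / \<beta> - mean_proj N (Q \<sigma>)\<bar>\<^sup>2"
        using e0 \<delta> by (intro power_mono) auto
      hence "(e * \<delta>)\<^sup>2 * (Q \<sigma> - q0)\<^sup>2 \<le> (Q \<sigma> / \<beta> - mean_proj N (Q \<sigma>))\<^sup>2"
        by (simp only: power_mult_distrib power2_abs)
      moreover have "0 < (e * \<delta>)\<^sup>2" using e0 \<delta> by simp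
      ultimately have "(Q \<sigma> - q0)\<^sup>2 \<le> (Q \<sigma> / \<beta> - mean_proj N (Q \<sigma>))\<^sup>2 / (e * \<delta>)\<^sup>2"
        by (simp only: pos_le_divide_eq mult.commute)
      thus ?thesis using False by simp
    qed
  qed (intro nice_intros)+
  also have "\<dots> = (\<beta>\<^sup>2)\<^sup>2 * ex (\<lambda>\<sigma>. indicator {..<e} (Q \<sigma>)) + 1 / (e * \<delta>)\<^sup>2 * ex (\<lambda>\<sigma>. (Q \<sigma> / \<beta> - mean_proj N (Q \<sigma>))\<^sup>2)"
    by (subst ex_add, (intro nice_intros)+) (simp only: ex_cmult)
  also have "\<dots> \<le> (\<beta>\<^sup>2)\<^sup>2 * (K2 / real n) + 1 / (e * \<delta>)\<^sup>2 * (K1 / real n)"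
  proof (intro add_mono mult_left_mono)
    show "ex (\<lambda>\<sigma>. indicator {..<e} (Q \<sigma>)) \<le> K2 / real n"
      unfolding K2 by (rule small_Q_unlikely[OF \<eta> \<epsilon> c0 e k])
    show "ex (\<lambda>\<sigma>. (Q \<sigma> / \<beta> - mean_proj N (Q \<sigma>))\<^sup>2) \<le> K1 / real n"
      unfolding K1 by (rule equation_of_state[OF L])
  qed auto
  also have "\<dots> = ((\<beta>\<^sup>2)\<^sup>2 * K2 + K1 / (e * \<delta>)\<^sup>2) / real n" by (simp add: add_divide_distrib mult.commute)
  finally show ?thesis .
qed

text \<open>The exact drift of \<open>Q\<close>, rescaled by \<open>\<kappa>\<close>, minus its
  linearisation at \<open>q0\<close>.\<close>

definition drift_error :: "real \<Rightarrow> real \<Rightarrow> (nat \<Rightarrow> nat \<Rightarrow> real) \<Rightarrow> real" where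
  "drift_error \<kappa> q0 \<sigma> = (Q \<sigma> - \<beta>\<^sup>2 / real n - \<beta> / real n * (\<Sum>i\<in>I. mean_proj N (Qc i \<sigma>))) / \<kappa> - (Q \<sigma> - q0)"

text \<open>The average over \<open>i\<close> of the conditional mean of
  \<open>(t i \<sigma> - dot N (cavity i \<sigma>) s)^2\<close> over the new spin, hence the squared
  increment of \<open>Q\<close> up to the factor \<open>(2 * \<beta> / n)^2\<close>.\<close>

definition avg_square :: "(nat \<Rightarrow> nat \<Rightarrow> real) \<Rightarrow> real" where
  "avg_square \<sigma> = (\<Sum>i\<in>I. (t i \<sigma>)\<^sup>2 - 2 * t i \<sigma> * mean_proj N (Qc i \<sigma>) + second_moment N (Qc i \<sigma>)) / real n"

section \<open>Drift and second moment near the critical point\<close>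

lemma nice_drift_error: "nice (drift_error \<kappa> q0)"
  unfolding drift_error_def[abs_def] by (intro nice_intros)

lemma nice_avg_square: "nice avg_square"
  unfolding avg_square_def[abs_def] by (intro nice_intros) assumption+

lemma sum_lipschitz_Qc:
  assumes L: "0 \<le> L" "\<And>x y. x \<in> {0..\<beta>\<^sup>2} \<Longrightarrow> y \<in> {0..\<beta>\<^sup>2} \<Longrightarrow> \<bar>f x - f y\<bar> \<le> L * \<bar>x - y\<bar>" and \<sigma>: "\<sigma> \<in> space \<Omega>"
    and c: "\<And>i. i \<in> I \<Longrightarrow> \<bar>c i\<bar> \<le> C"
  shows "\<bar>\<Sum>i\<in>I. c i * (f (Qc i \<sigma>) - f (Q \<sigma>))\<bar> \<le> 3 * L * \<beta>\<^sup>2 * C"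
proof -
  have "\<bar>\<Sum>i\<in>I. c i * (f (Qc i \<sigma>) - f (Q \<sigma>))\<bar> \<le> (\<Sum>i\<in>I. C * (L * (3 * \<beta>\<^sup>2 / real n)))"
  proof (rule order_trans[OF sum_abs], rule sum_mono)
    fix i assume i: "i \<in> I"
    have "\<bar>f (Qc i \<sigma>) - f (Q \<sigma>)\<bar> \<le> L * \<bar>Qc i \<sigma> - Q \<sigma>\<bar>"
      by (rule L(2)[OF Qc_mem[OF \<sigma>] Q_mem[OF \<sigma>]])
    also have "\<dots> \<le> L * (3 * \<beta>\<^sup>2 / real n)" by (rule mult_left_mono[OF Q_Qc[OF \<sigma> i] L(1)])
    finally show "\<bar>c i * (f (Qc i \<sigma>) - f (Q \<sigma>))\<bar> \<le> C * (L * (3 * \<beta>\<^sup>2 / real n))"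
      unfolding abs_mult using c[OF i] by (intro mult_mono) auto
  qed
  also have "\<dots> = 3 * L * \<beta>\<^sup>2 * C" using n0 by simp
  finally show ?thesis .
qed

text \<open>In the expansion at \<open>q0\<close> the constant term cancels because
  \<open>q0\<close> solves the equation of state, and the linear one because
  \<open>\<kappa> = 1 - \<beta> * m'\<close>.\<close>

lemma drift_error_bound:
  assumes L: "0 \<le> L" "\<And>x y. x \<in> {0..\<beta>\<^sup>2} \<Longrightarrow> y \<in> {0..\<beta>\<^sup>2} \<Longrightarrow> \<bar>mean_proj N x - mean_proj N y\<bar> \<le> L * \<bar>x - y\<bar>"
    and T: "\<And>x. x \<in> {0..\<beta>\<^sup>2} \<Longrightarrow> \<bar>mean_proj N x - mean_proj N q0 - m' * (x - q0)\<bar> \<le> L * (x - q0)\<^sup>2"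
    and m: "mean_proj N q0 = q0 / \<beta>" and \<kappa>: "\<kappa> = 1 - \<beta> * m'" "0 < \<kappa>" and \<sigma>: "\<sigma> \<in> space \<Omega>"
  shows "\<bar>drift_error \<kappa> q0 \<sigma>\<bar> \<le> (\<beta> * L + \<beta>\<^sup>2 + 3 * L * \<beta>\<^sup>2 * \<beta>) / \<kappa> * ((Q \<sigma> - q0)\<^sup>2 + 1 / real n)"
proof -
  let ?S = "\<Sum>i\<in>I. 1 * (mean_proj N (Qc i \<sigma>) - mean_proj N (Q \<sigma>))"
  have S: "(\<Sum>i\<in>I. mean_proj N (Qc i \<sigma>)) = ?S + real n * mean_proj N (Q \<sigma>)" by (simp add: sum_subtractf)
  have "\<kappa> * drift_error \<kappa> q0 \<sigma> = - \<beta> * (mean_proj N (Q \<sigma>) - mean_proj N q0 - m' * (Q \<sigma> - q0)) - \<beta>\<^sup>2 / real n - \<beta> / real n * ?S"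
  proof -
    have "\<kappa> * drift_error \<kappa> q0 \<sigma> = Q \<sigma> - \<beta>\<^sup>2 / real n - \<beta> / real n * (?S + real n * mean_proj N (Q \<sigma>)) - \<kappa> * (Q \<sigma> - q0)"
    proof -
      have "\<kappa> * (x / \<kappa> - y) = x - \<kappa> * y" for x y using \<kappa>(2) by (simp add: right_diff_distrib)
      thus ?thesis unfolding drift_error_def S .
    qed
    also have "\<beta> / real n * (?S + real n * mean_proj N (Q \<sigma>)) = \<beta> / real n * ?S + \<beta> * mean_proj N (Q \<sigma>)"
      using n0 by (simp add: distrib_left)
    finally show ?thesis unfolding m \<kappa>(1) using \<beta> by (simp add: algebra_simps)
  qed
  hence "\<kappa> * \<bar>drift_error \<kappa> q0 \<sigma>\<bar> = \<bar>- \<beta> * (mean_proj N (Q \<sigma>) - mean_proj N q0 - m' * (Q \<sigma> - q0)) - \<beta>\<^sup>2 / real n - \<beta> / real n * ?S\<bar>"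
    using \<kappa>(2) by (metis abs_mult abs_of_pos)
  also have "\<dots> \<le> \<beta> * \<bar>mean_proj N (Q \<sigma>) - mean_proj N q0 - m' * (Q \<sigma> - q0)\<bar> + \<beta>\<^sup>2 / real n + \<beta> / real n * \<bar>?S\<bar>"
  proof -
    have "\<bar>- a - b - c\<bar> \<le> \<bar>a\<bar> + \<bar>b\<bar> + \<bar>c\<bar>" for a b c :: real by linarith
    from this[of "\<beta> * (mean_proj N (Q \<sigma>) - mean_proj N q0 - m' * (Q \<sigma> - q0))" "\<beta>\<^sup>2 / real n" "\<beta> / real n * ?S"]
    show ?thesis using \<beta> n0 by (simp add: abs_mult)
  qed
  also have "\<dots> \<le> \<beta> * (L * (Q \<sigma> - q0)\<^sup>2) + \<beta>\<^sup>2 / real n + \<beta> / real n * (3 * L * \<beta>\<^sup>2 * 1)"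
    using \<beta> n0 by (intro add_mono mult_left_mono T[OF Q_mem[OF \<sigma>]] sum_lipschitz_Qc[OF L \<sigma>]) auto
  also have "\<dots> = (\<beta> * L) * (Q \<sigma> - q0)\<^sup>2 + (\<beta>\<^sup>2 + 3 * L * \<beta>\<^sup>2 * \<beta>) * (1 / real n)"
    by (simp add: add_divide_distrib distrib_right mult_ac)
  also have "\<dots> \<le> (\<beta> * L + \<beta>\<^sup>2 + 3 * L * \<beta>\<^sup>2 * \<beta>) * (Q \<sigma> - q0)\<^sup>2 + (\<beta> * L + \<beta>\<^sup>2 + 3 * L * \<beta>\<^sup>2 * \<beta>) * (1 / real n)"
    using \<beta> L(1) n0 by (intro add_mono mult_right_mono) auto
  finally have "\<kappa> * \<bar>drift_error \<kappa> q0 \<sigma>\<bar> \<le> (\<beta> * L + \<beta>\<^sup>2 + 3 * L * \<beta>\<^sup>2 * \<beta>) * ((Q \<sigma> - q0)\<^sup>2 + 1 / real n)"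
    by (simp only: distrib_left)
  thus ?thesis using \<kappa>(2) by (simp add: pos_le_divide_eq mult.commute)
qed

text \<open>Old and new spin each contribute a second moment. In the cross term \<open>sum_t\<close>
  turns the sum of the \<open>t i\<close> into a function of \<open>Q\<close>, so only the squares
  of \<open>t i\<close> leave a genuine fluctuation. At \<open>q0\<close> the rest is twice the
  tilted variance, \<open>2 * q0 * v\<close>.\<close>

lemma avg_square_bound:
  assumes L: "0 \<le> L" "\<And>x y. x \<in> {0..\<beta>\<^sup>2} \<Longrightarrow> y \<in> {0..\<beta>\<^sup>2} \<Longrightarrow> \<bar>mean_proj N x - mean_proj N y\<bar> \<le> L * \<bar>x - y\<bar>"
      "\<And>x y. x \<in> {0..\<beta>\<^sup>2} \<Longrightarrow> y \<in> {0..\<beta>\<^sup>2} \<Longrightarrow> \<bar>second_moment N x - second_moment N y\<bar> \<le> L * \<bar>x - y\<bar>"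
      "\<And>x y. x \<in> {0..\<beta>\<^sup>2} \<Longrightarrow> y \<in> {0..\<beta>\<^sup>2} \<Longrightarrow> \<bar>x * mean_proj N x - y * mean_proj N y\<bar> \<le> L * \<bar>x - y\<bar>"
    and q0: "q0 \<in> {0..\<beta>\<^sup>2}" and v: "second_moment N q0 - q0 * mean_proj N q0 / \<beta> = q0 * v" and \<sigma>: "\<sigma> \<in> space \<Omega>"
  shows "\<bar>avg_square \<sigma> - 2 * q0 * v\<bar> \<le> \<bar>\<Sum>i\<in>I. (t i \<sigma>)\<^sup>2 - second_moment N (Qc i \<sigma>)\<bar> / real n
     + (2 * L + 2 * L / \<beta>) * \<bar>Q \<sigma> - q0\<bar> + (6 * L * \<beta>\<^sup>2 + 6 * L * \<beta>\<^sup>2 * \<beta> + 2 * \<beta>\<^sup>2) / real n"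
proof -
  let ?Y = "\<Sum>i\<in>I. (t i \<sigma>)\<^sup>2 - second_moment N (Qc i \<sigma>)"
  let ?S = "\<Sum>i\<in>I. 1 * (second_moment N (Qc i \<sigma>) - second_moment N (Q \<sigma>))"
  let ?U = "\<Sum>i\<in>I. t i \<sigma> * (mean_proj N (Qc i \<sigma>) - mean_proj N (Q \<sigma>))"
  let ?m = "mean_proj N (Q \<sigma>)" and ?M = "second_moment N (Q \<sigma>)"
  have "real n * avg_square \<sigma> = ?Y + 2 * ?S + 2 * real n * ?M - 2 * ?U - 2 * (\<Sum>i\<in>I. t i \<sigma>) * ?m"
  proof -
    have "real n * avg_square \<sigma> = (\<Sum>i\<in>I. ((t i \<sigma>)\<^sup>2 - second_moment N (Qc i \<sigma>)) + 2 * (1 * (second_moment N (Qc i \<sigma>) - ?M)) + 2 * ?M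
       - 2 * (t i \<sigma> * (mean_proj N (Qc i \<sigma>) - ?m)) - 2 * ?m * t i \<sigma>)"
      unfolding avg_square_def using n0 by (simp add: algebra_simps)
    also have "\<dots> = ?Y + 2 * ?S + real n * (2 * ?M) - 2 * ?U - 2 * ?m * (\<Sum>i\<in>I. t i \<sigma>)"
      by (simp only: sum_subtractf sum.distrib sum_distrib_left[symmetric]) simp
    finally show ?thesis by simp
  qed
  hence "real n * (avg_square \<sigma> - 2 * q0 * v) = ?Y + 2 * ?S - 2 * ?U + 2 * \<beta> * ?m
     + real n * (2 * (?M - second_moment N q0) - 2 / \<beta> * (Q \<sigma> * ?m - q0 * mean_proj N q0))"
  proof -
    have v': "second_moment N q0 = q0 * v + q0 * mean_proj N q0 / \<beta>" using v by simp
    assume "real n * avg_square \<sigma> = ?Y + 2 * ?S + 2 * real n * ?M - 2 * ?U - 2 * (\<Sum>i\<in>I. t i \<sigma>) * ?m"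
    thus ?thesis unfolding sum_t[OF \<sigma>] v' by (simp add: algebra_simps)
  qed
  hence "real n * \<bar>avg_square \<sigma> - 2 * q0 * v\<bar> = \<bar>?Y + 2 * ?S - 2 * ?U + 2 * \<beta> * ?m
     + real n * (2 * (?M - second_moment N q0) - 2 / \<beta> * (Q \<sigma> * ?m - q0 * mean_proj N q0))\<bar>"
    using n0 by (metis abs_mult abs_of_pos)
  also have "\<dots> \<le> \<bar>?Y\<bar> + 2 * \<bar>?S\<bar> + 2 * \<bar>?U\<bar> + 2 * \<beta> * ?m
     + real n * (2 * \<bar>?M - second_moment N q0\<bar> + 2 / \<beta> * \<bar>Q \<sigma> * ?m - q0 * mean_proj N q0\<bar>)"
  proof -
    have g: "\<bar>a + 2 * b - 2 * c + d + e\<bar> \<le> \<bar>a\<bar> + 2 * \<bar>b\<bar> + 2 * \<bar>c\<bar> + \<bar>d\<bar> + \<bar>e\<bar>" for a b c d e :: real by linarith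
    have h: "\<bar>2 * (?M - second_moment N q0) - 2 / \<beta> * (Q \<sigma> * ?m - q0 * mean_proj N q0)\<bar>
       \<le> 2 * \<bar>?M - second_moment N q0\<bar> + 2 / \<beta> * \<bar>Q \<sigma> * ?m - q0 * mean_proj N q0\<bar>"
    proof -
      have "\<bar>2 * x - c * y\<bar> \<le> 2 * \<bar>x\<bar> + c * \<bar>y\<bar>" if "0 \<le> c" for x y c :: real
        using abs_triangle_ineq4[of "2 * x" "c * y"] that by (simp add: abs_mult)
      moreover have "0 \<le> 2 / \<beta>" using \<beta> by simp
      ultimately show ?thesis by blast
    qed
    have m0: "0 \<le> ?m" using mean_proj_bounds[OF N Q_nonneg Q_le[OF \<sigma>]] \<beta> by auto
    have d: "\<bar>2 * \<beta> * ?m\<bar> = 2 * \<beta> * ?m" using m0 \<beta> by simp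
    have e: "\<bar>real n * (2 * (?M - second_moment N q0) - 2 / \<beta> * (Q \<sigma> * ?m - q0 * mean_proj N q0))\<bar>
       \<le> real n * (2 * \<bar>?M - second_moment N q0\<bar> + 2 / \<beta> * \<bar>Q \<sigma> * ?m - q0 * mean_proj N q0\<bar>)"
      unfolding abs_mult[of "real n"] using h by (simp add: mult_left_mono)
    show ?thesis
      by (rule order_trans[OF g]) (unfold d, intro add_left_mono e)
  qed
  also have "\<dots> \<le> \<bar>?Y\<bar> + 2 * (3 * L * \<beta>\<^sup>2 * 1) + 2 * (3 * L * \<beta>\<^sup>2 * \<beta>) + 2 * \<beta> * \<beta>
     + real n * (2 * (L * \<bar>Q \<sigma> - q0\<bar>) + 2 / \<beta> * (L * \<bar>Q \<sigma> - q0\<bar>))"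
    using \<beta> mean_proj_bounds(2)[OF N Q_nonneg Q_le[OF \<sigma>]]
    by (intro add_mono mult_left_mono order_refl sum_lipschitz_Qc[OF L(1,2) \<sigma>] sum_lipschitz_Qc[OF L(1,3) \<sigma>]
        L(3)[OF Q_mem[OF \<sigma>] q0] L(4)[OF Q_mem[OF \<sigma>] q0] t_le[OF \<sigma>]) auto
  also have "\<dots> = real n * (\<bar>?Y\<bar> / real n + (2 * L + 2 * L / \<beta>) * \<bar>Q \<sigma> - q0\<bar> + (6 * L * \<beta>\<^sup>2 + 6 * L * \<beta>\<^sup>2 * \<beta> + 2 * \<beta>\<^sup>2) / real n)"
  proof -
    have g: "real n * (y / real n + c + d / real n) = y + real n * c + d" for y c d
      using n0 by (simp add: distrib_left)
    have "2 * (3 * L * \<beta>\<^sup>2 * 1) + 2 * (3 * L * \<beta>\<^sup>2 * \<beta>) + 2 * \<beta> * \<beta> = 6 * L * \<beta>\<^sup>2 + 6 * L * \<beta>\<^sup>2 * \<beta> + 2 * \<beta>\<^sup>2"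
      by (simp add: power2_eq_square)
    moreover have "2 * (L * \<bar>Q \<sigma> - q0\<bar>) + 2 / \<beta> * (L * \<bar>Q \<sigma> - q0\<bar>) = (2 * L + 2 * L / \<beta>) * \<bar>Q \<sigma> - q0\<bar>"
      by (simp add: distrib_right)
    moreover have "y + p + q + r + m * z = y + m * c + d" if "p + q + r = d" "z = c" for y p q r m z c d :: real
      using that by simp
    ultimately show ?thesis unfolding g by blast
  qed
  finally show ?thesis using n0 by (simp only: mult_le_cancel_left_pos)
qed

end

section \<open>The exchangeable pair\<close>

context vector_model
begin

abbreviation "\<Omega>\<mu> \<equiv> \<Omega> \<Otimes>\<^sub>M \<mu>"

text \<open>A point of \<open>pair_space\<close> consists of the index of the resampled spin, the configuration and the new spin.\<close>

definition pair_space :: "(nat \<times> (nat \<Rightarrow> nat \<Rightarrow> real) \<times> (nat \<Rightarrow> real)) measure" where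
  "pair_space = density (count_space I \<Otimes>\<^sub>M \<Omega>\<mu>)
     (\<lambda>(i, \<sigma>, s). ennreal (weight \<sigma> * kernel i \<sigma> s / (real n * Zn)))"

section \<open>The probability space of the pair\<close>

lemma measurable_index:
  assumes "\<And>i. i \<in> I \<Longrightarrow> (\<lambda>y. f (i, y)) \<in> borel_measurable \<Omega>\<mu>"
  shows "f \<in> borel_measurable (count_space I \<Otimes>\<^sub>M \<Omega>\<mu>)"
  by (rule measurable_pair_measure_countable1) (use assms in auto)

lemma integral_index:
  fixes f :: "_ \<Rightarrow> real"
  assumes m: "\<And>i. i \<in> I \<Longrightarrow> (\<lambda>y. f (i, y)) \<in> borel_measurable \<Omega>\<mu>"
    and b: "\<And>i y. i \<in> I \<Longrightarrow> y \<in> space \<Omega>\<mu> \<Longrightarrow> \<bar>f (i, y)\<bar> \<le> C"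
  shows "integrable (count_space I \<Otimes>\<^sub>M \<Omega>\<mu>) f"
    and "(\<integral>x. f x \<partial>(count_space I \<Otimes>\<^sub>M \<Omega>\<mu>)) = (\<Sum>i\<in>I. \<integral>y. f (i, y) \<partial>\<Omega>\<mu>)"
proof -
  interpret C: finite_measure "count_space I" by (rule finite_measure_count_space) simp
  interpret R: prob_space \<Omega>\<mu> by (rule \<Omega>\<mu>.prob_space_axioms)
  interpret CR: pair_sigma_finite "count_space I" \<Omega>\<mu> ..
  interpret P: finite_measure "count_space I \<Otimes>\<^sub>M \<Omega>\<mu>"
    by (rule finite_measure_pair_measure) unfold_locales
  show int: "integrable (count_space I \<Otimes>\<^sub>M \<Omega>\<mu>) f"
  proof (rule P.integrable_const_bound[where B=C])
    show "AE x in count_space I \<Otimes>\<^sub>M \<Omega>\<mu>. norm (f x) \<le> C"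
    proof (rule AE_I2)
      fix x assume "x \<in> space (count_space I \<Otimes>\<^sub>M \<Omega>\<mu>)"
      then obtain i y where "x = (i, y)" "i \<in> I" "y \<in> space \<Omega>\<mu>"
        unfolding space_pair_measure[of "count_space I"] space_count_space by blast
      thus "norm (f x) \<le> C" using b by simp
    qed
    show "f \<in> borel_measurable (count_space I \<Otimes>\<^sub>M \<Omega>\<mu>)" by (rule measurable_index[OF m])
  qed
  have "(\<integral>x. f x \<partial>(count_space I \<Otimes>\<^sub>M \<Omega>\<mu>)) = (\<integral>i. (\<integral>y. f (i, y) \<partial>\<Omega>\<mu>) \<partial>count_space I)"
    by (rule CR.integral_fst'[OF int, symmetric])
  also have "\<dots> = (\<Sum>i\<in>I. \<integral>y. f (i, y) \<partial>\<Omega>\<mu>)"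
    by (rule lebesgue_integral_count_space_finite) simp
  finally show "(\<integral>x. f x \<partial>(count_space I \<Otimes>\<^sub>M \<Omega>\<mu>)) = (\<Sum>i\<in>I. \<integral>y. f (i, y) \<partial>\<Omega>\<mu>)" .
qed

lemma density_bound:
  assumes "y \<in> space \<Omega>\<mu>"
  shows "\<bar>weight (fst y) * kernel i (fst y) (snd y) / (real n * Zn)\<bar>
    \<le> exp (real n / (2 * \<beta>) * \<beta>\<^sup>2) * exp \<beta> / (real n * Zn)"
proof -
  have y: "fst y \<in> space \<Omega>" "snd y \<in> space \<mu>" using assms by (auto simp: space_pair_measure)
  have "weight (fst y) * kernel i (fst y) (snd y) \<le> exp (real n / (2 * \<beta>) * \<beta>\<^sup>2) * exp \<beta>"
    using weight_le[OF y(1)] kernel_le[OF y, of i] weight_nonneg less_imp_le[OF kernel_pos]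
    by (intro mult_mono) auto
  moreover have "0 \<le> weight (fst y) * kernel i (fst y) (snd y)"
    using weight_nonneg less_imp_le[OF kernel_pos] by (intro mult_nonneg_nonneg) auto
  ultimately show ?thesis using n0 Zn_pos by (simp add: divide_right_mono)
qed

lemma measurable_pair_density:
  "(\<lambda>y. weight (fst y) * kernel i (fst y) (snd y) / (real n * Zn)) \<in> borel_measurable \<Omega>\<mu>"
  by (intro borel_measurable_divide borel_measurable_times borel_measurable_const
      measurable_fst_comp measurable_weight measurable_kernel)

lemma integral_pair_space:
  assumes F: "\<And>i. i \<in> I \<Longrightarrow> nice2 (F i)"
  shows "(\<integral>x. F (fst x) (fst (snd x)) (snd (snd x)) \<partial>pair_space) = (\<Sum>i\<in>I. ex (resample i (F i))) / real n"
    and "(\<lambda>x. F (fst x) (fst (snd x)) (snd (snd x))) \<in> borel_measurable pair_space"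
proof -
  let ?w = "\<lambda>x. weight (fst (snd x)) * kernel (fst x) (fst (snd x)) (snd (snd x)) / (real n * Zn)"
  let ?F = "\<lambda>x. F (fst x) (fst (snd x)) (snd (snd x))"
  have "\<forall>i\<in>I. \<exists>C. \<forall>\<sigma>\<in>space \<Omega>. \<forall>s\<in>space \<mu>. \<bar>F i \<sigma> s\<bar> \<le> C" using F unfolding nice2_def by blast
  then obtain C where C: "\<And>i \<sigma> s. i \<in> I \<Longrightarrow> \<sigma> \<in> space \<Omega> \<Longrightarrow> s \<in> space \<mu> \<Longrightarrow> \<bar>F i \<sigma> s\<bar> \<le> C i" by metis
  have Fm: "(\<lambda>y. F i (fst y) (snd y)) \<in> borel_measurable \<Omega>\<mu>" if "i \<in> I" for i
    using F[OF that] unfolding nice2_def by blast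
  have m: "?F \<in> borel_measurable (count_space I \<Otimes>\<^sub>M \<Omega>\<mu>)"
    by (rule measurable_index) (simp add: Fm)
  thus "?F \<in> borel_measurable pair_space" unfolding pair_space_def by simp
  have wm: "?w \<in> borel_measurable (count_space I \<Otimes>\<^sub>M \<Omega>\<mu>)"
    by (rule measurable_index) (simp add: measurable_pair_density)
  have w0: "0 \<le> ?w x" for x
    using weight_nonneg less_imp_le[OF kernel_pos] n0 Zn_pos by (intro divide_nonneg_pos mult_nonneg_nonneg mult_pos_pos) auto
  have "(\<integral>x. ?F x \<partial>pair_space) = (\<integral>x. ?w x * ?F x \<partial>(count_space I \<Otimes>\<^sub>M \<Omega>\<mu>))"
    unfolding pair_space_def case_prod_beta
    by (subst integral_density[OF m wm]) (use w0 in auto)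
  also have "\<dots> = (\<Sum>i\<in>I. \<integral>y. ?w (i, y) * ?F (i, y) \<partial>\<Omega>\<mu>)"
  proof (rule integral_index(2))
    show "(\<lambda>y. ?w (i, y) * ?F (i, y)) \<in> borel_measurable \<Omega>\<mu>" if "i \<in> I" for i
      using borel_measurable_times[OF measurable_pair_density[of i] Fm[OF that]] by (simp only: fst_conv snd_conv)
    fix i y assume i: "i \<in> I" and y: "y \<in> space \<Omega>\<mu>"
    have yy: "fst y \<in> space \<Omega>" "snd y \<in> space \<mu>" using y by (auto simp: space_pair_measure)
    have "\<bar>F i (fst y) (snd y)\<bar> \<le> (\<Sum>i\<in>I. \<bar>C i\<bar>)"
      using C[OF i yy] member_le_sum[of i I "\<lambda>i. \<bar>C i\<bar>"] i by force
    thus "\<bar>?w (i, y) * ?F (i, y)\<bar> \<le> exp (real n / (2 * \<beta>) * \<beta>\<^sup>2) * exp \<beta> / (real n * Zn) * (\<Sum>i\<in>I. \<bar>C i\<bar>)"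
      unfolding abs_mult using density_bound[OF y, of i] n0 Zn_pos by (intro mult_mono) auto
  qed
  also have "\<dots> = (\<Sum>i\<in>I. ex (resample i (F i)) / real n)"
  proof (rule sum.cong[OF refl])
    fix i assume i: "i \<in> I"
    have "ex (resample i (F i)) = (\<integral>x. weight (fst x) * kernel i (fst x) (snd x) * F i (fst x) (snd x) \<partial>\<Omega>\<mu>) / Zn"
      by (rule ex_resample(1)[OF Fm[OF i] C[OF i]])
    thus "(\<integral>y. ?w (i, y) * ?F (i, y) \<partial>\<Omega>\<mu>) = ex (resample i (F i)) / real n" by (simp add: mult.commute)
  qed
  also have "\<dots> = (\<Sum>i\<in>I. ex (resample i (F i))) / real n" by (simp add: sum_divide_distrib)
  finally show "(\<integral>x. ?F x \<partial>pair_space) = (\<Sum>i\<in>I. ex (resample i (F i))) / real n" .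
qed

lemma integral_pair_space_fst:
  assumes g: "nice g"
  shows "(\<integral>x. g (fst (snd x)) \<partial>pair_space) = ex g"
    and "(\<lambda>x. g (fst (snd x))) \<in> borel_measurable pair_space"
proof -
  have "ex (resample i (\<lambda>\<sigma> s. g \<sigma>)) = ex g" for i by (rule ex_cong) simp
  thus "(\<integral>x. g (fst (snd x)) \<partial>pair_space) = ex g"
    using integral_pair_space(1)[of "\<lambda>_ \<sigma> s. g \<sigma>"] nice2_fst[OF g] n0 by simp
  show "(\<lambda>x. g (fst (snd x))) \<in> borel_measurable pair_space"
    using integral_pair_space(2)[of "\<lambda>_ \<sigma> s. g \<sigma>"] nice2_fst[OF g] by simp
qed

lemma space_pair_space: "space pair_space = I \<times> space \<Omega> \<times> space \<mu>"
  unfolding pair_space_def by (simp add: space_pair_measure)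

sublocale pair: prob_space pair_space
proof
  let ?w = "\<lambda>x. weight (fst (snd x)) * kernel (fst x) (fst (snd x)) (snd (snd x)) / (real n * Zn)"
  have w0: "0 \<le> ?w x" for x
    using weight_nonneg less_imp_le[OF kernel_pos] n0 Zn_pos by (intro divide_nonneg_pos mult_nonneg_nonneg mult_pos_pos) auto
  have wm: "?w \<in> borel_measurable (count_space I \<Otimes>\<^sub>M \<Omega>\<mu>)"
    by (rule measurable_index) (simp add: measurable_pair_density)
  have int: "integrable (count_space I \<Otimes>\<^sub>M \<Omega>\<mu>) ?w" "(\<integral>x. ?w x \<partial>(count_space I \<Otimes>\<^sub>M \<Omega>\<mu>)) = (\<Sum>i\<in>I. \<integral>y. ?w (i, y) \<partial>\<Omega>\<mu>)"
    by (rule integral_index[where C="exp (real n / (2 * \<beta>) * \<beta>\<^sup>2) * exp \<beta> / (real n * Zn)"];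
        simp only: fst_conv snd_conv measurable_pair_density density_bound)+
  have w1: "(\<integral>y. ?w (i, y) \<partial>\<Omega>\<mu>) = 1 / real n" for i
  proof -
    have "1 = ex (resample i (\<lambda>_ _. 1))" by (simp add: ex_cong[of "resample i (\<lambda>_ _. 1)" "\<lambda>_. 1"])
    also have "\<dots> = (\<integral>x. weight (fst x) * kernel i (fst x) (snd x) * 1 \<partial>\<Omega>\<mu>) / Zn"
      by (rule ex_resample(1)[of _ 1]) auto
    finally show ?thesis by (simp add: mult.commute)
  qed
  have one: "(\<integral>x. ?w x \<partial>(count_space I \<Otimes>\<^sub>M \<Omega>\<mu>)) = 1" unfolding int(2) w1 using n0 by simp
  have "emeasure pair_space (space pair_space) = (\<integral>\<^sup>+x. 1 \<partial>pair_space)" by simp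
  also have "\<dots> = (\<integral>\<^sup>+x. ennreal (?w x) \<partial>(count_space I \<Otimes>\<^sub>M \<Omega>\<mu>))"
    unfolding pair_space_def case_prod_beta by (subst nn_integral_density) (use wm in auto)
  also have "\<dots> = ennreal 1"
    unfolding one[symmetric] by (rule nn_integral_eq_integral[OF int(1)]) (use w0 in auto)
  finally show "emeasure pair_space (space pair_space) = 1" by simp
qed

text \<open>A jump of \<open>T\<close> is \<open>sqrt n / (q0 * B)\<close> times
  \<open>2 * \<beta> / n\<close> times a difference of two inner products, itself at most
  \<open>2 * \<beta>\<close>; this is \<open>\<delta>\<close>. The drift rate is
  \<open>2 * \<kappa> / n\<close>, and the factor
  \<open>8 * \<beta>^4 / (q0^2 * B^2 * \<kappa>)\<close> is the quotient of
  \<open>\<delta>^2\<close> by that rate.\<close>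

lemma pair_exchangeable:
  fixes q0 B \<kappa> v s a :: real
  defines "T \<equiv> \<lambda>\<sigma>. sqrt (real n) / B * (Q \<sigma> / q0 - 1)"
  defines "R \<equiv> \<lambda>\<sigma>. sqrt (real n) / (q0 * B) * drift_error \<kappa> q0 \<sigma>"
  defines "D \<equiv> \<lambda>\<sigma>. (avg_square \<sigma> - 2 * q0 * v) / (2 * q0 * v)"
  defines "\<delta> \<equiv> 4 * \<beta>\<^sup>2 / (q0 * B * sqrt (real n))"
  assumes pos: "0 < q0" "0 < B" "0 < \<kappa>" "0 < v" and B2: "B\<^sup>2 = 2 * \<beta>\<^sup>2 * v / (\<kappa> * q0)"
    and s: "ex (\<lambda>\<sigma>. (T \<sigma>)\<^sup>2) \<le> s" and a: "ex (\<lambda>\<sigma>. \<bar>R \<sigma>\<bar>) \<le> a * \<delta>" "ex (\<lambda>\<sigma>. (D \<sigma>)\<^sup>2) \<le> a * \<delta>\<^sup>2"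
  shows "exchangeable_pair pair_space (\<lambda>x. T (fst (snd x))) (\<lambda>x. T ((fst (snd x))(fst x := snd (snd x))))
     (\<lambda>x. R (fst (snd x))) (\<lambda>x. D (fst (snd x))) \<delta> (2 * \<kappa> / real n) s a
     (8 * (\<beta>\<^sup>2)\<^sup>2 / (q0\<^sup>2 * B\<^sup>2 * \<kappa>)) (4 * \<beta>\<^sup>2 / (q0 * B))"
proof -
  have sn: "0 < sqrt (real n)" "(sqrt (real n))\<^sup>2 = real n" using n0 by auto
  have nT: "nice T" unfolding T_def by (intro nice_intros)
  have nR: "nice R" unfolding R_def by (intro nice_intros nice_drift_error)
  have nD: "nice D" unfolding D_def by (intro nice_intros nice_avg_square)
  have n\<psi>: "nice (\<lambda>\<sigma>. \<psi> (T \<sigma>))" if "continuous_on UNIV \<psi>" for \<psi> :: "real \<Rightarrow> real"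
    by (rule nice_continuous[OF that nT])
  have \<Delta>: "T \<sigma> - T (\<sigma>(i := s)) = sqrt (real n) / (q0 * B) * (2 * \<beta> / real n) * (t i \<sigma> - dot N (cavity i \<sigma>) s)"
    if "\<sigma> \<in> space \<Omega>" "i \<in> I" "s \<in> space \<mu>" for \<sigma> i s
  proof -
    have "T \<sigma> - T (\<sigma>(i := s)) = - (sqrt (real n) / (q0 * B)) * (Q (\<sigma>(i := s)) - Q \<sigma>)"
      unfolding T_def using pos by (simp add: field_simps)
    also have "\<dots> = sqrt (real n) / (q0 * B) * (2 * \<beta> / real n) * (t i \<sigma> - dot N (cavity i \<sigma>) s)"
    proof -
      have "- c * (p * (d - u)) = c * p * (u - d)" for c p d u :: real by (simp add: algebra_simps)
      thus ?thesis unfolding Q_update[OF that] by blast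
    qed
    finally show ?thesis .
  qed
  have upd: "nice2 (\<lambda>\<sigma> s. g (\<sigma>(i := s)))" if "i \<in> I" "nice g" for g i using that by (rule nice2_update)
  show ?thesis
  proof unfold_locales
    show "(\<lambda>x. T (fst (snd x))) \<in> borel_measurable pair_space" "(\<lambda>x. R (fst (snd x))) \<in> borel_measurable pair_space"
      "(\<lambda>x. D (fst (snd x))) \<in> borel_measurable pair_space"
      by (rule integral_pair_space_fst(2)[OF nT] integral_pair_space_fst(2)[OF nR] integral_pair_space_fst(2)[OF nD])+
    show "(\<lambda>x. T ((fst (snd x))(fst x := snd (snd x)))) \<in> borel_measurable pair_space"
      by (rule integral_pair_space(2)[of "\<lambda>i \<sigma> s. T (\<sigma>(i := s))"]) (rule upd[OF _ nT])
    obtain C1 C2 C3 where "\<And>\<sigma>. \<sigma> \<in> space \<Omega> \<Longrightarrow> \<bar>T \<sigma>\<bar> \<le> C1" "\<And>\<sigma>. \<sigma> \<in> space \<Omega> \<Longrightarrow> \<bar>R \<sigma>\<bar> \<le> C2" "\<And>\<sigma>. \<sigma> \<in> space \<Omega> \<Longrightarrow> \<bar>D \<sigma>\<bar> \<le> C3"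
      using nT nR nD unfolding nice_def by meson
    hence "\<forall>x\<in>space pair_space. \<bar>T (fst (snd x))\<bar> \<le> max C1 (max C2 C3) \<and> \<bar>T ((fst (snd x))(fst x := snd (snd x)))\<bar> \<le> max C1 (max C2 C3)
       \<and> \<bar>R (fst (snd x))\<bar> \<le> max C1 (max C2 C3) \<and> \<bar>D (fst (snd x))\<bar> \<le> max C1 (max C2 C3)"
      unfolding space_pair_space using update_mem by (auto simp del: fun_upd_apply simp: le_max_iff_disj)
    thus "\<exists>B. \<forall>x\<in>space pair_space. \<bar>T (fst (snd x))\<bar> \<le> B \<and> \<bar>T ((fst (snd x))(fst x := snd (snd x)))\<bar> \<le> B
       \<and> \<bar>R (fst (snd x))\<bar> \<le> B \<and> \<bar>D (fst (snd x))\<bar> \<le> B" by blast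
    show "0 < 2 * \<kappa> / real n" using pos n0 by simp
    show "0 < \<delta>" unfolding \<delta>_def using pos sn \<beta> by simp
    show "\<delta> \<le> 4 * \<beta>\<^sup>2 / (q0 * B)"
    proof -
      have "q0 * B * 1 \<le> q0 * B * sqrt (real n)" using pos n by (intro mult_left_mono) auto
      thus ?thesis unfolding \<delta>_def using pos sn by (intro divide_left_mono) auto
    qed
    show "\<delta>\<^sup>2 \<le> 8 * (\<beta>\<^sup>2)\<^sup>2 / (q0\<^sup>2 * B\<^sup>2 * \<kappa>) * (2 * \<kappa> / real n)"
      unfolding \<delta>_def power_divide power_mult_distrib sn(2) using pos n0 by simp
    show "\<bar>T (fst (snd x)) - T ((fst (snd x))(fst x := snd (snd x)))\<bar> \<le> \<delta>" if "x \<in> space pair_space" for x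
    proof -
      obtain i \<sigma> s where x: "x = (i, \<sigma>, s)" by (metis prod_cases3)
      have m: "i \<in> I" "\<sigma> \<in> space \<Omega>" "s \<in> space \<mu>" using that unfolding x space_pair_space by auto
      have "\<bar>T \<sigma> - T (\<sigma>(i := s))\<bar> = sqrt (real n) / (q0 * B) * (2 * \<beta> / real n) * \<bar>t i \<sigma> - dot N (cavity i \<sigma>) s\<bar>"
        unfolding \<Delta>[OF m(2,1,3)] using pos \<beta> n0 by (simp add: abs_mult)
      also have "\<dots> \<le> sqrt (real n) / (q0 * B) * (2 * \<beta> / real n) * (2 * \<beta>)"
        using t_le[OF m(2,1)] dot_cavity_le[OF m(2,3), of i] pos \<beta> n0 by (intro mult_left_mono) auto
      also have "\<dots> = \<delta>"
      proof -
        have "sqrt (real n) / real n = 1 / sqrt (real n)" using sn by (simp add: field_simps power2_eq_square)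
        hence "4 * \<beta>\<^sup>2 / (q0 * B) * (sqrt (real n) / real n) = \<delta>" unfolding \<delta>_def by simp
        thus ?thesis by (simp add: power2_eq_square mult_ac)
      qed
      finally show ?thesis unfolding x by simp
    qed
    show "(\<integral>x. (T (fst (snd x)) - T ((fst (snd x))(fst x := snd (snd x)))) * \<psi> (T ((fst (snd x))(fst x := snd (snd x)))) \<partial>pair_space)
       = - (\<integral>x. (T (fst (snd x)) - T ((fst (snd x))(fst x := snd (snd x)))) * \<psi> (T (fst (snd x))) \<partial>pair_space)"
      if c: "continuous_on UNIV \<psi>" for \<psi>
    proof -
      let ?F = "\<lambda>i \<sigma> s. (T \<sigma> - T (\<sigma>(i := s))) * \<psi> (T (\<sigma>(i := s)))"
      let ?G = "\<lambda>i \<sigma> s. (T \<sigma> - T (\<sigma>(i := s))) * \<psi> (T \<sigma>)"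
      have nF: "nice2 (?F i)" if i: "i \<in> I" for i
        by (intro nice2_mult nice2_diff nice2_fst upd[OF i nT] upd[OF i n\<psi>[OF c]] nT)
      have nG: "nice2 (?G i)" if i: "i \<in> I" for i
        by (intro nice2_mult nice2_diff nice2_fst upd[OF i nT] n\<psi>[OF c] nT)
      have "ex (resample i (?F i)) = - ex (resample i (?G i))" if i: "i \<in> I" for i
      proof -
        \<comment> \<open>Reversibility exchanges \<open>\<sigma>\<close> with
          \<open>\<sigma>(i := s)\<close> and so reverses the sign of the jump.\<close>
        have "ex (resample i (?F i)) = ex (resample i (\<lambda>\<sigma> s. (T (\<sigma>(i := s)) - T \<sigma>) * \<psi> (T \<sigma>)))"
          using balance[OF i nF[OF i]] by simp
        also have "\<dots> = ex (\<lambda>\<sigma>. - 1 * resample i (?G i) \<sigma>)"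
        proof (rule ex_cong)
          fix \<sigma>
          have "resample i (\<lambda>\<sigma> s. (T (\<sigma>(i := s)) - T \<sigma>) * \<psi> (T \<sigma>)) \<sigma> = resample i (\<lambda>\<sigma> s. - 1 * ?G i \<sigma> s) \<sigma>"
            by (rule resample_cong) (simp add: algebra_simps)
          thus "resample i (\<lambda>\<sigma> s. (T (\<sigma>(i := s)) - T \<sigma>) * \<psi> (T \<sigma>)) \<sigma> = - 1 * resample i (?G i) \<sigma>"
            by (simp only: resample_cmult)
        qed
        also have "\<dots> = - 1 * ex (resample i (?G i))" by (rule ex_cmult)
        finally show ?thesis by simp
      qed
      thus ?thesis
        using integral_pair_space(1)[of ?F, OF nF] integral_pair_space(1)[of ?G, OF nG]
        by (simp add: sum_negf)
    qed
    show "(\<integral>x. (T (fst (snd x)) - T ((fst (snd x))(fst x := snd (snd x)))) * \<psi> (T (fst (snd x))) \<partial>pair_space)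
       = 2 * \<kappa> / real n * (\<integral>x. (T (fst (snd x)) + R (fst (snd x))) * \<psi> (T (fst (snd x))) \<partial>pair_space)"
      if c: "continuous_on UNIV \<psi>" for \<psi>
    proof -
      let ?G = "\<lambda>i \<sigma> s. (T \<sigma> - T (\<sigma>(i := s))) * \<psi> (T \<sigma>)"
      have nG: "nice2 (?G i)" if i: "i \<in> I" for i
        by (intro nice2_mult nice2_diff nice2_fst upd[OF i nT] n\<psi>[OF c] nT)
      have "(\<Sum>i\<in>I. ex (resample i (?G i))) = ex (\<lambda>\<sigma>. \<Sum>i\<in>I. resample i (?G i) \<sigma>)"
        by (rule ex_sum'[symmetric]) (rule nice_resample[OF nG])
      also have "\<dots> = ex (\<lambda>\<sigma>. 2 * \<kappa> * ((T \<sigma> + R \<sigma>) * \<psi> (T \<sigma>)))"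
      proof (rule ex_cong)
        fix \<sigma> assume \<sigma>: "\<sigma> \<in> space \<Omega>"
        let ?c = "sqrt (real n) / (q0 * B)"
        have "resample i (?G i) \<sigma> = \<psi> (T \<sigma>) * ?c * (2 * \<beta> / real n) * (t i \<sigma> - mean_proj N (Qc i \<sigma>))" if i: "i \<in> I" for i
        proof -
          have "resample i (?G i) \<sigma> = resample i (\<lambda>\<sigma> s. (\<psi> (T \<sigma>) * ?c * (2 * \<beta> / real n)) * (t i \<sigma> - dot N (cavity i \<sigma>) s)) \<sigma>"
            by (rule resample_cong) (simp only: \<Delta>[OF \<sigma> i] mult_ac)
          also have "\<dots> = (\<psi> (T \<sigma>) * ?c * (2 * \<beta> / real n)) * resample i (\<lambda>\<sigma> s. t i \<sigma> - dot N (cavity i \<sigma>) s) \<sigma>"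
            by (rule resample_cmult)
          also have "resample i (\<lambda>\<sigma> s. t i \<sigma> - dot N (cavity i \<sigma>) s) \<sigma> = t i \<sigma> - mean_proj N (Qc i \<sigma>)"
            by (subst resample_diff[OF nice2_fst[OF nice_t[OF i]] nice2_dot \<sigma>]) (simp add: resample_dot)
          finally show ?thesis .
        qed
        hence "(\<Sum>i\<in>I. resample i (?G i) \<sigma>) = \<psi> (T \<sigma>) * ?c * (2 * \<beta> / real n) * (\<Sum>i\<in>I. t i \<sigma> - mean_proj N (Qc i \<sigma>))"
          by (simp only: sum_distrib_left cong: sum.cong)
        also have "(\<Sum>i\<in>I. t i \<sigma> - mean_proj N (Qc i \<sigma>)) = real n / \<beta> * Q \<sigma> - \<beta> - (\<Sum>i\<in>I. mean_proj N (Qc i \<sigma>))"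
          by (simp only: sum_subtractf sum_t[OF \<sigma>])
        also have "\<psi> (T \<sigma>) * ?c * (2 * \<beta> / real n) * (real n / \<beta> * Q \<sigma> - \<beta> - (\<Sum>i\<in>I. mean_proj N (Qc i \<sigma>)))
          = 2 * \<psi> (T \<sigma>) * ?c * (Q \<sigma> - \<beta>\<^sup>2 / real n - \<beta> / real n * (\<Sum>i\<in>I. mean_proj N (Qc i \<sigma>)))"
        proof -
          have "\<beta> / real n * (real n / \<beta> * Q \<sigma> - \<beta> - x) = Q \<sigma> - \<beta>\<^sup>2 / real n - \<beta> / real n * x" for x
            using n0 \<beta> by (simp add: right_diff_distrib power2_eq_square)
          from this[of "\<Sum>i\<in>I. mean_proj N (Qc i \<sigma>)", symmetric] show ?thesis by simp
        qed
        also have "\<dots> = 2 * \<kappa> * ((T \<sigma> + R \<sigma>) * \<psi> (T \<sigma>))"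
        proof -
          have "T \<sigma> = ?c * (Q \<sigma> - q0)" unfolding T_def using pos by (simp add: field_simps)
          hence "T \<sigma> + R \<sigma> = ?c * ((Q \<sigma> - \<beta>\<^sup>2 / real n - \<beta> / real n * (\<Sum>i\<in>I. mean_proj N (Qc i \<sigma>))) / \<kappa>)"
            unfolding R_def drift_error_def by (simp only: distrib_left[symmetric]) simp
          thus ?thesis using pos by (simp add: mult_ac)
        qed
        finally show "(\<Sum>i\<in>I. resample i (?G i) \<sigma>) = 2 * \<kappa> * ((T \<sigma> + R \<sigma>) * \<psi> (T \<sigma>))" .
      qed
      also have "\<dots> = 2 * \<kappa> * ex (\<lambda>\<sigma>. (T \<sigma> + R \<sigma>) * \<psi> (T \<sigma>))" by (rule ex_cmult)
      finally have "(\<Sum>i\<in>I. ex (resample i (?G i))) = 2 * \<kappa> * ex (\<lambda>\<sigma>. (T \<sigma> + R \<sigma>) * \<psi> (T \<sigma>))" .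
      thus ?thesis
        using integral_pair_space(1)[of ?G, OF nG]
          integral_pair_space_fst(1)[of "\<lambda>\<sigma>. (T \<sigma> + R \<sigma>) * \<psi> (T \<sigma>)", OF nice_mult[OF nice_add[OF nT nR] n\<psi>[OF c]]]
        by simp
    qed
    show "(\<integral>x. (T (fst (snd x)) - T ((fst (snd x))(fst x := snd (snd x))))\<^sup>2 * \<psi> (T (fst (snd x))) \<partial>pair_space)
       = 2 * (2 * \<kappa> / real n) * (\<integral>x. (1 + D (fst (snd x))) * \<psi> (T (fst (snd x))) \<partial>pair_space)"
      if c: "continuous_on UNIV \<psi>" for \<psi>
    proof -
      let ?G = "\<lambda>i \<sigma> s. (T \<sigma> - T (\<sigma>(i := s)))\<^sup>2 * \<psi> (T \<sigma>)"
      have nG: "nice2 (?G i)" if i: "i \<in> I" for i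
        by (intro nice2_mult nice2_power nice2_diff nice2_fst upd[OF i nT] n\<psi>[OF c] nT)
      have "(\<Sum>i\<in>I. ex (resample i (?G i))) = ex (\<lambda>\<sigma>. \<Sum>i\<in>I. resample i (?G i) \<sigma>)"
        by (rule ex_sum'[symmetric]) (rule nice_resample[OF nG])
      also have "\<dots> = ex (\<lambda>\<sigma>. 4 * \<kappa> * ((1 + D \<sigma>) * \<psi> (T \<sigma>)))"
      proof (rule ex_cong)
        fix \<sigma> assume \<sigma>: "\<sigma> \<in> space \<Omega>"
        let ?c = "(sqrt (real n) / (q0 * B) * (2 * \<beta> / real n))\<^sup>2"
        have "resample i (?G i) \<sigma> = (\<psi> (T \<sigma>) * ?c) * ((t i \<sigma>)\<^sup>2 - 2 * t i \<sigma> * mean_proj N (Qc i \<sigma>) + second_moment N (Qc i \<sigma>))" if i: "i \<in> I" for i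
        proof -
          let ?d = "\<lambda>\<sigma> s. dot N (cavity i \<sigma>) s"
          have nt: "nice2 (\<lambda>\<sigma> s. (t i \<sigma>)\<^sup>2)" "nice2 (\<lambda>\<sigma> s. 2 * t i \<sigma> * ?d \<sigma> s)" "nice2 (\<lambda>\<sigma> s. (?d \<sigma> s)\<^sup>2)"
            by (intro nice2_intros nice_intros i)+
          have "resample i (?G i) \<sigma> = resample i (\<lambda>\<sigma> s. (\<psi> (T \<sigma>) * ?c) * ((t i \<sigma>)\<^sup>2 - 2 * t i \<sigma> * ?d \<sigma> s + (?d \<sigma> s)\<^sup>2)) \<sigma>"
          proof (rule resample_cong)
            fix s assume s: "s \<in> space \<mu>"
            have "(t i \<sigma> - ?d \<sigma> s)\<^sup>2 = (t i \<sigma>)\<^sup>2 - 2 * t i \<sigma> * ?d \<sigma> s + (?d \<sigma> s)\<^sup>2"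
              by (simp add: power2_diff)
            thus "?G i \<sigma> s = (\<psi> (T \<sigma>) * ?c) * ((t i \<sigma>)\<^sup>2 - 2 * t i \<sigma> * ?d \<sigma> s + (?d \<sigma> s)\<^sup>2)"
              unfolding \<Delta>[OF \<sigma> i s] power_mult_distrib[of "_ * _" "t i \<sigma> - ?d \<sigma> s"] by (simp only: mult_ac)
          qed
          also have "\<dots> = (\<psi> (T \<sigma>) * ?c) * resample i (\<lambda>\<sigma> s. (t i \<sigma>)\<^sup>2 - 2 * t i \<sigma> * ?d \<sigma> s + (?d \<sigma> s)\<^sup>2) \<sigma>"
            by (rule resample_cmult)
          also have "resample i (\<lambda>\<sigma> s. (t i \<sigma>)\<^sup>2 - 2 * t i \<sigma> * ?d \<sigma> s + (?d \<sigma> s)\<^sup>2) \<sigma>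
             = (t i \<sigma>)\<^sup>2 - 2 * t i \<sigma> * mean_proj N (Qc i \<sigma>) + second_moment N (Qc i \<sigma>)"
            by (simp only: resample_add[OF nice2_diff[OF nt(1,2)] nt(3) \<sigma>] resample_diff[OF nt(1,2) \<sigma>]
                resample_fst resample_cmult resample_dot resample_dot_sq)
          finally show ?thesis .
        qed
        hence "(\<Sum>i\<in>I. resample i (?G i) \<sigma>) = \<psi> (T \<sigma>) * ?c * (\<Sum>i\<in>I. (t i \<sigma>)\<^sup>2 - 2 * t i \<sigma> * mean_proj N (Qc i \<sigma>) + second_moment N (Qc i \<sigma>))"
          by (simp only: sum_distrib_left cong: sum.cong)
        also have "\<dots> = \<psi> (T \<sigma>) * ?c * (real n * avg_square \<sigma>)"
          unfolding avg_square_def using n0 by simp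
        also have "avg_square \<sigma> = (2 * q0 * v) * (1 + D \<sigma>)" unfolding D_def using pos by (simp add: field_simps)
        also have "\<psi> (T \<sigma>) * ?c * (real n * ((2 * q0 * v) * (1 + D \<sigma>))) = (?c * real n * (2 * q0 * v)) * ((1 + D \<sigma>) * \<psi> (T \<sigma>))"
          by (simp only: mult_ac)
        \<comment> \<open>This normalisation determines \<open>B\<close>: the second moment must be
          twice the drift rate.\<close>
        also have "?c * real n * (2 * q0 * v) = 4 * \<kappa>"
          unfolding power_mult_distrib power_divide sn(2) B2 using pos n0 \<beta>
          by (simp add: field_simps power2_eq_square)
        finally show "(\<Sum>i\<in>I. resample i (?G i) \<sigma>) = 4 * \<kappa> * ((1 + D \<sigma>) * \<psi> (T \<sigma>))" .
      qed
      also have "\<dots> = 4 * \<kappa> * ex (\<lambda>\<sigma>. (1 + D \<sigma>) * \<psi> (T \<sigma>))" by (rule ex_cmult)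
      finally have "(\<Sum>i\<in>I. ex (resample i (?G i))) = 4 * \<kappa> * ex (\<lambda>\<sigma>. (1 + D \<sigma>) * \<psi> (T \<sigma>))" .
      thus ?thesis
        using integral_pair_space(1)[of ?G, OF nG]
          integral_pair_space_fst(1)[of "\<lambda>\<sigma>. (1 + D \<sigma>) * \<psi> (T \<sigma>)", OF nice_mult[OF nice_add[OF nice_const nD] n\<psi>[OF c]]]
        by simp
    qed
    show "(\<integral>x. (T (fst (snd x)))\<^sup>2 \<partial>pair_space) \<le> s"
      using s integral_pair_space_fst(1)[OF nice_power[OF nT, of 2]] by simp
    show "(\<integral>x. \<bar>R (fst (snd x))\<bar> \<partial>pair_space) \<le> a * \<delta>"
      using a(1) integral_pair_space_fst(1)[OF nice_abs[OF nR]] by simp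
    show "(\<integral>x. (D (fst (snd x)))\<^sup>2 \<partial>pair_space) \<le> a * \<delta>\<^sup>2"
      using a(2) integral_pair_space_fst(1)[OF nice_power[OF nD, of 2]] by simp
  qed
qed

end

section \<open>The normal approximation\<close>

context vector_model
begin

text \<open>The error is quadratic in \<open>Q - q0\<close>, hence of order \<open>1/n\<close> in
  the mean, and the prefactor \<open>sqrt n\<close> leaves order \<open>1 / sqrt n\<close>.\<close>

lemma drift_error_expectation:
  assumes R: "\<And>\<sigma>. \<sigma> \<in> space \<Omega> \<Longrightarrow> \<bar>drift_error \<kappa> q0 \<sigma>\<bar> \<le> Kr * ((Q \<sigma> - q0)\<^sup>2 + 1 / real n)"
    and V: "ex (\<lambda>\<sigma>. (Q \<sigma> - q0)\<^sup>2) \<le> C / real n" and pos: "0 \<le> Kr" "0 < c"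
  shows "ex (\<lambda>\<sigma>. \<bar>sqrt (real n) / c * drift_error \<kappa> q0 \<sigma>\<bar>) \<le> Kr * (C + 1) / c / sqrt (real n)"
proof -
  have "ex (\<lambda>\<sigma>. \<bar>sqrt (real n) / c * drift_error \<kappa> q0 \<sigma>\<bar>) \<le> ex (\<lambda>\<sigma>. sqrt (real n) / c * Kr * ((Q \<sigma> - q0)\<^sup>2 + 1 / real n))"
  proof (rule ex_le)
    fix \<sigma> assume \<sigma>: "\<sigma> \<in> space \<Omega>"
    have "\<bar>sqrt (real n) / c * drift_error \<kappa> q0 \<sigma>\<bar> = sqrt (real n) / c * \<bar>drift_error \<kappa> q0 \<sigma>\<bar>"
      using pos by (simp add: abs_mult)
    also have "\<dots> \<le> sqrt (real n) / c * (Kr * ((Q \<sigma> - q0)\<^sup>2 + 1 / real n))"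
      by (rule mult_left_mono[OF R[OF \<sigma>]]) (use pos in auto)
    finally show "\<bar>sqrt (real n) / c * drift_error \<kappa> q0 \<sigma>\<bar> \<le> sqrt (real n) / c * Kr * ((Q \<sigma> - q0)\<^sup>2 + 1 / real n)"
      by (simp only: mult.assoc)
  qed (intro nice_intros nice_drift_error)+
  also have "\<dots> = sqrt (real n) / c * Kr * (ex (\<lambda>\<sigma>. (Q \<sigma> - q0)\<^sup>2) + 1 / real n)"
    by (simp only: ex_cmult) (subst ex_add, (intro nice_intros)+, simp only: ex_const)
  also have "\<dots> \<le> sqrt (real n) / c * Kr * (C / real n + 1 / real n)"
    using V pos by (intro mult_left_mono add_right_mono) auto
  also have "\<dots> = Kr * (C + 1) / c / sqrt (real n)"
  proof -
    have "sqrt (real n) / c * Kr * (C / real n + 1 / real n) = Kr * (C + 1) / c * (sqrt (real n) / real n)"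
      by (simp add: add_divide_distrib[symmetric] mult_ac)
    also have "sqrt (real n) / real n = 1 / sqrt (real n)" using n0 by (simp add: field_simps)
    finally show ?thesis by simp
  qed
  finally show ?thesis .
qed

text \<open>Here the term linear in \<open>Q - q0\<close> and the fluctuation of the squares both
  have mean square of order \<open>1/n\<close>, matching the order \<open>\<delta>^2\<close> allowed
  for \<open>D\<close>.\<close>

lemma avg_square_expectation:
  assumes A: "\<And>\<sigma>. \<sigma> \<in> space \<Omega> \<Longrightarrow> \<bar>avg_square \<sigma> - m\<bar> \<le> \<bar>\<Sum>i\<in>I. (t i \<sigma>)\<^sup>2 - second_moment N (Qc i \<sigma>)\<bar> / real n
     + k1 * \<bar>Q \<sigma> - q0\<bar> + k2 / real n"
    and F: "ex (\<lambda>\<sigma>. (\<Sum>i\<in>I. (t i \<sigma>)\<^sup>2 - second_moment N (Qc i \<sigma>))\<^sup>2) \<le> k3 * real n"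
    and V: "ex (\<lambda>\<sigma>. (Q \<sigma> - q0)\<^sup>2) \<le> C / real n"
  shows "ex (\<lambda>\<sigma>. ((avg_square \<sigma> - m) / m)\<^sup>2) \<le> 3 * (k3 + k1\<^sup>2 * C + k2\<^sup>2) / m\<^sup>2 / real n"
proof -
  let ?Y = "\<lambda>\<sigma>. \<Sum>i\<in>I. (t i \<sigma>)\<^sup>2 - second_moment N (Qc i \<sigma>)"
  have nY: "nice ?Y" by (intro nice_intros) assumption
  have "ex (\<lambda>\<sigma>. ((avg_square \<sigma> - m) / m)\<^sup>2) \<le>
     ex (\<lambda>\<sigma>. 3 / m\<^sup>2 * (1 / (real n)\<^sup>2 * (?Y \<sigma>)\<^sup>2 + k1\<^sup>2 * (Q \<sigma> - q0)\<^sup>2 + (k2 / real n)\<^sup>2))"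
  proof (rule ex_le)
    fix \<sigma> assume \<sigma>: "\<sigma> \<in> space \<Omega>"
    have three: "(a + b + c)\<^sup>2 \<le> 3 * (a\<^sup>2 + b\<^sup>2 + c\<^sup>2)" for a b c :: real
      using zero_le_power2[of "a - b"] zero_le_power2[of "a - c"] zero_le_power2[of "b - c"]
      by (simp add: power2_eq_square algebra_simps)
    have "(avg_square \<sigma> - m)\<^sup>2 \<le> (\<bar>?Y \<sigma>\<bar> / real n + k1 * \<bar>Q \<sigma> - q0\<bar> + k2 / real n)\<^sup>2"
      using power_mono[OF A[OF \<sigma>] abs_ge_zero, of 2] by simp
    also have "\<dots> \<le> 3 * ((\<bar>?Y \<sigma>\<bar> / real n)\<^sup>2 + (k1 * \<bar>Q \<sigma> - q0\<bar>)\<^sup>2 + (k2 / real n)\<^sup>2)" by (rule three)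
    also have "\<dots> = 3 * (1 / (real n)\<^sup>2 * (?Y \<sigma>)\<^sup>2 + k1\<^sup>2 * (Q \<sigma> - q0)\<^sup>2 + (k2 / real n)\<^sup>2)"
      by (simp only: power_divide power_mult_distrib power2_abs times_divide_eq_left mult_1_left)
    finally have "(avg_square \<sigma> - m)\<^sup>2 / m\<^sup>2 \<le> 3 * (1 / (real n)\<^sup>2 * (?Y \<sigma>)\<^sup>2 + k1\<^sup>2 * (Q \<sigma> - q0)\<^sup>2 + (k2 / real n)\<^sup>2) / m\<^sup>2"
      by (rule divide_right_mono) simp
    thus "((avg_square \<sigma> - m) / m)\<^sup>2 \<le> 3 / m\<^sup>2 * (1 / (real n)\<^sup>2 * (?Y \<sigma>)\<^sup>2 + k1\<^sup>2 * (Q \<sigma> - q0)\<^sup>2 + (k2 / real n)\<^sup>2)"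
      by (simp only: power_divide times_divide_eq_left)
  qed (intro nice_intros nY nice_avg_square)+
  also have "\<dots> = 3 / m\<^sup>2 * (1 / (real n)\<^sup>2 * ex (\<lambda>\<sigma>. (?Y \<sigma>)\<^sup>2) + k1\<^sup>2 * ex (\<lambda>\<sigma>. (Q \<sigma> - q0)\<^sup>2) + (k2 / real n)\<^sup>2)"
    by (simp only: ex_cmult) (subst ex_add, (intro nice_intros nY)+, subst ex_add, (intro nice_intros nY)+, simp only: ex_const ex_cmult)
  also have "\<dots> \<le> 3 / m\<^sup>2 * (1 / (real n)\<^sup>2 * (k3 * real n) + k1\<^sup>2 * (C / real n) + k2\<^sup>2 / real n)"
  proof (intro mult_left_mono add_mono F V)
    have "1 * real n \<le> real n * real n" using n by (intro mult_right_mono) auto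
    thus "(k2 / real n)\<^sup>2 \<le> k2\<^sup>2 / real n"
      unfolding power_divide using n0 by (intro divide_left_mono) (auto simp: power2_eq_square)
  qed auto
  also have "1 / (real n)\<^sup>2 * (k3 * real n) = k3 / real n" using n0 by (simp add: power2_eq_square)
  also have "3 / m\<^sup>2 * (k3 / real n + k1\<^sup>2 * (C / real n) + k2\<^sup>2 / real n) = 3 * (k3 + k1\<^sup>2 * C + k2\<^sup>2) / m\<^sup>2 / real n"
    by (simp only: times_divide_eq_right times_divide_eq_left add_divide_distrib[symmetric] divide_divide_eq_left mult.commute)
  finally show ?thesis .
qed

end

lemma logd_margin:
  assumes N: "2 \<le> N" and \<beta>: "real N < \<beta>"
  obtains \<eta> \<epsilon> where "0 < \<eta>" "0 < \<epsilon>" "\<And>q. 0 \<le> q \<Longrightarrow> q \<le> \<epsilon> \<Longrightarrow> (1 + \<eta>) / \<beta> \<le> logd N q"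
proof -
  \<comment> \<open>With this choice \<open>(1 + \<eta>) / \<beta>\<close> is the midpoint of
    \<open>1 / \<beta>\<close> and \<open>1 / N\<close>, the latter being
    \<open>logd N 0\<close>.\<close>
  define \<eta> where "\<eta> = (\<beta> / real N - 1) / 2"
  have \<eta>: "0 < \<eta>" unfolding \<eta>_def using N \<beta> by (simp add: field_simps)
  have lt: "(1 + \<eta>) / \<beta> < logd N 0"
    unfolding logd_at_0[OF N] \<eta>_def using N \<beta> by (simp add: field_simps)
  have "isCont (logd N) 0" by (rule DERIV_isCont[OF logd_has_derivative[OF N]]) simp
  hence "eventually (\<lambda>q. (1 + \<eta>) / \<beta> < logd N q) (at 0)"
    using lt unfolding isCont_def by (rule order_tendstoD)
  then obtain d where d: "0 < d" "\<And>q. q \<noteq> 0 \<Longrightarrow> dist q 0 < d \<Longrightarrow> (1 + \<eta>) / \<beta> < logd N q"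
    unfolding eventually_at by auto
  show thesis
  proof (rule that[OF \<eta>, of "d / 2"])
    fix q assume "0 \<le> q" "q \<le> d / 2"
    thus "(1 + \<eta>) / \<beta> \<le> logd N q" using d lt by (cases "q = 0") (auto simp: less_imp_le)
  qed (use d in simp)
qed

text \<open>\<open>- logd'\<close> is continuous and positive, hence bounded below on the compact
  interval, and the mean value theorem turns this into linear growth away from
  \<open>q0\<close>.\<close>

lemma logd_expanding:
  assumes N: "2 \<le> N" and q0: "q0 \<in> {0..r}"
  obtains \<delta> where "0 < \<delta>" "\<And>q. q \<in> {0..r} \<Longrightarrow> \<delta> * \<bar>q - q0\<bar> \<le> \<bar>logd N q0 - logd N q\<bar>"
proof -
  have "\<exists>x\<in>{0..r}. \<forall>y\<in>{0..r}. - logd' N x \<le> - logd' N y"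
    by (rule continuous_attains_inf) (use q0 in \<open>auto intro!: continuous_intros continuous_on_logd'[OF N]\<close>)
  then obtain x where x: "x \<in> {0..r}" "\<And>y. y \<in> {0..r} \<Longrightarrow> - logd' N x \<le> - logd' N y" by blast
  show thesis
  proof (rule that[of "- logd' N x"])
    show "0 < - logd' N x" using logd'_neg[OF N, of x] x(1) by simp
    fix q assume q: "q \<in> {0..r}"
    obtain \<xi> where \<xi>: "\<xi> \<in> {0..r}" "logd N q - logd N q0 = (q - q0) * logd' N \<xi>"
      by (rule mean_value_Icc[OF _ q q0, of "logd N" "logd' N"]) (use logd_has_derivative[OF N] in auto)
    have "- logd' N x * \<bar>q - q0\<bar> \<le> \<bar>logd' N \<xi>\<bar> * \<bar>q - q0\<bar>"
      using x(2)[OF \<xi>(1)] by (intro mult_right_mono) auto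
    also have "\<dots> = \<bar>logd N q0 - logd N q\<bar>"
      by (subst (2) abs_minus_commute) (simp only: \<xi>(2) abs_mult mult.commute)
    finally show "- logd' N x * \<bar>q - q0\<bar> \<le> \<bar>logd N q0 - logd N q\<bar>" .
  qed
qed

text \<open>All constants are fixed before \<open>n\<close> is introduced; the locale is then
  interpreted for each \<open>n\<close> and the pair fed into the abstract theorem.\<close>

theorem fixed_dimension_bounds:
  assumes N: "2 \<le> N" and N\<beta>: "real N < \<beta>"
  shows "\<exists>C>0. \<forall>n\<ge>1.
    (\<forall>h :: real \<Rightarrow> real. (\<forall>x y. \<bar>h x - h y\<bar> \<le> \<bar>x - y\<bar>) \<longrightarrow>
       \<bar>(\<integral>\<sigma>. h (W N \<beta> n \<sigma> / B_const N \<beta>) \<partial>gibbs N \<beta> n) - gauss_exp h\<bar> \<le> C / sqrt (real n)) \<and>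
    (\<forall>z. \<bar>measure (gibbs N \<beta> n) {\<sigma> \<in> space (gibbs N \<beta> n). W N \<beta> n \<sigma> / B_const N \<beta> \<le> z}
       - cdf std_normal_distribution z\<bar> \<le> C / sqrt (real n))"
proof -
  have \<beta>: "0 < \<beta>" using N N\<beta> by simp
  define q0 where "q0 = (b_crit N \<beta>)\<^sup>2"
  define v where "v = 1 - (real N - 1) / \<beta> - q0 / \<beta>\<^sup>2"
  define \<kappa> where "\<kappa> = - \<beta> * q0 * logd' N q0"
  define B where "B = B_const N \<beta>"
  note b = b_crit_properties[OF N N\<beta>]
  have q0: "0 < q0" "q0 \<in> {0..\<beta>\<^sup>2}" using b unfolding q0_def by auto
  have lq: "logd N q0 = 1 / \<beta>" using b(2) \<beta> unfolding q0_def by (simp add: field_simps)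
  have mq: "mean_proj N q0 = q0 / \<beta>" unfolding mean_proj_def lq by simp
  have c: "0 < v" "0 < \<kappa>" "0 < B" "B\<^sup>2 = 2 * \<beta>\<^sup>2 * v / (\<kappa> * q0)" "second_moment N q0 - (q0 / \<beta>)\<^sup>2 = q0 * v"
    using B_const_properties[OF N N\<beta>] unfolding q0_def[symmetric] v_def \<kappa>_def B_def by auto
  have sv: "second_moment N q0 - q0 * mean_proj N q0 / \<beta> = q0 * v"
    using c(5) unfolding mq by (simp add: power2_eq_square)
  \<comment> \<open>Two readings of the restoring slope agree by the Riccati equation:
    \<open>\<kappa>\<close> is defined from \<open>logd'\<close>, whereas the drift expansion
    produces \<open>mean_proj'\<close>.\<close>
  have \<kappa>1: "\<kappa> = 1 - \<beta> * mean_proj' N q0"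
  proof -
    have r: "2 * q0 * logd' N q0 = 1 - real N * (1 / \<beta>) - q0 * (1 / \<beta>)\<^sup>2"
      using logd_riccati[OF N, of q0] q0(1) unfolding lq by simp
    have "\<kappa> = - (\<beta> / 2) * (2 * q0 * logd' N q0)" unfolding \<kappa>_def by simp
    thus ?thesis unfolding r mean_proj'_def lq using \<beta> by (simp add: field_simps power2_eq_square)
  qed
  obtain L where L: "0 < L"
    "\<And>x y. x \<in> {0..\<beta>\<^sup>2} \<Longrightarrow> y \<in> {0..\<beta>\<^sup>2} \<Longrightarrow> \<bar>mean_proj N x - mean_proj N y\<bar> \<le> L * \<bar>x - y\<bar>"
    "\<And>x y. x \<in> {0..\<beta>\<^sup>2} \<Longrightarrow> y \<in> {0..\<beta>\<^sup>2} \<Longrightarrow> \<bar>second_moment N x - second_moment N y\<bar> \<le> L * \<bar>x - y\<bar>"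
    "\<And>x y. x \<in> {0..\<beta>\<^sup>2} \<Longrightarrow> y \<in> {0..\<beta>\<^sup>2} \<Longrightarrow> \<bar>x * mean_proj N x - y * mean_proj N y\<bar> \<le> L * \<bar>x - y\<bar>"
    "\<And>x. x \<in> {0..\<beta>\<^sup>2} \<Longrightarrow> \<bar>mean_proj N x - mean_proj N q0 - mean_proj' N q0 * (x - q0)\<bar> \<le> L * (x - q0)\<^sup>2"
    by (rule lipschitz_constants[OF N q0(2)]) blast
  have L0: "0 \<le> L" using L by simp
  obtain \<eta> \<epsilon> where \<eta>: "0 < \<eta>" "0 < \<epsilon>" "\<And>q. 0 \<le> q \<Longrightarrow> q \<le> \<epsilon> \<Longrightarrow> (1 + \<eta>) / \<beta> \<le> logd N q"
    by (rule logd_margin[OF N N\<beta>]) blast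
  obtain \<delta> where \<delta>: "0 < \<delta>" "\<And>q. q \<in> {0..\<beta>\<^sup>2} \<Longrightarrow> \<delta> * \<bar>q - q0\<bar> \<le> \<bar>1 / \<beta> - logd N q\<bar>"
    by (rule logd_expanding[OF N q0(2)]) (use lq in auto)
  \<comment> \<open>The bound of \<open>Q_concentration\<close> contains no \<open>n\<close> in its
    numerator, so one constant can be extracted for all \<open>n\<close>.\<close>
  have "\<exists>C. \<forall>n\<ge>1. vector_model.ex N n \<beta> (\<lambda>\<sigma>. (vector_model.Q N n \<beta> \<sigma> - q0)\<^sup>2) \<le> C / real n"
  proof (intro exI allI impI)
    fix n :: nat assume n: "1 \<le> n"
    interpret vector_model N n \<beta> by unfold_locales (rule N n \<beta>)+
    show "ex (\<lambda>\<sigma>. (Q \<sigma> - q0)\<^sup>2) \<le> ((\<beta>\<^sup>2)\<^sup>2 * (4 * (1 + \<eta>) / \<eta> + 6 * \<beta>\<^sup>2 / \<epsilon> + (16 * \<beta> * (1 + \<beta>\<^sup>2) / (min (\<eta> / (2 * \<beta>)) \<beta> * (\<epsilon> / 8)))\<^sup>2 * (1 + \<beta>\<^sup>2))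
      + (2 * ((2 * \<beta>)\<^sup>2 + 2 * \<beta> * (2 * \<beta> + 4 * \<beta>\<^sup>2 * L)) + 2 * (\<beta> + 3 * L * \<beta>\<^sup>2)\<^sup>2) / (\<epsilon> / 8 * \<delta>)\<^sup>2) / real n"
      by (rule Q_concentration[OF L0 L(2) \<eta>(1,3,2) \<delta> q0(2) refl refl refl refl refl])
  qed
  then obtain C3 where C3: "\<And>n. 1 \<le> n \<Longrightarrow> vector_model.ex N n \<beta> (\<lambda>\<sigma>. (vector_model.Q N n \<beta> \<sigma> - q0)\<^sup>2) \<le> C3 / real n"
    by blast
  define Kr where "Kr = (\<beta> * L + \<beta>\<^sup>2 + 3 * L * \<beta>\<^sup>2 * \<beta>) / \<kappa>"
  have Kr0: "0 \<le> Kr" unfolding Kr_def using \<beta> L c by auto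
  define d where "d = 4 * \<beta>\<^sup>2 / (q0 * B)"
  have d0: "0 < d" unfolding d_def using \<beta> q0 c by simp
  define s where "s = C3 / (B\<^sup>2 * q0\<^sup>2)"
  define k3 where "k3 = (\<beta>\<^sup>2)\<^sup>2 + \<beta>\<^sup>2 * (4 * \<beta>\<^sup>2 + 4 * \<beta>\<^sup>2 * L)"
  define k1 where "k1 = 2 * L + 2 * L / \<beta>"
  define k2 where "k2 = 6 * L * \<beta>\<^sup>2 + 6 * L * \<beta>\<^sup>2 * \<beta> + 2 * \<beta>\<^sup>2"
  define a1 where "a1 = Kr * (C3 + 1) / (q0 * B)"
  define a2 where "a2 = 3 * (k3 + k1\<^sup>2 * C3 + k2\<^sup>2) / (2 * q0 * v)\<^sup>2"
  \<comment> \<open>The abstract theorem measures errors in units of its \<open>\<delta>\<close>,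
    here \<open>d / sqrt n\<close>, so the L1 constant is divided by \<open>d\<close> and the L2
    constant by \<open>d^2\<close>.\<close>
  define a where "a = max (a1 / d) (a2 / d\<^sup>2)"
  obtain CA where CA0: "0 < CA" and CA1: "\<forall>(M :: (nat \<times> (nat \<Rightarrow> nat \<Rightarrow> real) \<times> (nat \<Rightarrow> real)) measure) T T' R D \<delta> \<rho>.
    exchangeable_pair M T T' R D \<delta> \<rho> s a (8 * (\<beta>\<^sup>2)\<^sup>2 / (q0\<^sup>2 * B\<^sup>2 * \<kappa>)) d \<longrightarrow>
      (\<forall>h :: real \<Rightarrow> real. (\<forall>x y. \<bar>h x - h y\<bar> \<le> \<bar>x - y\<bar>) \<longrightarrow>
         \<bar>(\<integral>x. h (T x) \<partial>M) - gauss_exp h\<bar> \<le> CA * \<delta>) \<and>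
      (\<forall>z. \<bar>measure M {x \<in> space M. T x \<le> z} - cdf std_normal_distribution z\<bar> \<le> CA * \<delta>)"
    using exchangeable_pair_normal_approximation[of s a "8 * (\<beta>\<^sup>2)\<^sup>2 / (q0\<^sup>2 * B\<^sup>2 * \<kappa>)" d]
    by (elim exE conjE) (rule that)
  note CA = CA0 CA1[THEN spec, THEN spec, THEN spec, THEN spec, THEN spec, THEN spec, THEN spec, THEN mp]
  show ?thesis
  proof (intro exI[of _ "CA * d"] conjI allI impI)
    show "0 < CA * d" using CA d0 by simp
  next
    fix n :: nat assume n: "1 \<le> n"
    interpret vector_model N n \<beta> by unfold_locales (rule N n \<beta>)+
    let ?T = "\<lambda>\<sigma>. sqrt (real n) / B * (Q \<sigma> / q0 - 1)"
    let ?\<delta> = "4 * \<beta>\<^sup>2 / (q0 * B * sqrt (real n))"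
    have sn: "0 < sqrt (real n)" using n0 by simp
    have \<delta>n: "?\<delta> = d / sqrt (real n)" unfolding d_def by simp
    have V: "ex (\<lambda>\<sigma>. (Q \<sigma> - q0)\<^sup>2) \<le> C3 / real n" by (rule C3[OF n])
    have Ts: "ex (\<lambda>\<sigma>. (?T \<sigma>)\<^sup>2) \<le> s"
    proof -
      have "(?T \<sigma>)\<^sup>2 = real n / (B\<^sup>2 * q0\<^sup>2) * (Q \<sigma> - q0)\<^sup>2" for \<sigma>
      proof -
        have "?T \<sigma> = sqrt (real n) / (B * q0) * (Q \<sigma> - q0)" using q0 c by (simp add: field_simps)
        thus ?thesis by (simp add: power_mult_distrib power_divide)
      qed
      hence "ex (\<lambda>\<sigma>. (?T \<sigma>)\<^sup>2) = real n / (B\<^sup>2 * q0\<^sup>2) * ex (\<lambda>\<sigma>. (Q \<sigma> - q0)\<^sup>2)" by (simp only: ex_cmult)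
      also have "\<dots> \<le> real n / (B\<^sup>2 * q0\<^sup>2) * (C3 / real n)" by (rule mult_left_mono[OF V]) simp
      also have "\<dots> = s" unfolding s_def using n0 by simp
      finally show ?thesis .
    qed
    have Rs: "ex (\<lambda>\<sigma>. \<bar>sqrt (real n) / (q0 * B) * drift_error \<kappa> q0 \<sigma>\<bar>) \<le> a * ?\<delta>"
    proof -
      have "ex (\<lambda>\<sigma>. \<bar>sqrt (real n) / (q0 * B) * drift_error \<kappa> q0 \<sigma>\<bar>) \<le> Kr * (C3 + 1) / (q0 * B) / sqrt (real n)"
        by (rule drift_error_expectation[OF drift_error_bound[OF L0 L(2) L(5) mq \<kappa>1 c(2), folded Kr_def] V Kr0
              mult_pos_pos[OF q0(1) c(3)]])
      also have "\<dots> = (a1 / d) * ?\<delta>" unfolding \<delta>n a1_def using d0 by simp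
      also have "\<dots> \<le> a * ?\<delta>" unfolding a_def \<delta>n using d0 sn by (intro mult_right_mono) auto
      finally show ?thesis .
    qed
    have Ds: "ex (\<lambda>\<sigma>. ((avg_square \<sigma> - 2 * q0 * v) / (2 * q0 * v))\<^sup>2) \<le> a * ?\<delta>\<^sup>2"
    proof -
      have "ex (\<lambda>\<sigma>. ((avg_square \<sigma> - 2 * q0 * v) / (2 * q0 * v))\<^sup>2) \<le> 3 * (k3 + k1\<^sup>2 * C3 + k2\<^sup>2) / (2 * q0 * v)\<^sup>2 / real n"
        by (rule avg_square_expectation[OF avg_square_bound[OF L0 L(2,3,4) q0(2) sv, folded k1_def k2_def]
              square_fluctuation[OF L0 L(3), folded k3_def] V])
      also have "\<dots> = (a2 / d\<^sup>2) * ?\<delta>\<^sup>2" unfolding \<delta>n a2_def using d0 n0 by (simp add: power_divide)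
      also have "\<dots> \<le> a * ?\<delta>\<^sup>2" unfolding a_def by (intro mult_right_mono) auto
      finally show ?thesis .
    qed
    have ep: "exchangeable_pair pair_space (\<lambda>x. ?T (fst (snd x))) (\<lambda>x. ?T ((fst (snd x))(fst x := snd (snd x))))
     (\<lambda>x. sqrt (real n) / (q0 * B) * drift_error \<kappa> q0 (fst (snd x)))
     (\<lambda>x. (avg_square (fst (snd x)) - 2 * q0 * v) / (2 * q0 * v)) ?\<delta> (2 * \<kappa> / real n) s a
     (8 * (\<beta>\<^sup>2)\<^sup>2 / (q0\<^sup>2 * B\<^sup>2 * \<kappa>)) d"
      unfolding d_def by (rule pair_exchangeable[OF q0(1) c(3,2,1,4) Ts Rs Ds])
    \<comment> \<open>The statistic of the theorem is the rescaled \<open>Q\<close>, since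
      \<open>q0\<close> is the square of \<open>b_crit N \<beta>\<close>.\<close>
    have W: "W N \<beta> n \<sigma> / B_const N \<beta> = ?T \<sigma>" for \<sigma>
      unfolding W_def Q_eq B_def[symmetric] q0_def[symmetric] using q0 by (simp add: field_simps)
    have nT: "nice ?T" by (intro nice_intros)
    have bnd: "CA * ?\<delta> = CA * d / sqrt (real n)" unfolding \<delta>n by simp
    show "\<bar>(\<integral>\<sigma>. h (W N \<beta> n \<sigma> / B_const N \<beta>) \<partial>gibbs N \<beta> n) - gauss_exp h\<bar> \<le> CA * d / sqrt (real n)"
      if h: "\<forall>x y. \<bar>h x - h y\<bar> \<le> \<bar>x - y\<bar>" for h :: "real \<Rightarrow> real"
    proof -
      have "continuous_on UNIV h"
        by (rule lipschitz_on_continuous_on[of 1]) (use h in \<open>auto simp: lipschitz_on_def dist_real_def\<close>)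
      from integral_pair_space_fst(1)[OF nice_continuous[OF this nT]]
      have "(\<integral>\<sigma>. h (W N \<beta> n \<sigma> / B_const N \<beta>) \<partial>gibbs N \<beta> n) = (\<integral>x. h (?T (fst (snd x))) \<partial>pair_space)"
        unfolding W ex_def ..
      thus ?thesis using CA(2)[OF ep] h unfolding bnd by simp
    qed
    show "\<bar>measure (gibbs N \<beta> n) {\<sigma> \<in> space (gibbs N \<beta> n). W N \<beta> n \<sigma> / B_const N \<beta> \<le> z}
       - cdf std_normal_distribution z\<bar> \<le> CA * d / sqrt (real n)" for z
    proof -
      let ?g = "\<lambda>\<sigma>. indicat_real {..z} (?T \<sigma>)"
      have mT: "?T \<in> borel_measurable \<Omega>" using nT unfolding nice_def by blast
      have "nice ?g"
        by (rule niceI[of _ 1]) (use mT in \<open>auto split: split_indicator\<close>)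
      from integral_pair_space_fst(1)[OF this] have e: "(\<integral>x. ?g (fst (snd x)) \<partial>pair_space) = ex ?g" .
      have "ex ?g = (\<integral>\<sigma>. indicat_real {\<sigma> \<in> space (gibbs N \<beta> n). ?T \<sigma> \<le> z} \<sigma> \<partial>gibbs N \<beta> n)"
        unfolding ex_def by (rule Bochner_Integration.integral_cong) (auto split: split_indicator)
      also have "\<dots> = measure (gibbs N \<beta> n) ({\<sigma> \<in> space (gibbs N \<beta> n). ?T \<sigma> \<le> z} \<inter> space (gibbs N \<beta> n))"
        by (rule Bochner_Integration.integral_indicator)
      also have "{\<sigma> \<in> space (gibbs N \<beta> n). ?T \<sigma> \<le> z} \<inter> space (gibbs N \<beta> n) = {\<sigma> \<in> space (gibbs N \<beta> n). ?T \<sigma> \<le> z}"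
        by auto
      finally have 1: "ex ?g = measure (gibbs N \<beta> n) {\<sigma> \<in> space (gibbs N \<beta> n). ?T \<sigma> \<le> z}" .
      have "(\<integral>x. ?g (fst (snd x)) \<partial>pair_space) = (\<integral>x. indicat_real {x \<in> space pair_space. ?T (fst (snd x)) \<le> z} x \<partial>pair_space)"
        by (rule Bochner_Integration.integral_cong) (auto split: split_indicator)
      also have "\<dots> = measure pair_space ({x \<in> space pair_space. ?T (fst (snd x)) \<le> z} \<inter> space pair_space)"
        by (rule Bochner_Integration.integral_indicator)
      also have "{x \<in> space pair_space. ?T (fst (snd x)) \<le> z} \<inter> space pair_space = {x \<in> space pair_space. ?T (fst (snd x)) \<le> z}"
        by auto
      finally have "measure (gibbs N \<beta> n) {\<sigma> \<in> space (gibbs N \<beta> n). ?T \<sigma> \<le> z} = measure pair_space {x \<in> space pair_space. ?T (fst (snd x)) \<le> z}"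
        using 1 e by simp
      thus ?thesis using CA(2)[OF ep] unfolding bnd W by simp
    qed
  qed
qed

text \<open>The final constant may not depend on \<open>N\<close>; this works because only finitely
  many dimensions lie below \<open>\<beta>\<close>.\<close>

lemma real_le_nat: "real N < \<beta> \<Longrightarrow> N \<le> nat \<lceil>\<beta>\<rceil>"
  by linarith

theorem theorem1p1:
  fixes \<beta> :: real
  shows "\<exists>C>0. \<forall>N::nat. 2 \<le> N \<and> real N < \<beta> \<longrightarrow>
    (\<forall>n::nat. 1 \<le> n \<longrightarrow>
      (SUP h \<in> {h :: real \<Rightarrow> real.
            \<exists>h'. \<forall>x. (h has_real_derivative h' x) (at x) \<and> \<bar>h' x\<bar> \<le> 1}.
         ereal \<bar>(\<integral>\<sigma>. h (W N \<beta> n \<sigma> / B_const N \<beta>) \<partial>gibbs N \<beta> n)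
                 - (\<integral>x. h x \<partial>std_normal_distribution)\<bar>)
        \<le> ereal (C * real n powr (-1/2))
      \<and>
      (SUP z \<in> (UNIV :: real set).
         ereal \<bar>measure (gibbs N \<beta> n)
                    {\<sigma> \<in> space (gibbs N \<beta> n). W N \<beta> n \<sigma> / B_const N \<beta> \<le> z}
                 - cdf std_normal_distribution z\<bar>)
        \<le> ereal (C * real n powr (-1/2)))"
proof -
  let ?S = "{N. 2 \<le> N \<and> real N < \<beta>}"
  have "finite ?S"
    by (rule finite_subset[of _ "{..nat \<lceil>\<beta>\<rceil>}"]) (auto intro!: real_le_nat)
  define ok where "ok = (\<lambda>N C. \<forall>n\<ge>1.
    (\<forall>h :: real \<Rightarrow> real. (\<forall>x y. \<bar>h x - h y\<bar> \<le> \<bar>x - y\<bar>) \<longrightarrow>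
       \<bar>(\<integral>\<sigma>. h (W N \<beta> n \<sigma> / B_const N \<beta>) \<partial>gibbs N \<beta> n) - gauss_exp h\<bar> \<le> C / sqrt (real n)) \<and>
    (\<forall>z. \<bar>measure (gibbs N \<beta> n) {\<sigma> \<in> space (gibbs N \<beta> n). W N \<beta> n \<sigma> / B_const N \<beta> \<le> z}
       - cdf std_normal_distribution z\<bar> \<le> C / sqrt (real n)))"
  have "\<exists>C>0. ok N C" if "N \<in> ?S" for N
    unfolding ok_def by (rule fixed_dimension_bounds) (use that in auto)
  hence "\<forall>N\<in>?S. \<exists>C. 0 < C \<and> ok N C" by blast
  from bchoice[OF this] obtain K where K: "\<And>N. N \<in> ?S \<Longrightarrow> 0 < K N" "\<And>N. N \<in> ?S \<Longrightarrow> ok N (K N)" by blast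
  \<comment> \<open>A sum dominates each of the finitely many constants; the 1 keeps it positive
    when no dimension is admissible, which happens for \<open>\<beta> \<le> 2\<close>.\<close>
  define C where "C = 1 + (\<Sum>N\<in>?S. K N)"
  have C0: "0 < C" unfolding C_def using K(1) by (intro add_pos_nonneg sum_nonneg less_imp_le) auto
  have KC: "K N \<le> C" if "N \<in> ?S" for N
  proof -
    have "K N \<le> sum K ?S"
      by (rule member_le_sum[OF that _ \<open>finite ?S\<close>]) (rule less_imp_le[OF K(1)], erule DiffD1)
    thus ?thesis unfolding C_def by simp
  qed
  have main: "(SUP h \<in> {h :: real \<Rightarrow> real.
            \<exists>h'. \<forall>x. (h has_real_derivative h' x) (at x) \<and> \<bar>h' x\<bar> \<le> 1}.
         ereal \<bar>(\<integral>\<sigma>. h (W N \<beta> n \<sigma> / B_const N \<beta>) \<partial>gibbs N \<beta> n)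
                 - (\<integral>x. h x \<partial>std_normal_distribution)\<bar>)
        \<le> ereal (C * real n powr (-1/2))
      \<and>
      (SUP z \<in> (UNIV :: real set).
         ereal \<bar>measure (gibbs N \<beta> n)
                    {\<sigma> \<in> space (gibbs N \<beta> n). W N \<beta> n \<sigma> / B_const N \<beta> \<le> z}
                 - cdf std_normal_distribution z\<bar>)
        \<le> ereal (C * real n powr (-1/2))"
    if N: "N \<in> ?S" and n: "1 \<le> n" for N n :: nat
  proof -
    have le: "K N / sqrt (real n) \<le> C * real n powr (-1/2)"
    proof -
      have "real n powr (-1/2) = 1 / sqrt (real n)"
        using n powr_minus_divide[of "real n" "1/2"] by (simp add: powr_half_sqrt)
      thus ?thesis using KC[OF N] n by (simp add: divide_right_mono)
    qed
    \<comment> \<open>Test functions with derivative bounded by 1 are 1-Lipschitz by the mean value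
      theorem, so the supremum runs over a subclass of the functions already treated.\<close>
    have lip: "\<forall>x y. \<bar>h x - h y\<bar> \<le> \<bar>x - y\<bar>"
      if hh: "\<forall>x. (h has_real_derivative h' x) (at x) \<and> \<bar>h' x\<bar> \<le> 1" for h h' :: "real \<Rightarrow> real"
    proof (intro allI)
      fix x y
      obtain \<xi> where xi: "h x - h y = (x - y) * h' \<xi>"
        by (rule mvt_between[of h h' x y]) (use hh in auto)
      have "\<bar>x - y\<bar> * \<bar>h' \<xi>\<bar> \<le> \<bar>x - y\<bar> * 1"
        using hh by (intro mult_left_mono) auto
      thus "\<bar>h x - h y\<bar> \<le> \<bar>x - y\<bar>" using xi by (simp add: abs_mult)
    qed
    note bnd = K(2)[OF N, unfolded ok_def, THEN spec, THEN mp, OF n]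
    show ?thesis
    proof (intro conjI SUP_least)
      fix h :: "real \<Rightarrow> real"
      assume "h \<in> {h. \<exists>h'. \<forall>x. (h has_real_derivative h' x) (at x) \<and> \<bar>h' x\<bar> \<le> 1}"
      then obtain h' where "\<forall>x. (h has_real_derivative h' x) (at x) \<and> \<bar>h' x\<bar> \<le> 1" by blast
      from lip[OF this] have "\<bar>(\<integral>\<sigma>. h (W N \<beta> n \<sigma> / B_const N \<beta>) \<partial>gibbs N \<beta> n) - gauss_exp h\<bar> \<le> K N / sqrt (real n)"
        by (rule conjunct1[OF bnd, THEN spec, THEN mp])
      thus "ereal \<bar>(\<integral>\<sigma>. h (W N \<beta> n \<sigma> / B_const N \<beta>) \<partial>gibbs N \<beta> n) - gauss_exp h\<bar> \<le> ereal (C * real n powr (-1/2))"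
        unfolding ereal_less_eq using le by (rule order_trans)
    next
      fix z :: real
      have "\<bar>measure (gibbs N \<beta> n) {\<sigma> \<in> space (gibbs N \<beta> n). W N \<beta> n \<sigma> / B_const N \<beta> \<le> z}
       - cdf std_normal_distribution z\<bar> \<le> K N / sqrt (real n)"
        by (rule conjunct2[OF bnd, THEN spec])
      thus "ereal \<bar>measure (gibbs N \<beta> n) {\<sigma> \<in> space (gibbs N \<beta> n). W N \<beta> n \<sigma> / B_const N \<beta> \<le> z}
       - cdf std_normal_distribution z\<bar> \<le> ereal (C * real n powr (-1/2))"
        unfolding ereal_less_eq using le by (rule order_trans)
    qed
  qed
  show ?thesis
    by (intro exI[of _ C] conjI[OF C0] allI impI main) auto
qed

end
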